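(* Let $\mathcal G$ be a metric graph equipped with a Lagrangian function $\mathscr L$ satisfying the conditions (i), (ii), (L1), (L2) listed in the context, let $x$ be a solution of the Euler–Lagrange equation on $\mathcal G$ under Dirichlet boundary conditions at the vertices, and let $L$ be the minimal Sturm–Liouville operator obtained by linearization at $x$. Assume that $L$ is a closed, densely defined, symmetric Fredholm operator on $L^2(\mathcal G)$. Then $$\mathrm n_-(L_{\mathcal G,\Lambda_D})=\sum_{j=1}^m\ \sum_{\sigma\in(a_j,b_j)}\dim\ker L_{j,\sigma,\Lambda_D}.$$
   Context: **Graph.** $\mathcal G$ is a finite connected directed metric graph (loops and multiple edges allowed) with edges $j=1,\dots,m$; edge $j$ is identified with an interval $I_j$ with left end $a_j$ and right end $b_j$, of the form $[a_j,b_j]$, $[a_j,+\infty)$ or $(-\infty,b_j]$ (vertices at infinity have degree one). $L^2(\mathcal G)=\bigoplus_jL^2(I_j;\mathbb R^d)$. **Lagrangian.** (i) $\mathscr L\in C^0(\mathcal G\times T\mathbb R^d,\mathbb R)$; (ii) $\mathscr L_j:=\mathscr L|_{I_j}\in C^2(I_j\times T\mathbb R^d,\mathbb R)$ for every $j$; (L1) $\partial^2_{vv}\mathscr L_j>0$ (positive definite); (L2) $\mathscr L_j$ is exactly quadratic in the velocities $v$. The Euler–Lagrange equation is $\frac{d}{dt}\partial_v\mathscr L(t,x,x')-\partial_q\mathscr L(t,x,x')=0$ on every edge. **Linearized operator.** Along $x$ put $P_j=\partial^2_{vv}\mathscr L_j$, $Q_j=\partial^2_{qv}\mathscr L_j$,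 $R_j=\partial^2_{qq}\mathscr L_j$ evaluated at $(t,x_j(t),x_j'(t))$, with the standing regularity $P_j^{-1},Q_j\in C^1$ and $R_j\in C^0$ on $I_j$. On each edge $\ell_jf=-(P_jf'+Q_jf)'+Q_j^{\top}f'+R_jf$. The minimal operator $L$ has domain $\bigoplus_jW^{2,2}_0(I_j;\mathbb R^d)$; its adjoint, the maximal operator $L^*$, has domain $\bigoplus_jW^{2,2}(I_j;\mathbb R^d)$ (standing convention). **Dirichlet realizations.** $L_{\mathcal G,\Lambda_D}$ is the restriction of $L^*$ to functions vanishing at every finite endpoint of every edge. For $\sigma\in(a_j,b_j)$, $L_{j,\sigma,\Lambda_D}$ is the operator $f\mapsto\ell_jf$ on $L^2((a_j,\sigma);\mathbb R^d)$ with domain $\{f\in W^{2,2}((a_j,\sigma);\mathbb R^d): f(\sigma)=0\text{ and, if }a_j\text{ is finite, }f(a_j)=0\}$. **Morse index.** $\mathrm n_-(A)$ of a self-adjoint operator $A$ is the dimension of its negative spectral subspace, equivalently the maximal dimension of a subspace on which its quadratic form is negative definite. *)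

theory Defs
  imports
    "HOL-Analysis.Analysis"
    "HOL-Library.Function_Algebras"
    "Graph_Theory.Digraph_Component"
begin

section \<open>Functions as real vector spaces\<close>

instantiation "fun" :: (type, scaleR) scaleR
begin

definition scaleR_fun_def: "c *\<^sub>R f = (\<lambda>x. c *\<^sub>R f x)"

instance ..

end

instance "fun" :: (type, real_vector) real_vector
  by standard (auto simp: scaleR_fun_def plus_fun_def scaleR_add_left scaleR_add_right)

text \<open>\<open>dim\<close> is 0 on infinite-dimensional spaces; this version is \<open>\<infinity>\<close> there.\<close>

definition edim :: "'a::real_vector set \<Rightarrow> enat" where
  "edim S = (SUP B \<in> {B. B \<subseteq> S \<and> finite B \<and> independent B}. enat (card B))"


section \<open>Metric graphs\<close>

text \<open>The edge \<open>j\<close> is parametrized by the real points between \<open>lend G j\<close> and \<open>rend G j\<close>;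
  its left end sits at the vertex \<open>tail G j\<close>, its right end at \<open>head G j\<close>.\<close>

record ('v, 'e) metric_digraph = "('v, 'e) pre_digraph" +
  lend :: "'e \<Rightarrow> ereal"
  rend :: "'e \<Rightarrow> ereal"

definition edge :: "('v, 'e) metric_digraph \<Rightarrow> 'e \<Rightarrow> real set" where
  "edge G j = {t. lend G j \<le> ereal t \<and> ereal t \<le> rend G j}"

definition vertex_degree :: "('v, 'e) metric_digraph \<Rightarrow> 'v \<Rightarrow> nat" where
  "vertex_degree G p =
     in_degree (pre_digraph.truncate G) p + out_degree (pre_digraph.truncate G) p"

definition metric_graph :: "('v, 'e) metric_digraph \<Rightarrow> bool" where
  "metric_graph G \<longleftrightarrow>
     fin_digraph (pre_digraph.truncate G) \<and>
     Digraph_Component.connected (pre_digraph.truncate G) \<and>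
     (\<forall>j\<in>arcs G. lend G j < rend G j \<and> \<not> (lend G j = -\<infinity> \<and> rend G j = \<infinity>) \<and>
        (lend G j = -\<infinity> \<longrightarrow> vertex_degree G (tail G j) = 1) \<and>
        (rend G j = \<infinity> \<longrightarrow> vertex_degree G (head G j) = 1))"

text \<open>The point with parameter \<open>t\<close> on the edge \<open>j\<close> is the (finite) vertex \<open>p\<close>.\<close>

definition edge_end :: "('v, 'e) metric_digraph \<Rightarrow> 'e \<Rightarrow> real \<Rightarrow> 'v \<Rightarrow> bool" where
  "edge_end G j t p \<longleftrightarrow>
     (ereal t = lend G j \<and> p = tail G j) \<or> (ereal t = rend G j \<and> p = head G j)"

definition vanishes_at_vertices ::
    "('v, 'e) metric_digraph \<Rightarrow> ('e \<Rightarrow> real \<Rightarrow> real^'d) \<Rightarrow> bool" where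
  "vanishes_at_vertices G f \<longleftrightarrow> (\<forall>j\<in>arcs G. \<forall>t p. edge_end G j t p \<longrightarrow> f j t = 0)"


section \<open>Lagrangians on metric graphs\<close>

text \<open>Derivatives along edges are taken within the edge, hence one-sided at its ends.\<close>

abbreviation deriv_on :: "real set \<Rightarrow> (real \<Rightarrow> 'a::real_normed_vector) \<Rightarrow> real \<Rightarrow> 'a" where
  "deriv_on S f t \<equiv> vector_derivative f (at t within S)"

definition C1_on :: "real set \<Rightarrow> (real \<Rightarrow> 'a::real_normed_vector) \<Rightarrow> bool" where
  "C1_on S f \<longleftrightarrow>
     (\<exists>D. (\<forall>t\<in>S. (f has_vector_derivative D t) (at t within S)) \<and> continuous_on S D)"

definition C2_on :: "'a::real_normed_vector set \<Rightarrow> ('a \<Rightarrow> real) \<Rightarrow> bool" where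
  "C2_on U F \<longleftrightarrow>
     (\<exists>(DF :: 'a \<Rightarrow> 'a \<Rightarrow>\<^sub>L real) (D2F :: 'a \<Rightarrow> 'a \<Rightarrow>\<^sub>L 'a \<Rightarrow>\<^sub>L real).
        (\<forall>z\<in>U. (F has_derivative blinfun_apply (DF z)) (at z within U)) \<and>
        (\<forall>z\<in>U. (DF has_derivative blinfun_apply (D2F z)) (at z within U)) \<and>
        continuous_on U D2F)"

text \<open>\<open>Lag j t q v\<close> is the Lagrangian at the point with parameter \<open>t\<close> on the edge \<open>j\<close>.\<close>

type_synonym ('e, 'd) lagrangian = "'e \<Rightarrow> real \<Rightarrow> real^'d \<Rightarrow> real^'d \<Rightarrow> real"

definition edge_phase_space :: "('v, 'e) metric_digraph \<Rightarrow> 'e \<Rightarrow> (real \<times> (real^'d) \<times> (real^'d)) set" where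
  "edge_phase_space G j = edge G j \<times> UNIV \<times> UNIV"

text \<open>A family of functions on the edges is a continuous function on the graph iff each member
  is continuous and the values at edge ends glued to the same vertex agree.\<close>

definition lagrangian_C0 :: "('v, 'e) metric_digraph \<Rightarrow> ('e, 'd::finite) lagrangian \<Rightarrow> bool" where
  "lagrangian_C0 G Lag \<longleftrightarrow>
     (\<forall>j\<in>arcs G. continuous_on (edge_phase_space G j) (\<lambda>(t, q, v). Lag j t q v)) \<and>
     (\<forall>j\<in>arcs G. \<forall>k\<in>arcs G. \<forall>s t p. edge_end G j s p \<and> edge_end G k t p \<longrightarrow>
        (\<forall>q v. Lag j s q v = Lag k t q v))"

definition lagrangian_C2 :: "('v, 'e) metric_digraph \<Rightarrow> ('e, 'd::finite) lagrangian \<Rightarrow> bool" where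
  "lagrangian_C2 G Lag \<longleftrightarrow>
     (\<forall>j\<in>arcs G. C2_on (edge_phase_space G j) (\<lambda>(t, q, v). Lag j t q v))"

definition partial :: "'d \<Rightarrow> (real^'d \<Rightarrow> real) \<Rightarrow> real^'d \<Rightarrow> real" where
  "partial i h p = deriv (\<lambda>s. h (p + s *\<^sub>R axis i 1)) 0"

definition grad_v :: "(real \<Rightarrow> real^'d \<Rightarrow> real^'d \<Rightarrow> real) \<Rightarrow> real \<Rightarrow> real^'d \<Rightarrow> real^'d \<Rightarrow> real^'d" where
  "grad_v F t q v = (\<chi> i. partial i (\<lambda>w. F t q w) v)"

definition grad_q :: "(real \<Rightarrow> real^'d \<Rightarrow> real^'d \<Rightarrow> real) \<Rightarrow> real \<Rightarrow> real^'d \<Rightarrow> real^'d \<Rightarrow> real^'d" where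
  "grad_q F t q v = (\<chi> i. partial i (\<lambda>r. F t r v) q)"

text \<open>Rows are indexed by the derivative taken first. In particular \<open>hess_qv F t q v\<close> is the
  Jacobian of \<open>grad_v F t q v\<close> with respect to \<open>q\<close>, so that linearizing
  \<open>d/dt grad_v - grad_q\<close> gives \<open>(P f' + Q f)' - Q\<^sup>T f' - R f\<close>.\<close>

definition hess_vv :: "(real \<Rightarrow> real^'d \<Rightarrow> real^'d \<Rightarrow> real) \<Rightarrow> real \<Rightarrow> real^'d \<Rightarrow> real^'d \<Rightarrow> real^'d^'d" where
  "hess_vv F t q v = (\<chi> i k. partial k (\<lambda>w. grad_v F t q w $ i) v)"

definition hess_qv :: "(real \<Rightarrow> real^'d \<Rightarrow> real^'d \<Rightarrow> real) \<Rightarrow> real \<Rightarrow> real^'d \<Rightarrow> real^'d \<Rightarrow> real^'d^'d" where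
  "hess_qv F t q v = (\<chi> i k. partial k (\<lambda>r. grad_v F t r v $ i) q)"

definition hess_qq :: "(real \<Rightarrow> real^'d \<Rightarrow> real^'d \<Rightarrow> real) \<Rightarrow> real \<Rightarrow> real^'d \<Rightarrow> real^'d \<Rightarrow> real^'d^'d" where
  "hess_qq F t q v = (\<chi> i k. partial k (\<lambda>r. grad_q F t r v $ i) q)"

definition lagrangian_convex :: "('v, 'e) metric_digraph \<Rightarrow> ('e, 'd::finite) lagrangian \<Rightarrow> bool" where
  "lagrangian_convex G Lag \<longleftrightarrow>
     (\<forall>j\<in>arcs G. \<forall>t\<in>edge G j. \<forall>q v w. w \<noteq> 0 \<longrightarrow> w \<bullet> (hess_vv (Lag j) t q v *v w) > 0)"

definition lagrangian_quadratic :: "('v, 'e) metric_digraph \<Rightarrow> ('e, 'd::finite) lagrangian \<Rightarrow> bool" where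
  "lagrangian_quadratic G Lag \<longleftrightarrow>
     (\<forall>j\<in>arcs G. \<exists>(A :: real \<Rightarrow> real^'d \<Rightarrow> real^'d^'d) (b :: real \<Rightarrow> real^'d \<Rightarrow> real^'d) c.
        \<forall>t\<in>edge G j. \<forall>q v. Lag j t q v = v \<bullet> (A t q *v v) + b t q \<bullet> v + c t q)"

definition euler_lagrange_solution ::
    "('v, 'e) metric_digraph \<Rightarrow> ('e, 'd::finite) lagrangian \<Rightarrow> ('e \<Rightarrow> real \<Rightarrow> real^'d) \<Rightarrow> bool" where
  "euler_lagrange_solution G Lag x \<longleftrightarrow>
     (\<forall>j\<in>arcs G. C1_on (edge G j) (x j) \<and>
        (\<forall>t\<in>edge G j.
           ((\<lambda>s. grad_v (Lag j) s (x j s) (deriv_on (edge G j) (x j) s))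
              has_vector_derivative grad_q (Lag j) t (x j t) (deriv_on (edge G j) (x j) t))
             (at t within edge G j)))"


section \<open>Coefficients of the linearization\<close>

definition coeff_P ::
    "('v, 'e) metric_digraph \<Rightarrow> ('e, 'd::finite) lagrangian \<Rightarrow> ('e \<Rightarrow> real \<Rightarrow> real^'d) \<Rightarrow> 'e \<Rightarrow> real \<Rightarrow> real^'d^'d" where
  "coeff_P G Lag x j t = hess_vv (Lag j) t (x j t) (deriv_on (edge G j) (x j) t)"

definition coeff_Q ::
    "('v, 'e) metric_digraph \<Rightarrow> ('e, 'd::finite) lagrangian \<Rightarrow> ('e \<Rightarrow> real \<Rightarrow> real^'d) \<Rightarrow> 'e \<Rightarrow> real \<Rightarrow> real^'d^'d" where
  "coeff_Q G Lag x j t = hess_qv (Lag j) t (x j t) (deriv_on (edge G j) (x j) t)"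

definition coeff_R ::
    "('v, 'e) metric_digraph \<Rightarrow> ('e, 'd::finite) lagrangian \<Rightarrow> ('e \<Rightarrow> real \<Rightarrow> real^'d) \<Rightarrow> 'e \<Rightarrow> real \<Rightarrow> real^'d^'d" where
  "coeff_R G Lag x j t = hess_qq (Lag j) t (x j t) (deriv_on (edge G j) (x j) t)"

definition regular_coefficients ::
    "('v, 'e) metric_digraph \<Rightarrow> ('e, 'd::finite) lagrangian \<Rightarrow> ('e \<Rightarrow> real \<Rightarrow> real^'d) \<Rightarrow> bool" where
  "regular_coefficients G Lag x \<longleftrightarrow>
     (\<forall>j\<in>arcs G. C1_on (edge G j) (\<lambda>t. matrix_inv (coeff_P G Lag x j t)) \<and>
        C1_on (edge G j) (coeff_Q G Lag x j) \<and> continuous_on (edge G j) (coeff_R G Lag x j))"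


section \<open>\<open>L\<^sup>2\<close> and Sobolev spaces\<close>

text \<open>Functions on an interval are extended by zero. Elements of \<open>L2_on S\<close> are functions, not
  classes; equality almost everywhere is made explicit wherever it matters.\<close>

definition L2_on :: "real set \<Rightarrow> (real \<Rightarrow> 'a::euclidean_space) set" where
  "L2_on S = {f. (\<forall>t. t \<notin> S \<longrightarrow> f t = 0) \<and> f \<in> borel_measurable (lebesgue_on S) \<and>
                 integrable (lebesgue_on S) (\<lambda>t. (norm (f t))\<^sup>2)}"

text \<open>\<open>W\<^sup>2\<^sup>,\<^sup>2\<close> of a nondegenerate closed interval \<open>S\<close>, by its \<open>C\<^sup>1\<close> representatives:
  \<open>f\<close> and \<open>f'\<close> are locally absolutely continuous, and \<open>f\<close>, \<open>f'\<close>, \<open>f''\<close> are square integrable.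
  As the representative is unique, distinct members of \<open>W22_on S\<close> are distinct in \<open>L\<^sup>2\<close>.\<close>

definition W22_on :: "real set \<Rightarrow> (real \<Rightarrow> 'a::euclidean_space) set" where
  "W22_on S = {f \<in> L2_on S. \<exists>g\<in>L2_on S. \<exists>h\<in>L2_on S. \<forall>s\<in>S. \<forall>t\<in>S. s \<le> t \<longrightarrow>
     (g has_integral (f t - f s)) {s..t} \<and> (h has_integral (g t - g s)) {s..t}}"

definition W22_norm :: "real set \<Rightarrow> (real \<Rightarrow> 'a::euclidean_space) \<Rightarrow> real" where
  "W22_norm S f = sqrt (LINT t|lebesgue_on S.
     (norm (f t))\<^sup>2 + (norm (deriv_on S f t))\<^sup>2 + (norm (deriv_on S (deriv_on S f) t))\<^sup>2)"

text \<open>Smooth functions with compact support in the open interval \<open>interior S\<close>.\<close>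

definition test_functions :: "real set \<Rightarrow> (real \<Rightarrow> 'a::euclidean_space) set" where
  "test_functions S = {\<phi>.
     (\<exists>D :: nat \<Rightarrow> real \<Rightarrow> 'a. D 0 = \<phi> \<and> (\<forall>k t. (D k has_vector_derivative D (Suc k) t) (at t))) \<and>
     (\<exists>K. compact K \<and> K \<subseteq> interior S \<and> (\<forall>t. t \<notin> K \<longrightarrow> \<phi> t = 0))}"

definition W22_0_on :: "real set \<Rightarrow> (real \<Rightarrow> 'a::euclidean_space) set" where
  "W22_0_on S = {f \<in> W22_on S. \<exists>\<phi>. (\<forall>n::nat. \<phi> n \<in> test_functions S) \<and>
     (\<lambda>n. W22_norm S (\<phi> n - f)) \<longlonglongrightarrow> 0}"

definition sturm_liouville :: "real set \<Rightarrow> (real \<Rightarrow> real^'d^'d) \<Rightarrow> (real \<Rightarrow> real^'d^'d) \<Rightarrow>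
    (real \<Rightarrow> real^'d^'d) \<Rightarrow> (real \<Rightarrow> real^'d) \<Rightarrow> real \<Rightarrow> real^'d" where
  "sturm_liouville S P Q R f t = (if t \<in> S then
     - deriv_on S (\<lambda>s. P s *v deriv_on S f s + Q s *v f s) t
     + transpose (Q t) *v deriv_on S f t + R t *v f t else 0)"


section \<open>Operators on \<open>L\<^sup>2\<close> of a metric graph\<close>

type_synonym ('e, 'd) graph_fun = "'e \<Rightarrow> real \<Rightarrow> real^'d"

definition L2_graph :: "('v, 'e) metric_digraph \<Rightarrow> ('e, 'd::finite) graph_fun set" where
  "L2_graph G = {f. (\<forall>j\<in>arcs G. f j \<in> L2_on (edge G j)) \<and> (\<forall>j. j \<notin> arcs G \<longrightarrow> f j = 0)}"

definition l2_inner ::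
    "('v, 'e) metric_digraph \<Rightarrow> ('e, 'd::finite) graph_fun \<Rightarrow> ('e, 'd) graph_fun \<Rightarrow> real" where
  "l2_inner G f g = (\<Sum>j\<in>arcs G. LINT t|lebesgue_on (edge G j). f j t \<bullet> g j t)"

definition l2_norm :: "('v, 'e) metric_digraph \<Rightarrow> ('e, 'd::finite) graph_fun \<Rightarrow> real" where
  "l2_norm G f = sqrt (l2_inner G f f)"

definition ae_eq ::
    "('v, 'e) metric_digraph \<Rightarrow> ('e, 'd::finite) graph_fun \<Rightarrow> ('e, 'd) graph_fun \<Rightarrow> bool" where
  "ae_eq G f g \<longleftrightarrow> (\<forall>j\<in>arcs G. AE t in lebesgue_on (edge G j). f j t = g j t)"

definition l2_tendsto ::
    "('v, 'e) metric_digraph \<Rightarrow> (nat \<Rightarrow> ('e, 'd::finite) graph_fun) \<Rightarrow> ('e, 'd) graph_fun \<Rightarrow> bool" where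
  "l2_tendsto G fs f \<longleftrightarrow> (\<lambda>n. l2_norm G (fs n - f)) \<longlonglongrightarrow> 0"

text \<open>An unbounded operator is given by its domain and its action. The action is only used on
  the domain, and only up to equality almost everywhere.\<close>

type_synonym ('e, 'd) operator =
  "('e, 'd) graph_fun set \<times> (('e, 'd) graph_fun \<Rightarrow> ('e, 'd) graph_fun)"

definition operator_in :: "('v, 'e) metric_digraph \<Rightarrow> ('e, 'd::finite) operator \<Rightarrow> bool" where
  "operator_in G T \<longleftrightarrow> subspace (fst T) \<and> (\<forall>f\<in>fst T. f \<in> L2_graph G \<and> snd T f \<in> L2_graph G)"

definition closed_op :: "('v, 'e) metric_digraph \<Rightarrow> ('e, 'd::finite) operator \<Rightarrow> bool" where
  "closed_op G T \<longleftrightarrow>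
     (\<forall>fs. \<forall>g\<in>L2_graph G. \<forall>h\<in>L2_graph G.
        (\<forall>n. fs n \<in> fst T) \<and> l2_tendsto G fs g \<and> l2_tendsto G (\<lambda>n. snd T (fs n)) h \<longrightarrow>
        (\<exists>f\<in>fst T. ae_eq G f g \<and> ae_eq G (snd T f) h))"

definition densely_defined :: "('v, 'e) metric_digraph \<Rightarrow> ('e, 'd::finite) operator \<Rightarrow> bool" where
  "densely_defined G T \<longleftrightarrow>
     (\<forall>g\<in>L2_graph G. \<exists>fs. (\<forall>n. fs n \<in> fst T) \<and> l2_tendsto G fs g)"

definition symmetric_op :: "('v, 'e) metric_digraph \<Rightarrow> ('e, 'd::finite) operator \<Rightarrow> bool" where
  "symmetric_op G T \<longleftrightarrow>
     (\<forall>f\<in>fst T. \<forall>g\<in>fst T. l2_inner G (snd T f) g = l2_inner G f (snd T g))"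

definition fredholm_op :: "('v, 'e) metric_digraph \<Rightarrow> ('e, 'd::finite) operator \<Rightarrow> bool" where
  "fredholm_op G T \<longleftrightarrow>
     edim {f \<in> fst T. ae_eq G (snd T f) 0} < \<infinity> \<and>
     (\<forall>fs. \<forall>h\<in>L2_graph G. (\<forall>n. fs n \<in> fst T) \<and> l2_tendsto G (\<lambda>n. snd T (fs n)) h \<longrightarrow>
        (\<exists>f\<in>fst T. ae_eq G (snd T f) h)) \<and>
     (\<exists>B. finite B \<and> B \<subseteq> L2_graph G \<and>
        (\<forall>h\<in>L2_graph G. \<exists>f\<in>fst T. \<exists>b\<in>span B. ae_eq G h (snd T f + b)))"

text \<open>\<open>S\<close> is the Hilbert space adjoint of \<open>T\<close>; the domain of \<open>S\<close> contains one representative of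
  each class in the domain of the adjoint.\<close>

definition is_adjoint ::
    "('v, 'e) metric_digraph \<Rightarrow> ('e, 'd::finite) operator \<Rightarrow> ('e, 'd) operator \<Rightarrow> bool" where
  "is_adjoint G T S \<longleftrightarrow> operator_in G S \<and>
     (\<forall>g\<in>L2_graph G. \<forall>h\<in>L2_graph G.
        (\<forall>f\<in>fst T. l2_inner G (snd T f) g = l2_inner G f h) \<longleftrightarrow>
        (\<exists>w\<in>fst S. ae_eq G w g \<and> ae_eq G (snd S w) h))"

text \<open>For self-adjoint \<open>T\<close>: the maximal dimension of a subspace of the domain on which the
  quadratic form of \<open>T\<close> is negative definite.\<close>

definition morse_index :: "('v, 'e) metric_digraph \<Rightarrow> ('e, 'd::finite) operator \<Rightarrow> enat" where
  "morse_index G T =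
     (SUP V \<in> {V. subspace V \<and> V \<subseteq> fst T \<and> (\<forall>f\<in>V. f \<noteq> 0 \<longrightarrow> l2_inner G (snd T f) f < 0)}. edim V)"


section \<open>Sturm--Liouville operators of the linearization\<close>

definition edge_operator ::
    "('v, 'e) metric_digraph \<Rightarrow> ('e, 'd::finite) lagrangian \<Rightarrow> ('e, 'd) graph_fun \<Rightarrow> 'e \<Rightarrow>
     real set \<Rightarrow> (real \<Rightarrow> real^'d) \<Rightarrow> real \<Rightarrow> real^'d" where
  "edge_operator G Lag x j S =
     sturm_liouville S (coeff_P G Lag x j) (coeff_Q G Lag x j) (coeff_R G Lag x j)"

definition graph_operator ::
    "('v, 'e) metric_digraph \<Rightarrow> ('e, 'd::finite) lagrangian \<Rightarrow> ('e, 'd) graph_fun \<Rightarrow>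
     ('e, 'd) graph_fun \<Rightarrow> ('e, 'd) graph_fun" where
  "graph_operator G Lag x f =
     (\<lambda>j. if j \<in> arcs G then edge_operator G Lag x j (edge G j) (f j) else 0)"

definition W22_graph :: "('v, 'e) metric_digraph \<Rightarrow> ('e, 'd::finite) graph_fun set" where
  "W22_graph G = {f. (\<forall>j\<in>arcs G. f j \<in> W22_on (edge G j)) \<and> (\<forall>j. j \<notin> arcs G \<longrightarrow> f j = 0)}"

definition W22_0_graph :: "('v, 'e) metric_digraph \<Rightarrow> ('e, 'd::finite) graph_fun set" where
  "W22_0_graph G = {f. (\<forall>j\<in>arcs G. f j \<in> W22_0_on (edge G j)) \<and> (\<forall>j. j \<notin> arcs G \<longrightarrow> f j = 0)}"

definition minimal_operator ::
    "('v, 'e) metric_digraph \<Rightarrow> ('e, 'd::finite) lagrangian \<Rightarrow> ('e, 'd) graph_fun \<Rightarrow> ('e, 'd) operator" where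
  "minimal_operator G Lag x = (W22_0_graph G, graph_operator G Lag x)"

definition maximal_operator ::
    "('v, 'e) metric_digraph \<Rightarrow> ('e, 'd::finite) lagrangian \<Rightarrow> ('e, 'd) graph_fun \<Rightarrow> ('e, 'd) operator" where
  "maximal_operator G Lag x = (W22_graph G, graph_operator G Lag x)"

definition dirichlet_operator ::
    "('v, 'e) metric_digraph \<Rightarrow> ('e, 'd::finite) lagrangian \<Rightarrow> ('e, 'd) graph_fun \<Rightarrow> ('e, 'd) operator" where
  "dirichlet_operator G Lag x =
     ({f \<in> fst (maximal_operator G Lag x). vanishes_at_vertices G f}, snd (maximal_operator G Lag x))"

text \<open>The kernel of the Dirichlet realization on the part of the edge \<open>j\<close> to the left of \<open>\<sigma>\<close>.\<close>

definition left_part :: "('v, 'e) metric_digraph \<Rightarrow> 'e \<Rightarrow> real \<Rightarrow> real set" where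
  "left_part G j \<sigma> = {t. lend G j \<le> ereal t \<and> t \<le> \<sigma>}"

definition left_dirichlet_domain ::
    "('v, 'e) metric_digraph \<Rightarrow> 'e \<Rightarrow> real \<Rightarrow> (real \<Rightarrow> real^'d) set" where
  "left_dirichlet_domain G j \<sigma> =
     {f \<in> W22_on (left_part G j \<sigma>). f \<sigma> = 0 \<and> (\<forall>a. ereal a = lend G j \<longrightarrow> f a = 0)}"

definition left_dirichlet_kernel ::
    "('v, 'e) metric_digraph \<Rightarrow> ('e, 'd::finite) lagrangian \<Rightarrow> ('e, 'd) graph_fun \<Rightarrow> 'e \<Rightarrow> real \<Rightarrow>
     (real \<Rightarrow> real^'d) set" where
  "left_dirichlet_kernel G Lag x j \<sigma> =
     {f \<in> left_dirichlet_domain G j \<sigma>.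
        AE t in lebesgue_on (left_part G j \<sigma>). edge_operator G Lag x j (left_part G j \<sigma>) f t = 0}"

end

theory Submission
  imports Defs "HOL-Probability.Sinc_Integral"
begin

text \<open>The index is counted edge by edge, because the Dirichlet conditions decouple the edges.

  Lower bound: let \<open>y\<close> solve \<open>L y = 0\<close> to the left of a conjugate point \<open>\<sigma>\<close> and vanish at
  \<open>\<sigma>\<close>. Extended by zero, \<open>y\<close> has form value zero and a corner at \<open>\<sigma>\<close>; rounding off the corner within
  distance \<open>\<delta>\<close> makes the form negative and keeps the function in the operator domain. Functions
  belonging to different conjugate points are orthogonal for the form, so the dimensions add up.

  Upper bound: the solutions satisfying the condition at the left end form a conjoined basis \<open>Y\<close>.
  Where \<open>f\<close> lies in the range of \<open>Y\<close>, Picone's identity writes the form as the integral of a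
  nonnegative density. This needs \<open>f \<sigma> \<in> range (Y \<sigma>)\<close> at the conjugate points, which amounts to
  \<open>dim ker (Y \<sigma>)\<close> linear conditions at each \<open>\<sigma>\<close>.

  At a left end \<open>-\<infinity>\<close> the basis \<open>Y\<close> does not come from an initial value problem: its existence is
  where closedness of the range and the description of the adjoint enter.\<close>

section \<open>Indefinite integrals on intervals\<close>

text \<open>The difficulty is that everything must happen inside \<open>W22_on\<close>, with no
  growth bound on the coefficients at an infinite end. The energy integral over a half-line is not
  known to converge, so the form is the pairing of \<open>L f\<close> with \<open>f\<close>, and
  every integration by parts takes place on a compact interval, after multiplication by a cutoff
  where necessary. At infinity the cutoffs are controlled only by \<open>L\<close> mapping
  \<open>W22_on\<close> into \<open>L2_on\<close>. The same control makes the boundary data of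
  square integrable solutions isotropic; closed range gives the opposite inclusion, so the data are
  Lagrangian. An infinite right end needs no basis, the cutoff suffices. Finitely many conjugate
  points are not presupposed: otherwise arbitrarily large finite families of them make both sides
  infinite. In Picone's identity the coefficients of \<open>f\<close> with respect to
  \<open>Y\<close> may jump at a conjugate point; the boundary form stays continuous because
  isotropy makes it independent of their choice and \<open>Y\<close> is injective to first order
  nearby.\<close>

lemma Icc_subset_interval:
  fixes s t :: real
  shows "is_interval S \<Longrightarrow> s \<in> S \<Longrightarrow> t \<in> S \<Longrightarrow> {s..t} \<subseteq> S"
  by (meson atLeastAtMost_iff mem_is_interval_1_I subsetI)

text \<open>Local absolute continuity of \<open>g\<close> with derivative \<open>h\<close>. Absolute
  integrability is demanded because the gauge integral alone does not survive multiplication by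
  bounded measurable functions, which the product rule needs.\<close>

definition primitive_on :: "real set \<Rightarrow> (real \<Rightarrow> 'a::euclidean_space) \<Rightarrow> (real \<Rightarrow> 'a) \<Rightarrow> bool" where
  "primitive_on S g h \<longleftrightarrow> (\<forall>s\<in>S. \<forall>t\<in>S. s \<le> t \<longrightarrow>
     h absolutely_integrable_on {s..t} \<and> (h has_integral (g t - g s)) {s..t})"

lemma primitive_onD:
  assumes "primitive_on S g h" "s \<in> S" "t \<in> S" "s \<le> t"
  shows "h absolutely_integrable_on {s..t}" "(h has_integral (g t - g s)) {s..t}"
    "h integrable_on {s..t}" "integral {s..t} h = g t - g s"
  using assms unfolding primitive_on_def by (blast intro: has_integral_integrable integral_unique)+

lemma primitive_on_subset: "primitive_on S g h \<Longrightarrow> T \<subseteq> S \<Longrightarrow> primitive_on T g h"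
  unfolding primitive_on_def by blast

lemma primitive_on_cong:
  assumes "is_interval S" "\<And>t. t \<in> S \<Longrightarrow> g t = g' t" "\<And>t. t \<in> S \<Longrightarrow> h t = h' t"
  shows "primitive_on S g h \<longleftrightarrow> primitive_on S g' h'"
proof -
  have sub: "r \<in> S" if "s \<in> S" "t \<in> S" "r \<in> {s..t}" for r s t
    using Icc_subset_interval[OF assms(1) that(1,2)] that(3) by blast
  have "h absolutely_integrable_on {s..t} \<longleftrightarrow> h' absolutely_integrable_on {s..t}" if "s \<in> S" "t \<in> S" for s t
    by (rule set_integrable_cong) (use sub[OF that] assms(3) in auto)
  moreover have "(h has_integral I) {s..t} \<longleftrightarrow> (h' has_integral I) {s..t}" if "s \<in> S" "t \<in> S" for s t I
    by (rule has_integral_cong) (use sub[OF that] assms(3) in auto)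
  ultimately show ?thesis
    unfolding primitive_on_def using assms(2) by simp
qed

lemma primitive_on_add:
  assumes "primitive_on S g h" "primitive_on S g' h'"
  shows "primitive_on S (\<lambda>t. g t + g' t) (\<lambda>t. h t + h' t)"
proof -
  have "(\<lambda>t. h t + h' t) absolutely_integrable_on {s..t}"
      "((\<lambda>t. h t + h' t) has_integral g t + g' t - (g s + g' s)) {s..t}"
    if "s \<in> S" "t \<in> S" "s \<le> t" for s t
    using primitive_onD(1)[OF assms(1) that] primitive_onD(1)[OF assms(2) that]
      has_integral_add[OF primitive_onD(2)[OF assms(1) that] primitive_onD(2)[OF assms(2) that]]
    by (auto simp: algebra_simps set_integral_add(1) simp del: plus_fun_apply)
  then show ?thesis unfolding primitive_on_def by blast
qed

lemma primitive_on_linear: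
  fixes L :: "'a::euclidean_space \<Rightarrow> 'b::euclidean_space"
  assumes "primitive_on S g h" "bounded_linear L"
  shows "primitive_on S (\<lambda>t. L (g t)) (\<lambda>t. L (h t))"
proof -
  have "(\<lambda>t. L (h t)) absolutely_integrable_on {s..t}"
      "((\<lambda>t. L (h t)) has_integral L (g t) - L (g s)) {s..t}"
    if "s \<in> S" "t \<in> S" "s \<le> t" for s t
    using has_integral_linear[OF primitive_onD(2)[OF assms(1) that] assms(2)]
      absolutely_integrable_linear[OF primitive_onD(1)[OF assms(1) that] assms(2)]
    by (auto simp: o_def linear_diff bounded_linear.linear assms(2))
  then show ?thesis unfolding primitive_on_def by blast
qed

lemma primitive_on_zero [simp]: "primitive_on S (\<lambda>t. 0) (\<lambda>t. 0)"
  unfolding primitive_on_def by auto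

lemma primitive_on_scaleR:
  assumes "primitive_on S g h"
  shows "primitive_on S (\<lambda>t. c *\<^sub>R g t) (\<lambda>t. c *\<^sub>R h t)"
  using primitive_on_linear[OF assms bounded_linear_scaleR_right] .

text \<open>A compact subinterval ending at \<open>t\<close> controls one side of \<open>t\<close>
  only, so the two one-sided limits are proved separately and joined; at an end of \<open>S\<close>
  one of them is trivial.\<close>

lemma primitive_on_continuous:
  assumes S: "is_interval S" and prim: "primitive_on S g h"
  shows "continuous_on S g"
proof -
  have loc: "continuous_on {s..t} g" if st: "s \<in> S" "t \<in> S" "s < t" for s t
  proof -
    have hint: "h integrable_on {s..t}" using primitive_onD(3)[OF prim] st by auto
    have "continuous_on {s..t} (\<lambda>x. g s + integral {s..x} h)"
      by (intro continuous_intros indefinite_integral_continuous_1 hint)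
    moreover have "g s + integral {s..x} h = g x" if "x \<in> {s..t}" for x
    proof -
      have "x \<in> S" using that st Icc_subset_interval[OF S] by blast
      then show ?thesis using primitive_onD(4)[OF prim, of s x] st that by auto
    qed
    ultimately show ?thesis by (metis (no_types, lifting) continuous_on_cong)
  qed
  show ?thesis
    unfolding continuous_on_eq_continuous_within
  proof
    fix t assume t: "t \<in> S"
    have left: "continuous (at t within S \<inter> {..t}) g"
    proof (cases "\<exists>s\<in>S. s < t")
      case True
      then obtain s where s: "s \<in> S" "s < t" by auto
      have "continuous (at t within {s..t}) g"
        using loc[OF s(1) t s(2)] s by (auto simp: continuous_on_eq_continuous_within)
      moreover have "at t within {s..t} = at t within (S \<inter> {..t})"
        by (rule at_within_nhd[of t "{s<..}"]) (use s t Icc_subset_interval[OF S, of s t] Icc_subset_interval[OF S, of t s] in auto)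
      ultimately show ?thesis by simp
    next
      case False
      then have "S \<inter> {..t} = {t}" using t by force
      then show ?thesis using continuous_on_sing[of t g] by (simp add: continuous_on_eq_continuous_within)
    qed
    have right: "continuous (at t within S \<inter> {t..}) g"
    proof (cases "\<exists>s\<in>S. s > t")
      case True
      then obtain s where s: "s \<in> S" "s > t" by auto
      have "continuous (at t within {t..s}) g"
        using loc[OF t s(1) s(2)] s by (auto simp: continuous_on_eq_continuous_within)
      moreover have "at t within {t..s} = at t within (S \<inter> {t..})"
        by (rule at_within_nhd[of t "{..<s}"]) (use s t Icc_subset_interval[OF S, of s t] Icc_subset_interval[OF S, of t s] in auto)
      ultimately show ?thesis by simp
    next
      case False
      then have "S \<inter> {t..} = {t}" using t by force
      then show ?thesis using continuous_on_sing[of t g] by (simp add: continuous_on_eq_continuous_within)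
    qed
    have "S = (S \<inter> {..t}) \<union> (S \<inter> {t..})" by auto
    then show "continuous (at t within S) g"
      using left right by (metis continuous_within at_within_union filterlim_sup)
  qed
qed

lemma has_vector_derivative_within_interval:
  assumes "s \<in> S" "\<And>t. t \<in> S \<Longrightarrow> (f has_vector_derivative g t) (at t within S)"
    "is_interval S" "s \<le> t" "t \<in> S" "s \<le> r" "r \<le> t"
  shows "(f has_vector_derivative g r) (at r within {s..t})"
  by (rule has_vector_derivative_within_subset[where S=S])
    (use assms Icc_subset_interval[OF assms(3,1,5)] in auto)

lemma primitive_onI_C1:
  assumes "is_interval S" "\<And>t. t \<in> S \<Longrightarrow> (f has_vector_derivative g t) (at t within S)" "continuous_on S g"
  shows "primitive_on S f g"
  unfolding primitive_on_def
proof (intro ballI impI conjI)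
  fix s t assume st: "s \<in> S" "t \<in> S" "s \<le> t"
  then have sub: "{s..t} \<subseteq> S" using Icc_subset_interval[OF assms(1)] by blast
  show "(g has_integral f t - f s) {s..t}"
    by (rule fundamental_theorem_of_calculus[OF st(3)])
      (use has_vector_derivative_within_interval[OF st(1) assms(2,1)] st in auto)
  show "g absolutely_integrable_on {s..t}"
    using continuous_on_subset[OF assms(3) sub]
    by (metis absolutely_integrable_continuous_real)
qed

lemma primitive_on_has_derivative:
  assumes S: "is_interval S" and prim: "primitive_on S f g" and g: "continuous_on S g" and t: "t \<in> S"
  shows "(f has_vector_derivative g t) (at t within S)"
proof -
  have one: "(f has_vector_derivative g t) (at t within {a..b})" if ab: "a \<in> S" "b \<in> S" "a \<le> t" "t \<le> b" for a b
  proof -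
    have sub: "{a..b} \<subseteq> S" using ab Icc_subset_interval[OF S] by blast
    have der: "((\<lambda>u. f a + integral {a..u} g) has_vector_derivative 0 + g t) (at t within {a..b})"
      by (intro has_vector_derivative_add integral_has_vector_derivative continuous_on_subset[OF g sub])
        (use ab in auto)
    have eq: "f u = f a + integral {a..u} g" if "u \<in> {a..b}" for u
      using primitive_onD(4)[OF prim, of a u] sub ab that by auto
    show ?thesis
      by (rule has_vector_derivative_transform[OF _ eq]) (use ab der in simp_all)
  qed
  obtain a where a: "a \<in> S" "a \<le> t" "(\<exists>a\<in>S. a < t) \<Longrightarrow> a < t"
    using t by (metis order_refl less_imp_le)
  obtain b where b: "b \<in> S" "t \<le> b" "(\<exists>b\<in>S. b > t) \<Longrightarrow> b > t"
    using t by (metis order_refl less_imp_le)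
  define U where "U = (if a < t then {a<..} else UNIV) \<inter> (if t < b then {..<b} else UNIV)"
  have sub: "{a..b} \<subseteq> S" using a b Icc_subset_interval[OF S] by blast
  have "x \<in> {a..b}" if x: "x \<in> S" "x \<in> U" for x
  proof -
    have "a \<le> x"
      using x a by (cases "a < t"; cases "x < t") (auto simp: U_def)
    moreover have "x \<le> b"
      using x b by (cases "t < b"; cases "t < x") (auto simp: U_def)
    ultimately show ?thesis by simp
  qed
  then have eq: "{a..b} \<inter> U - {t} = S \<inter> U - {t}" using sub by blast
  have "t \<in> U" "open U" by (simp_all add: U_def open_Int)
  from at_within_nhd[OF this eq] have "at t within {a..b} = at t within S" .
  then show ?thesis using one[OF a(1) b(1) a(2) b(2)] by simp
qed

text \<open>The error of the product rule over a short interval is small compared with the total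
  variation of \<open>u\<close> and \<open>v\<close> over it.\<close>

lemma primitive_on_bilinear:
  fixes prod :: "'a::euclidean_space \<Rightarrow> 'b::euclidean_space \<Rightarrow> 'c::euclidean_space"
  assumes bil: "bounded_bilinear prod" and S: "is_interval S"
    and u: "primitive_on S u u'" and v: "primitive_on S v v'"
  shows "primitive_on S (\<lambda>t. prod (u t) (v t)) (\<lambda>t. prod (u' t) (v t) + prod (u t) (v' t))"
  unfolding primitive_on_def
proof (intro ballI impI)
  interpret bounded_bilinear prod by fact
  have bil': "bilinear prod" "bilinear (\<lambda>x y. prod y x)"
    using bil bounded_bilinear.flip[OF bil] by (auto simp: bilinear_conv_bounded_bilinear)
  fix s t assume st: "s \<in> S" "t \<in> S" "s \<le> t"
  let ?F = "\<lambda>r. prod (u' r) (v r) + prod (u r) (v' r)"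
  have sub: "{s..t} \<subseteq> S" using st Icc_subset_interval[OF S] by blast
  have cu: "continuous_on {s..t} u" and cv: "continuous_on {s..t} v"
    using primitive_on_continuous[OF S] u v sub continuous_on_subset by blast+
  note int_u' = primitive_onD(1)[OF u st] and int_v' = primitive_onD(1)[OF v st]
  have a1: "(\<lambda>r. prod (u' r) (v r)) absolutely_integrable_on {s..t}"
    by (rule absolutely_integrable_bounded_measurable_product[OF bil'(2) _ _ _ int_u'])
      (use cv compact_imp_bounded[OF compact_continuous_image[OF cv compact_Icc]] in
        \<open>auto intro: continuous_imp_measurable_on_sets_lebesgue\<close>)
  have a2: "(\<lambda>r. prod (u r) (v' r)) absolutely_integrable_on {s..t}"
    by (rule absolutely_integrable_bounded_measurable_product[OF bil'(1) _ _ _ int_v'])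
      (use cu compact_imp_bounded[OF compact_continuous_image[OF cu compact_Icc]] in
        \<open>auto intro: continuous_imp_measurable_on_sets_lebesgue\<close>)
  show F: "?F absolutely_integrable_on {s..t} \<and> (?F has_integral prod (u t) (v t) - prod (u s) (v s)) {s..t}"
  proof
    show Fi: "?F absolutely_integrable_on {s..t}" using a1 a2 by (rule set_integral_add(1))
    obtain K where K: "K > 0" "\<And>a b. norm (prod a b) \<le> norm a * norm b * K"
      using pos_bounded by blast
    \<comment> \<open>\<open>E\<close> is the defect of the product rule on an interval,
      \<open>M\<close> the variation of \<open>u\<close> and \<open>v\<close> over it. Both are
      additive over adjacent intervals, so a bound of \<open>E\<close> by \<open>M\<close> on short
      intervals extends to \<open>{s..t}\<close> by bisection.\<close>
    define M where "M a b = integral {a..b} (\<lambda>r. norm (u' r)) + integral {a..b} (\<lambda>r. norm (v' r))" for a b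
    define E where "E a b = prod (u b) (v b) - prod (u a) (v a) - integral {a..b} ?F" for a b
    have subint: "w absolutely_integrable_on {a..b}" if "w absolutely_integrable_on {s..t}" "{a..b} \<subseteq> {s..t}"
      for w :: "real \<Rightarrow> 'z::euclidean_space" and a b
      using that absolutely_integrable_on_subinterval by blast
    have ni: "(\<lambda>r. norm (w r)) integrable_on {a..b}" if "w absolutely_integrable_on {s..t}" "{a..b} \<subseteq> {s..t}"
      for w :: "real \<Rightarrow> 'z::euclidean_space" and a b
      using subint[OF that] by (simp add: absolutely_integrable_on_def)
    have Msplit: "M a b + M b c = M a c" if "s \<le> a" "a \<le> b" "b \<le> c" "c \<le> t" for a b c
      unfolding M_def using that
        Henstock_Kurzweil_Integration.integral_combine[OF that(2,3) ni[OF int_u', of a c]]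
        Henstock_Kurzweil_Integration.integral_combine[OF that(2,3) ni[OF int_v', of a c]] by force
    have Esplit: "E a b + E b c = E a c" if "s \<le> a" "a \<le> b" "b \<le> c" "c \<le> t" for a b c
      unfolding E_def using that
        Henstock_Kurzweil_Integration.integral_combine[OF that(2,3), of ?F]
        subint[OF Fi, of a c] by (auto simp: algebra_simps set_lebesgue_integral_eq_integral(1))
    have small: "norm (E s t) \<le> e * (K * M s t)" if e: "e > 0" for e
    proof -
      obtain d1 where d1: "d1 > 0" "\<And>x y. x \<in> {s..t} \<Longrightarrow> y \<in> {s..t} \<Longrightarrow> dist y x < d1 \<Longrightarrow> dist (u y) (u x) < e"
        using compact_uniformly_continuous[OF cu] e unfolding uniformly_continuous_on_def by (metis compact_Icc)
      obtain d2 where d2: "d2 > 0" "\<And>x y. x \<in> {s..t} \<Longrightarrow> y \<in> {s..t} \<Longrightarrow> dist y x < d2 \<Longrightarrow> dist (v y) (v x) < e"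
        using compact_uniformly_continuous[OF cv] e unfolding uniformly_continuous_on_def by (metis compact_Icc)
      have short: "norm (E a b) \<le> e * (K * M a b)"
        if ab: "s \<le> a" "a \<le> b" "b \<le> t" "b - a < min d1 d2" for a b
      proof -
        have abS: "a \<in> S" "b \<in> S" using ab sub by auto
        have sb: "{a..b} \<subseteq> {s..t}" using ab by auto
        have i1: "((\<lambda>r. prod (u' r) (v b)) has_integral prod (u b - u a) (v b)) {a..b}"
          using has_integral_linear[OF primitive_onD(2)[OF u abS ab(2)] bounded_linear_left[of "v b"]]
          by (simp add: o_def)
        have i2: "((\<lambda>r. prod (u a) (v' r)) has_integral prod (u a) (v b - v a)) {a..b}"
          using has_integral_linear[OF primitive_onD(2)[OF v abS ab(2)] bounded_linear_right[of "u a"]]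
          by (simp add: o_def)
        have i3: "(?F has_integral integral {a..b} ?F) {a..b}"
          using subint[OF Fi sb] by (intro integrable_integral set_lebesgue_integral_eq_integral(1))
        \<comment> \<open>Freezing \<open>v\<close> at the right end and \<open>u\<close> at the
          left end reproduces the increment of the product exactly: the two products telescope. What
          remains is the error caused by freezing.\<close>
        have "((\<lambda>r. prod (u' r) (v b) + prod (u a) (v' r) - ?F r) has_integral
            prod (u b - u a) (v b) + prod (u a) (v b - v a) - integral {a..b} ?F) {a..b}"
          by (intro has_integral_diff has_integral_add i1 i2 i3)
        moreover have "prod (u b - u a) (v b) + prod (u a) (v b - v a) - integral {a..b} ?F = E a b"
          unfolding E_def by (simp add: diff_left diff_right)
        moreover have "prod (u' r) (v b) + prod (u a) (v' r) - ?F r = prod (u' r) (v b - v r) + prod (u a - u r) (v' r)" for r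
          by (simp add: diff_left diff_right)
        ultimately have i4: "((\<lambda>r. prod (u' r) (v b - v r) + prod (u a - u r) (v' r)) has_integral E a b) {a..b}"
          by simp
        have i5: "((\<lambda>r. e * (K * (norm (u' r) + norm (v' r)))) has_integral e * (K * M a b)) {a..b}"
          unfolding M_def
          by (intro has_integral_mult_right has_integral_add integrable_integral ni[OF int_u' sb] ni[OF int_v' sb])
        have "norm (integral {a..b} (\<lambda>r. prod (u' r) (v b - v r) + prod (u a - u r) (v' r)))
          \<le> integral {a..b} (\<lambda>r. e * (K * (norm (u' r) + norm (v' r))))"
        proof (rule integral_norm_bound_integral)
          fix r assume r: "r \<in> {a..b}"
          then have "dist (u a) (u r) < e" "dist (v b) (v r) < e"
            using d1(2)[of r a] d2(2)[of r b] ab by (auto simp: dist_real_def)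
          then have n: "norm (u a - u r) \<le> e" "norm (v b - v r) \<le> e" by (auto simp: dist_norm)
          have "norm (prod (u' r) (v b - v r)) \<le> norm (u' r) * e * K"
            using K n by (meson mult_left_mono mult_right_mono norm_ge_zero order_trans less_imp_le)
          moreover have "norm (prod (u a - u r) (v' r)) \<le> e * norm (v' r) * K"
            using K n by (meson mult_left_mono mult_right_mono norm_ge_zero order_trans less_imp_le)
          ultimately show "norm (prod (u' r) (v b - v r) + prod (u a - u r) (v' r)) \<le> e * (K * (norm (u' r) + norm (v' r)))"
            using norm_triangle_ineq[of "prod (u' r) (v b - v r)" "prod (u a - u r) (v' r)"]
            by (simp add: algebra_simps)
        qed (use i4 i5 in auto)
        then show ?thesis by (simp only: integral_unique[OF i4] integral_unique[OF i5])
      qed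
      have "s \<le> s \<longrightarrow> t \<le> t \<longrightarrow> norm (E s t) \<le> e * (K * M s t)"
        using st(3)
      proof (induction rule: Bolzano[where P="\<lambda>a b. s \<le> a \<longrightarrow> b \<le> t \<longrightarrow> norm (E a b) \<le> e * (K * M a b)"])
        case (trans a b c)
        show ?case
        proof (intro impI)
          assume ac: "s \<le> a" "c \<le> t"
          have "norm (E a c) \<le> norm (E a b) + norm (E b c)"
            using Esplit[of a b c] trans ac norm_triangle_ineq[of "E a b" "E b c"] by simp
          also have "\<dots> \<le> e * (K * M a b) + e * (K * M b c)" using trans ac by auto
          also have "\<dots> = e * (K * M a c)" using Msplit[of a b c] trans ac by (simp flip: distrib_left)
          finally show "norm (E a c) \<le> e * (K * M a c)" .
        qed
      next
        case (local x)
        show ?case using short d1(1) d2(1) by (intro exI[of _ "min d1 d2"]) auto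
      qed
      then show ?thesis by simp
    qed
    have "norm (E s t) \<le> 0"
    proof (rule field_le_epsilon)
      fix e :: real assume e: "e > 0"
      have M0: "M s t \<ge> 0" unfolding M_def
        by (intro add_nonneg_nonneg integral_nonneg ni[OF int_u'] ni[OF int_v']) auto
      have "norm (E s t) \<le> e / (K * M s t + 1) * (K * M s t)"
        using small[of "e / (K * M s t + 1)"] e K M0 by (simp add: add_nonneg_pos)
      also have "\<dots> \<le> e"
      proof -
        have "0 \<le> K * M s t" using K M0 by simp
        then show ?thesis using e by (simp add: divide_simps mult_left_mono)
      qed
      finally show "norm (E s t) \<le> 0 + e" by simp
    qed
    then have "integral {s..t} ?F = prod (u t) (v t) - prod (u s) (v s)" unfolding E_def by simp
    then show "(?F has_integral prod (u t) (v t) - prod (u s) (v s)) {s..t}"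
      using Fi by (metis integrable_integral set_lebesgue_integral_eq_integral(1))
  qed
qed

section \<open>Matrix inverses and linear differential equations\<close>

lemma has_vector_derivative_iff_tendsto:
  fixes f :: "real \<Rightarrow> 'a::real_normed_vector"
  shows "(f has_vector_derivative D) (at t within S) \<longleftrightarrow>
    ((\<lambda>s. (f s - f t) /\<^sub>R (s - t)) \<longlongrightarrow> D) (at t within S)"
proof -
  have "norm (f y - f t - (y - t) *\<^sub>R D) / norm (y - t) = norm ((f y - f t) /\<^sub>R (y - t) - D)" if "y \<noteq> t" for y
  proof -
    have "(f y - f t) /\<^sub>R (y - t) - D = (f y - f t - (y - t) *\<^sub>R D) /\<^sub>R (y - t)"
      using that by (simp add: scaleR_diff_right)
    then show ?thesis by (simp add: divide_inverse mult.commute)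
  qed
  then have "((\<lambda>y. norm (f y - f t - (y - t) *\<^sub>R D) / norm (y - t)) \<longlongrightarrow> 0) (at t within S) \<longleftrightarrow>
     ((\<lambda>y. norm ((f y - f t) /\<^sub>R (y - t) - D)) \<longlongrightarrow> 0) (at t within S)"
    by (intro Lim_cong_within) auto
  then show ?thesis
    unfolding has_vector_derivative_def has_derivative_iff_norm
    by (simp add: tendsto_norm_zero_iff LIM_zero_iff bounded_linear_scaleR_left)
qed

text \<open>Lebesgue differentiation for \<open>h\<close> extended by zero:
  \<open>integrable_ccontinuous_explicit\<close> handles the quotients to the right off a null set
  and, applied to the reflected function, those to the left. The ends of \<open>S\<close> are put
  into the null set so that both sides lie in \<open>S\<close>.\<close>

lemma primitive_on_AE_derivative:
  fixes g :: "real \<Rightarrow> 'a::euclidean_space"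
  assumes S: "is_interval S" "closed S" and prim: "primitive_on S g h"
  shows "AE t in lebesgue_on S. (g has_vector_derivative h t) (at t within S)"
proof -
  define h1 where "h1 x = (if x \<in> S then h x else 0)" for x
  have int: "h1 integrable_on {a..b}" for a b
  proof -
    have "is_interval (S \<inter> {a..b})" "compact (S \<inter> {a..b})"
      using S by (auto simp: is_interval_Int is_interval_cc closed_Int_compact)
    then obtain c d where cd: "S \<inter> {a..b} = {c..d}"
      by (metis cbox_interval is_interval_compact)
    have "h integrable_on {c..d}"
    proof (cases "c \<le> d")
      case True
      have "{c..d} \<subseteq> S" using cd by blast
      then have "c \<in> S" "d \<in> S" using True by (meson atLeastAtMost_iff order_refl subsetD)+
      then show ?thesis using primitive_onD(3)[OF prim] True by blast
    qed (simp add: integrable_on_empty)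
    then have "h integrable_on S \<inter> {a..b}" by (simp only: cd)
    then show ?thesis unfolding h1_def by (simp only: integrable_restrict_Int)
  qed
  obtain N1 where N1: "negligible N1"
    "\<And>x e. \<lbrakk>x \<notin> N1; 0 < e\<rbrakk> \<Longrightarrow> \<exists>d>0. \<forall>k. 0 < k \<and> k < d \<longrightarrow> norm (integral {x..x+k} h1 /\<^sub>R k - h1 x) < e"
    using integrable_ccontinuous_explicit[of h1] int by (auto simp: cbox_interval)
  have "(\<lambda>x. h1 (- x)) integrable_on {a..b}" for a b
    using int[of "-b" "-a"] Henstock_Kurzweil_Integration.integrable_reflect_real[where f=h1 and a="-b" and b="-a"] by simp
  then obtain N2 where N2: "negligible N2"
    "\<And>x e. \<lbrakk>x \<notin> N2; 0 < e\<rbrakk> \<Longrightarrow> \<exists>d>0. \<forall>k. 0 < k \<and> k < d \<longrightarrow>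
      norm (integral {x..x+k} (\<lambda>x. h1 (- x)) /\<^sub>R k - h1 (- x)) < e"
    using integrable_ccontinuous_explicit[of "\<lambda>x. h1 (- x)"] by (auto simp: cbox_interval)
  define N where "N = N1 \<union> uminus ` N2 \<union> frontier S"
  have negN: "negligible N"
    unfolding N_def using N1(1) N2(1) negligible_differentiable_image_negligible[of N2 "uminus :: real \<Rightarrow> real"]
      negligible_convex_frontier[of S] S
    by (simp add: is_interval_convex_1 differentiable_on_minus)
  have der: "(g has_vector_derivative h t) (at t within S)" if t: "t \<in> S" "t \<notin> N" for t
  proof -
    have "t \<in> interior S" using t S(2) by (auto simp: N_def frontier_def)
    then obtain r where r: "r > 0" "ball t r \<subseteq> S" by (meson mem_interior)
    have inS: "s \<in> S" if "\<bar>s - t\<bar> < r" for s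
      using r(2) that by (auto simp: ball_def dist_real_def)
    have h1h: "integral {a..b} h1 = g b - g a" if "\<bar>a - t\<bar> < r" "\<bar>b - t\<bar> < r" "a \<le> b" for a b
    proof -
      have sub: "{a..b} \<subseteq> S" using Icc_subset_interval[OF S(1)] inS that by blast
      then have "integral {a..b} h1 = integral {a..b} h"
        by (intro integral_cong) (auto simp: h1_def)
      then show ?thesis using primitive_onD(4)[OF prim] inS that by metis
    qed
    show ?thesis
      unfolding has_vector_derivative_iff_tendsto
    proof (rule tendstoI)
      fix e :: real assume e: "e > 0"
      have t1: "t \<notin> N1" "- t \<notin> N2" using t(2) by (auto simp: N_def) (metis add.inverse_inverse image_eqI)
      obtain d1 where d1: "d1 > 0" "\<And>k. 0 < k \<Longrightarrow> k < d1 \<Longrightarrow> norm (integral {t..t+k} h1 /\<^sub>R k - h1 t) < e"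
        using N1(2)[OF t1(1) e] by blast
      obtain d2 where d2: "d2 > 0" "\<And>k. 0 < k \<Longrightarrow> k < d2 \<Longrightarrow>
          norm (integral {-t..-t+k} (\<lambda>x. h1 (- x)) /\<^sub>R k - h1 t) < e"
        using N2(2)[OF t1(2) e] by auto
      have "dist ((g s - g t) /\<^sub>R (s - t)) (h t) < e" if s: "s \<noteq> t" "dist s t < min r (min d1 d2)" for s
      proof (cases "s > t")
        case True
        have "integral {t..t + (s - t)} h1 = g s - g t" using h1h[of t s] s True r(1) by (simp add: dist_real_def)
        then show ?thesis using d1(2)[of "s - t"] True s t(1) by (simp add: dist_real_def dist_norm h1_def)
      next
        case False
        then have lt: "s < t" using s by simp
        have "integral {-t..-t + (t - s)} (\<lambda>x. h1 (- x)) = integral {s..t} h1"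
          using Henstock_Kurzweil_Integration.integral_reflect_real[where f=h1 and a=s and b=t] by simp
        also have "\<dots> = g t - g s" using h1h[of s t] s lt r(1) by (simp add: dist_real_def)
        finally have "norm ((g t - g s) /\<^sub>R (t - s) - h t) < e"
          using d2(2)[of "t - s"] lt s t(1) by (simp add: dist_real_def h1_def)
        moreover have "(g t - g s) /\<^sub>R (t - s) = (g s - g t) /\<^sub>R (s - t)"
          by (metis (no_types, lifting) minus_diff_eq inverse_minus_eq scaleR_minus_left scaleR_minus_right)
        ultimately show ?thesis by (simp add: dist_norm)
      qed
      then show "\<forall>\<^sub>F s in at t within S. dist ((g s - g t) /\<^sub>R (s - t)) (h t) < e"
        unfolding eventually_at using r(1) d1(1) d2(1) by (intro exI[of _ "min r (min d1 d2)"]) auto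
    qed
  qed
  have "AE t in lebesgue. t \<notin> N" using negN by (metis AE_not_in negligible_iff_null_sets)
  then show ?thesis
    using S(2) der by (subst AE_restrict_space_iff) (auto elim: eventually_mono)
qed

lemma bounded_bilinear_matrix_vector_mult:
  "bounded_bilinear (\<lambda>(A::real^'n^'m) x. A *v x)"
  unfolding bilinear_conv_bounded_bilinear[symmetric] bilinear_def
  by (auto intro!: linearI simp: matrix_vector_mult_add_rdistrib matrix_vector_right_distrib
      matrix_vector_mult_scaleR simp flip: scaleR_matrix_vector_assoc)

lemma bounded_bilinear_matrix_matrix_mult:
  "bounded_bilinear (\<lambda>(A::real^'n^'m) (B::real^'k^'n). A ** B)"
  unfolding bilinear_conv_bounded_bilinear[symmetric] bilinear_def
  by (auto intro!: linearI simp: matrix_matrix_mult_def vec_eq_iff sum.distrib sum_distrib_left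
      algebra_simps)

lemma matrix_inv_mult:
  fixes A :: "real^'n^'n"
  assumes "invertible A"
  shows "A ** matrix_inv A = mat 1" "matrix_inv A ** A = mat 1"
  using assms someI_ex[of "\<lambda>A'. A ** A' = mat 1 \<and> A' ** A = mat 1"]
  unfolding matrix_inv_def invertible_def by auto

lemma matrix_inv_eqI:
  fixes A :: "real^'n^'n"
  assumes "A ** B = mat 1"
  shows "matrix_inv A = B"
proof -
  have "invertible A" using assms invertible_right_inverse by blast
  then have "matrix_inv A ** (A ** B) = B" by (simp add: matrix_mul_assoc matrix_inv_mult)
  then show ?thesis using assms by simp
qed

lemma matrix_inv_involutive:
  fixes A :: "real^'n^'n"
  assumes "invertible A"
  shows "matrix_inv (matrix_inv A) = A"
  using matrix_inv_eqI[OF matrix_inv_mult(2)[OF assms]] .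

lemma invertible_matrix_inv:
  fixes A :: "real^'n^'n"
  assumes "invertible A"
  shows "invertible (matrix_inv A)"
  using matrix_inv_mult[OF assms] unfolding invertible_def by blast

text \<open>Writing \<open>N\<close> for the inverse of \<open>M s\<close>, the identity
  \<open>N - matrix_inv A = N ** (A - M s) ** matrix_inv A\<close> bounds the error by
  \<open>norm N\<close> times a factor tending to 0. Once this factor is below 1/2, the same
  identity bounds \<open>norm N\<close> by \<open>2 * norm (matrix_inv A)\<close>.\<close>

lemma tendsto_matrix_inv:
  fixes M :: "'x::t2_space \<Rightarrow> real^'n^'n"
  assumes lim: "(M \<longlongrightarrow> A) F" and A: "invertible A" and inv: "\<forall>\<^sub>F s in F. invertible (M s)"
  shows "((\<lambda>s. matrix_inv (M s)) \<longlongrightarrow> matrix_inv A) F"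
proof -
  interpret mm: bounded_bilinear "\<lambda>(A::real^'n^'n) (B::real^'n^'n). A ** B"
    by (rule bounded_bilinear_matrix_matrix_mult)
  obtain C where C: "C > 0" "\<And>(A::real^'n^'n) (B::real^'n^'n). norm (A ** B) \<le> norm A * norm B * C"
    using mm.pos_bounded by blast
  let ?N = "\<lambda>s. matrix_inv (M s)"
  let ?k = "C * C * norm (matrix_inv A)"
  have id: "?N s - matrix_inv A = ?N s ** (A - M s) ** matrix_inv A" if "invertible (M s)" for s
  proof -
    have "?N s ** (A - M s) ** matrix_inv A = (?N s ** A) ** matrix_inv A - (?N s ** M s) ** matrix_inv A"
      by (simp add: mm.diff_left mm.diff_right matrix_mul_assoc)
    also have "\<dots> = ?N s - matrix_inv A"
      using that A by (simp add: matrix_inv_mult flip: matrix_mul_assoc)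
    finally show ?thesis by simp
  qed
  have bd: "norm (?N s - matrix_inv A) \<le> norm (?N s) * (?k * norm (A - M s))" if "invertible (M s)" for s
  proof -
    have "norm (?N s ** (A - M s) ** matrix_inv A) \<le> norm (?N s ** (A - M s)) * norm (matrix_inv A) * C"
      by (rule C(2))
    also have "\<dots> \<le> (norm (?N s) * norm (A - M s) * C) * norm (matrix_inv A) * C"
      using C by (intro mult_right_mono) auto
    finally show ?thesis by (simp add: id[OF that] mult_ac)
  qed
  have lim0: "((\<lambda>s. ?k * norm (A - M s)) \<longlongrightarrow> 0) F"
  proof -
    have "((\<lambda>s. ?k * norm (A - M s)) \<longlongrightarrow> ?k * norm (A - A)) F" by (intro tendsto_intros lim)
    then show ?thesis by simp
  qed
  then have "\<forall>\<^sub>F s in F. ?k * norm (A - M s) < 1/2" by (rule order_tendstoD) simp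
  then have ev: "\<forall>\<^sub>F s in F. norm (?N s - matrix_inv A) \<le> 2 * norm (matrix_inv A) * (?k * norm (A - M s))"
    using inv
  proof eventually_elim
    case (elim s)
    have "norm (?N s) \<le> norm (matrix_inv A) + norm (?N s - matrix_inv A)"
      by (metis add.commute diff_add_cancel norm_triangle_ineq)
    also have "\<dots> \<le> norm (matrix_inv A) + norm (?N s) * (1/2)"
      using bd[OF elim(2)] elim(1) by (smt (verit) mult_left_mono norm_ge_zero)
    finally have "norm (?N s) \<le> 2 * norm (matrix_inv A)" by simp
    then show ?case
      using bd[OF elim(2)] C(1) by (smt (verit) mult_right_mono norm_ge_zero mult_nonneg_nonneg)
  qed
  have "((\<lambda>s. ?N s - matrix_inv A) \<longlongrightarrow> 0) F"
    by (rule Lim_null_comparison[OF ev]) (use tendsto_mult_left[OF lim0, of "2 * norm (matrix_inv A)"] in simp)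
  then show ?thesis by (simp add: LIM_zero_iff)
qed

text \<open>The difference quotient of the inverse is minus the quotient of \<open>M\<close>
  multiplied by \<open>?N s\<close> on the left and \<open>?N t\<close> on the right, so continuity
  of the inverse suffices.\<close>

lemma has_vector_derivative_matrix_inv:
  fixes M :: "real \<Rightarrow> real^'n^'n"
  assumes d: "(M has_vector_derivative M') (at t within T)" and inv: "\<forall>\<^sub>F s in at t within T. invertible (M s)"
    and t: "invertible (M t)"
  shows "((\<lambda>s. matrix_inv (M s)) has_vector_derivative - (matrix_inv (M t) ** M' ** matrix_inv (M t))) (at t within T)"
proof -
  interpret mm: bounded_bilinear "\<lambda>(A::real^'n^'n) (B::real^'n^'n). A ** B"
    by (rule bounded_bilinear_matrix_matrix_mult)
  let ?N = "\<lambda>s. matrix_inv (M s)"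
  have "(M \<longlongrightarrow> M t) (at t within T)"
    using has_vector_derivative_continuous[OF d] by (simp add: continuous_within)
  then have limN: "(?N \<longlongrightarrow> ?N t) (at t within T)" using tendsto_matrix_inv inv t by blast
  have "((\<lambda>s. - (?N s ** ((M s - M t) /\<^sub>R (s - t)) ** ?N t)) \<longlongrightarrow> - (?N t ** M' ** ?N t)) (at t within T)"
    using d unfolding has_vector_derivative_iff_tendsto
    by (intro tendsto_intros mm.tendsto limN) auto
  moreover have "\<forall>\<^sub>F s in at t within T. - (?N s ** ((M s - M t) /\<^sub>R (s - t)) ** ?N t) = (?N s - ?N t) /\<^sub>R (s - t)"
    using inv
  proof eventually_elim
    case (elim s)
    have "?N s ** (M s - M t) ** ?N t = (?N s ** M s) ** ?N t - ?N s ** (M t ** ?N t)"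
      by (simp add: mm.diff_left mm.diff_right matrix_mul_assoc)
    also have "\<dots> = ?N t - ?N s" using elim t by (simp add: matrix_inv_mult)
    finally have "?N s ** ((M s - M t) /\<^sub>R (s - t)) ** ?N t = (?N t - ?N s) /\<^sub>R (s - t)"
      by (simp add: mm.scaleR_left mm.scaleR_right)
    then show ?case by (simp flip: scaleR_minus_right)
  qed
  ultimately show ?thesis
    unfolding has_vector_derivative_iff_tendsto by (rule Lim_transform_eventually)
qed

text \<open>Gronwall's argument. \<open>e\<close> is the direction of time: 1 starts at
  \<open>a\<close>, -1 starts at \<open>b\<close>. The weighted square \<open>\<phi>\<close> does
  not increase in that direction and vanishes where it starts.\<close>

lemma linear_ode_forward_unique:
  fixes x :: "real \<Rightarrow> 'a::euclidean_space"
  assumes ab: "a \<le> b" and A: "continuous_on {a..b} A"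
    and x: "\<And>t. t \<in> {a..b} \<Longrightarrow> (x has_vector_derivative blinfun_apply (A t) (x t)) (at t within {a..b})"
    and e: "e = 1 \<or> e = (-1::real)" and x0: "(if e = 1 then x a else x b) = 0" and t: "t \<in> {a..b}"
  shows "x t = 0"
proof -
  obtain M where M: "\<And>t. t \<in> {a..b} \<Longrightarrow> norm (A t) \<le> M"
    using compact_imp_bounded[OF compact_continuous_image[OF A compact_Icc]] unfolding bounded_iff by fastforce
  define \<phi> where "\<phi> r = (x r \<bullet> x r) * exp (- (2 * e * M * r))" for r
  have cx: "continuous_on {a..b} x"
    using has_vector_derivative_continuous[OF x] by (simp add: continuous_on_eq_continuous_within)
  have cphi: "continuous_on {a..b} \<phi>" unfolding \<phi>_def by (intro continuous_intros cx)
  have d: "\<exists>y. DERIV \<phi> r :> y \<and> e * y \<le> 0" if r: "a < r" "r < b" for r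
  proof -
    have xd: "(x has_vector_derivative blinfun_apply (A r) (x r)) (at r)"
      using x[of r] r by (simp add: at_within_Icc_at)
    have "DERIV (\<lambda>r. x r \<bullet> x r) r :> 2 * (x r \<bullet> blinfun_apply (A r) (x r))"
      using bounded_bilinear.has_vector_derivative[OF bounded_bilinear_inner xd xd]
      by (simp add: has_real_derivative_iff_has_vector_derivative inner_commute)
    then have "DERIV \<phi> r :> 2 * (x r \<bullet> blinfun_apply (A r) (x r)) * exp (- (2 * e * M * r)) +
        - (2 * e * M) * exp (- (2 * e * M * r)) * (x r \<bullet> x r)"
      unfolding \<phi>_def by (rule DERIV_mult) (auto intro!: derivative_eq_intros)
    moreover have "e * (2 * (x r \<bullet> blinfun_apply (A r) (x r)) * exp (- (2 * e * M * r)) +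
        - (2 * e * M) * exp (- (2 * e * M * r)) * (x r \<bullet> x r)) \<le> 0"
    proof -
      have "\<bar>x r \<bullet> blinfun_apply (A r) (x r)\<bar> \<le> norm (x r) * norm (blinfun_apply (A r) (x r))"
        by (rule Cauchy_Schwarz_ineq2)
      also have "\<dots> \<le> norm (x r) * (M * norm (x r))"
        using order_trans[OF norm_blinfun[of "A r" "x r"] mult_right_mono[OF M[of r] norm_ge_zero]] r
        by (intro mult_left_mono) auto
      finally have "\<bar>x r \<bullet> blinfun_apply (A r) (x r)\<bar> \<le> M * (x r \<bullet> x r)"
        by (simp add: power2_norm_eq_inner[symmetric] power2_eq_square mult_ac)
      then have "e * (x r \<bullet> blinfun_apply (A r) (x r)) - M * (x r \<bullet> x r) \<le> 0" using e by auto
      then have "2 * exp (- (2 * e * M * r)) * (e * (x r \<bullet> blinfun_apply (A r) (x r)) - M * (x r \<bullet> x r)) \<le> 0"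
        by (simp add: mult_nonneg_nonpos)
      moreover have "e * (2 * (x r \<bullet> blinfun_apply (A r) (x r)) * exp (- (2 * e * M * r)) +
          - (2 * e * M) * exp (- (2 * e * M * r)) * (x r \<bullet> x r)) =
        2 * exp (- (2 * e * M * r)) * (e * (x r \<bullet> blinfun_apply (A r) (x r)) - (e * e) * (M * (x r \<bullet> x r)))"
        by (simp add: algebra_simps)
      moreover have "e * e = 1" using e by auto
      ultimately show ?thesis by (simp only: mult_1_left)
    qed
    ultimately show ?thesis by blast
  qed
  have "\<phi> t \<le> 0"
  proof (cases "e = 1")
    case True
    have "\<phi> t \<le> \<phi> a"
    proof (rule DERIV_nonpos_imp_decreasing_open[where f=\<phi> and a=a and b=t])
      show "\<exists>y. DERIV \<phi> r :> y \<and> y \<le> 0" if "a < r" "r < t" for r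
        using d[of r] that t True by auto
      show "continuous_on {a..t} \<phi>" by (rule continuous_on_subset[OF cphi]) (use t in auto)
    qed (use t in simp)
    then show ?thesis using x0 True by (simp add: \<phi>_def)
  next
    case False
    then have em: "e = -1" using e by simp
    have "\<phi> t \<le> \<phi> b"
    proof (rule DERIV_nonneg_imp_increasing_open[where f=\<phi> and a=t and b=b])
      show "\<exists>y. DERIV \<phi> r :> y \<and> y \<ge> 0" if "t < r" "r < b" for r
        using d[of r] that t em by auto
      show "continuous_on {t..b} \<phi>" by (rule continuous_on_subset[OF cphi]) (use t in auto)
    qed (use t in simp)
    then show ?thesis using x0 False by (simp add: \<phi>_def)
  qed
  then have "x t \<bullet> x t \<le> 0" by (simp add: \<phi>_def mult_le_0_iff)
  then show ?thesis using inner_ge_zero[of "x t"] inner_eq_zero_iff[of "x t"] by linarith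
qed

lemma linear_ode_unique:
  fixes x :: "real \<Rightarrow> 'a::euclidean_space"
  assumes S: "is_interval S" and A: "continuous_on S A"
    and x: "\<And>t. t \<in> S \<Longrightarrow> (x has_vector_derivative blinfun_apply (A t) (x t)) (at t within S)"
    and s: "s \<in> S" "x s = 0" and t: "t \<in> S"
  shows "x t = 0"
proof (cases "s \<le> t")
  case True
  have sub: "{s..t} \<subseteq> S" using Icc_subset_interval[OF S s(1) t] .
  show ?thesis
    by (rule linear_ode_forward_unique[where a=s and b=t and A=A and e=1])
      (use True s sub continuous_on_subset[OF A sub] has_vector_derivative_within_subset[OF x sub] in auto)
next
  case False
  have sub: "{t..s} \<subseteq> S" using Icc_subset_interval[OF S t s(1)] .
  show ?thesis
    by (rule linear_ode_forward_unique[where a=t and b=s and A=A and e="-1"])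
      (use False s sub continuous_on_subset[OF A sub] has_vector_derivative_within_subset[OF x sub] in auto)
qed

text \<open>Picard iteration written as a series: \<open>X n\<close> is its n-th term, and the
  factorial bound gives uniform convergence on each compact \<open>{a..t}\<close>. No uniformity
  over \<open>S\<close> is required, so \<open>S\<close> may be a half-line.\<close>

lemma linear_ode_exists:
  fixes x0 :: "'a::euclidean_space"
  assumes S: "is_interval S" "a \<in> S" "\<And>t. t \<in> S \<Longrightarrow> a \<le> t" and A: "continuous_on S A"
  obtains x where "x a = x0"
    "\<And>t. t \<in> S \<Longrightarrow> (x has_vector_derivative blinfun_apply (A t) (x t)) (at t within S)"
proof -
  define X where "X = rec_nat (\<lambda>_. x0) (\<lambda>n y t. integral {a..t} (\<lambda>s. blinfun_apply (A s) (y s)))"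
  have X0: "X 0 = (\<lambda>_. x0)" and XS: "X (Suc n) = (\<lambda>t. integral {a..t} (\<lambda>s. blinfun_apply (A s) (X n s)))" for n
    by (simp_all add: X_def)
  have sub: "{a..b} \<subseteq> S" if "b \<in> S" for b using Icc_subset_interval[OF S(1,2) that] .
  have cX: "continuous_on {a..b} (X n)" if b: "b \<in> S" for n b
  proof (induction n)
    case (Suc n)
    have "continuous_on {a..b} (\<lambda>s. blinfun_apply (A s) (X n s))"
      by (intro continuous_intros continuous_on_subset[OF A sub[OF b]] Suc)
    then show ?case unfolding XS
      by (intro indefinite_integral_continuous_1 integrable_continuous_real)
  qed (simp add: X0)
  have cAX: "continuous_on {a..b} (\<lambda>s. blinfun_apply (A s) (X n s))" if b: "b \<in> S" for n b
    by (intro continuous_intros continuous_on_subset[OF A sub[OF b]] cX[OF b])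
  have bound: "norm (X n t) \<le> norm x0 * (M ^ n * (t - a) ^ n / fact n)"
    if M: "\<And>s. s \<in> {a..b} \<Longrightarrow> norm (A s) \<le> M" and b: "b \<in> S" and t: "t \<in> {a..b}" for n M b t
    using t
  proof (induction n arbitrary: t)
    case (Suc n)
    have tS: "t \<in> S" using sub[OF b] Suc.prems by auto
    have M0: "M \<ge> 0" using norm_ge_zero[of "A a"] M[of a] Suc.prems by (simp del: norm_ge_zero)
    have int: "((\<lambda>s. norm x0 * (M ^ Suc n * (s - a) ^ n / fact n)) has_integral
        norm x0 * (M ^ Suc n * (t - a) ^ Suc n / fact (Suc n)) - norm x0 * (M ^ Suc n * (a - a) ^ Suc n / fact (Suc n))) {a..t}"
    proof (rule fundamental_theorem_of_calculus)
      fix s assume "s \<in> {a..t}"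
      have "((\<lambda>s. norm x0 * (M ^ Suc n * (s - a) ^ Suc n / fact (Suc n))) has_real_derivative
         norm x0 * (M ^ Suc n * (real (Suc n) * (s - a) ^ n) / fact (Suc n))) (at s within {a..t})"
        by (auto intro!: derivative_eq_intros simp del: power_Suc fact_Suc)
      moreover have "norm x0 * (M ^ Suc n * (real (Suc n) * (s - a) ^ n) / fact (Suc n)) = norm x0 * (M ^ Suc n * (s - a) ^ n / fact n)"
        by (simp add: field_simps del: of_nat_Suc)
      ultimately show "((\<lambda>s. norm x0 * (M ^ Suc n * (s - a) ^ Suc n / fact (Suc n))) has_vector_derivative
         norm x0 * (M ^ Suc n * (s - a) ^ n / fact n)) (at s within {a..t})"
        by (simp only: has_real_derivative_iff_has_vector_derivative)
    qed (use Suc.prems in auto)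
    have "norm (X (Suc n) t) \<le> integral {a..t} (\<lambda>s. norm x0 * (M ^ Suc n * (s - a) ^ n / fact n))"
      unfolding XS
    proof (rule integral_norm_bound_integral)
      show "(\<lambda>s. blinfun_apply (A s) (X n s)) integrable_on {a..t}"
        using integrable_continuous_real[OF cAX[OF tS]] .
      fix s assume s: "s \<in> {a..t}"
      have "norm (blinfun_apply (A s) (X n s)) \<le> norm (A s) * norm (X n s)" by (rule norm_blinfun)
      also have "\<dots> \<le> M * (norm x0 * (M ^ n * (s - a) ^ n / fact n))"
        using s Suc M M0 by (intro mult_mono) auto
      finally show "norm (blinfun_apply (A s) (X n s)) \<le> norm x0 * (M ^ Suc n * (s - a) ^ n / fact n)" by (simp add: mult_ac)
    qed (use int in auto)
    also have "\<dots> = norm x0 * (M ^ Suc n * (t - a) ^ Suc n / fact (Suc n))"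
      using integral_unique[OF int] by simp
    finally show ?case .
  qed (simp add: X0)
  define Y where "Y t = (\<Sum>n. X n t)" for t
  define Pn where "Pn n t = (\<Sum>k<n. X k t)" for n t
  have step: "Y t = x0 + integral {a..t} (\<lambda>s. blinfun_apply (A s) (Y s)) \<and> continuous_on {a..t} Y" if t: "t \<in> S" for t
  proof -
    have at: "a \<le> t" using S(3)[OF t] .
    have cA: "continuous_on {a..t} A" using continuous_on_subset[OF A sub[OF t]] .
    have bA: "bounded (A ` {a..t})" using compact_imp_bounded[OF compact_continuous_image[OF cA compact_Icc]] .
    then obtain M where M: "\<And>s. s \<in> {a..t} \<Longrightarrow> norm (A s) \<le> M" unfolding bounded_iff by fastforce
    have M0: "M \<ge> 0" using norm_ge_zero[of "A a"] M[of a] at by (simp del: norm_ge_zero)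
    have unif: "uniform_limit {a..t} Pn Y sequentially"
      unfolding Pn_def[abs_def] Y_def[abs_def]
    proof (rule Weierstrass_m_test)
      fix n s assume s: "s \<in> {a..t}"
      have "norm (X n s) \<le> norm x0 * (M ^ n * (s - a) ^ n / fact n)" by (rule bound[OF M t s]) 
      also have "\<dots> \<le> norm x0 * ((M * (t - a)) ^ n / fact n)"
        using s M0 by (intro mult_left_mono divide_right_mono) (auto simp: power_mult_distrib intro!: mult_left_mono power_mono)
      finally show "norm (X n s) \<le> norm x0 * ((M * (t - a)) ^ n / fact n)" .
    next
      show "summable (\<lambda>n. norm x0 * ((M * (t - a)) ^ n / fact n))"
        using summable_exp[of "M * (t - a)"] by (intro summable_mult) (simp add: field_simps)
    qed
    have cP: "continuous_on {a..t} (Pn n)" for n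
      unfolding Pn_def by (intro continuous_intros cX[OF t])
    have cY: "continuous_on {a..t} Y"
      using uniform_limit_theorem[OF _ unif] cP by simp
    have bY: "bounded (Y ` {a..t})" using compact_imp_bounded[OF compact_continuous_image[OF cY compact_Icc]] .
    have unif2: "uniform_limit {a..t} (\<lambda>n s. blinfun_apply (A s) (Pn n s)) (\<lambda>s. blinfun_apply (A s) (Y s)) sequentially"
      by (rule bounded_bilinear.bounded_uniform_limit[OF bounded_bilinear_blinfun_apply uniform_limit_const unif bY bA])
    obtain I J where IJ: "\<And>n. ((\<lambda>s. blinfun_apply (A s) (Pn n s)) has_integral I n) {a..t}"
       "((\<lambda>s. blinfun_apply (A s) (Y s)) has_integral J) {a..t}" "I \<longlonglongrightarrow> J"
      by (rule uniform_limit_integral[OF unif2]) (auto intro!: continuous_intros cA cP)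
    have "I n = (\<Sum>k<n. X (Suc k) t)" for n
    proof -
      have "((\<lambda>s. \<Sum>k<n. blinfun_apply (A s) (X k s)) has_integral (\<Sum>k<n. X (Suc k) t)) {a..t}"
        unfolding XS by (intro has_integral_sum integrable_integral integrable_continuous_real cAX[OF t]) auto
      then show ?thesis using has_integral_unique[OF IJ(1)] by (simp add: Pn_def blinfun.sum_right)
    qed
    then have "x0 + I n = Pn (Suc n) t" for n
      by (simp add: Pn_def sum.lessThan_Suc_shift X0 del: sum.lessThan_Suc)
    moreover have "(\<lambda>n. Pn (Suc n) t) \<longlonglongrightarrow> Y t"
      using at by (intro LIMSEQ_Suc tendsto_uniform_limitI[OF unif]) simp
    moreover have "(\<lambda>n. x0 + I n) \<longlonglongrightarrow> x0 + J" by (intro tendsto_intros IJ)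
    ultimately have "Y t = x0 + J" using LIMSEQ_unique by simp
    then show ?thesis using cY integral_unique[OF IJ(2)] by simp
  qed
  have prim: "primitive_on S Y (\<lambda>s. blinfun_apply (A s) (Y s))"
    unfolding primitive_on_def
  proof (intro ballI impI)
    fix s t assume st: "s \<in> S" "t \<in> S" "s \<le> t"
    let ?F = "\<lambda>s. blinfun_apply (A s) (Y s)"
    have c: "continuous_on {a..t} ?F"
      by (intro continuous_intros continuous_on_subset[OF A sub[OF st(2)]]) (use step[OF st(2)] in auto)
    then have i: "?F integrable_on {a..t}" by (rule integrable_continuous_real)
    have le: "a \<le> s" using S(3) st by auto
    have sub': "{s..t} \<subseteq> {a..t}" using le by auto
    have "integral {a..s} ?F + integral {s..t} ?F = integral {a..t} ?F"
      using Henstock_Kurzweil_Integration.integral_combine[OF le st(3) i] .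
    then have "integral {s..t} ?F = Y t - Y s" using step[OF st(1)] step[OF st(2)]
      by (metis add_diff_cancel_left add_diff_cancel_left')
    then show "?F absolutely_integrable_on {s..t} \<and> (?F has_integral Y t - Y s) {s..t}"
      using absolutely_integrable_continuous_real[OF continuous_on_subset[OF c sub']]
        integrable_subinterval_real[OF i sub'] by (metis integrable_integral)
  qed
  have cY: "continuous_on S Y" using primitive_on_continuous[OF S(1) prim] .
  show ?thesis
  proof
    show "Y a = x0" using step[OF S(2)] by simp
    show "(Y has_vector_derivative blinfun_apply (A t) (Y t)) (at t within S)" if "t \<in> S" for t
      by (rule primitive_on_has_derivative[OF S(1) prim _ that]) (intro continuous_intros A cY)
  qed
qed

section \<open>Completeness of \<open>L\<^sup>2\<close>\<close>

lemma integrable_inner_square: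
  fixes f g :: "'x \<Rightarrow> 'a::euclidean_space"
  assumes [measurable]: "f \<in> borel_measurable M" "g \<in> borel_measurable M"
    and f: "integrable M (\<lambda>t. (norm (f t))\<^sup>2)" and g: "integrable M (\<lambda>t. (norm (g t))\<^sup>2)"
  shows "integrable M (\<lambda>t. f t \<bullet> g t)"
proof (rule Bochner_Integration.integrable_bound)
  show "integrable M (\<lambda>t. (norm (f t))\<^sup>2 + (norm (g t))\<^sup>2)" using f g by simp
  have "norm (f t \<bullet> g t) \<le> norm ((norm (f t))\<^sup>2 + (norm (g t))\<^sup>2)" for t
  proof -
    have "\<bar>f t \<bullet> g t\<bar> \<le> norm (f t) * norm (g t)" by (rule Cauchy_Schwarz_ineq2)
    also have "2 * (norm (f t) * norm (g t)) \<le> (norm (f t))\<^sup>2 + (norm (g t))\<^sup>2"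
      using sum_squares_bound[of "norm (f t)" "norm (g t)"] by simp
    finally have "\<bar>f t \<bullet> g t\<bar> \<le> (norm (f t))\<^sup>2 + (norm (g t))\<^sup>2"
      using Cauchy_Schwarz_ineq2[of "f t" "g t"] abs_ge_zero[of "f t \<bullet> g t"] by linarith
    then show ?thesis by simp
  qed
  then show "AE t in M. norm (f t \<bullet> g t) \<le> norm ((norm (f t))\<^sup>2 + (norm (g t))\<^sup>2)" by simp
qed simp

lemma norm_square_add_expand:
  fixes a b :: "'a::real_inner"
  shows "(norm (a + c *\<^sub>R b))\<^sup>2 = (norm a)\<^sup>2 + 2 * c * (a \<bullet> b) + c\<^sup>2 * (norm b)\<^sup>2"
  unfolding power2_norm_eq_inner
  by (simp add: inner_add_left inner_add_right inner_commute[of b a] power2_eq_square algebra_simps)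

lemma integral_norm_square_add:
  fixes f g :: "'x \<Rightarrow> 'a::euclidean_space"
  assumes m: "f \<in> borel_measurable M" "g \<in> borel_measurable M"
    and f: "integrable M (\<lambda>t. (norm (f t))\<^sup>2)" and g: "integrable M (\<lambda>t. (norm (g t))\<^sup>2)"
  shows "integrable M (\<lambda>t. (norm (f t + c *\<^sub>R g t))\<^sup>2)"
    "(LINT t|M. (norm (f t + c *\<^sub>R g t))\<^sup>2) =
      (LINT t|M. (norm (f t))\<^sup>2) + 2 * c * (LINT t|M. f t \<bullet> g t) + c\<^sup>2 * (LINT t|M. (norm (g t))\<^sup>2)"
  using integrable_inner_square[OF m f g] f g by (simp_all add: norm_square_add_expand)

text \<open>The discriminant criterion. Besides Cauchy--Schwarz it serves the projection theorem,
  where \<open>a = 0\<close> forces \<open>b = 0\<close>.\<close>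

lemma quadratic_nonneg_imp:
  fixes a b c :: real
  assumes c: "c \<ge> 0" and q: "\<And>t. a + 2 * t * b + t\<^sup>2 * c \<ge> 0"
  shows "b\<^sup>2 \<le> a * c"
proof (cases "c = 0")
  case True
  have "b = 0"
  proof (rule ccontr)
    assume "b \<noteq> 0"
    then show False using q[of "- (a + 1) / (2 * b)"] True by (simp add: field_simps)
  qed
  then show ?thesis using True by simp
next
  case False
  then have "c > 0" using c by simp
  then have "0 \<le> c * (a + 2 * (- b / c) * b + (- b / c)\<^sup>2 * c)" using q[of "- b / c"] c by (intro mult_nonneg_nonneg)
  also have "\<dots> = a * c - b\<^sup>2" using \<open>c > 0\<close> by (simp add: field_simps power2_eq_square)
  finally show ?thesis by simp
qed

lemma Cauchy_Schwarz_LINT: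
  fixes f g :: "'x \<Rightarrow> 'a::euclidean_space"
  assumes m: "f \<in> borel_measurable M" "g \<in> borel_measurable M"
    and f: "integrable M (\<lambda>t. (norm (f t))\<^sup>2)" and g: "integrable M (\<lambda>t. (norm (g t))\<^sup>2)"
  shows "(LINT t|M. f t \<bullet> g t)\<^sup>2 \<le> (LINT t|M. (norm (f t))\<^sup>2) * (LINT t|M. (norm (g t))\<^sup>2)"
proof (rule quadratic_nonneg_imp)
  fix c :: real
  have "0 \<le> (LINT t|M. (norm (f t + c *\<^sub>R g t))\<^sup>2)" by simp
  then show "0 \<le> (LINT t|M. (norm (f t))\<^sup>2) + 2 * c * (LINT t|M. f t \<bullet> g t) + c\<^sup>2 * (LINT t|M. (norm (g t))\<^sup>2)"
    by (simp only: integral_norm_square_add(2)[OF m f g])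
qed simp

text \<open>Multiplying by a positive square integrable weight turns \<open>L\<^sup>2\<close>-Cauchy sequences into
  \<open>L\<^sup>1\<close>-Cauchy sequences, for which an almost everywhere convergent subsequence is available.\<close>

lemma L2_complete:
  fixes s :: "nat \<Rightarrow> 'x \<Rightarrow> 'a::euclidean_space" and w :: "'x \<Rightarrow> real"
  assumes [measurable]: "\<And>n. s n \<in> borel_measurable M"
    and s: "\<And>n. integrable M (\<lambda>t. (norm (s n t))\<^sup>2)"
    and cau: "\<And>e. e > 0 \<Longrightarrow> \<exists>N. \<forall>i\<ge>N. \<forall>j\<ge>N. (LINT t|M. (norm (s i t - s j t))\<^sup>2) < e"
    and [measurable]: "w \<in> borel_measurable M" and w: "\<And>t. w t > 0" "integrable M (\<lambda>t. (w t)\<^sup>2)"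
  obtains h where "h \<in> borel_measurable M" "integrable M (\<lambda>t. (norm (h t))\<^sup>2)"
    "(\<lambda>n. LINT t|M. (norm (s n t - h t))\<^sup>2) \<longlonglongrightarrow> 0"
proof -
  have sd: "integrable M (\<lambda>t. (norm (s i t - s j t))\<^sup>2)" for i j
    using integral_norm_square_add(1)[of "s i" M "s j" "-1"] s by simp
  let ?W = "LINT t|M. (w t)\<^sup>2"
  have W0: "?W \<ge> 0" by simp
  have i1: "integrable M (\<lambda>t. w t *\<^sub>R s n t)" for n
  proof (rule Bochner_Integration.integrable_bound)
    show "integrable M (\<lambda>t. (norm (s n t))\<^sup>2 + (w t)\<^sup>2)" using s w by simp
    have "norm (w t *\<^sub>R s n t) \<le> norm ((norm (s n t))\<^sup>2 + (w t)\<^sup>2)" for t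
    proof -
      have "0 \<le> w t * norm (s n t)" using w(1)[of t] by simp
      then have "w t * norm (s n t) \<le> (norm (s n t))\<^sup>2 + (w t)\<^sup>2"
        using sum_squares_bound[of "norm (s n t)" "w t"] by (simp add: mult_ac)
      then show ?thesis using w(1)[of t] by simp
    qed
    then show "AE t in M. norm (w t *\<^sub>R s n t) \<le> norm ((norm (s n t))\<^sup>2 + (w t)\<^sup>2)" by simp
  qed simp
  have "\<exists>N. \<forall>i\<ge>N. \<forall>j\<ge>N. (LINT t|M. norm (w t *\<^sub>R s i t - w t *\<^sub>R s j t)) < e" if e: "e > 0" for e
  proof -
    \<comment> \<open>By Cauchy--Schwarz the square of the weighted L1 distance is at most
      \<open>?W\<close> times the squared L2 distance; \<open>?W + 1\<close> keeps the quotient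
      meaningful when \<open>?W\<close> is 0.\<close>
    have "e\<^sup>2 / (?W + 1) > 0" using e W0 by (intro divide_pos_pos add_nonneg_pos) simp_all
    from cau[OF this] obtain N where N: "\<And>i j. i \<ge> N \<Longrightarrow> j \<ge> N \<Longrightarrow> (LINT t|M. (norm (s i t - s j t))\<^sup>2) < e\<^sup>2 / (?W + 1)"
      by blast
    have "(LINT t|M. norm (w t *\<^sub>R s i t - w t *\<^sub>R s j t)) < e" if "i \<ge> N" "j \<ge> N" for i j
    proof -
      let ?D = "LINT t|M. (norm (s i t - s j t))\<^sup>2"
      have D: "0 \<le> ?D" by simp
      have "(LINT t|M. norm (s i t - s j t) \<bullet> w t)\<^sup>2 \<le> (LINT t|M. (norm (norm (s i t - s j t)))\<^sup>2) * (LINT t|M. (norm (w t))\<^sup>2)"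
        by (rule Cauchy_Schwarz_LINT) (use sd w in simp_all)
      then have "(LINT t|M. norm (s i t - s j t) \<bullet> w t)\<^sup>2 \<le> ?D * ?W" by simp
      also have "\<dots> \<le> ?D * (?W + 1)" using D by (intro mult_left_mono) auto
      also have "\<dots> < e\<^sup>2"
        using N[OF that] W0 by (simp add: pos_less_divide_eq add_nonneg_pos)
      finally have "(LINT t|M. norm (s i t - s j t) \<bullet> w t)\<^sup>2 < e\<^sup>2" .
      then have "(LINT t|M. norm (s i t - s j t) \<bullet> w t) < e" by (rule power2_less_imp_less) (use e in simp)
      moreover have "norm (w t *\<^sub>R s i t - w t *\<^sub>R s j t) = norm (s i t - s j t) \<bullet> w t" for t
        using w(1)[of t] by (simp add: mult_ac flip: scaleR_diff_right)
      ultimately show ?thesis using e by simp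
    qed
    then show ?thesis by blast
  qed
  then obtain r where r: "strict_mono r" "AE t in M. Cauchy (\<lambda>i. w t *\<^sub>R s (r i) t)"
    using cauchy_L1_AE_cauchy_subseq[of M "\<lambda>n t. w t *\<^sub>R s n t"] i1 by blast
  define h where "h t = lim (\<lambda>i. s (r i) t)" for t
  have [measurable]: "h \<in> borel_measurable M" unfolding h_def by measurable
  have conv: "AE t in M. (\<lambda>i. s (r i) t) \<longlonglongrightarrow> h t"
    using r(2)
  proof eventually_elim
    case (elim t)
    then obtain l where "(\<lambda>i. w t *\<^sub>R s (r i) t) \<longlonglongrightarrow> l" using Cauchy_convergent convergent_def by blast
    then have "(\<lambda>i. inverse (w t) *\<^sub>R (w t *\<^sub>R s (r i) t)) \<longlonglongrightarrow> inverse (w t) *\<^sub>R l" by (intro tendsto_intros)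
    moreover have "inverse (w t) *\<^sub>R (w t *\<^sub>R s (r i) t) = s (r i) t" for i using w(1)[of t] by simp
    ultimately have "convergent (\<lambda>i. s (r i) t)" by (auto simp: convergent_def)
    then show ?case unfolding h_def by (simp add: convergent_LIMSEQ_iff)
  qed
  \<comment> \<open>Fatou's lemma along the almost everywhere convergent subsequence turns the
    Cauchy bound into a bound for the distance to the limit, for every late \<open>i\<close> and not
    only along the subsequence.\<close>
  have fatou: "(\<integral>\<^sup>+t. ennreal ((norm (s i t - h t))\<^sup>2) \<partial>M) \<le> ennreal e"
    if N: "\<And>j. j \<ge> N \<Longrightarrow> (LINT t|M. (norm (s i t - s j t))\<^sup>2) < e" for i e N
  proof -
    have "(\<integral>\<^sup>+t. ennreal ((norm (s i t - h t))\<^sup>2) \<partial>M) = (\<integral>\<^sup>+t. liminf (\<lambda>n. ennreal ((norm (s i t - s (r n) t))\<^sup>2)) \<partial>M)"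
    proof (rule nn_integral_cong_AE)
      show "AE t in M. ennreal ((norm (s i t - h t))\<^sup>2) = liminf (\<lambda>n. ennreal ((norm (s i t - s (r n) t))\<^sup>2))"
        using conv
      proof eventually_elim
        case (elim t)
        have "(\<lambda>n. ennreal ((norm (s i t - s (r n) t))\<^sup>2)) \<longlonglongrightarrow> ennreal ((norm (s i t - h t))\<^sup>2)"
          by (intro tendsto_intros elim)
        then show ?case using lim_imp_Liminf[OF sequentially_bot] by metis
      qed
    qed
    also have "\<dots> \<le> liminf (\<lambda>n. \<integral>\<^sup>+t. ennreal ((norm (s i t - s (r n) t))\<^sup>2) \<partial>M)"
      by (rule nn_integral_liminf) measurable
    also have "\<dots> \<le> ennreal e"
    proof (rule Liminf_le)
      have "(\<integral>\<^sup>+t. ennreal ((norm (s i t - s (r n) t))\<^sup>2) \<partial>M) \<le> ennreal e" if "n \<ge> N" for n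
      proof -
        have "r n \<ge> N" using that seq_suble[OF r(1), of n] by simp
        then show ?thesis using N[of "r n"] by (subst nn_integral_eq_integral[OF sd]) (auto intro: ennreal_leI)
      qed
      then show "\<forall>\<^sub>F n in sequentially. (\<integral>\<^sup>+t. ennreal ((norm (s i t - s (r n) t))\<^sup>2) \<partial>M) \<le> ennreal e"
        by (auto simp: eventually_sequentially)
    qed simp
    finally show ?thesis .
  qed
  have int_diff: "integrable M (\<lambda>t. (norm (s i t - h t))\<^sup>2) \<and> (LINT t|M. (norm (s i t - h t))\<^sup>2) \<le> e"
    if N: "\<And>j. j \<ge> N \<Longrightarrow> (LINT t|M. (norm (s i t - s j t))\<^sup>2) < e" for i e N
  proof -
    have e: "e \<ge> 0" using N[of N] by (smt (verit) integral_nonneg_AE AE_I2 zero_le_power2 order_refl)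
    have i: "integrable M (\<lambda>t. (norm (s i t - h t))\<^sup>2)"
      by (rule integrableI_bounded) (use fatou[where N=N and e=e and i=i, OF N] in \<open>auto intro: order.strict_trans1\<close>)
    then have "ennreal (LINT t|M. (norm (s i t - h t))\<^sup>2) \<le> ennreal e"
      using fatou[where N=N and e=e and i=i, OF N] by (subst nn_integral_eq_integral[symmetric]) auto
    then show ?thesis using i e by simp
  qed
  obtain N1 where N1: "\<And>i j. i \<ge> N1 \<Longrightarrow> j \<ge> N1 \<Longrightarrow> (LINT t|M. (norm (s i t - s j t))\<^sup>2) < 1"
    using cau[of 1] by auto
  have "integrable M (\<lambda>t. (norm (s N1 t + (-1) *\<^sub>R (s N1 t - h t)))\<^sup>2)"
    using int_diff[of N1 N1 1] N1 by (intro integral_norm_square_add(1) s) auto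
  then have hi: "integrable M (\<lambda>t. (norm (h t))\<^sup>2)" by simp
  have "(\<lambda>n. LINT t|M. (norm (s n t - h t))\<^sup>2) \<longlonglongrightarrow> 0"
  proof (rule LIMSEQ_I)
    fix e :: real assume e: "e > 0"
    then obtain N where N: "\<And>i j. i \<ge> N \<Longrightarrow> j \<ge> N \<Longrightarrow> (LINT t|M. (norm (s i t - s j t))\<^sup>2) < e / 2"
      using cau[of "e/2"] by auto
    have "norm ((LINT t|M. (norm (s n t - h t))\<^sup>2) - 0) < e" if "n \<ge> N" for n
      using int_diff[of N n "e/2"] N that e by simp
    then show "\<exists>N. \<forall>n\<ge>N. norm ((LINT t|M. (norm (s n t - h t))\<^sup>2) - 0) < e" by blast
  qed
  with hi show ?thesis by (rule that[OF \<open>h \<in> borel_measurable M\<close>])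
qed

lemma L2_onD:
  assumes "f \<in> L2_on S"
  shows "f \<in> borel_measurable (lebesgue_on S)" "integrable (lebesgue_on S) (\<lambda>t. (norm (f t))\<^sup>2)"
    "\<And>t. t \<notin> S \<Longrightarrow> f t = 0"
  using assms by (auto simp: L2_on_def)

lemma L2_on_add_scaleR:
  assumes "f \<in> L2_on S" "g \<in> L2_on S"
  shows "(\<lambda>t. f t + c *\<^sub>R g t) \<in> L2_on S"
  using assms integral_norm_square_add(1)[of f "lebesgue_on S" g c] by (auto simp: L2_on_def)

lemma L2_on_zero [simp]: "(\<lambda>t. 0) \<in> L2_on S"
  by (auto simp: L2_on_def)

lemma L2_on_integrable_inner:
  assumes "f \<in> L2_on S" "g \<in> L2_on S"
  shows "integrable (lebesgue_on S) (\<lambda>t. f t \<bullet> g t)"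
  using assms by (intro integrable_inner_square) (auto simp: L2_on_def)

lemma L2_on_complete:
  fixes s :: "nat \<Rightarrow> real \<Rightarrow> 'a::euclidean_space"
  assumes S: "S \<in> sets lebesgue" and s: "\<And>n. s n \<in> L2_on S"
    and cau: "\<And>e. e > 0 \<Longrightarrow> \<exists>N. \<forall>i\<ge>N. \<forall>j\<ge>N. (LINT t|lebesgue_on S. (norm (s i t - s j t))\<^sup>2) < e"
  obtains h where "h \<in> L2_on S" "(\<lambda>n. LINT t|lebesgue_on S. (norm (s n t - h t))\<^sup>2) \<longlonglongrightarrow> 0"
proof -
  \<comment> \<open>This weight is integrable on the whole line and at most 1, hence square
    integrable as well.\<close>
  define w :: "real \<Rightarrow> real" where "w t = inverse (1 + t\<^sup>2)" for t
  have "set_integrable lborel UNIV w"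
    using integrable_inverse_1_plus_square unfolding w_def by (simp add: set_integrable_def einterval_eq)
  then have "integrable lborel w" by (simp add: set_integrable_def)
  then have w1: "integrable lebesgue w" by (simp add: integrable_completion)
  then have "integrable lebesgue (\<lambda>t. indicator S t *\<^sub>R w t)" using S by (intro integrable_mult_indicator) auto
  then have w2: "integrable (lebesgue_on S) w" using S by (simp add: integrable_restrict_space)
  have wpos: "w t > 0" for t unfolding w_def by (simp add: add_pos_nonneg)
  have wle: "w t \<le> 1" for t unfolding w_def by (simp add: inverse_le_1_iff)
  have w3: "integrable (lebesgue_on S) (\<lambda>t. (w t)\<^sup>2)"
  proof (rule Bochner_Integration.integrable_bound[OF w2])
    show "(\<lambda>t. (w t)\<^sup>2) \<in> borel_measurable (lebesgue_on S)" using w2 by measurable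
    have "norm ((w t)\<^sup>2) \<le> norm (w t)" for t
      using mult_left_mono[OF wle[of t], of "w t"] wpos[of t] by (simp add: power2_eq_square)
    then show "AE t in lebesgue_on S. norm ((w t)\<^sup>2) \<le> norm (w t)" by simp
  qed
  obtain h where h: "h \<in> borel_measurable (lebesgue_on S)" "integrable (lebesgue_on S) (\<lambda>t. (norm (h t))\<^sup>2)"
     "(\<lambda>n. LINT t|lebesgue_on S. (norm (s n t - h t))\<^sup>2) \<longlonglongrightarrow> 0"
    using L2_complete[of s "lebesgue_on S" w] L2_onD(1,2)[OF s] cau w3 wpos borel_measurable_integrable[OF w2] by blast
  define h' where "h' t = (if t \<in> S then h t else 0)" for t
  have cong: "t \<in> space (lebesgue_on S) \<Longrightarrow> h' t = h t" for t by (simp add: h'_def)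
  have "h' \<in> L2_on S"
    unfolding L2_on_def mem_Collect_eq
    using h(1,2) iffD2[OF measurable_cong[of "lebesgue_on S" h' h borel, OF cong] h(1)]
      Bochner_Integration.integrable_cong[OF refl, of "lebesgue_on S" "\<lambda>t. (norm (h' t))\<^sup>2" "\<lambda>t. (norm (h t))\<^sup>2"] cong
    by (simp add: h'_def)
  moreover have "(\<lambda>n. LINT t|lebesgue_on S. (norm (s n t - h' t))\<^sup>2) \<longlonglongrightarrow> 0"
  proof -
    have "(LINT t|lebesgue_on S. (norm (s n t - h' t))\<^sup>2) = (LINT t|lebesgue_on S. (norm (s n t - h t))\<^sup>2)" for n
      by (rule Bochner_Integration.integral_cong) (simp_all add: cong)
    then show ?thesis using h(3) by simp
  qed
  ultimately show ?thesis using that by blast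
qed

text \<open>The projection onto a closed subspace, for sets of functions instead of classes:
  combinations and limits need to lie in \<open>V\<close> only up to null sets. In the application
  \<open>V\<close> is a range of \<open>L\<close>, and \<open>L\<close> is linear only almost
  everywhere.\<close>

lemma L2_on_projection:
  fixes V :: "(real \<Rightarrow> 'a::euclidean_space) set"
  assumes S: "S \<in> sets lebesgue" and V: "V \<subseteq> L2_on S" "V \<noteq> {}"
    and lin: "\<And>u v c. u \<in> V \<Longrightarrow> v \<in> V \<Longrightarrow> \<exists>w\<in>V. AE t in lebesgue_on S. w t = u t + c *\<^sub>R v t"
    and closed: "\<And>fs h. (\<And>n. fs n \<in> V) \<Longrightarrow> h \<in> L2_on S \<Longrightarrow>
       (\<lambda>n. LINT t|lebesgue_on S. (norm (fs n t - h t))\<^sup>2) \<longlonglongrightarrow> 0 \<Longrightarrow>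
       \<exists>m\<in>V. AE t in lebesgue_on S. m t = h t"
    and x: "x \<in> L2_on S"
  shows "\<exists>m\<in>V. \<forall>u\<in>V. (LINT t|lebesgue_on S. (x t - m t) \<bullet> u t) = 0"
proof -
  define N where "N f = (LINT t|lebesgue_on S. (norm (f t))\<^sup>2)" for f :: "real \<Rightarrow> 'a"
  define ip where "ip f g = (LINT t|lebesgue_on S. f t \<bullet> g t)" for f g :: "real \<Rightarrow> 'a"
  have N0: "N f \<ge> 0" for f unfolding N_def by simp
  have exp: "N (\<lambda>t. f t + c *\<^sub>R g t) = N f + 2 * c * ip f g + c\<^sup>2 * N g" if "f \<in> L2_on S" "g \<in> L2_on S" for f g c
    unfolding N_def ip_def using L2_onD[OF that(1)] L2_onD[OF that(2)] by (intro integral_norm_square_add(2))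
  have sub: "(\<lambda>t. f t - g t) \<in> L2_on S" if "f \<in> L2_on S" "g \<in> L2_on S" for f g :: "real \<Rightarrow> 'a"
    using L2_on_add_scaleR[OF that, of "-1"] by simp
  have Ncong: "N f = N g" if "AE t in lebesgue_on S. f t = g t" "f \<in> L2_on S" "g \<in> L2_on S" for f g
    unfolding N_def using that(1)
    by (intro integral_cong_AE borel_measurable_integrable[OF L2_onD(2)] that) (auto elim: eventually_mono)
  define d where "d = (INF v\<in>V. N (\<lambda>t. x t - v t))"
  have dle: "d \<le> N (\<lambda>t. x t - v t)" if "v \<in> V" for v
    unfolding d_def by (intro cINF_lower[OF _ that] bdd_belowI2[of _ 0] N0)
  have "\<exists>v\<in>V. N (\<lambda>t. x t - v t) < d + 1 / real (Suc n)" for n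
  proof -
    have "bdd_below ((\<lambda>v. N (\<lambda>t. x t - v t)) ` V)" by (rule bdd_belowI2[of _ 0]) (rule N0)
    moreover have "(INF v\<in>V. N (\<lambda>t. x t - v t)) < d + 1 / real (Suc n)" by (simp add: d_def)
    ultimately show ?thesis using cINF_less_iff[OF V(2)] by blast
  qed
  then obtain v where v: "\<And>n. v n \<in> V" "\<And>n. N (\<lambda>t. x t - v n t) < d + 1 / real (Suc n)" by metis
  have vL: "v n \<in> L2_on S" for n using v(1) V(1) by blast
  have xv: "(\<lambda>t. x t - v n t) \<in> L2_on S" for n using sub[OF x vL] .
  have par: "N (\<lambda>t. v i t - v j t) \<le> 2 / real (Suc i) + 2 / real (Suc j)" for i j
  proof -
    let ?a = "\<lambda>t. x t - v i t" and ?b = "\<lambda>t. x t - v j t"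
    \<comment> \<open>\<open>u\<close> represents the midpoint of \<open>v i\<close> and
      \<open>v j\<close>. Its squared distance from \<open>x\<close> is at least \<open>d\<close>,
      and the parallelogram law then makes the minimizing sequence Cauchy.\<close>
    obtain u1 where u1: "u1 \<in> V" "AE t in lebesgue_on S. u1 t = v j t + (-1) *\<^sub>R v i t" using lin[OF v(1) v(1), of j "-1" i] by blast
    obtain u where u: "u \<in> V" "AE t in lebesgue_on S. u t = v i t + (1/2) *\<^sub>R u1 t" using lin[OF v(1) u1(1), of i "1/2"] by blast
    have "AE t in lebesgue_on S. x t - u t = (1/2) *\<^sub>R ((x t - v i t) + 1 *\<^sub>R (x t - v j t))"
      using u(2) u1(2)
    proof eventually_elim
      case (elim t)
      have "(1/2) *\<^sub>R (v i t) + (1/2) *\<^sub>R (v i t) = v i t" "(1/2) *\<^sub>R (x t) + (1/2) *\<^sub>R (x t) = x t"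
        by (simp_all flip: scaleR_add_left)
      then show ?case unfolding elim by (simp add: algebra_simps)
    qed
    moreover have "(\<lambda>t. (1/2) *\<^sub>R ((x t - v i t) + 1 *\<^sub>R (x t - v j t))) \<in> L2_on S"
      using L2_on_add_scaleR[OF L2_on_zero L2_on_add_scaleR[OF xv[of i] xv[of j], of 1], of "1/2"] by simp
    ultimately have "N (\<lambda>t. x t - u t) = N (\<lambda>t. (1/2) *\<^sub>R ((x t - v i t) + 1 *\<^sub>R (x t - v j t)))"
      using sub[OF x] u(1) V(1) by (intro Ncong) auto
    also have "\<dots> = (1/4) * N (\<lambda>t. ?a t + 1 *\<^sub>R ?b t)"
      unfolding N_def by (simp add: power_mult_distrib power2_eq_square)
    finally have "4 * d \<le> N (\<lambda>t. ?a t + 1 *\<^sub>R ?b t)" using dle[OF u(1)] by simp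
    moreover have "N (\<lambda>t. ?a t + 1 *\<^sub>R ?b t) = N ?a + 2 * ip ?a ?b + N ?b"
      using exp[OF xv xv, of i 1 j] by simp
    moreover have "N (\<lambda>t. ?b t + (-1) *\<^sub>R ?a t) = N ?b - 2 * ip ?b ?a + N ?a"
      using exp[OF xv xv, of j "-1" i] by simp
    moreover have "ip ?b ?a = ip ?a ?b" unfolding ip_def by (simp add: inner_commute)
    moreover have "(\<lambda>t. ?b t + (-1) *\<^sub>R ?a t) = (\<lambda>t. v i t - v j t)" by auto
    ultimately have "N (\<lambda>t. v i t - v j t) \<le> 2 * N ?a + 2 * N ?b - 4 * d" by simp
    then show ?thesis using v(2)[of i] v(2)[of j] by simp
  qed
  have cau: "\<exists>n0. \<forall>i\<ge>n0. \<forall>j\<ge>n0. (LINT t|lebesgue_on S. (norm (v i t - v j t))\<^sup>2) < e" if e: "e > 0" for e :: real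
  proof -
    obtain n0 where n0: "4 / real (Suc n0) < e"
      using reals_Archimedean[of "e/4"] e by (auto simp: field_simps)
    have "N (\<lambda>t. v i t - v j t) < e" if "i \<ge> n0" "j \<ge> n0" for i j
    proof -
      have "2 / real (Suc i) \<le> 2 / real (Suc n0)" "2 / real (Suc j) \<le> 2 / real (Suc n0)"
        using that by (simp_all add: frac_le)
      then show ?thesis using par[of i j] n0 by simp
    qed
    then show ?thesis unfolding N_def by blast
  qed
  obtain h where h: "h \<in> L2_on S" "(\<lambda>n. LINT t|lebesgue_on S. (norm (v n t - h t))\<^sup>2) \<longlonglongrightarrow> 0"
    using cau by (rule L2_on_complete[OF S vL])
  obtain m where m: "m \<in> V" "AE t in lebesgue_on S. m t = h t" using closed[OF v(1) h] by blast
  have mL: "m \<in> L2_on S" using m V by blast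
  have lim: "(\<lambda>n. N (\<lambda>t. v n t - m t)) \<longlonglongrightarrow> 0"
  proof -
    have "N (\<lambda>t. v n t - m t) = N (\<lambda>t. v n t - h t)" for n
      using m(2) by (intro Ncong sub vL mL h) (auto elim: eventually_mono)
    then show ?thesis using h(2) by (simp add: N_def)
  qed
  have "ip (\<lambda>t. x t - m t) u = 0" if u: "u \<in> V" for u
  proof -
    have uL: "u \<in> L2_on S" using u V by blast
    \<comment> \<open>Minimality of \<open>d\<close> is tested against \<open>v n - c u\<close>; in
      the limit the slack \<open>1 / real (Suc n)\<close> disappears and a nonnegative quadratic in
      \<open>c\<close> without constant term remains.\<close>
    have "0 \<le> 0 + 2 * c * ip (\<lambda>t. x t - m t) u + c\<^sup>2 * N u" for c
    proof -
      have key: "- 1 / real (Suc n) \<le> 2 * c * ip (\<lambda>t. x t - v n t) u + c\<^sup>2 * N u" for n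
      proof -
        obtain w where w: "w \<in> V" "AE t in lebesgue_on S. w t = v n t + (- c) *\<^sub>R u t" using lin[OF v(1) u, of n "-c"] by blast
        have "d \<le> N (\<lambda>t. x t - w t)" by (rule dle[OF w(1)])
        also have "\<dots> = N (\<lambda>t. (x t - v n t) + c *\<^sub>R u t)"
          using w V(1) by (intro Ncong sub x L2_on_add_scaleR xv uL) (auto elim!: eventually_mono)
        also have "\<dots> = N (\<lambda>t. x t - v n t) + 2 * c * ip (\<lambda>t. x t - v n t) u + c\<^sup>2 * N u"
          by (rule exp[OF xv uL])
        finally show ?thesis using v(2)[of n] by simp
      qed
      have "(\<lambda>n. ip (\<lambda>t. v n t - m t) u) \<longlonglongrightarrow> 0"
      proof (rule Lim_null_comparison)
        have "norm (ip (\<lambda>t. v n t - m t) u) \<le> sqrt (N (\<lambda>t. v n t - m t) * N u)" for n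
        proof -
          have "(ip (\<lambda>t. v n t - m t) u)\<^sup>2 \<le> N (\<lambda>t. v n t - m t) * N u"
            unfolding ip_def N_def using L2_onD[OF sub[OF vL mL]] L2_onD[OF uL]
            by (intro Cauchy_Schwarz_LINT)
          from real_sqrt_le_mono[OF this] show ?thesis by simp
        qed
        then show "\<forall>\<^sub>F n in sequentially. norm (ip (\<lambda>t. v n t - m t) u) \<le> sqrt (N (\<lambda>t. v n t - m t) * N u)" by simp
        have "(\<lambda>n. sqrt (N (\<lambda>t. v n t - m t) * N u)) \<longlonglongrightarrow> sqrt (0 * N u)" by (intro tendsto_intros lim)
        then show "(\<lambda>n. sqrt (N (\<lambda>t. v n t - m t) * N u)) \<longlonglongrightarrow> 0" by simp
      qed
      moreover have "ip (\<lambda>t. x t - v n t) u = ip (\<lambda>t. x t - m t) u - ip (\<lambda>t. v n t - m t) u" for n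
        unfolding ip_def using L2_on_integrable_inner[OF sub[OF x mL] uL] L2_on_integrable_inner[OF sub[OF vL mL] uL, of n]
        by (subst Bochner_Integration.integral_diff[symmetric]) (auto simp: inner_diff_left algebra_simps)
      ultimately have "(\<lambda>n. ip (\<lambda>t. x t - v n t) u) \<longlonglongrightarrow> ip (\<lambda>t. x t - m t) u - 0"
        by (simp only:) (intro tendsto_intros)
      then have l1: "(\<lambda>n. 2 * c * ip (\<lambda>t. x t - v n t) u + c\<^sup>2 * N u) \<longlonglongrightarrow> 2 * c * (ip (\<lambda>t. x t - m t) u - 0) + c\<^sup>2 * N u"
        by (intro tendsto_intros)
      have l2: "(\<lambda>n. - 1 / real (Suc n)) \<longlonglongrightarrow> 0"
        using tendsto_minus[OF LIMSEQ_Suc[OF lim_1_over_n]] by simp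
      show ?thesis using LIMSEQ_le[OF l2 l1] key by auto
    qed
    then have "(ip (\<lambda>t. x t - m t) u)\<^sup>2 \<le> 0 * N u" by (intro quadratic_nonneg_imp N0)
    then show ?thesis by simp
  qed
  then show ?thesis using m(1) unfolding ip_def by blast
qed

section \<open>Sturm--Liouville expressions on an interval\<close>

lemma L2_on_iff:
  fixes f :: "real \<Rightarrow> 'a::euclidean_space"
  assumes S: "S \<in> sets lebesgue"
  shows "f \<in> L2_on S \<longleftrightarrow> (\<forall>t. t \<notin> S \<longrightarrow> f t = 0) \<and> f \<in> borel_measurable lebesgue \<and>
    integrable lebesgue (\<lambda>t. (norm (f t))\<^sup>2)"
proof (cases "\<forall>t. t \<notin> S \<longrightarrow> f t = 0")
  case True
  have 1: "(\<lambda>t. indicator S t *\<^sub>R f t) = f" using True by (auto simp: indicator_def)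
  have 2: "(\<lambda>t. indicator S t *\<^sub>R (norm (f t))\<^sup>2) = (\<lambda>t. (norm (f t))\<^sup>2)"
 
  proof
    fix t show "indicator S t *\<^sub>R (norm (f t))\<^sup>2 = (norm (f t))\<^sup>2" using True by (cases "t \<in> S") auto
  qed
  have S': "S \<inter> space lebesgue \<in> sets lebesgue" using S by simp
  show ?thesis
    unfolding L2_on_def mem_Collect_eq borel_measurable_restrict_space_iff[OF S'] integrable_restrict_space[OF S'] 1 2
    by simp
qed (auto simp: L2_on_def)

lemma L2_on_mono:
  assumes "f \<in> L2_on T" "T \<subseteq> S" "T \<in> sets lebesgue" "S \<in> sets lebesgue"
  shows "f \<in> L2_on S"
  using assms by (auto simp: L2_on_iff)

lemma L2_on_mult:
  fixes f :: "real \<Rightarrow> 'a::euclidean_space"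
  assumes f: "f \<in> L2_on S" and c: "c \<in> borel_measurable lebesgue" "\<And>t. \<bar>c t\<bar> \<le> B" and S: "S \<in> sets lebesgue"
  shows "(\<lambda>t. c t *\<^sub>R f t) \<in> L2_on S"
proof -
  have f': "\<And>t. t \<notin> S \<Longrightarrow> f t = 0" "f \<in> borel_measurable lebesgue" "integrable lebesgue (\<lambda>t. (norm (f t))\<^sup>2)"
    using f by (auto simp: L2_on_iff[OF S])
  have m: "(\<lambda>t. c t *\<^sub>R f t) \<in> borel_measurable lebesgue" using c(1) f'(2) by measurable
  have "integrable lebesgue (\<lambda>t. (norm (c t *\<^sub>R f t))\<^sup>2)"
  proof (rule Bochner_Integration.integrable_bound)
    show "integrable lebesgue (\<lambda>t. B\<^sup>2 * (norm (f t))\<^sup>2)" using f'(3) by simp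
    have "norm ((norm (c t *\<^sub>R f t))\<^sup>2) \<le> norm (B\<^sup>2 * (norm (f t))\<^sup>2)" for t
    proof -
      have "\<bar>c t\<bar>\<^sup>2 \<le> B\<^sup>2" using c(2)[of t] by (intro power_mono) auto
      then show ?thesis by (simp add: power_mult_distrib mult_right_mono)
    qed
    then show "AE t in lebesgue. norm ((norm (c t *\<^sub>R f t))\<^sup>2) \<le> norm (B\<^sup>2 * (norm (f t))\<^sup>2)" by simp
  qed (use m in measurable)
  then show ?thesis using m f'(1) by (simp add: L2_on_iff[OF S])
qed

lemma L2_on_restrict:
  fixes f :: "real \<Rightarrow> 'a::euclidean_space"
  assumes f: "f \<in> L2_on S" and T: "T \<in> sets lebesgue" "T \<subseteq> S" and S: "S \<in> sets lebesgue"
  shows "(\<lambda>t. if t \<in> T then f t else 0) \<in> L2_on T"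
proof -
  have "(\<lambda>t. indicator T t *\<^sub>R f t) \<in> L2_on S"
    by (rule L2_on_mult[OF f _ _ S, where B=1]) (use T(1) in \<open>auto simp: indicator_def\<close>)
  moreover have "(\<lambda>t. indicator T t *\<^sub>R f t) = (\<lambda>t. if t \<in> T then f t else 0)" by (auto simp: indicator_def)
  ultimately show ?thesis using S T by (auto simp: L2_on_iff)
qed

lemma integrable_indicator_Icc: "integrable lebesgue (indicator {a..b::real} :: real \<Rightarrow> real)"
proof -
  have "integrable lborel (indicator {a..b} :: real \<Rightarrow> real)"
    by (rule integrable_real_indicator) (auto simp: emeasure_lborel_Icc_eq)
  then show ?thesis by (simp add: integrable_completion)
qed

lemma L2_on_absolutely_integrable:
  fixes f :: "real \<Rightarrow> 'a::euclidean_space"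
  assumes f: "f \<in> L2_on S" and S: "S \<in> sets lebesgue"
  shows "f absolutely_integrable_on {s..t}"
proof -
  have f': "f \<in> borel_measurable lebesgue" "integrable lebesgue (\<lambda>t. (norm (f t))\<^sup>2)"
    using f by (auto simp: L2_on_iff[OF S])
  show ?thesis
    unfolding set_integrable_def
  proof (rule Bochner_Integration.integrable_bound)
    have "integrable lebesgue (indicator {s..t} :: real \<Rightarrow> real)"
      by (rule integrable_indicator_Icc)
    then show "integrable lebesgue (\<lambda>r. indicator {s..t} r + (norm (f r))\<^sup>2 :: real)" using f'(2) by simp
    show "(\<lambda>r. indicat_real {s..t} r *\<^sub>R f r) \<in> borel_measurable lebesgue"
      by (intro borel_measurable_scaleR borel_measurable_indicator f'(1)) simp
    have "norm (indicat_real {s..t} r *\<^sub>R f r) \<le> norm (indicat_real {s..t} r + (norm (f r))\<^sup>2)" for r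
      using sum_squares_bound[of "norm (f r)" 1] by (auto simp: indicator_def) (smt (verit) norm_ge_zero)
    then show "AE r in lebesgue. norm (indicat_real {s..t} r *\<^sub>R f r) \<le> norm (indicat_real {s..t} r + (norm (f r))\<^sup>2)"
      by simp
  qed
qed

lemma L2_on_boundedI:
  fixes f :: "real \<Rightarrow> 'a::euclidean_space"
  assumes f: "f \<in> borel_measurable (lebesgue_on S)" and S: "S \<in> sets lebesgue"
    and b: "\<And>t. t \<in> S \<Longrightarrow> norm (f t) \<le> B" and v: "\<And>t. t \<in> S \<Longrightarrow> r < \<bar>t\<bar> \<Longrightarrow> f t = 0"
  shows "(\<lambda>t. if t \<in> S then f t else 0) \<in> L2_on S"
proof -
  let ?f = "\<lambda>t. if t \<in> S then f t else 0"
  have eq: "(\<lambda>t. indicator S t *\<^sub>R f t) = ?f" by (auto simp: indicator_def)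
  have S': "S \<inter> space lebesgue \<in> sets lebesgue" using S by simp
  have m: "?f \<in> borel_measurable lebesgue"
    using f unfolding borel_measurable_restrict_space_iff[OF S'] eq .
  have "integrable lebesgue (\<lambda>t. (norm (?f t))\<^sup>2)"
  proof (rule Bochner_Integration.integrable_bound)
    have "integrable lebesgue (indicator {-r..r} :: real \<Rightarrow> real)"
      by (rule integrable_indicator_Icc)
    then show "integrable lebesgue (\<lambda>t. B\<^sup>2 * indicator {-r..r} t :: real)" by simp
    have "norm ((norm (?f t))\<^sup>2) \<le> norm (B\<^sup>2 * indicat_real {-r..r} t)" for t
    proof (cases "t \<in> S \<and> \<bar>t\<bar> \<le> r")
      case True
      then have "(norm (f t))\<^sup>2 \<le> B\<^sup>2" using b[of t] by (intro power_mono) auto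
      then show ?thesis using True by (auto simp: indicator_def)
    next
      case False
      then show ?thesis using v[of t] by auto
    qed
    then show "AE t in lebesgue. norm ((norm (?f t))\<^sup>2) \<le> norm (B\<^sup>2 * indicat_real {-r..r} t)" by simp
  qed (use m in measurable)
  then show ?thesis using m by (simp add: L2_on_iff[OF S])
qed

lemma closed_sets_lebesgue: "closed (S :: real set) \<Longrightarrow> S \<in> sets lebesgue"
  by (simp add: borel_closed)

lemma interval_at_within_nontrivial:
  fixes S :: "real set"
  assumes S: "is_interval S" "a \<in> S" "b \<in> S" "a < b" and t: "t \<in> S"
  shows "at t within S \<noteq> bot"
proof -
  obtain u where u: "u \<in> S" "u \<noteq> t" using S(2-4) by (metis less_irrefl)
  have "t islimpt {min t u..max t u}" using u(2) by (simp add: min_def max_def)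
  moreover have "{min t u..max t u} \<subseteq> S"
    using Icc_subset_interval[OF S(1)] u(1) t by (simp add: min_def max_def)
  ultimately show ?thesis using islimpt_subset trivial_limit_within by blast
qed

lemma deriv_on_eq:
  assumes "is_interval S" "a \<in> S" "b \<in> S" "a < b" "t \<in> S" "(f has_vector_derivative D) (at t within S)"
  shows "deriv_on S f t = D"
  using vector_derivative_within interval_at_within_nontrivial assms by blast

text \<open>Keeps the witnesses of \<open>W22_on\<close> explicit: the continuous derivative
  \<open>g\<close> and a representative \<open>h\<close> of the second derivative. This replaces
  reasoning about \<open>deriv_on\<close> where a derivative exists only almost everywhere.\<close>

definition jet :: "real set \<Rightarrow> (real \<Rightarrow> 'a::euclidean_space) \<Rightarrow> (real \<Rightarrow> 'a) \<Rightarrow> (real \<Rightarrow> 'a) \<Rightarrow> bool" where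
  "jet S f g h \<longleftrightarrow> f \<in> L2_on S \<and> g \<in> L2_on S \<and> h \<in> L2_on S \<and> primitive_on S f g \<and> primitive_on S g h"

lemma jetD:
  assumes "jet S f g h"
  shows "f \<in> L2_on S" "g \<in> L2_on S" "h \<in> L2_on S" "primitive_on S f g" "primitive_on S g h"
  using assms by (auto simp: jet_def)

lemma W22_on_iff_jet:
  assumes S: "closed S"
  shows "f \<in> W22_on S \<longleftrightarrow> (\<exists>g h. jet S f g h)"
proof
  note Sl = closed_sets_lebesgue[OF S]
  assume "f \<in> W22_on S"
  then obtain g h where "f \<in> L2_on S" "g \<in> L2_on S" "h \<in> L2_on S" "\<forall>s\<in>S. \<forall>t\<in>S. s \<le> t \<longrightarrow>
     (g has_integral (f t - f s)) {s..t} \<and> (h has_integral (g t - g s)) {s..t}"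
    unfolding W22_on_def by blast
  then have "jet S f g h"
    unfolding jet_def primitive_on_def using L2_on_absolutely_integrable[OF _ Sl] by blast
  then show "\<exists>g h. jet S f g h" by blast
next
  assume "\<exists>g h. jet S f g h"
  then show "f \<in> W22_on S" unfolding W22_on_def jet_def primitive_on_def by blast
qed

lemma jet_add_scaleR:
  assumes "jet S f g h" "jet S f' g' h'"
  shows "jet S (\<lambda>t. f t + c *\<^sub>R f' t) (\<lambda>t. g t + c *\<^sub>R g' t) (\<lambda>t. h t + c *\<^sub>R h' t)"
  using assms unfolding jet_def
  by (auto intro!: L2_on_add_scaleR primitive_on_add primitive_on_scaleR)

lemma jet_zero [simp]: "jet S (\<lambda>t. 0) (\<lambda>t. 0) (\<lambda>t. 0)"
  by (simp add: jet_def)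

lemma primitive_on_restrict:
  assumes "is_interval T" "T \<subseteq> S" "primitive_on S g h"
  shows "primitive_on T (\<lambda>t. if t \<in> T then g t else 0) (\<lambda>t. if t \<in> T then h t else 0)"
  using primitive_on_cong[OF assms(1), of "\<lambda>t. if t \<in> T then g t else 0" g "\<lambda>t. if t \<in> T then h t else 0" h]
    primitive_on_subset[OF assms(3,2)] by simp

lemma jet_restrict:
  assumes "jet S f g h" "is_interval T" "closed T" "T \<subseteq> S" "closed S"
  shows "jet T (\<lambda>t. if t \<in> T then f t else 0) (\<lambda>t. if t \<in> T then g t else 0) (\<lambda>t. if t \<in> T then h t else 0)"
  using assms unfolding jet_def
  by (intro conjI L2_on_restrict[where S=S] primitive_on_restrict[where S=S] closed_sets_lebesgue; blast)

lemma jetI: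
  fixes f g h :: "real \<Rightarrow> 'a::euclidean_space"
  assumes S: "is_interval S" "closed S"
    and prim: "primitive_on S f g" "primitive_on S g h" and h: "h \<in> borel_measurable (lebesgue_on S)"
    and bd: "\<And>t. t \<in> S \<Longrightarrow> norm (f t) \<le> B" "\<And>t. t \<in> S \<Longrightarrow> norm (g t) \<le> B" "\<And>t. t \<in> S \<Longrightarrow> norm (h t) \<le> B"
    and v: "\<And>t. t \<in> S \<Longrightarrow> r < \<bar>t\<bar> \<Longrightarrow> f t = 0 \<and> g t = 0 \<and> h t = 0"
  shows "jet S (\<lambda>t. if t \<in> S then f t else 0) (\<lambda>t. if t \<in> S then g t else 0) (\<lambda>t. if t \<in> S then h t else 0)"
proof -
  note Sl = closed_sets_lebesgue[OF S(2)]
  have "f \<in> borel_measurable (lebesgue_on S)" "g \<in> borel_measurable (lebesgue_on S)"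
    using primitive_on_continuous[OF S(1)] prim Sl by (auto intro!: continuous_imp_measurable_on_sets_lebesgue)
  then show ?thesis
    unfolding jet_def using primitive_on_restrict[OF S(1) order_refl] prim h bd v
    by (auto intro!: L2_on_boundedI[OF _ Sl, where B=B and r=r])
qed

text \<open>The value of the derivative at \<open>\<sigma>\<close> is immaterial: to the right of
  \<open>\<sigma>\<close> the glued derivative differs from \<open>g2\<close> in at most this one
  point.\<close>

lemma primitive_on_glue:
  fixes f1 :: "real \<Rightarrow> 'a::euclidean_space"
  assumes S: "is_interval S" "\<sigma> \<in> S" and 1: "primitive_on (S \<inter> {..\<sigma>}) f1 g1" and 2: "primitive_on (S \<inter> {\<sigma>..}) f2 g2"
    and eq: "f1 \<sigma> = f2 \<sigma>"
  shows "primitive_on S (\<lambda>t. if t \<le> \<sigma> then f1 t else f2 t) (\<lambda>t. if t \<le> \<sigma> then g1 t else g2 t)"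
  (is "primitive_on S ?f ?g")
proof -
  have left: "?g absolutely_integrable_on {s..t} \<and> (?g has_integral ?f t - ?f s) {s..t}"
    if "s \<in> S" "t \<in> S" "s \<le> t" "t \<le> \<sigma>" for s t
  proof
    have st: "s \<in> S \<inter> {..\<sigma>}" "t \<in> S \<inter> {..\<sigma>}" using that by auto
    show "?g absolutely_integrable_on {s..t}"
      by (rule absolutely_integrable_spike[OF primitive_onD(1)[OF 1 st that(3)], of "{}"]) (use that in auto)
    show "(?g has_integral ?f t - ?f s) {s..t}"
      using that by (intro has_integral_spike_finite[OF _ _ primitive_onD(2)[OF 1 st that(3)], of "{}", THEN has_integral_eq_rhs]) auto
  qed
  have right: "?g absolutely_integrable_on {s..t} \<and> (?g has_integral ?f t - ?f s) {s..t}"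
    if "s \<in> S" "t \<in> S" "s \<le> t" "\<sigma> \<le> s" for s t
  proof
    have st: "s \<in> S \<inter> {\<sigma>..}" "t \<in> S \<inter> {\<sigma>..}" using that by auto
    show "?g absolutely_integrable_on {s..t}"
      by (rule absolutely_integrable_spike[OF primitive_onD(1)[OF 2 st that(3)], of "{\<sigma>}"]) (use that in auto)
    have "?f t - ?f s = f2 t - f2 s" using that eq by (cases "t = \<sigma>"; cases "s = \<sigma>") auto
    then show "(?g has_integral ?f t - ?f s) {s..t}"
      using that by (intro has_integral_spike_finite[OF _ _ primitive_onD(2)[OF 2 st that(3)], of "{\<sigma>}", THEN has_integral_eq_rhs]) auto
  qed
  show ?thesis
    unfolding primitive_on_def
  proof (intro ballI impI)
    fix s t assume st: "s \<in> S" "t \<in> S" "s \<le> t"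
    consider "t \<le> \<sigma>" | "\<sigma> \<le> s" | "s \<le> \<sigma>" "\<sigma> \<le> t" by linarith
    then show "?g absolutely_integrable_on {s..t} \<and> (?g has_integral ?f t - ?f s) {s..t}"
    proof cases
      case 3
      have l: "?g absolutely_integrable_on {s..\<sigma>}" "(?g has_integral ?f \<sigma> - ?f s) {s..\<sigma>}"
        using left[OF st(1) S(2) 3(1)] by auto
      have r: "?g absolutely_integrable_on {\<sigma>..t}" "(?g has_integral ?f t - ?f \<sigma>) {\<sigma>..t}"
        using right[OF S(2) st(2) 3(2)] by auto
      have "(?g has_integral (?f \<sigma> - ?f s) + (?f t - ?f \<sigma>)) {s..t}"
        by (rule has_integral_combine[OF 3 l(2) r(2)])
      then show ?thesis using absolutely_integrable_on_combine[OF l(1) r(1) 3] by simp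
    qed (use left right st in blast)+
  qed
qed

lemma jet_glue:
  fixes f1 :: "real \<Rightarrow> 'a::euclidean_space"
  assumes S: "is_interval S" "closed S" "\<sigma> \<in> S" and 1: "jet (S \<inter> {..\<sigma>}) f1 g1 h1" and 2: "jet (S \<inter> {\<sigma>..}) f2 g2 h2"
    and eq: "f1 \<sigma> = f2 \<sigma>" "g1 \<sigma> = g2 \<sigma>"
  shows "jet S (\<lambda>t. if t \<le> \<sigma> then f1 t else f2 t) (\<lambda>t. if t \<le> \<sigma> then g1 t else g2 t) (\<lambda>t. if t \<le> \<sigma> then h1 t else h2 t)"
proof -
  note Sl = closed_sets_lebesgue[OF S(2)]
  have T: "S \<inter> {..\<sigma>} \<in> sets lebesgue" "S \<inter> {\<sigma>..} \<in> sets lebesgue"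
    using S(2) by (auto intro!: closed_sets_lebesgue)
  have glueL2: "(\<lambda>t. if t \<le> \<sigma> then u t else v t) \<in> L2_on S"
    if u: "u \<in> L2_on (S \<inter> {..\<sigma>})" and v: "v \<in> L2_on (S \<inter> {\<sigma>..})" for u v :: "real \<Rightarrow> 'a"
  proof -
    have "u \<in> L2_on S" "v \<in> L2_on S" using L2_on_mono[OF u _ T(1) Sl] L2_on_mono[OF v _ T(2) Sl] by auto
    moreover have "(\<lambda>t. indicator {\<sigma><..} t *\<^sub>R v t) \<in> L2_on S"
      by (rule L2_on_mult[OF \<open>v \<in> L2_on S\<close> _ _ Sl, where B=1]) (rule borel_measurable_indicator, simp, simp add: indicator_def)
    ultimately have "(\<lambda>t. u t + 1 *\<^sub>R (indicator {\<sigma><..} t *\<^sub>R v t)) \<in> L2_on S" by (intro L2_on_add_scaleR)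
    moreover have "(\<lambda>t. u t + 1 *\<^sub>R (indicator {\<sigma><..} t *\<^sub>R v t)) = (\<lambda>t. if t \<le> \<sigma> then u t else v t)"
      using L2_onD(3)[OF u] by (auto simp: indicator_def)
    ultimately show ?thesis by simp
  qed
  show ?thesis
    using jetD[OF 1] jetD[OF 2] unfolding jet_def
    by (intro conjI glueL2 primitive_on_glue[OF S(1,3)] eq)
qed

lemma jet_mult:
  fixes f g h :: "real \<Rightarrow> 'a::euclidean_space"
  assumes S: "is_interval S" "closed S" and j: "jet S f g h"
    and c: "primitive_on S c c1" "primitive_on S c1 c2"
    and m: "c \<in> borel_measurable lebesgue" "c1 \<in> borel_measurable lebesgue" "c2 \<in> borel_measurable lebesgue"
    and b: "\<And>t. \<bar>c t\<bar> \<le> B" "\<And>t. \<bar>c1 t\<bar> \<le> B" "\<And>t. \<bar>c2 t\<bar> \<le> B"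
  shows "jet S (\<lambda>t. c t *\<^sub>R f t) (\<lambda>t. c1 t *\<^sub>R f t + c t *\<^sub>R g t)
     (\<lambda>t. (c2 t *\<^sub>R f t + c1 t *\<^sub>R g t) + (c1 t *\<^sub>R g t + c t *\<^sub>R h t))"
proof -
  note Sl = closed_sets_lebesgue[OF S(2)]
  note jj = jetD[OF j]
  note M = L2_on_mult[OF _ m(1) b(1) Sl] L2_on_mult[OF _ m(2) b(2) Sl] L2_on_mult[OF _ m(3) b(3) Sl]
  note A = L2_on_add_scaleR[where c=1, simplified]
  have "(\<lambda>t. c t *\<^sub>R f t) \<in> L2_on S" "(\<lambda>t. c1 t *\<^sub>R f t + c t *\<^sub>R g t) \<in> L2_on S"
    "(\<lambda>t. (c2 t *\<^sub>R f t + c1 t *\<^sub>R g t) + (c1 t *\<^sub>R g t + c t *\<^sub>R h t)) \<in> L2_on S"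
    by (auto intro!: M A jj)
  moreover have "primitive_on S (\<lambda>t. c t *\<^sub>R f t) (\<lambda>t. c1 t *\<^sub>R f t + c t *\<^sub>R g t)"
    by (rule primitive_on_bilinear[OF bounded_bilinear_scaleR S(1) c(1) jj(4)])
  moreover have "primitive_on S (\<lambda>t. c1 t *\<^sub>R f t + c t *\<^sub>R g t)
     (\<lambda>t. (c2 t *\<^sub>R f t + c1 t *\<^sub>R g t) + (c1 t *\<^sub>R g t + c t *\<^sub>R h t))"
    by (intro primitive_on_add primitive_on_bilinear[OF bounded_bilinear_scaleR S(1)] c jj)
  ultimately show ?thesis by (simp add: jet_def)
qed

lemma jet_derivs:
  assumes S: "is_interval S" and j: "jet S f g h"
  shows "continuous_on S f" "continuous_on S g" "\<And>t. t \<in> S \<Longrightarrow> (f has_vector_derivative g t) (at t within S)"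
proof -
  show c: "continuous_on S f" "continuous_on S g"
    using primitive_on_continuous[OF S] jetD(4,5)[OF j] by blast+
  show "(f has_vector_derivative g t) (at t within S)" if "t \<in> S" for t
    by (rule primitive_on_has_derivative[OF S jetD(4)[OF j] c(2) that])
qed

section \<open>The Sturm--Liouville expression and Green's identity\<close>

locale sl_coefficients =
  fixes S :: "real set" and P Q R P1 Q1 :: "real \<Rightarrow> real^'d^'d"
  assumes interval: "is_interval S" and closed: "closed S" and nondegenerate: "\<exists>a\<in>S. \<exists>b\<in>S. a < b"
    and P_deriv: "\<And>t. t \<in> S \<Longrightarrow> (P has_vector_derivative P1 t) (at t within S)" and P1_cont: "continuous_on S P1"
    and Q_deriv: "\<And>t. t \<in> S \<Longrightarrow> (Q has_vector_derivative Q1 t) (at t within S)" and Q1_cont: "continuous_on S Q1"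
    and R_cont: "continuous_on S R"
    and P_sym: "\<And>t. t \<in> S \<Longrightarrow> transpose (P t) = P t" and R_sym: "\<And>t. t \<in> S \<Longrightarrow> transpose (R t) = R t"
    and P_pos: "\<And>t w. t \<in> S \<Longrightarrow> w \<noteq> 0 \<Longrightarrow> w \<bullet> (P t *v w) > 0"
begin

text \<open>The Legendre momentum, that is, the velocity gradient of the quadratic Lagrangian of the
  second variation; \<open>force\<close> is its position gradient.\<close>

definition mom :: "real \<Rightarrow> real^'d \<Rightarrow> real^'d \<Rightarrow> real^'d" where
  "mom t a b = P t *v b + Q t *v a"

definition force :: "real \<Rightarrow> real^'d \<Rightarrow> real^'d \<Rightarrow> real^'d" where
  "force t a b = transpose (Q t) *v b + R t *v a"

text \<open>The Sturm--Liouville expression with its outer derivative expanded, as a function of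
  value, first and second derivative at one point. In these arguments it is linear everywhere,
  unlike \<open>L\<close> on functions.\<close>

definition ell :: "real \<Rightarrow> real^'d \<Rightarrow> real^'d \<Rightarrow> real^'d \<Rightarrow> real^'d" where
  "ell t a b c = - ((P1 t *v b + P t *v c) + (Q1 t *v a + Q t *v b)) + force t a b"

text \<open>The polarized integrand of the second variation, symmetric wherever \<open>P\<close> and
  \<open>R\<close> are.\<close>

definition energy :: "real \<Rightarrow> real^'d \<Rightarrow> real^'d \<Rightarrow> real^'d \<Rightarrow> real^'d \<Rightarrow> real" where
  "energy t a b a' b' = mom t a b \<bullet> b' + force t a b \<bullet> a'"

abbreviation L :: "(real \<Rightarrow> real^'d) \<Rightarrow> real \<Rightarrow> real^'d" where
  "L \<equiv> sturm_liouville S P Q R"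

lemmas S_sets = closed_sets_lebesgue[OF closed]

lemma P_cont: "continuous_on S P" and Q_cont: "continuous_on S Q"
  using has_vector_derivative_continuous[OF P_deriv] has_vector_derivative_continuous[OF Q_deriv]
  by (auto simp: continuous_on_eq_continuous_within)

lemmas cont_mv = bounded_bilinear.continuous_on[OF bounded_bilinear_matrix_vector_mult]

lemma continuous_on_transpose:
  fixes A :: "'z::topological_space \<Rightarrow> real^'n^'m"
  assumes "continuous_on T A"
  shows "continuous_on T (\<lambda>t. transpose (A t))"
  unfolding transpose_def using assms by (intro continuous_intros)

lemma P_inj: "t \<in> S \<Longrightarrow> P t *v w = 0 \<Longrightarrow> w = 0"
  using P_pos[of t w] by (cases "w = 0") auto

lemma P_invertible: "t \<in> S \<Longrightarrow> invertible (P t)"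
  using P_inj[of t] by (simp add: invertible_left_inverse matrix_left_invertible_ker)

lemma P_dot: "t \<in> S \<Longrightarrow> (P t *v a) \<bullet> b = a \<bullet> (P t *v b)"
  using dot_lmul_matrix[of a "P t" b] P_sym[of t] by (metis transpose_matrix_vector)

lemma R_dot: "t \<in> S \<Longrightarrow> (R t *v a) \<bullet> b = a \<bullet> (R t *v b)"
  using dot_lmul_matrix[of a "R t" b] R_sym[of t] by (metis transpose_matrix_vector)

lemma QT_dot: "(transpose (Q t) *v a) \<bullet> b = a \<bullet> (Q t *v b)"
  by (metis dot_lmul_matrix transpose_matrix_vector)

lemma energy_eq: "energy t a b a' b' = (P t *v b) \<bullet> b' + (Q t *v a) \<bullet> b' + b \<bullet> (Q t *v a') + (R t *v a) \<bullet> a'"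
  by (simp add: energy_def mom_def force_def inner_add_left dot_lmul_matrix)

lemma energy_sym: "t \<in> S \<Longrightarrow> energy t a b a' b' = energy t a' b' a b"
  
  unfolding energy_eq
  using P_dot[of t b b'] R_dot[of t a a'] inner_commute[of "P t *v b'" b] inner_commute[of "R t *v a'" a]
    inner_commute[of "Q t *v a" b'] inner_commute[of "Q t *v a'" b]
  by linarith

lemma mom_linear: "mom t (a + c *\<^sub>R a') (b + c *\<^sub>R b') = mom t a b + c *\<^sub>R mom t a' b'"
  by (simp add: mom_def matrix_vector_right_distrib matrix_vector_mult_scaleR scaleR_add_right)

lemma force_linear: "force t (a + c *\<^sub>R a') (b + c *\<^sub>R b') = force t a b + c *\<^sub>R force t a' b'"
  by (simp add: force_def matrix_vector_right_distrib matrix_vector_mult_scaleR scaleR_add_right)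

lemma ell_linear: "ell t (a + c *\<^sub>R a') (b + c *\<^sub>R b') (e + c *\<^sub>R e') = ell t a b e + c *\<^sub>R ell t a' b' e'"
  by (simp add: ell_def force_linear matrix_vector_right_distrib matrix_vector_mult_scaleR scaleR_add_right algebra_simps)

lemma zero_values [simp]: "mom t 0 0 = 0" "force t 0 0 = 0" "ell t 0 0 0 = 0"
  by (simp_all add: mom_def force_def ell_def)

lemma energy_cont:
  assumes "continuous_on T a" "continuous_on T b" "continuous_on T a'" "continuous_on T b'" "T \<subseteq> S"
  shows "continuous_on T (\<lambda>t. energy t (a t) (b t) (a' t) (b' t))"
  unfolding energy_def mom_def force_def using assms P_cont Q_cont R_cont
  by (intro continuous_intros cont_mv continuous_on_transpose) (blast intro: continuous_on_subset)+

lemma mom_primitive: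
  assumes f: "primitive_on S f g" and g: "primitive_on S g h"
  shows "primitive_on S (\<lambda>t. mom t (f t) (g t)) (\<lambda>t. force t (f t) (g t) - ell t (f t) (g t) (h t))"
proof -
  have "primitive_on S (\<lambda>t. P t *v g t + Q t *v f t) (\<lambda>t. (P1 t *v g t + P t *v h t) + (Q1 t *v f t + Q t *v g t))"
    by (intro primitive_on_add primitive_on_bilinear[OF bounded_bilinear_matrix_vector_mult interval]
        f g primitive_onI_C1[OF interval P_deriv P1_cont] primitive_onI_C1[OF interval Q_deriv Q1_cont])
  moreover have "(P1 t *v g t + P t *v h t) + (Q1 t *v f t + Q t *v g t) = force t (f t) (g t) - ell t (f t) (g t) (h t)" for t
    by (simp add: ell_def)
  ultimately show ?thesis by (simp add: mom_def)
qed

lemma deriv_on_jet: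
  assumes "jet S f g h" "t \<in> S"
  shows "deriv_on S f t = g t"
  using deriv_on_eq[OF interval] nondegenerate jet_derivs(3)[OF interval assms] assms(2) by blast

text \<open>Along a \<open>W22_on\<close> function the momentum is only absolutely continuous, so
  the outer derivative in \<open>L\<close> is meaningful almost everywhere; elsewhere
  \<open>deriv_on\<close> is an arbitrary value.\<close>

lemma L_AE:
  assumes j: "jet S f g h"
  shows "AE t in lebesgue_on S. L f t = ell t (f t) (g t) (h t)"
proof -
  have "AE t in lebesgue_on S. t \<in> S" using S_sets by (subst AE_restrict_space_iff) auto
  then show ?thesis
    using primitive_on_AE_derivative[OF interval closed mom_primitive[OF jetD(4,5)[OF j]]]
  proof eventually_elim
    case (elim t)
    have "((\<lambda>s. P s *v deriv_on S f s + Q s *v f s) has_vector_derivative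
        force t (f t) (g t) - ell t (f t) (g t) (h t)) (at t within S)"
      by (rule has_vector_derivative_transform[OF elim(1) _ elim(2)]) (simp add: mom_def deriv_on_jet[OF j])
    then have "deriv_on S (\<lambda>s. P s *v deriv_on S f s + Q s *v f s) t = force t (f t) (g t) - ell t (f t) (g t) (h t)"
      using deriv_on_eq[OF interval] nondegenerate elim(1) by blast
    then show ?case
      unfolding sturm_liouville_def using elim(1) deriv_on_jet[OF j elim(1)] by (simp add: force_def)
  qed
qed

text \<open>The derivative of \<open>mom\<close> is \<open>force - ell\<close>; the product rule for
  \<open>mom \<bullet> u\<close> then collects \<open>energy\<close>.\<close>

lemma green:
  assumes f: "primitive_on S f g" and g: "primitive_on S g h" and u: "primitive_on S u v"
  shows "primitive_on S (\<lambda>t. mom t (f t) (g t) \<bullet> u t)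
    (\<lambda>t. energy t (f t) (g t) (u t) (v t) - ell t (f t) (g t) (h t) \<bullet> u t)"
proof -
  have "primitive_on S (\<lambda>t. mom t (f t) (g t) \<bullet> u t)
    (\<lambda>t. (force t (f t) (g t) - ell t (f t) (g t) (h t)) \<bullet> u t + mom t (f t) (g t) \<bullet> v t)"
    by (rule primitive_on_bilinear[OF bounded_bilinear_inner interval mom_primitive[OF f g] u])
  moreover have "(force t (f t) (g t) - ell t (f t) (g t) (h t)) \<bullet> u t + mom t (f t) (g t) \<bullet> v t =
    energy t (f t) (g t) (u t) (v t) - ell t (f t) (g t) (h t) \<bullet> u t" for t
    by (simp add: energy_def inner_diff_left)
  ultimately show ?thesis by simp
qed

end

lemma L2_on_AE_cong:
  fixes f g :: "real \<Rightarrow> 'a::euclidean_space"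
  assumes f: "f \<in> L2_on S" and eq: "AE t in lebesgue_on S. f t = g t" and g: "\<And>t. t \<notin> S \<Longrightarrow> g t = 0"
    and S: "S \<in> sets lebesgue"
  shows "g \<in> L2_on S"
proof -
  have f': "\<And>t. t \<notin> S \<Longrightarrow> f t = 0" "f \<in> borel_measurable lebesgue" "integrable lebesgue (\<lambda>t. (norm (f t))\<^sup>2)"
    using f by (auto simp: L2_on_iff[OF S])
  have "AE t in lebesgue. t \<in> S \<longrightarrow> f t = g t"
    using eq S by (subst (asm) AE_restrict_space_iff) auto
  then have ae: "AE t in lebesgue. f t = g t" by eventually_elim (use f'(1) g in metis)
  have m: "g \<in> borel_measurable lebesgue" using borel_measurable_AE[OF f'(2) ae] .
  have "integrable lebesgue (\<lambda>t. (norm (g t))\<^sup>2)"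
    by (rule integrable_cong_AE_imp[OF f'(3)]) (use m ae in \<open>auto elim: eventually_mono\<close>)
  then show ?thesis using m g by (simp add: L2_on_iff[OF S])
qed

lemma integral_outside_zero:
  fixes \<phi> :: "real \<Rightarrow> real"
  assumes i: "integrable (lebesgue_on S) \<phi>" and S: "S \<in> sets lebesgue" and ab: "{a..b} \<subseteq> S"
    and z: "\<And>t. t \<in> S \<Longrightarrow> t \<notin> {a..b} \<Longrightarrow> \<phi> t = 0"
  shows "(LINT t|lebesgue_on S. \<phi> t) = integral {a..b} \<phi>"
proof -
  have "(LINT t|lebesgue_on S. \<phi> t) = integral S \<phi>" by (rule lebesgue_integral_eq_integral[OF i S])
  also have "\<dots> = integral {a..b} \<phi>"
  proof (rule integral_spike_set)
    have e: "{x \<in> S - {a..b}. \<phi> x \<noteq> 0} = {}" "{x \<in> {a..b} - S. \<phi> x \<noteq> 0} = {}" using z ab by blast+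
    show "negligible {x \<in> S - {a..b}. \<phi> x \<noteq> 0}" "negligible {x \<in> {a..b} - S. \<phi> x \<noteq> 0}"
      unfolding e by (rule negligible_empty)+
  qed
  finally show ?thesis .
qed

section \<open>Cutoff functions\<close>

text \<open>Clamping the argument makes the function constant outside \<open>{a..b}\<close>, so
  there the derivative is replaced by zero. Applied to \<open>wave\<close> and \<open>wave1\<close>
  this produces the cutoffs.\<close>

lemma primitive_on_clamp:
  fixes f :: "real \<Rightarrow> real"
  assumes ab: "a \<le> b" and f: "primitive_on UNIV f f'"
  shows "primitive_on UNIV (\<lambda>t. f (max a (min b t))) (\<lambda>t. if t \<in> {a..b} then f' t else 0)"
  unfolding primitive_on_def
proof (intro ballI impI)
  fix s t :: real assume st: "s \<le> t"
  let ?g = "\<lambda>t. if t \<in> {a..b} then f' t else 0"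
  have int: "{s..t} \<inter> {a..b} = {max s a..min t b}" by auto
  have ai: "f' absolutely_integrable_on {s..t}" using primitive_onD(1)[OF f] st by simp
  have "f' absolutely_integrable_on {max s a..min t b}"
    using absolutely_integrable_on_subinterval[OF ai] by auto
  moreover have "(\<lambda>r. indicat_real {s..t} r *\<^sub>R ?g r) = (\<lambda>r. indicat_real {max s a..min t b} r *\<^sub>R f' r)"
    by (auto simp: indicator_def fun_eq_iff)
  ultimately have 1: "?g absolutely_integrable_on {s..t}" by (simp only: set_integrable_def)
  have "(f' has_integral f (max a (min b t)) - f (max a (min b s))) ({s..t} \<inter> {a..b})"
  proof (cases "max s a \<le> min t b")
    case True
    have "max a (min b t) = min t b" "max a (min b s) = max s a" using True ab st by (auto simp: max_def min_def split: if_splits)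
    then show ?thesis unfolding int using primitive_onD(2)[OF f, of "max s a" "min t b"] True by simp
  next
    case False
    then have "max a (min b t) = max a (min b s)" using ab st by (auto simp: max_def min_def split: if_splits)
    moreover have "{s..t} \<inter> {a..b} = {}" unfolding int using False by simp
    ultimately show ?thesis by simp
  qed
  then have 2: "(?g has_integral f (max a (min b t)) - f (max a (min b s))) {s..t}"
    using has_integral_restrict_Int[of "{a..b}" f' _ "{s..t}"] by (simp add: Int_commute)
  show "?g absolutely_integrable_on {s..t} \<and> (?g has_integral f (max a (min b t)) - f (max a (min b s))) {s..t}"
    using 1 2 by blast
qed

text \<open>\<open>wave\<close> equals 1 at odd and 0 at even integers and is stationary at all integers, so it can
  be continued at integers by constants without leaving \<open>W\<^sup>2\<^sup>,\<^sup>2\<close>.\<close>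

definition wave :: "real \<Rightarrow> real" where "wave t = (1 - cos (pi * t)) / 2"
definition wave1 :: "real \<Rightarrow> real" where "wave1 t = pi / 2 * sin (pi * t)"
definition wave2 :: "real \<Rightarrow> real" where "wave2 t = pi\<^sup>2 / 2 * cos (pi * t)"

text \<open>The transition zone of \<open>cut n\<close>. Its inner radius is odd and its outer
  radius even, so \<open>wave\<close> falls from 1 to 0 across it.\<close>

definition shell :: "nat \<Rightarrow> real \<Rightarrow> bool" where
  "shell n t \<longleftrightarrow> 2 * real n + 1 \<le> \<bar>t\<bar> \<and> \<bar>t\<bar> \<le> 2 * real n + 2"

definition cut :: "nat \<Rightarrow> real \<Rightarrow> real" where
  "cut n t = (if \<bar>t\<bar> \<le> 2 * real n + 1 then 1 else if shell n t then wave t else 0)"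
definition cut1 :: "nat \<Rightarrow> real \<Rightarrow> real" where "cut1 n t = (if shell n t then wave1 t else 0)"
definition cut2 :: "nat \<Rightarrow> real \<Rightarrow> real" where "cut2 n t = (if shell n t then wave2 t else 0)"

lemma wave_primitives: "primitive_on UNIV wave wave1" "primitive_on UNIV wave1 wave2"
proof -
  have "(wave has_real_derivative wave1 t) (at t)" "(wave1 has_real_derivative wave2 t) (at t)" for t
    unfolding wave_def[abs_def] wave1_def[abs_def] wave2_def[abs_def]
    by (auto intro!: derivative_eq_intros simp: power2_eq_square)
  then have d: "(wave has_vector_derivative wave1 t) (at t)" "(wave1 has_vector_derivative wave2 t) (at t)" for t
    by (simp_all add: has_real_derivative_iff_has_vector_derivative)
  have c: "continuous_on UNIV wave1" "continuous_on UNIV wave2"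
    unfolding wave1_def[abs_def] wave2_def[abs_def] by (intro continuous_intros)+
  show "primitive_on UNIV wave wave1" "primitive_on UNIV wave1 wave2"
    using d c by (auto intro!: primitive_onI_C1)
qed

lemma wave_integer:
  "wave (2 * real n + 1) = 1" "wave (2 * real n + 2) = 0" "wave1 (2 * real n + 1) = 0" "wave1 (2 * real n + 2) = 0"
proof -
  have 1: "pi * (2 * real n + 1) = pi * real (2 * n + 1)" "pi * (2 * real n + 2) = pi * real (2 * n + 2)"
    by (simp_all add: algebra_simps)
  show "wave (2 * real n + 1) = 1" "wave (2 * real n + 2) = 0" "wave1 (2 * real n + 1) = 0" "wave1 (2 * real n + 2) = 0"
    unfolding wave_def wave1_def 1 cos_npi2 sin_npi2 by simp_all
qed

lemma wave_minus: "wave (- t) = wave t" "wave1 (- t) = - wave1 t"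
  by (simp_all add: wave_def wave1_def)

lemma wave_abs: "wave \<bar>t\<bar> = wave t"
  by (simp add: abs_if wave_minus)

lemma wave_bounds: "0 \<le> wave t" "wave t \<le> 1" "\<bar>wave t\<bar> \<le> 10" "\<bar>wave1 t\<bar> \<le> 10" "\<bar>wave2 t\<bar> \<le> 10"
proof -
  have c: "cos (pi * t) \<le> 1" "-1 \<le> cos (pi * t)" by auto
  show w: "0 \<le> wave t" "wave t \<le> 1" using c by (simp_all add: wave_def)
  then show "\<bar>wave t\<bar> \<le> 10" by simp
  have p: "0 \<le> pi" "pi \<le> 4" using pi_less_4 pi_ge_zero by auto
  have "\<bar>wave1 t\<bar> = pi / 2 * \<bar>sin (pi * t)\<bar>" unfolding wave1_def using p by (simp add: abs_mult)
  also have "\<dots> \<le> 4 / 2 * 1" using p by (intro mult_mono) auto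
  finally show "\<bar>wave1 t\<bar> \<le> 10" by simp
  have "\<bar>wave2 t\<bar> = pi\<^sup>2 / 2 * \<bar>cos (pi * t)\<bar>" unfolding wave2_def by (simp add: abs_mult)
  also have "\<dots> \<le> 4\<^sup>2 / 2 * 1" using p by (intro mult_mono divide_right_mono power_mono) auto
  finally show "\<bar>wave2 t\<bar> \<le> 10" by simp
qed

lemma cut_primitives: "primitive_on UNIV (cut n) (cut1 n)" "primitive_on UNIV (cut1 n) (cut2 n)"
proof -
  let ?a = "2 * real n + 1" and ?b = "2 * real n + 2"
  have ab: "?a \<le> ?b" "- ?b \<le> - ?a" by auto
  note c = primitive_on_clamp[OF ab(1)] primitive_on_clamp[OF ab(2)]
  have sh: "shell n t \<longleftrightarrow> t \<in> {?a..?b} \<or> t \<in> {-?b..-?a}" "\<not> (t \<in> {?a..?b} \<and> t \<in> {-?b..-?a})" for t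
    unfolding shell_def by auto
  \<comment> \<open>On the plateau both clamped waves equal 1, beyond a shell one of them is 0 and
    the other 1, hence the correction -1.\<close>
  have eq0: "cut n t = (wave (max ?a (min ?b t)) + wave (max (-?b) (min (-?a) t))) + (-1)" for t
  proof -
    consider "t < - ?b" | "-?b \<le> t" "t < -?a" | "-?a \<le> t" "t \<le> ?a" | "?a < t" "t \<le> ?b" | "?b < t" by linarith
    then show ?thesis
    proof cases
      case 1
      then have "max ?a (min ?b t) = ?a" "max (-?b) (min (-?a) t) = -?b" by (auto simp: max_def min_def)
      then show ?thesis using 1 wave_minus(1)[of ?b] by (simp add: cut_def shell_def wave_integer)
    next
      case 2
      then have "max ?a (min ?b t) = ?a" "max (-?b) (min (-?a) t) = t" by (auto simp: max_def min_def)
      then show ?thesis using 2 by (simp add: cut_def shell_def wave_integer)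
    next
      case 3
      then have "max ?a (min ?b t) = ?a" "max (-?b) (min (-?a) t) = -?a" by (auto simp: max_def min_def)
      then show ?thesis using 3 wave_minus(1)[of ?a] by (simp add: cut_def shell_def wave_integer)
    next
      case 4
      then have "max ?a (min ?b t) = t" "max (-?b) (min (-?a) t) = -?a" by (auto simp: max_def min_def)
      then show ?thesis using 4 wave_minus(1)[of ?a] by (simp add: cut_def shell_def wave_integer)
    next
      case 5
      then have "max ?a (min ?b t) = ?b" "max (-?b) (min (-?a) t) = -?a" by (auto simp: max_def min_def)
      then show ?thesis using 5 wave_minus(1)[of ?a] by (simp add: cut_def shell_def wave_integer)
    qed
  qed
  have eq1: "cut1 n t = wave1 (max ?a (min ?b t)) + wave1 (max (-?b) (min (-?a) t))" for t
  proof -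
    have 1: "wave1 (max ?a (min ?b t)) = (if t \<in> {?a..?b} then wave1 t else 0)"
      using wave_integer(3,4)[of n] by (auto simp: max_def min_def)
    have 2: "wave1 (max (-?b) (min (-?a) t)) = (if t \<in> {-?b..-?a} then wave1 t else 0)"
      using wave_integer(3,4)[of n] wave_minus(2)[of ?a] wave_minus(2)[of ?b] by (auto simp: max_def min_def)
    show ?thesis unfolding 1 2 cut1_def using sh[of t] by auto
  qed
  \<comment> \<open>\<open>cut1\<close> is needed in two forms: as a sum of clamped waves it has the
    derivative \<open>cut2\<close>, as a sum of restricted waves it is the derivative of
    \<open>cut\<close>.\<close>
  have eq1': "cut1 n t = ((if t \<in> {?a..?b} then wave1 t else 0) + (if t \<in> {-?b..-?a} then wave1 t else 0)) + 0" for t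
    unfolding cut1_def using sh[of t] by auto
  have eq2: "cut2 n t = (if t \<in> {?a..?b} then wave2 t else 0) + (if t \<in> {-?b..-?a} then wave2 t else 0)" for t
    unfolding cut2_def using sh[of t] by auto
  have const: "primitive_on UNIV (\<lambda>t. -1 :: real) (\<lambda>t. 0)" by (rule primitive_onI_C1) auto
  show "primitive_on UNIV (cut n) (cut1 n)"
    unfolding eq0[abs_def] eq1'[abs_def] by (intro primitive_on_add c wave_primitives const)
  show "primitive_on UNIV (cut1 n) (cut2 n)"
    unfolding eq1[abs_def] eq2[abs_def] by (intro primitive_on_add c wave_primitives)
qed

lemma primitive_on_UNIV_measurable:
  "primitive_on UNIV c c1 \<Longrightarrow> c \<in> borel_measurable lebesgue"
  using primitive_on_continuous[of UNIV c c1] continuous_imp_measurable_on_sets_lebesgue[of UNIV c] by simp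

lemma cut_measurable: "cut n \<in> borel_measurable lebesgue" "cut1 n \<in> borel_measurable lebesgue" "cut2 n \<in> borel_measurable lebesgue"
proof -
  show "cut n \<in> borel_measurable lebesgue" "cut1 n \<in> borel_measurable lebesgue"
    using cut_primitives primitive_on_UNIV_measurable by blast+
  have "(\<lambda>t. if \<bar>t\<bar> < 2 * real n + 1 \<or> 2 * real n + 2 < \<bar>t\<bar> then 0 else wave2 t) \<in> borel_measurable borel"
    unfolding wave2_def by measurable
  moreover have "cut2 n = (\<lambda>t. if \<bar>t\<bar> < 2 * real n + 1 \<or> 2 * real n + 2 < \<bar>t\<bar> then 0 else wave2 t)"
    by (auto simp: cut2_def shell_def)
  ultimately have "cut2 n \<in> borel_measurable borel" by simp
  then show "cut2 n \<in> borel_measurable lebesgue" by (simp add: measurable_completion)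
qed

lemma wave_measurable: "wave \<in> borel_measurable lebesgue" "wave1 \<in> borel_measurable lebesgue" "wave2 \<in> borel_measurable lebesgue"
proof -
  show "wave \<in> borel_measurable lebesgue" "wave1 \<in> borel_measurable lebesgue"
    using wave_primitives primitive_on_UNIV_measurable by blast+
  have "wave2 \<in> borel_measurable borel" unfolding wave2_def by measurable
  then show "wave2 \<in> borel_measurable lebesgue" by (simp add: measurable_completion)
qed

lemma cut_bounds: "0 \<le> cut n t" "cut n t \<le> 1" "\<bar>cut n t\<bar> \<le> 10" "\<bar>cut1 n t\<bar> \<le> 10" "\<bar>cut2 n t\<bar> \<le> 10"
  using wave_bounds[of t] by (auto simp: cut_def cut1_def cut2_def)

text \<open>Each end of the truncated interval is either an end of \<open>S\<close>, where Dirichlet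
  functions vanish, or an end of \<open>{-r..r}\<close>, where a suitable cutoff vanishes.\<close>

lemma interval_truncation:
  fixes S :: "real set"
  assumes S: "is_interval S" "closed S" and t: "t \<in> S" "\<bar>t\<bar> \<le> r"
  obtains \<alpha> \<beta> where "S \<inter> {-r..r} = {\<alpha>..\<beta>}" "\<alpha> \<in> S" "\<beta> \<in> S" "\<alpha> \<le> \<beta>" "\<alpha> \<in> frontier S \<or> \<alpha> = -r" "\<beta> \<in> frontier S \<or> \<beta> = r"
proof -
  have "is_interval (S \<inter> {-r..r})" "compact (S \<inter> {-r..r})"
    using S by (auto simp: is_interval_Int is_interval_cc closed_Int_compact)
  then obtain \<alpha> \<beta> where ab: "S \<inter> {-r..r} = {\<alpha>..\<beta>}"
    by (metis cbox_interval is_interval_compact)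
  have "t \<in> {\<alpha>..\<beta>}" unfolding ab[symmetric] using t by auto
  then have le: "\<alpha> \<le> \<beta>" by simp
  then have in': "\<alpha> \<in> S \<inter> {-r..r}" "\<beta> \<in> S \<inter> {-r..r}" unfolding ab by simp_all
  have "\<alpha> \<in> frontier S \<or> \<alpha> = -r"
  proof (rule ccontr)
    assume "\<not> ?thesis"
    then have a: "\<alpha> \<in> interior S" "-r < \<alpha>" using in' S(2) by (auto simp: frontier_def)
    then obtain e where e: "e > 0" "ball \<alpha> e \<subseteq> S" by (meson mem_interior)
    define s where "s = max (\<alpha> - e / 2) (-r)"
    have "s \<in> ball \<alpha> e" "s < \<alpha>" "s \<in> {-r..r}" using e a in' by (auto simp: s_def dist_real_def)
    then have "s \<in> {\<alpha>..\<beta>}" unfolding ab[symmetric] using e(2) by blast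
    then show False using \<open>s < \<alpha>\<close> by simp
  qed
  moreover have "\<beta> \<in> frontier S \<or> \<beta> = r"
  proof (rule ccontr)
    assume "\<not> ?thesis"
    then have a: "\<beta> \<in> interior S" "\<beta> < r" using in' S(2) by (auto simp: frontier_def)
    then obtain e where e: "e > 0" "ball \<beta> e \<subseteq> S" by (meson mem_interior)
    define s where "s = min (\<beta> + e / 2) r"
    have "s \<in> ball \<beta> e" "\<beta> < s" "s \<in> {-r..r}" using e a in' by (auto simp: s_def dist_real_def)
    then have "s \<in> {\<alpha>..\<beta>}" unfolding ab[symmetric] using e(2) by blast
    then show False using \<open>\<beta> < s\<close> by simp
  qed
  ultimately show ?thesis using that[OF ab] in' le by blast
qed

text \<open>\<open>L_L2\<close> is all that is known about the coefficients near an infinite end;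
  they need not be bounded there.\<close>

locale sl_operator = sl_coefficients S P Q R P1 Q1
  for S :: "real set" and P Q R P1 Q1 :: "real \<Rightarrow> real^'d^'d" +
  assumes L_L2: "\<And>f. f \<in> W22_on S \<Longrightarrow> L f \<in> L2_on S"
begin

text \<open>Defined through \<open>L\<close> and not through \<open>energy\<close>, whose integral
  over an unbounded \<open>S\<close> is not known to converge.\<close>

definition form :: "(real \<Rightarrow> real^'d) \<Rightarrow> (real \<Rightarrow> real^'d) \<Rightarrow> real" where
  "form f u = (LINT t|lebesgue_on S. L f t \<bullet> u t)"

lemma jet_W22: "jet S f g h \<Longrightarrow> f \<in> W22_on S"
  using W22_on_iff_jet[OF closed] by blast

lemma ell_L2:
  assumes j: "jet S f g h"
  shows "(\<lambda>t. ell t (f t) (g t) (h t)) \<in> L2_on S"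
proof (rule L2_on_AE_cong[OF L_L2[OF jet_W22[OF j]] L_AE[OF j] _ S_sets])
  fix t assume "t \<notin> S"
  then have "f t = 0" "g t = 0" "h t = 0" using L2_onD(3)[OF jetD(1)[OF j]] L2_onD(3)[OF jetD(2)[OF j]] L2_onD(3)[OF jetD(3)[OF j]] by auto
  then show "ell t (f t) (g t) (h t) = 0" by simp
qed

lemma form_ell:
  assumes j: "jet S f g h" and u: "u \<in> L2_on S"
  shows "form f u = (LINT t|lebesgue_on S. ell t (f t) (g t) (h t) \<bullet> u t)"
  unfolding form_def
proof (rule integral_cong_AE)
  show "AE t in lebesgue_on S. L f t \<bullet> u t = ell t (f t) (g t) (h t) \<bullet> u t"
    using L_AE[OF j] by eventually_elim simp
qed (use L2_on_integrable_inner[OF L_L2[OF jet_W22[OF j]] u] L2_on_integrable_inner[OF ell_L2[OF j] u]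
    in \<open>auto intro: borel_measurable_integrable\<close>)

text \<open>Green's identity on a compact interval, where \<open>energy\<close> is integrable by
  continuity. The hypothesis on the outside is what the cutoffs provide.\<close>

lemma form_interval:
  assumes f: "jet S f g h" and u: "jet S u v w" and ab: "\<alpha> \<in> S" "\<beta> \<in> S" "\<alpha> \<le> \<beta>"
    and z: "\<And>t. t \<in> S \<Longrightarrow> t \<notin> {\<alpha>..\<beta>} \<Longrightarrow> ell t (f t) (g t) (h t) \<bullet> u t = 0"
  shows "form f u = integral {\<alpha>..\<beta>} (\<lambda>t. energy t (f t) (g t) (u t) (v t))
    - mom \<beta> (f \<beta>) (g \<beta>) \<bullet> u \<beta> + mom \<alpha> (f \<alpha>) (g \<alpha>) \<bullet> u \<alpha>"
proof -
  have sub: "{\<alpha>..\<beta>} \<subseteq> S" using Icc_subset_interval[OF interval ab(1,2)] .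
  have i: "integrable (lebesgue_on S) (\<lambda>t. ell t (f t) (g t) (h t) \<bullet> u t)"
    using L2_on_integrable_inner[OF ell_L2[OF f] jetD(1)[OF u]] .
  have e: "continuous_on {\<alpha>..\<beta>} (\<lambda>t. energy t (f t) (g t) (u t) (v t))"
    using jet_derivs[OF interval f] jet_derivs[OF interval u] sub
    by (intro energy_cont) (blast intro: continuous_on_subset)+
  note gr = primitive_onD(2)[OF green[OF jetD(4,5)[OF f] jetD(4)[OF u]] ab]
  have "((\<lambda>t. energy t (f t) (g t) (u t) (v t) - (energy t (f t) (g t) (u t) (v t) - ell t (f t) (g t) (h t) \<bullet> u t)) has_integral
      integral {\<alpha>..\<beta>} (\<lambda>t. energy t (f t) (g t) (u t) (v t)) - (mom \<beta> (f \<beta>) (g \<beta>) \<bullet> u \<beta> - mom \<alpha> (f \<alpha>) (g \<alpha>) \<bullet> u \<alpha>)) {\<alpha>..\<beta>}"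
    by (rule has_integral_diff[OF integrable_integral[OF integrable_continuous_real[OF e]] gr])
  then have "integral {\<alpha>..\<beta>} (\<lambda>t. ell t (f t) (g t) (h t) \<bullet> u t) =
     integral {\<alpha>..\<beta>} (\<lambda>t. energy t (f t) (g t) (u t) (v t)) - (mom \<beta> (f \<beta>) (g \<beta>) \<bullet> u \<beta> - mom \<alpha> (f \<alpha>) (g \<alpha>) \<bullet> u \<alpha>)"
    by (intro integral_unique) simp
  then show ?thesis
    using form_ell[OF f jetD(1)[OF u]] integral_outside_zero[OF i S_sets sub z] by simp
qed

definition cut_jet :: "nat \<Rightarrow> (real \<Rightarrow> real^'d) \<Rightarrow> (real \<Rightarrow> real^'d) \<Rightarrow> (real \<Rightarrow> real^'d) \<Rightarrow> bool" where
  "cut_jet n f g h \<longleftrightarrow> jet S (\<lambda>t. cut n t *\<^sub>R f t) (\<lambda>t. cut1 n t *\<^sub>R f t + cut n t *\<^sub>R g t)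
     (\<lambda>t. (cut2 n t *\<^sub>R f t + cut1 n t *\<^sub>R g t) + (cut1 n t *\<^sub>R g t + cut n t *\<^sub>R h t))"

lemma cut_jet:
  assumes "jet S f g h"
  shows "cut_jet n f g h"
  unfolding cut_jet_def
  by (rule jet_mult[OF interval closed assms primitive_on_subset[OF cut_primitives(1)] primitive_on_subset[OF cut_primitives(2)]
        cut_measurable cut_bounds(3-5)]) auto

text \<open>The commutator of \<open>L\<close> with the cutoff functions is controlled without any information on
  the coefficients near infinity: on the shells, the cut off function agrees with the single \<open>W\<^sup>2\<^sup>,\<^sup>2\<close>
  function \<open>wave * f\<close>, to which \<open>L\<close> may be applied.\<close>

lemma form_cut_tendsto:
  assumes f: "jet S f g h" and u: "u \<in> L2_on S"
    and c: "\<And>n t. 0 \<le> c n t \<and> c n t \<le> 1" "\<And>n. c n \<in> borel_measurable lebesgue"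
      "\<And>t. \<forall>\<^sub>F n in sequentially. c n t = 1"
  shows "(\<lambda>n. form (\<lambda>t. cut n t *\<^sub>R f t) (\<lambda>t. c n t *\<^sub>R u t)) \<longlonglongrightarrow> form f u"
proof -
  define E where "E t = ell t (f t) (g t) (h t)" for t
  define W where "W t = ell t (wave t *\<^sub>R f t) (wave1 t *\<^sub>R f t + wave t *\<^sub>R g t)
     ((wave2 t *\<^sub>R f t + wave1 t *\<^sub>R g t) + (wave1 t *\<^sub>R g t + wave t *\<^sub>R h t))" for t
  define C where "C n t = ell t (cut n t *\<^sub>R f t) (cut1 n t *\<^sub>R f t + cut n t *\<^sub>R g t)
     ((cut2 n t *\<^sub>R f t + cut1 n t *\<^sub>R g t) + (cut1 n t *\<^sub>R g t + cut n t *\<^sub>R h t))" for n t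
  have jw: "jet S (\<lambda>t. wave t *\<^sub>R f t) (\<lambda>t. wave1 t *\<^sub>R f t + wave t *\<^sub>R g t)
     (\<lambda>t. (wave2 t *\<^sub>R f t + wave1 t *\<^sub>R g t) + (wave1 t *\<^sub>R g t + wave t *\<^sub>R h t))"
    by (rule jet_mult[OF interval closed f primitive_on_subset[OF wave_primitives(1)] primitive_on_subset[OF wave_primitives(2)]
        wave_measurable wave_bounds(3-5)]) auto
  have EL: "E \<in> L2_on S" "W \<in> L2_on S" "C n \<in> L2_on S" for n
    unfolding E_def[abs_def] W_def[abs_def] C_def[abs_def]
    using ell_L2[OF f] ell_L2[OF jw] ell_L2[OF cut_jet[OF f, unfolded cut_jet_def]] by blast+
  have cu: "(\<lambda>t. c n t *\<^sub>R u t) \<in> L2_on S" for n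
    by (rule L2_on_mult[OF u c(2) _ S_sets, where B=1]) (use c(1)[of n] in auto)
  have C_cases: "norm (C n t) \<le> norm (E t) + norm (W t)" for n t
  proof (cases "shell n t")
    case True
    then have "C n t = W t" unfolding C_def W_def
      using wave_integer(1)[of n] wave_abs[of t] by (auto simp: cut_def cut1_def cut2_def shell_def)
    then show ?thesis by simp
  next
    case False
    then have "C n t = E t \<or> C n t = 0" unfolding C_def E_def
      by (auto simp: cut_def cut1_def cut2_def)
    then show ?thesis by (auto simp: add_increasing2)
  qed
  have "(\<lambda>n. LINT t|lebesgue_on S. C n t \<bullet> (c n t *\<^sub>R u t)) \<longlonglongrightarrow> (LINT t|lebesgue_on S. E t \<bullet> u t)"
  proof (rule integral_dominated_convergence)
    show "(\<lambda>t. E t \<bullet> u t) \<in> borel_measurable (lebesgue_on S)" "\<And>n. (\<lambda>t. C n t \<bullet> (c n t *\<^sub>R u t)) \<in> borel_measurable (lebesgue_on S)"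
      using EL cu u by (intro borel_measurable_inner L2_onD(1); blast)+
    show "integrable (lebesgue_on S) (\<lambda>t. ((norm (E t))\<^sup>2 + (norm (W t))\<^sup>2) + (norm (u t))\<^sup>2)"
      using EL u by (intro Bochner_Integration.integrable_add L2_onD(2))
    have "norm (C n t \<bullet> (c n t *\<^sub>R u t)) \<le> ((norm (E t))\<^sup>2 + (norm (W t))\<^sup>2) + (norm (u t))\<^sup>2" for n t
    proof -
      have "norm (C n t \<bullet> (c n t *\<^sub>R u t)) \<le> norm (C n t) * norm (c n t *\<^sub>R u t)"
        by (simp only: real_norm_def Cauchy_Schwarz_ineq2)
      also have "\<dots> \<le> (norm (E t) + norm (W t)) * norm (u t)"
        using c(1)[of n t] C_cases[of n t] by (intro mult_mono) (auto intro: mult_left_le_one_le)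
      also have "\<dots> \<le> ((norm (E t))\<^sup>2 + (norm (W t))\<^sup>2) + (norm (u t))\<^sup>2"
        using sum_squares_bound[of "norm (E t)" "norm (u t)"] sum_squares_bound[of "norm (W t)" "norm (u t)"]
          zero_le_power2[of "norm (E t)"] zero_le_power2[of "norm (W t)"]
        unfolding distrib_right by linarith
      finally show ?thesis .
    qed
    then show "AE t in lebesgue_on S. norm (C n t \<bullet> (c n t *\<^sub>R u t)) \<le> ((norm (E t))\<^sup>2 + (norm (W t))\<^sup>2) + (norm (u t))\<^sup>2" for n
      by simp
    have "(\<lambda>n. C n t \<bullet> (c n t *\<^sub>R u t)) \<longlonglongrightarrow> E t \<bullet> u t" for t
    proof (rule tendsto_eventually)
      obtain n0 :: nat where n0: "\<bar>t\<bar> < real n0" using reals_Archimedean2 by blast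
      have "\<forall>\<^sub>F n in sequentially. n0 \<le> n" by (rule eventually_ge_at_top)
      then show "\<forall>\<^sub>F n in sequentially. C n t \<bullet> (c n t *\<^sub>R u t) = E t \<bullet> u t"
        using c(3)[of t]
      proof eventually_elim
        case (elim n)
        then have "\<bar>t\<bar> < 2 * real n + 1" using n0 by simp
        then have "C n t = E t" unfolding C_def E_def by (simp add: cut_def cut1_def cut2_def shell_def)
        then show ?case using elim by simp
      qed
    qed
    then show "AE t in lebesgue_on S. (\<lambda>n. C n t \<bullet> (c n t *\<^sub>R u t)) \<longlonglongrightarrow> E t \<bullet> u t" by simp
  qed
  moreover have "form (\<lambda>t. cut n t *\<^sub>R f t) (\<lambda>t. c n t *\<^sub>R u t) = (LINT t|lebesgue_on S. C n t \<bullet> (c n t *\<^sub>R u t))" for n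
    unfolding C_def by (rule form_ell[OF cut_jet[OF f, unfolded cut_jet_def] cu])
  moreover have "form f u = (LINT t|lebesgue_on S. E t \<bullet> u t)"
    unfolding E_def by (rule form_ell[OF f u])
  ultimately show ?thesis by simp
qed

lemma cut_eventually: "\<forall>\<^sub>F n in sequentially. cut n t = 1"
proof -
  obtain n0 :: nat where n0: "\<bar>t\<bar> < real n0" using reals_Archimedean2 by blast
  have "\<forall>\<^sub>F n in sequentially. n0 \<le> n" by (rule eventually_ge_at_top)
  then show ?thesis by eventually_elim (use n0 in \<open>auto simp: cut_def\<close>)
qed

lemma form_cut_cut:
  assumes f: "jet S f g h" and u: "jet S u v w"
  shows "(\<lambda>n. form (\<lambda>t. cut n t *\<^sub>R f t) (\<lambda>t. cut n t *\<^sub>R u t)) \<longlonglongrightarrow> form f u"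
  by (rule form_cut_tendsto[OF f jetD(1)[OF u]]) (use cut_bounds cut_measurable cut_eventually in auto)

definition dirichlet :: "(real \<Rightarrow> real^'d) \<Rightarrow> bool" where
  "dirichlet f \<longleftrightarrow> (\<forall>t\<in>frontier S. f t = 0)"

lemma cut_truncation:
  assumes t0: "t0 \<in> S" "\<bar>t0\<bar> \<le> 2 * real n + 2"
  obtains \<alpha> \<beta> where "S \<inter> {- (2 * real n + 2)..2 * real n + 2} = {\<alpha>..\<beta>}" "\<alpha> \<in> S" "\<beta> \<in> S" "\<alpha> \<le> \<beta>"
    "\<And>f. dirichlet f \<Longrightarrow> cut n \<alpha> *\<^sub>R f \<alpha> = 0" "\<And>f. dirichlet f \<Longrightarrow> cut n \<beta> *\<^sub>R f \<beta> = 0"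
    "\<And>t. t \<in> S \<Longrightarrow> t \<notin> {\<alpha>..\<beta>} \<Longrightarrow> cut n t = 0" "\<alpha> \<in> frontier S \<or> cut n \<alpha> = 0" "\<beta> \<in> frontier S \<or> cut n \<beta> = 0"
proof -
  let ?r = "2 * real n + 2"
  obtain \<alpha> \<beta> where ab: "S \<inter> {-?r..?r} = {\<alpha>..\<beta>}" "\<alpha> \<in> S" "\<beta> \<in> S" "\<alpha> \<le> \<beta>" "\<alpha> \<in> frontier S \<or> \<alpha> = -?r" "\<beta> \<in> frontier S \<or> \<beta> = ?r"
    using interval_truncation[OF interval closed t0] by blast
  have c: "cut n ?r = 0" "cut n (-?r) = 0"
    using wave_integer(2)[of n] wave_minus(1)[of ?r] by (simp_all add: cut_def shell_def)
  have fr: "\<alpha> \<in> frontier S \<or> cut n \<alpha> = 0" "\<beta> \<in> frontier S \<or> cut n \<beta> = 0" using ab(5,6) c by auto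
  have out: "cut n t = 0" if "t \<in> S" "t \<notin> {\<alpha>..\<beta>}" for t
  proof -
    have "t \<notin> {-?r..?r}" using that ab(1) by blast
    then show ?thesis by (auto simp: cut_def shell_def)
  qed
  show ?thesis
    by (rule that[OF ab(1-4) _ _ out fr]) (use fr in \<open>auto simp: dirichlet_def\<close>)
qed

text \<open>For the cut off functions all boundary terms vanish: at an end of \<open>S\<close> by
  the Dirichlet condition, at the outer radius of the shell by the cutoff. Symmetry of
  \<open>energy\<close> then passes to the limit by \<open>form_cut_cut\<close>.\<close>

lemma form_sym:
  assumes f: "jet S f g h" "dirichlet f" and u: "jet S u v w" "dirichlet u"
  shows "form f u = form u f"
proof -
  obtain t0 where t0: "t0 \<in> S" using nondegenerate by blast
  obtain n0 :: nat where n0: "\<bar>t0\<bar> < real n0" using reals_Archimedean2 by blast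
  have eq: "form (\<lambda>t. cut n t *\<^sub>R f t) (\<lambda>t. cut n t *\<^sub>R u t) = form (\<lambda>t. cut n t *\<^sub>R u t) (\<lambda>t. cut n t *\<^sub>R f t)"
    if n: "n \<ge> n0" for n
  proof -
    have "\<bar>t0\<bar> \<le> 2 * real n + 2" using n n0 by simp
    then obtain \<alpha> \<beta> where ab: "\<alpha> \<in> S" "\<beta> \<in> S" "\<alpha> \<le> \<beta>"
      "\<And>f. dirichlet f \<Longrightarrow> cut n \<alpha> *\<^sub>R f \<alpha> = 0" "\<And>f. dirichlet f \<Longrightarrow> cut n \<beta> *\<^sub>R f \<beta> = 0"
      "\<And>t. t \<in> S \<Longrightarrow> t \<notin> {\<alpha>..\<beta>} \<Longrightarrow> cut n t = 0"
      using cut_truncation[OF t0, of n] by metis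
    have sub: "{\<alpha>..\<beta>} \<subseteq> S" using Icc_subset_interval[OF interval ab(1,2)] .
    have sy: "integral {\<alpha>..\<beta>} (\<lambda>t. energy t (a t) (b t) (a' t) (b' t)) = integral {\<alpha>..\<beta>} (\<lambda>t. energy t (a' t) (b' t) (a t) (b t))"
      for a b a' b' by (rule integral_cong) (use sub energy_sym in blast)
    have "mom \<alpha> a b \<bullet> (cut n \<alpha> *\<^sub>R u \<alpha>) = 0" "mom \<beta> a b \<bullet> (cut n \<beta> *\<^sub>R u \<beta>) = 0"
         "mom \<alpha> a b \<bullet> (cut n \<alpha> *\<^sub>R f \<alpha>) = 0" "mom \<beta> a b \<bullet> (cut n \<beta> *\<^sub>R f \<beta>) = 0" for a b
      unfolding ab(4)[OF f(2)] ab(4)[OF u(2)] ab(5)[OF f(2)] ab(5)[OF u(2)] by simp_all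
    note bd = this
    note jf = cut_jet[OF f(1), of n, unfolded cut_jet_def] and ju = cut_jet[OF u(1), of n, unfolded cut_jet_def]
    let ?f0 = "\<lambda>t. cut n t *\<^sub>R f t" and ?f1 = "\<lambda>t. cut1 n t *\<^sub>R f t + cut n t *\<^sub>R g t"
    let ?u0 = "\<lambda>t. cut n t *\<^sub>R u t" and ?u1 = "\<lambda>t. cut1 n t *\<^sub>R u t + cut n t *\<^sub>R v t"
    have "form ?f0 ?u0 = integral {\<alpha>..\<beta>} (\<lambda>t. energy t (?f0 t) (?f1 t) (?u0 t) (?u1 t))
        - mom \<beta> (?f0 \<beta>) (?f1 \<beta>) \<bullet> ?u0 \<beta> + mom \<alpha> (?f0 \<alpha>) (?f1 \<alpha>) \<bullet> ?u0 \<alpha>"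
      by (rule form_interval[OF jf ju ab(1-3)]) (simp add: ab(6))
    moreover have "form ?u0 ?f0 = integral {\<alpha>..\<beta>} (\<lambda>t. energy t (?u0 t) (?u1 t) (?f0 t) (?f1 t))
        - mom \<beta> (?u0 \<beta>) (?u1 \<beta>) \<bullet> ?f0 \<beta> + mom \<alpha> (?u0 \<alpha>) (?u1 \<alpha>) \<bullet> ?f0 \<alpha>"
      by (rule form_interval[OF ju jf ab(1-3)]) (simp add: ab(6))
    ultimately show ?thesis unfolding bd using sy[of ?f0 ?f1 ?u0 ?u1] by simp
  qed
  have "\<forall>\<^sub>F n in sequentially. form (\<lambda>t. cut n t *\<^sub>R f t) (\<lambda>t. cut n t *\<^sub>R u t) = form (\<lambda>t. cut n t *\<^sub>R u t) (\<lambda>t. cut n t *\<^sub>R f t)"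
    using eventually_ge_at_top[of n0] by eventually_elim (rule eq)
  then have "(\<lambda>n. form (\<lambda>t. cut n t *\<^sub>R u t) (\<lambda>t. cut n t *\<^sub>R f t)) \<longlonglongrightarrow> form f u"
    by (rule Lim_transform_eventually[OF form_cut_cut[OF f(1) u(1)]])
  then show ?thesis using form_cut_cut[OF u(1) f(1)] LIMSEQ_unique by blast
qed

end

lemma primitive_on_AE_cong:
  fixes g :: "real \<Rightarrow> 'a::euclidean_space"
  assumes p: "primitive_on S g h" and ae: "AE t in lebesgue_on S. h t = h' t" and S: "is_interval S" "S \<in> sets lebesgue"
  shows "primitive_on S g h'"
proof -
  have "AE t in lebesgue. t \<in> S \<longrightarrow> h t = h' t"
    using ae S(2) by (subst (asm) AE_restrict_space_iff) auto
  then obtain N where N: "N \<in> null_sets lebesgue" "\<And>t. t \<notin> N \<Longrightarrow> t \<in> S \<Longrightarrow> h t = h' t"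
    unfolding eventually_ae_filter by auto
  then have neg: "negligible N" by (simp add: negligible_iff_null_sets)
  show ?thesis
    unfolding primitive_on_def
  proof (intro ballI impI conjI)
    fix s t assume st: "s \<in> S" "t \<in> S" "s \<le> t"
    have sub: "{s..t} \<subseteq> S" using Icc_subset_interval[OF S(1) st(1,2)] .
    have eq: "h' r = h r" if "r \<in> {s..t} - N" for r using N(2)[of r] that sub by auto
    show "h' absolutely_integrable_on {s..t}"
      using absolutely_integrable_spike[OF primitive_onD(1)[OF p st] neg eq] .
    show "(h' has_integral g t - g s) {s..t}"
      using has_integral_spike[OF neg eq primitive_onD(2)[OF p st]] .
  qed
qed

lemma integral_outside_zero_AE:
  fixes \<phi> :: "real \<Rightarrow> real"
  assumes i: "integrable (lebesgue_on S) \<phi>" and S: "S \<in> sets lebesgue" and ab: "{a..b} \<subseteq> S"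
    and z: "AE t in lebesgue_on S. t \<notin> {a..b} \<longrightarrow> \<phi> t = 0"
  shows "(LINT t|lebesgue_on S. \<phi> t) = integral {a..b} \<phi>"
proof -
  let ?\<psi> = "\<lambda>t. indicator {a..b} t *\<^sub>R \<phi> t"
  have "indicator {a..b} \<in> borel_measurable (lebesgue_on S)"
    by (rule measurable_restrict_space1) (rule borel_measurable_indicator, simp)
  then have m: "?\<psi> \<in> borel_measurable (lebesgue_on S)"
    by (intro borel_measurable_scaleR borel_measurable_integrable[OF i])
  have ae: "AE t in lebesgue_on S. \<phi> t = ?\<psi> t"
    using z by eventually_elim (auto simp: indicator_def)
  have i': "integrable (lebesgue_on S) ?\<psi>"
    by (rule integrable_cong_AE_imp[OF i m]) (use ae in \<open>auto elim: eventually_mono\<close>)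
  have "(LINT t|lebesgue_on S. \<phi> t) = (LINT t|lebesgue_on S. ?\<psi> t)"
    by (rule integral_cong_AE[OF borel_measurable_integrable[OF i] m ae])
  also have "\<dots> = integral {a..b} ?\<psi>"
    by (rule integral_outside_zero[OF i' S ab]) (simp add: indicator_def)
  also have "\<dots> = integral {a..b} \<phi>" by (rule integral_cong) simp
  finally show ?thesis .
qed

section \<open>Solutions of the homogeneous equation and the energy of a rounded corner\<close>

context sl_coefficients
begin

text \<open>The equation in first-order form: position and momentum are each differentiable, and no
  second derivative of \<open>y\<close> is presupposed.\<close>

definition solution :: "(real \<Rightarrow> real^'d) \<Rightarrow> (real \<Rightarrow> real^'d) \<Rightarrow> bool" where
  "solution y y1 \<longleftrightarrow> (\<forall>t\<in>S. (y has_vector_derivative y1 t) (at t within S)) \<and> continuous_on S y1 \<and>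
     (\<forall>t\<in>S. ((\<lambda>s. mom s (y s) (y1 s)) has_vector_derivative force t (y t) (y1 t)) (at t within S))"

text \<open>The linear Hamiltonian vector field in position and momentum; \<open>b\<close> is the
  velocity recovered from the momentum. It involves no derivative of the coefficients and is
  therefore continuous in \<open>t\<close>.\<close>

definition ham :: "real \<Rightarrow> (real^'d) \<times> (real^'d) \<Rightarrow> (real^'d) \<times> (real^'d)" where
  "ham t = (\<lambda>(y, p). let b = matrix_inv (P t) *v (p - Q t *v y) in (b, force t y b))"

lemma bounded_linear_ham: "bounded_linear (ham t)"
proof -
  have "linear (ham t)"
    by (rule linearI)
      (auto simp: ham_def Let_def force_def matrix_vector_right_distrib matrix_vector_mult_scaleR
        matrix_vector_mult_diff_distrib scaleR_vector_matrix_assoc algebra_simps)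
  then show ?thesis by (rule linear_conv_bounded_linear[THEN iffD1])
qed

lemma matrix_inv_P_cont: "continuous_on S (\<lambda>t. matrix_inv (P t))"
  unfolding continuous_on_def
proof
  fix t assume t: "t \<in> S"
  show "((\<lambda>t. matrix_inv (P t)) \<longlongrightarrow> matrix_inv (P t)) (at t within S)"
    using P_cont t P_invertible
    by (intro tendsto_matrix_inv) (auto simp: continuous_on_def eventually_at_filter)
qed

lemma ham_cont: "continuous_on S (\<lambda>t. Blinfun (ham t))"
proof (rule continuous_on_blinfun_componentwise)
  fix i :: "(real^'d) \<times> (real^'d)"
  have "continuous_on S (\<lambda>t. ham t (fst i, snd i))"
    unfolding ham_def force_def Let_def prod.case
    by (intro continuous_intros cont_mv continuous_on_transpose matrix_inv_P_cont P_cont Q_cont R_cont)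
  then show "continuous_on S (\<lambda>t. blinfun_apply (Blinfun (ham t)) i)"
    by (simp add: bounded_linear_Blinfun_apply[OF bounded_linear_ham])
qed

lemma solution_ham:
  assumes s: "solution y y1" and t: "t \<in> S"
  shows "((\<lambda>t. (y t, mom t (y t) (y1 t))) has_vector_derivative
    blinfun_apply (Blinfun (ham t)) (y t, mom t (y t) (y1 t))) (at t within S)"
proof -
  have "matrix_inv (P t) *v (P t *v y1 t) = y1 t"
    using matrix_inv_mult(2)[OF P_invertible[OF t]] by (simp add: matrix_vector_mul_assoc)
  then have "ham t (y t, mom t (y t) (y1 t)) = (y1 t, force t (y t) (y1 t))"
    by (simp add: ham_def mom_def Let_def)
  then show ?thesis
    using s t unfolding solution_def
    by (simp add: bounded_linear_Blinfun_apply[OF bounded_linear_ham] has_vector_derivative_Pair)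
qed

lemma solution_unique:
  assumes s: "solution y y1" and t: "t \<in> S" and z: "s \<in> S" "y s = 0" "y1 s = 0"
  shows "y t = 0" "y1 t = 0"
proof -
  have "mom s (y s) (y1 s) = 0" using z(2,3) by simp
  then have z0: "(\<lambda>t. (y t, mom t (y t) (y1 t))) s = 0" using z(2) by (simp add: prod_eq_iff)
  have "(y t, mom t (y t) (y1 t)) = 0"
    by (rule linear_ode_unique[OF interval ham_cont solution_ham[OF s] z(1) z0 t])
  then have "y t = 0" "P t *v y1 t = 0" by (auto simp: mom_def zero_prod_def)
  then show "y t = 0" "y1 t = 0" using P_inj[OF t] by auto
qed

lemma solution_green:
  assumes s: "solution y y1" and u: "\<And>t. t \<in> T \<Longrightarrow> (u has_vector_derivative u1 t) (at t within T)"
    and T: "T \<subseteq> S" and t: "t \<in> T"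
  shows "((\<lambda>t. mom t (y t) (y1 t) \<bullet> u t) has_vector_derivative energy t (y t) (y1 t) (u t) (u1 t)) (at t within T)"
proof -
  have "((\<lambda>s. mom s (y s) (y1 s)) has_vector_derivative force t (y t) (y1 t)) (at t within T)"
    using s T t unfolding solution_def by (blast intro: has_vector_derivative_within_subset)
  from bounded_bilinear.has_vector_derivative[OF bounded_bilinear_inner this u[OF t]]
  show ?thesis by (simp add: energy_def)
qed

text \<open>Regularity of weak solutions: the momentum is absolutely continuous, and its derivative
  agrees almost everywhere with the continuous function \<open>force\<close>, so the momentum is
  continuously differentiable.\<close>

lemma jet_kernel_solution:
  assumes j: "jet S y y1 y2" and ae: "AE t in lebesgue_on S. ell t (y t) (y1 t) (y2 t) = 0"
  shows "solution y y1"
proof -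
  note c = jet_derivs[OF interval j]
  have "primitive_on S (\<lambda>t. mom t (y t) (y1 t)) (\<lambda>t. force t (y t) (y1 t))"
    by (rule primitive_on_AE_cong[OF mom_primitive[OF jetD(4,5)[OF j]] _ interval S_sets])
      (use ae in \<open>auto elim: eventually_mono\<close>)
  moreover have "continuous_on S (\<lambda>t. force t (y t) (y1 t))"
    unfolding force_def by (intro continuous_intros cont_mv continuous_on_transpose Q_cont R_cont c)
  ultimately have "((\<lambda>t. mom t (y t) (y1 t)) has_vector_derivative force t (y t) (y1 t)) (at t within S)" if "t \<in> S" for t
    using primitive_on_has_derivative[OF interval _ _ that] by blast
  then show ?thesis unfolding solution_def using c by blast
qed

lemma sub_coefficients:
  assumes "is_interval T" "closed T" "T \<subseteq> S" "a \<in> T" "b \<in> T" "a < b"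
  shows "sl_coefficients T P Q R P1 Q1"
  using assms P1_cont Q1_cont R_cont P_sym R_sym P_pos
  by unfold_locales
    (blast intro: continuous_on_subset has_vector_derivative_within_subset[OF P_deriv]
      has_vector_derivative_within_subset[OF Q_deriv])+

lemma mv_bound:
  assumes A: "continuous_on {a..b} (A :: real \<Rightarrow> real^'d^'d)"
  obtains K where "K \<ge> 0" "\<And>t v. t \<in> {a..b} \<Longrightarrow> \<bar>(A t *v v) \<bullet> v\<bar> \<le> K * (norm v)\<^sup>2"
proof -
  obtain C where C: "C > 0" "\<And>(A::real^'d^'d) x. norm (A *v x) \<le> norm A * norm x * C"
    using bounded_bilinear.pos_bounded[OF bounded_bilinear_matrix_vector_mult] by blast
  have "bounded (A ` {a..b})" by (intro compact_imp_bounded compact_continuous_image A compact_Icc)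
  then obtain B where B: "B > 0" "\<forall>M\<in>A ` {a..b}. norm M \<le> B" using bounded_pos by blast
  have "\<bar>(A t *v v) \<bullet> v\<bar> \<le> B * C * (norm v)\<^sup>2" if "t \<in> {a..b}" for t v
  proof -
    have "\<bar>(A t *v v) \<bullet> v\<bar> \<le> norm (A t *v v) * norm v" by (rule Cauchy_Schwarz_ineq2)
    also have "\<dots> \<le> (norm (A t) * norm v * C) * norm v" by (intro mult_right_mono C(2)) simp
    also have "\<dots> \<le> (B * norm v * C) * norm v"
      using B(2) that C(1) by (intro mult_right_mono) auto
    finally show ?thesis by (simp add: power2_eq_square mult_ac)
  qed
  then show ?thesis using that[of "B * C"] B(1) C(1) by simp
qed

lemma P_coercive:
  assumes t: "t \<in> S"
  obtains c where "c > 0" "\<And>v. c * (norm v)\<^sup>2 \<le> (P t *v v) \<bullet> v"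
proof -
  let ?q = "\<lambda>v. (P t *v v) \<bullet> v"
  have ne: "sphere (0::real^'d) 1 \<noteq> {}" by simp
  have "continuous_on (sphere 0 1) ?q"
    by (intro continuous_intros matrix_vector_mult_linear_continuous_on)
  then obtain v0 where v0: "v0 \<in> sphere 0 1" "\<And>v. v \<in> sphere 0 1 \<Longrightarrow> ?q v0 \<le> ?q v"
    using continuous_attains_inf[OF compact_sphere ne] by blast
  have "v0 \<noteq> 0" using v0(1) by auto
  then have pos: "?q v0 > 0" using P_pos[OF t] by (simp add: inner_commute)
  have "?q v0 * (norm v)\<^sup>2 \<le> ?q v" for v
  proof (cases "v = 0")
    case False
    then have "?q v0 \<le> ?q (v /\<^sub>R norm v)" by (intro v0(2)) simp
    also have "\<dots> = ?q v / (norm v)\<^sup>2"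
      by (simp add: matrix_vector_mult_scaleR power2_eq_square divide_inverse)
    finally show ?thesis using False by (simp add: field_simps)
  qed simp
  then show ?thesis using that pos by blast
qed

lemma energy_scaled:
  "energy t (a *\<^sub>R v) (b *\<^sub>R v) (a *\<^sub>R v) (b *\<^sub>R v) =
    b\<^sup>2 * ((P t *v v) \<bullet> v) + 2 * a * b * ((Q t *v v) \<bullet> v) + a\<^sup>2 * ((R t *v v) \<bullet> v)"
  unfolding energy_eq by (simp add: matrix_vector_mult_scaleR power2_eq_square inner_commute algebra_simps)

text \<open>The energy of the profile that rounds off a corner. The profile is linear-quadratic with
  slope at most 1/2, so its energy (about \<open>\<delta>/6\<close> in units of \<open>P v \<bullet> v\<close>) does not
  compensate the gain \<open>\<delta>/2\<close> from cutting the corner.\<close>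

lemma corner_energy_bound:
  assumes \<sigma>: "\<sigma> \<in> interior S"
  obtains \<delta>0 where "\<delta>0 > 0" "{\<sigma> - \<delta>0..\<sigma> + \<delta>0} \<subseteq> S"
    "\<And>\<delta> v a b a' b'. 0 < \<delta> \<Longrightarrow> \<delta> < \<delta>0 \<Longrightarrow> v \<noteq> 0 \<Longrightarrow>
      a = (\<lambda>t. - ((t - (\<sigma> - \<delta>))\<^sup>2 / (4 * \<delta>))) \<Longrightarrow> b = (\<lambda>t. - ((t - (\<sigma> - \<delta>)) / (2 * \<delta>))) \<Longrightarrow>
      a' = (\<lambda>t. - (((\<sigma> + \<delta>) - t)\<^sup>2 / (4 * \<delta>))) \<Longrightarrow> b' = (\<lambda>t. ((\<sigma> + \<delta>) - t) / (2 * \<delta>)) \<Longrightarrow>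
      - (\<delta> / 2) * ((P \<sigma> *v v) \<bullet> v)
      + integral {\<sigma> - \<delta>..\<sigma>} (\<lambda>t. energy t (a t *\<^sub>R v) (b t *\<^sub>R v) (a t *\<^sub>R v) (b t *\<^sub>R v))
      + integral {\<sigma>..\<sigma> + \<delta>} (\<lambda>t. energy t (a' t *\<^sub>R v) (b' t *\<^sub>R v) (a' t *\<^sub>R v) (b' t *\<^sub>R v)) < 0"
proof -
  obtain r where r: "r > 0" "cball \<sigma> r \<subseteq> S" using \<sigma> by (meson mem_interior_cball)
  then have sub: "{\<sigma> - r..\<sigma> + r} \<subseteq> S" by (simp add: cball_eq_atLeastAtMost)
  have \<sigma>S: "\<sigma> \<in> S" using \<sigma> interior_subset by blast
  obtain c where c: "c > 0" "\<And>v. c * (norm v)\<^sup>2 \<le> (P \<sigma> *v v) \<bullet> v" using P_coercive[OF \<sigma>S] by blast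
  obtain K1 where K1: "K1 \<ge> 0" "\<And>t v. t \<in> {\<sigma> - r..\<sigma> + r} \<Longrightarrow> \<bar>(Q t *v v) \<bullet> v\<bar> \<le> K1 * (norm v)\<^sup>2"
    using mv_bound[OF continuous_on_subset[OF Q_cont sub]] by blast
  obtain K2 where K2: "K2 \<ge> 0" "\<And>t v. t \<in> {\<sigma> - r..\<sigma> + r} \<Longrightarrow> \<bar>(R t *v v) \<bullet> v\<bar> \<le> K2 * (norm v)\<^sup>2"
    using mv_bound[OF continuous_on_subset[OF R_cont sub]] by blast
  obtain C where C: "C > 0" "\<And>(A::real^'d^'d) x. norm (A *v x) \<le> norm A * norm x * C"
    using bounded_bilinear.pos_bounded[OF bounded_bilinear_matrix_vector_mult] by blast
  \<comment> \<open>With this closeness of \<open>P t\<close> to \<open>P \<sigma>\<close> the value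
    of \<open>P t *v v \<bullet> v\<close> exceeds that at \<open>\<sigma>\<close> by at most a
    quarter, which is the origin of the factor 5/4 below.\<close>
  have cC: "c / (4 * C) > 0" using c(1) C(1) by simp
  obtain d where d: "d > 0" "\<And>t. t \<in> S \<Longrightarrow> dist t \<sigma> < d \<Longrightarrow> dist (P t) (P \<sigma>) < c / (4 * C)"
    using P_cont[unfolded continuous_on_iff, rule_format, OF \<sigma>S cC] by blast
  define K where "K = K1 + K2"
  \<comment> \<open>\<open>r\<close> keeps the interval in \<open>S\<close>, \<open>d\<close> keeps
    \<open>P\<close> close to \<open>P \<sigma>\<close>, 1 allows replacing
    \<open>\<delta>\<^sup>2\<close> by \<open>\<delta>\<close>, and the last entry makes the
    contribution of \<open>Q\<close> and \<open>R\<close> smaller than one eighth of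
    \<open>P \<sigma> *v v \<bullet> v\<close>.\<close>
  define \<delta>0 where "\<delta>0 = Min {r, d, 1, c / (8 * (K + 1))}"
  have K0: "K \<ge> 0" using K1 K2 by (simp add: K_def)
  have \<delta>0: "\<delta>0 > 0" "\<delta>0 \<le> r" "\<delta>0 \<le> d" "\<delta>0 \<le> 1" "\<delta>0 \<le> c / (8 * (K + 1))"
    using r(1) d(1) c(1) K0 by (auto simp: \<delta>0_def)
  show ?thesis
  proof (rule that[OF \<delta>0(1)])
    have "{\<sigma> - \<delta>0..\<sigma> + \<delta>0} \<subseteq> {\<sigma> - r..\<sigma> + r}" using \<delta>0(2) by auto
    then show "{\<sigma> - \<delta>0..\<sigma> + \<delta>0} \<subseteq> S" using sub by blast
  next
    fix \<delta> :: real and v :: "real^'d" and a b a' b' :: "real \<Rightarrow> real"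
    assume \<delta>: "0 < \<delta>" "\<delta> < \<delta>0" and v: "v \<noteq> 0"
      and ab: "a = (\<lambda>t. - ((t - (\<sigma> - \<delta>))\<^sup>2 / (4 * \<delta>)))" "b = (\<lambda>t. - ((t - (\<sigma> - \<delta>)) / (2 * \<delta>)))"
      and ab': "a' = (\<lambda>t. - (((\<sigma> + \<delta>) - t)\<^sup>2 / (4 * \<delta>)))" "b' = (\<lambda>t. ((\<sigma> + \<delta>) - t) / (2 * \<delta>))"
    define p where "p = (P \<sigma> *v v) \<bullet> v"
    define n where "n = (norm v)\<^sup>2"
    have n: "n > 0" using v by (simp add: n_def)
    have cp: "c * n \<le> p" using c(2) by (simp add: p_def n_def)
    have pt: "energy t (x *\<^sub>R v) (y *\<^sub>R v) (x *\<^sub>R v) (y *\<^sub>R v) \<le> y\<^sup>2 * (5/4 * p) + \<delta> * K * n"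
      if t: "\<bar>t - \<sigma>\<bar> \<le> \<delta>" and xy: "\<bar>x\<bar> \<le> \<delta> / 4" "\<bar>y\<bar> \<le> 1/2" for t x y
    proof -
      have tr: "t \<in> {\<sigma> - r..\<sigma> + r}" using t \<delta> \<delta>0(2) by auto
      have tS: "t \<in> S" using tr sub by blast
      have "norm (P t - P \<sigma>) \<le> c / (4 * C)"
        using d(2)[OF tS] t \<delta> \<delta>0(3) by (force simp: dist_real_def dist_norm)
      then have "norm (P t - P \<sigma>) * norm v * C \<le> c / (4 * C) * norm v * C"
        using C(1) by (intro mult_right_mono) auto
      then have "norm ((P t - P \<sigma>) *v v) \<le> c / 4 * norm v"
        using C(1) C(2)[of "P t - P \<sigma>" v] by simp
      then have "norm ((P t - P \<sigma>) *v v) * norm v \<le> c / 4 * norm v * norm v" by (intro mult_right_mono) auto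
      then have "\<bar>((P t - P \<sigma>) *v v) \<bullet> v\<bar> \<le> c / 4 * norm v * norm v"
        using Cauchy_Schwarz_ineq2[of "(P t - P \<sigma>) *v v" v] by linarith
      moreover have "c / 4 * norm v * norm v = c / 4 * n" by (simp add: n_def power2_eq_square)
      moreover have "((P t - P \<sigma>) *v v) \<bullet> v = (P t *v v) \<bullet> v - p"
        by (simp add: p_def matrix_vector_mult_diff_rdistrib inner_diff_left)
      ultimately have "(P t *v v) \<bullet> v - p \<le> c / 4 * n" by linarith
      then have P1: "(P t *v v) \<bullet> v \<le> 5/4 * p" using cp by simp
      have "2 * x * y * ((Q t *v v) \<bullet> v) \<le> \<bar>2 * x * y\<bar> * \<bar>(Q t *v v) \<bullet> v\<bar>"
        by (metis abs_ge_self abs_mult)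
      also have "\<dots> \<le> \<delta> * (K1 * n)"
      proof (rule mult_mono)
        have "\<bar>x\<bar> * \<bar>y\<bar> \<le> \<delta> / 4 * (1/2)" using xy \<delta> by (intro mult_mono) auto
        then show "\<bar>2 * x * y\<bar> \<le> \<delta>" using \<delta> by (simp add: abs_mult)
        show "\<bar>(Q t *v v) \<bullet> v\<bar> \<le> K1 * n" using K1(2)[OF tr] by (simp add: n_def)
      qed (use \<delta> in auto)
      finally have Q1: "2 * x * y * ((Q t *v v) \<bullet> v) \<le> \<delta> * (K1 * n)" .
      have "x\<^sup>2 * ((R t *v v) \<bullet> v) \<le> x\<^sup>2 * \<bar>(R t *v v) \<bullet> v\<bar>" by (intro mult_left_mono) auto
      also have "\<dots> \<le> \<delta> * (K2 * n)"
      proof (rule mult_mono)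
        have "\<bar>x\<bar>\<^sup>2 \<le> (\<delta>/4)\<^sup>2" using xy by (intro power_mono) auto
        also have "\<dots> \<le> \<delta> * 1" using \<delta> \<delta>0(4) by (simp add: power2_eq_square)
        finally show "x\<^sup>2 \<le> \<delta>" by simp
        show "\<bar>(R t *v v) \<bullet> v\<bar> \<le> K2 * n" using K2(2)[OF tr] by (simp add: n_def)
      qed (use \<delta> in auto)
      finally have R1: "x\<^sup>2 * ((R t *v v) \<bullet> v) \<le> \<delta> * (K2 * n)" .
      have "y\<^sup>2 * ((P t *v v) \<bullet> v) \<le> y\<^sup>2 * (5/4 * p)" by (intro mult_left_mono P1) simp
      then show ?thesis unfolding energy_scaled using Q1 R1 by (simp add: K_def algebra_simps)
    qed
    \<comment> \<open>The squared slope integrates to \<open>\<delta> / 12\<close> on each side;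
      multiplied by 5/4 this gives 5/48.\<close>
    have half: "integral {l..u} (\<lambda>t. energy t (x t *\<^sub>R v) (y t *\<^sub>R v) (x t *\<^sub>R v) (y t *\<^sub>R v)) \<le> \<delta> * (5/48 * p + \<delta> * K * n)"
      if lu: "u = l + \<delta>" "{l..u} \<subseteq> {\<sigma> - \<delta>..\<sigma> + \<delta>}"
        and xc: "continuous_on {l..u} x" "continuous_on {l..u} y"
        and xb: "\<And>t. t \<in> {l..u} \<Longrightarrow> \<bar>x t\<bar> \<le> \<delta> / 4" "\<And>t. t \<in> {l..u} \<Longrightarrow> \<bar>y t\<bar> \<le> 1 / 2"
        and yi: "((\<lambda>t. (y t)\<^sup>2) has_integral \<delta> / 12) {l..u}" for l u x y
    proof -
      have "{\<sigma> - \<delta>..\<sigma> + \<delta>} \<subseteq> {\<sigma> - r..\<sigma> + r}" using \<delta> \<delta>0(2) by auto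
      then have luS: "{l..u} \<subseteq> S" using lu(2) sub by blast
      have i1: "((\<lambda>t. (y t)\<^sup>2 * (5/4 * p) + \<delta> * K * n) has_integral \<delta> / 12 * (5/4 * p) + (u - l) *\<^sub>R (\<delta> * K * n)) {l..u}"
        using has_integral_const_real[of "\<delta> * K * n" l u] lu(1) \<delta>
        by (intro has_integral_add has_integral_mult_left yi) simp
      have i2: "(\<lambda>t. energy t (x t *\<^sub>R v) (y t *\<^sub>R v) (x t *\<^sub>R v) (y t *\<^sub>R v)) integrable_on {l..u}"
        by (intro integrable_continuous_real energy_cont continuous_intros xc luS)
      have "integral {l..u} (\<lambda>t. energy t (x t *\<^sub>R v) (y t *\<^sub>R v) (x t *\<^sub>R v) (y t *\<^sub>R v))
          \<le> \<delta> / 12 * (5/4 * p) + (u - l) *\<^sub>R (\<delta> * K * n)"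
      proof (rule has_integral_le[OF integrable_integral[OF i2] i1])
        fix t assume "t \<in> {l..u}"
        then show "energy t (x t *\<^sub>R v) (y t *\<^sub>R v) (x t *\<^sub>R v) (y t *\<^sub>R v) \<le> (y t)\<^sup>2 * (5/4 * p) + \<delta> * K * n"
          using lu(2) xb by (intro pt) force+
      qed
      also have "\<dots> = \<delta> * (5/48 * p + \<delta> * K * n)" using lu(1) by (simp add: algebra_simps)
      finally show ?thesis .
    qed
    have h1: "integral {\<sigma> - \<delta>..\<sigma>} (\<lambda>t. energy t (a t *\<^sub>R v) (b t *\<^sub>R v) (a t *\<^sub>R v) (b t *\<^sub>R v)) \<le> \<delta> * (5/48 * p + \<delta> * K * n)"
    proof (rule half)
      show "((\<lambda>t. (b t)\<^sup>2) has_integral \<delta> / 12) {\<sigma> - \<delta>..\<sigma>}"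
      proof -
        have "((\<lambda>t. (b t)\<^sup>2) has_integral (\<sigma> - (\<sigma> - \<delta>))^3 / (12 * \<delta>\<^sup>2) - ((\<sigma> - \<delta>) - (\<sigma> - \<delta>))^3 / (12 * \<delta>\<^sup>2)) {\<sigma> - \<delta>..\<sigma>}"
          unfolding ab(2)
          by (rule fundamental_theorem_of_calculus)
            (use \<delta> in \<open>auto intro!: derivative_eq_intros simp: has_real_derivative_iff_has_vector_derivative[symmetric] power2_eq_square field_simps\<close>)
        then show ?thesis using \<delta> by (simp add: power3_eq_cube power2_eq_square)
      qed
      show "\<bar>a t\<bar> \<le> \<delta> / 4" "\<bar>b t\<bar> \<le> 1 / 2" if "t \<in> {\<sigma> - \<delta>..\<sigma>}" for t
      proof -
        have w: "0 \<le> t - (\<sigma> - \<delta>)" "t - (\<sigma> - \<delta>) \<le> \<delta>" using that by auto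
        have "(t - (\<sigma> - \<delta>))\<^sup>2 \<le> \<delta>\<^sup>2" using w by (intro power_mono) auto
        then show "\<bar>a t\<bar> \<le> \<delta> / 4" using \<delta> by (simp add: ab(1) power2_eq_square divide_simps)
        show "\<bar>b t\<bar> \<le> 1 / 2" using w \<delta> by (simp add: ab(2) divide_simps)
      qed
    qed (use \<delta> in \<open>auto simp: ab intro!: continuous_intros\<close>)
    have h2: "integral {\<sigma>..\<sigma> + \<delta>} (\<lambda>t. energy t (a' t *\<^sub>R v) (b' t *\<^sub>R v) (a' t *\<^sub>R v) (b' t *\<^sub>R v)) \<le> \<delta> * (5/48 * p + \<delta> * K * n)"
    proof (rule half)
      show "((\<lambda>t. (b' t)\<^sup>2) has_integral \<delta> / 12) {\<sigma>..\<sigma> + \<delta>}"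
      proof -
        have "((\<lambda>t. (b' t)\<^sup>2) has_integral (- ((((\<sigma> + \<delta>) - (\<sigma> + \<delta>))^3) / (12 * \<delta>\<^sup>2))) - (- ((((\<sigma> + \<delta>) - \<sigma>)^3) / (12 * \<delta>\<^sup>2)))) {\<sigma>..\<sigma> + \<delta>}"
          unfolding ab'(2)
          by (rule fundamental_theorem_of_calculus)
            (use \<delta> in \<open>auto intro!: derivative_eq_intros simp: has_real_derivative_iff_has_vector_derivative[symmetric] power2_eq_square field_simps\<close>)
        then show ?thesis using \<delta> by (simp add: power3_eq_cube power2_eq_square)
      qed
      show "\<bar>a' t\<bar> \<le> \<delta> / 4" "\<bar>b' t\<bar> \<le> 1 / 2" if "t \<in> {\<sigma>..\<sigma> + \<delta>}" for t
      proof -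
        have w: "0 \<le> (\<sigma> + \<delta>) - t" "(\<sigma> + \<delta>) - t \<le> \<delta>" using that by auto
        have "((\<sigma> + \<delta>) - t)\<^sup>2 \<le> \<delta>\<^sup>2" using w by (intro power_mono) auto
        then show "\<bar>a' t\<bar> \<le> \<delta> / 4" using \<delta> by (simp add: ab'(1) power2_eq_square divide_simps)
        show "\<bar>b' t\<bar> \<le> 1 / 2" using w \<delta> by (simp add: ab'(2) divide_simps)
      qed
    qed (use \<delta> in \<open>auto simp: ab' intro!: continuous_intros\<close>)
    have "\<delta> * (K + 1) < \<delta>0 * (K + 1)" using \<delta>(2) K0 by (intro mult_strict_right_mono) auto
    moreover have "\<delta>0 * (K + 1) \<le> c / 8" using \<delta>0(5) K0 by (simp add: pos_le_divide_eq field_simps)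
    ultimately have "\<delta> * (K + 1) < c / 8" by linarith
    then have "\<delta> * K < c / 8" using \<delta> by (simp add: algebra_simps)
    then have "\<delta> * K * n < c / 8 * n" using n by (rule mult_strict_right_mono)
    then have "\<delta> * K * n < p / 8" using cp by simp
    \<comment> \<open>The two halves cost less than \<open>p\<close> times 5/24 + 1/4 = 11/24, which
      is below the gain 1/2.\<close>
    then have "5/48 * p + \<delta> * K * n + (5/48 * p + \<delta> * K * n) - p / 2 < 0"
      using cp mult_pos_pos[OF c(1) n] by linarith
    then have "\<delta> * (5/48 * p + \<delta> * K * n + (5/48 * p + \<delta> * K * n) - p / 2) < 0"
      using \<delta>(1) by (simp add: mult_pos_neg)
    then show "- (\<delta> / 2) * ((P \<sigma> *v v) \<bullet> v)
      + integral {\<sigma> - \<delta>..\<sigma>} (\<lambda>t. energy t (a t *\<^sub>R v) (b t *\<^sub>R v) (a t *\<^sub>R v) (b t *\<^sub>R v))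
      + integral {\<sigma>..\<sigma> + \<delta>} (\<lambda>t. energy t (a' t *\<^sub>R v) (b' t *\<^sub>R v) (a' t *\<^sub>R v) (b' t *\<^sub>R v)) < 0"
      using h1 h2 by (simp add: p_def[symmetric] algebra_simps)
  qed
qed

end

section \<open>Negative directions from broken solutions\<close>

text \<open>Half the square of the positive part of \<open>t - c\<close>, with its two derivatives:
  the building block both for rounding corners and, in \<open>end_jet\<close>, for prescribing
  boundary data.\<close>

definition hump0 :: "real \<Rightarrow> real \<Rightarrow> real" where "hump0 c t = (if t \<le> c then 0 else (t - c)\<^sup>2 / 2)"
definition hump1 :: "real \<Rightarrow> real \<Rightarrow> real" where "hump1 c t = (if t \<le> c then 0 else t - c)"
definition hump2 :: "real \<Rightarrow> real \<Rightarrow> real" where "hump2 c t = (if t \<le> c then 0 else 1)"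

lemma hump_primitives: "primitive_on UNIV (hump0 c) (hump1 c)" "primitive_on UNIV (hump1 c) (hump2 c)"
proof -
  have 0: "primitive_on T (\<lambda>t. 0::real) (\<lambda>t. 0)" for T by simp
  have 1: "primitive_on UNIV (\<lambda>t. t - c) (\<lambda>t. 1)"
    by (rule primitive_onI_C1) (auto intro!: derivative_eq_intros)
  have "((\<lambda>t. (t - c)\<^sup>2 / 2) has_real_derivative t - c) (at t)" for t
    by (auto intro!: derivative_eq_intros)
  then have 2: "primitive_on UNIV (\<lambda>t. (t - c)\<^sup>2 / 2) (\<lambda>t. t - c)"
    by (intro primitive_onI_C1) (auto simp: has_real_derivative_iff_has_vector_derivative intro!: continuous_intros)
  have "primitive_on UNIV (\<lambda>t. if t \<le> c then 0 else (t - c)\<^sup>2 / 2) (\<lambda>t. if t \<le> c then 0 else t - c)"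
    by (rule primitive_on_glue) (use 0 primitive_on_subset[OF 2] in auto)
  moreover have "primitive_on UNIV (\<lambda>t. if t \<le> c then 0 else t - c) (\<lambda>t. if t \<le> c then 0 else 1)"
    by (rule primitive_on_glue) (use 0 primitive_on_subset[OF 1] in auto)
  ultimately show "primitive_on UNIV (hump0 c) (hump1 c)" "primitive_on UNIV (hump1 c) (hump2 c)"
    by (simp_all add: hump0_def[abs_def] hump1_def[abs_def] hump2_def[abs_def])
qed

lemma primitive_on_reflect:
  assumes "primitive_on UNIV f g"
  shows "primitive_on UNIV (\<lambda>t. f (- t)) (\<lambda>t. - g (- t))"
  unfolding primitive_on_def
proof (intro ballI impI conjI)
  fix s t :: real assume st: "s \<le> t"
  have le: "- t \<le> - s" using st by simp
  note p = primitive_onD(1,2)[OF assms UNIV_I UNIV_I le]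
  have "((\<lambda>x. g (- x)) has_integral f (- s) - f (- t)) {s..t}"
    using p(2) has_integral_reflect_real[where f=g and a="-t" and b="-s" and i="f (- s) - f (- t)"] by simp
  from has_integral_neg[OF this] show "((\<lambda>x. - g (- x)) has_integral f (- t) - f (- s)) {s..t}" by simp
  have "(\<lambda>x. g (- x)) absolutely_integrable_on {s..t}"
    using p(1) absolutely_integrable_reflect_real[where f=g and a="-t" and b="-s"] by simp
  then have "(\<lambda>x. (-1) *\<^sub>R g (- x)) absolutely_integrable_on {s..t}"
    by (rule absolutely_integrable_scaleR_left)
  then show "(\<lambda>x. - g (- x)) absolutely_integrable_on {s..t}" by simp
qed

lemma hump_measurable: "hump2 c \<in> borel_measurable borel"
  unfolding hump2_def[abs_def] by measurable

lemma hump_bounds: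
  assumes "t \<le> c + \<delta>" "0 < \<delta>"
  shows "0 \<le> hump0 c t" "hump0 c t \<le> \<delta>\<^sup>2" "0 \<le> hump1 c t" "hump1 c t \<le> \<delta>" "0 \<le> hump2 c t" "hump2 c t \<le> 1"
proof -
  show "0 \<le> hump0 c t" "0 \<le> hump1 c t" "hump1 c t \<le> \<delta>" "0 \<le> hump2 c t" "hump2 c t \<le> 1"
    using assms by (auto simp: hump0_def hump1_def hump2_def)
  show "hump0 c t \<le> \<delta>\<^sup>2"
  proof (cases "t \<le> c")
    case False
    then have "(t - c)\<^sup>2 \<le> \<delta>\<^sup>2" using assms by (intro power_mono) auto
    then have "(t - c)\<^sup>2 / 2 \<le> \<delta>\<^sup>2" using zero_le_power2[of \<delta>] by linarith
    then show ?thesis using False by (simp only: hump0_def if_False)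
  qed (simp add: hump0_def)
qed

lemma hump_jet_left:
  fixes v :: "'a::euclidean_space"
  assumes T: "is_interval T" "closed T" and b: "\<And>t. t \<in> T \<Longrightarrow> t \<le> c + \<delta>" and \<delta>: "0 < \<delta>"
  shows "jet T (\<lambda>t. if t \<in> T then hump0 c t *\<^sub>R v else 0) (\<lambda>t. if t \<in> T then hump1 c t *\<^sub>R v else 0)
    (\<lambda>t. if t \<in> T then hump2 c t *\<^sub>R v else 0)"
proof (rule jetI[OF T, where B="(\<delta>\<^sup>2 + \<delta> + 1) * norm v" and r="\<bar>c\<bar> + \<delta>"])
  have vl: "bounded_linear (\<lambda>x. x *\<^sub>R v)" by (rule bounded_linear_scaleR_left)
  show "primitive_on T (\<lambda>t. hump0 c t *\<^sub>R v) (\<lambda>t. hump1 c t *\<^sub>R v)" "primitive_on T (\<lambda>t. hump1 c t *\<^sub>R v) (\<lambda>t. hump2 c t *\<^sub>R v)"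
    using primitive_on_linear[OF primitive_on_subset[OF hump_primitives(1)] vl] primitive_on_linear[OF primitive_on_subset[OF hump_primitives(2)] vl] by auto
  have "hump2 c \<in> borel_measurable lebesgue" using hump_measurable by (simp add: measurable_completion)
  then show "(\<lambda>t. hump2 c t *\<^sub>R v) \<in> borel_measurable (lebesgue_on T)"
    by (intro borel_measurable_scaleR measurable_restrict_space1) auto
  show "norm (hump0 c t *\<^sub>R v) \<le> (\<delta>\<^sup>2 + \<delta> + 1) * norm v" "norm (hump1 c t *\<^sub>R v) \<le> (\<delta>\<^sup>2 + \<delta> + 1) * norm v"
    "norm (hump2 c t *\<^sub>R v) \<le> (\<delta>\<^sup>2 + \<delta> + 1) * norm v" if "t \<in> T" for t
    using hump_bounds[OF b[OF that] \<delta>] \<delta> zero_le_power2[of \<delta>] by (auto intro!: mult_right_mono)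
  show "hump0 c t *\<^sub>R v = 0 \<and> hump1 c t *\<^sub>R v = 0 \<and> hump2 c t *\<^sub>R v = 0" if "t \<in> T" "\<bar>c\<bar> + \<delta> < \<bar>t\<bar>" for t
  proof -
    have "t \<le> c" using b[OF that(1)] that(2) by linarith
    then show ?thesis by (simp add: hump0_def hump1_def hump2_def)
  qed
qed

lemma hump_jet_right:
  fixes v :: "'a::euclidean_space"
  assumes T: "is_interval T" "closed T" and b: "\<And>t. t \<in> T \<Longrightarrow> c - \<delta> \<le> t" and \<delta>: "0 < \<delta>"
  shows "jet T (\<lambda>t. if t \<in> T then hump0 (- c) (- t) *\<^sub>R v else 0) (\<lambda>t. if t \<in> T then - hump1 (- c) (- t) *\<^sub>R v else 0)
    (\<lambda>t. if t \<in> T then hump2 (- c) (- t) *\<^sub>R v else 0)"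
proof (rule jetI[OF T, where B="(\<delta>\<^sup>2 + \<delta> + 1) * norm v" and r="\<bar>c\<bar> + \<delta>"])
  have vl: "bounded_linear (\<lambda>x. x *\<^sub>R v)" "bounded_linear (\<lambda>x. - x *\<^sub>R v)"
    using bounded_linear_scaleR_left bounded_linear_minus[OF bounded_linear_scaleR_left] by auto
  show "primitive_on T (\<lambda>t. hump0 (- c) (- t) *\<^sub>R v) (\<lambda>t. - hump1 (- c) (- t) *\<^sub>R v)"
    using primitive_on_linear[OF primitive_on_subset[OF primitive_on_reflect[OF hump_primitives(1)]] vl(1)] by auto
  show "primitive_on T (\<lambda>t. - hump1 (- c) (- t) *\<^sub>R v) (\<lambda>t. hump2 (- c) (- t) *\<^sub>R v)"
    using primitive_on_linear[OF primitive_on_subset[OF primitive_on_reflect[OF hump_primitives(2)]] vl(2), of T "- c"] by auto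
  have "(\<lambda>t. hump2 (- c) (- t)) \<in> borel_measurable borel"
    by (rule measurable_compose[OF _ hump_measurable]) simp
  then have "(\<lambda>t. hump2 (- c) (- t)) \<in> borel_measurable lebesgue" by (simp add: measurable_completion)
  then show "(\<lambda>t. hump2 (- c) (- t) *\<^sub>R v) \<in> borel_measurable (lebesgue_on T)"
    by (intro borel_measurable_scaleR measurable_restrict_space1) auto
  show "norm (hump0 (- c) (- t) *\<^sub>R v) \<le> (\<delta>\<^sup>2 + \<delta> + 1) * norm v" "norm (- hump1 (- c) (- t) *\<^sub>R v) \<le> (\<delta>\<^sup>2 + \<delta> + 1) * norm v"
    "norm (hump2 (- c) (- t) *\<^sub>R v) \<le> (\<delta>\<^sup>2 + \<delta> + 1) * norm v" if "t \<in> T" for t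
  proof -
    have "- t \<le> - c + \<delta>" using b[OF that] by simp
    from hump_bounds[OF this \<delta>]
    show "norm (hump0 (- c) (- t) *\<^sub>R v) \<le> (\<delta>\<^sup>2 + \<delta> + 1) * norm v" "norm (- hump1 (- c) (- t) *\<^sub>R v) \<le> (\<delta>\<^sup>2 + \<delta> + 1) * norm v"
    "norm (hump2 (- c) (- t) *\<^sub>R v) \<le> (\<delta>\<^sup>2 + \<delta> + 1) * norm v"
      using \<delta> zero_le_power2[of \<delta>] by (auto intro!: mult_right_mono)
  qed
  show "hump0 (- c) (- t) *\<^sub>R v = 0 \<and> - hump1 (- c) (- t) *\<^sub>R v = 0 \<and> hump2 (- c) (- t) *\<^sub>R v = 0" if "t \<in> T" "\<bar>c\<bar> + \<delta> < \<bar>t\<bar>" for t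
  proof -
    have "c \<le> t" using b[OF that(1)] that(2) by linarith
    then show ?thesis by (simp add: hump0_def hump1_def hump2_def)
  qed
qed

section \<open>Broken solutions with rounded corners\<close>

context sl_operator
begin

text \<open>Needed because to the left of its corner a rounded broken solution satisfies
  \<open>ell = 0\<close> only almost everywhere.\<close>

lemma form_interval_AE:
  assumes f: "jet S f g h" and u: "jet S u v w" and ab: "\<alpha> \<in> S" "\<beta> \<in> S" "\<alpha> \<le> \<beta>"
    and z: "AE t in lebesgue_on S. t \<notin> {\<alpha>..\<beta>} \<longrightarrow> ell t (f t) (g t) (h t) \<bullet> u t = 0"
  shows "form f u = integral {\<alpha>..\<beta>} (\<lambda>t. energy t (f t) (g t) (u t) (v t))
    - mom \<beta> (f \<beta>) (g \<beta>) \<bullet> u \<beta> + mom \<alpha> (f \<alpha>) (g \<alpha>) \<bullet> u \<alpha>"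
proof -
  have sub: "{\<alpha>..\<beta>} \<subseteq> S" using Icc_subset_interval[OF interval ab(1,2)] .
  have i: "integrable (lebesgue_on S) (\<lambda>t. ell t (f t) (g t) (h t) \<bullet> u t)"
    using L2_on_integrable_inner[OF ell_L2[OF f] jetD(1)[OF u]] .
  have e: "continuous_on {\<alpha>..\<beta>} (\<lambda>t. energy t (f t) (g t) (u t) (v t))"
    using jet_derivs[OF interval f] jet_derivs[OF interval u] sub
    by (intro energy_cont) (blast intro: continuous_on_subset)+
  note gr = primitive_onD(2)[OF green[OF jetD(4,5)[OF f] jetD(4)[OF u]] ab]
  have "((\<lambda>t. energy t (f t) (g t) (u t) (v t) - (energy t (f t) (g t) (u t) (v t) - ell t (f t) (g t) (h t) \<bullet> u t)) has_integral
      integral {\<alpha>..\<beta>} (\<lambda>t. energy t (f t) (g t) (u t) (v t)) - (mom \<beta> (f \<beta>) (g \<beta>) \<bullet> u \<beta> - mom \<alpha> (f \<alpha>) (g \<alpha>) \<bullet> u \<alpha>)) {\<alpha>..\<beta>}"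
    by (rule has_integral_diff[OF integrable_integral[OF integrable_continuous_real[OF e]] gr])
  then have "integral {\<alpha>..\<beta>} (\<lambda>t. ell t (f t) (g t) (h t) \<bullet> u t) =
     integral {\<alpha>..\<beta>} (\<lambda>t. energy t (f t) (g t) (u t) (v t)) - (mom \<beta> (f \<beta>) (g \<beta>) \<bullet> u \<beta> - mom \<alpha> (f \<alpha>) (g \<alpha>) \<bullet> u \<alpha>)"
    by (intro integral_unique) simp
  then show ?thesis
    using form_ell[OF f jetD(1)[OF u]] integral_outside_zero_AE[OF i S_sets sub z] by simp
qed

definition left :: "real \<Rightarrow> real set" where "left \<sigma> = S \<inter> {..\<sigma>}"

text \<open>The left end is described as the least element of \<open>S\<close>, so the condition
  there is void when the edge extends to minus infinity.\<close>

definition left_kernel :: "real \<Rightarrow> (real \<Rightarrow> real^'d) \<Rightarrow> bool" where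
  "left_kernel \<sigma> y \<longleftrightarrow> y \<in> W22_on (left \<sigma>) \<and> y \<sigma> = 0 \<and> (\<forall>a\<in>S. (\<forall>t\<in>S. a \<le> t) \<longrightarrow> y a = 0) \<and>
     (AE t in lebesgue_on (left \<sigma>). sturm_liouville (left \<sigma>) P Q R y t = 0)"

lemma left_facts:
  assumes "\<sigma> \<in> interior S"
  shows "\<sigma> \<in> S" "is_interval (left \<sigma>)" "closed (left \<sigma>)" "left \<sigma> \<subseteq> S" "\<sigma> \<in> left \<sigma>" "\<exists>a\<in>left \<sigma>. a < \<sigma>"
    "sl_coefficients (left \<sigma>) P Q R P1 Q1"
proof -
  show s: "\<sigma> \<in> S" using assms interior_subset by blast
  show i: "is_interval (left \<sigma>)" "closed (left \<sigma>)" "left \<sigma> \<subseteq> S" "\<sigma> \<in> left \<sigma>"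
    using interval closed s by (auto simp: left_def is_interval_Int is_interval_ic)
  obtain e where e: "e > 0" "cball \<sigma> e \<subseteq> S" using assms by (meson mem_interior_cball)
  have "\<sigma> - e \<in> cball \<sigma> e" using e(1) by (simp add: dist_real_def)
  then have "\<sigma> - e \<in> left \<sigma>" using e by (auto simp: left_def)
  then show ex: "\<exists>a\<in>left \<sigma>. a < \<sigma>" using e(1) by (intro bexI[of _ "\<sigma> - e"]) auto
  then show "sl_coefficients (left \<sigma>) P Q R P1 Q1" using sub_coefficients i by blast
qed

lemma left_kernelE:
  assumes y: "left_kernel \<sigma> y" and \<sigma>: "\<sigma> \<in> interior S"
  obtains y1 y2 where "jet (left \<sigma>) y y1 y2" "AE t in lebesgue_on (left \<sigma>). ell t (y t) (y1 t) (y2 t) = 0"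
    "sl_coefficients.solution (left \<sigma>) P Q R y y1" "deriv_on (left \<sigma>) y \<sigma> = y1 \<sigma>"
proof -
  interpret T: sl_coefficients "left \<sigma>" P Q R P1 Q1 by (rule left_facts(7)[OF \<sigma>])
  obtain y1 y2 where j: "jet (left \<sigma>) y y1 y2"
    using y[unfolded left_kernel_def] W22_on_iff_jet[OF left_facts(3)[OF \<sigma>]] by blast
  have "AE t in lebesgue_on (left \<sigma>). sturm_liouville (left \<sigma>) P Q R y t = 0" using y by (simp add: left_kernel_def)
  then have ae: "AE t in lebesgue_on (left \<sigma>). ell t (y t) (y1 t) (y2 t) = 0"
    using T.L_AE[OF j] by eventually_elim simp
  show ?thesis
    using that[OF j ae T.jet_kernel_solution[OF j ae] T.deriv_on_jet[OF j left_facts(5)[OF \<sigma>]]] .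
qed

text \<open>Let \<open>v\<close> be the slope of \<open>y\<close> at \<open>\<sigma>\<close>. The
  parabolas are chosen so that both sides have the value \<open>- (\<delta> / 4) *\<^sub>R v\<close>
  and the slope \<open>v / 2\<close> at \<open>\<sigma>\<close>, and so that they leave
  \<open>y\<close> and 0 with matching slopes at distance \<open>\<delta>\<close>.\<close>

definition corner :: "real \<Rightarrow> real \<Rightarrow> (real \<Rightarrow> real^'d) \<Rightarrow> real \<Rightarrow> real^'d" where
  "corner \<delta> \<sigma> y t = (if t \<in> S then
     (if t \<le> \<sigma> then y t - (hump0 (\<sigma> - \<delta>) t / (2 * \<delta>)) *\<^sub>R deriv_on (left \<sigma>) y \<sigma>
      else - (hump0 (- (\<sigma> + \<delta>)) (- t) / (2 * \<delta>)) *\<^sub>R deriv_on (left \<sigma>) y \<sigma>) else 0)"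

lemma corner_jet:
  assumes y: "left_kernel \<sigma> y" and \<delta>: "0 < \<delta>" "{\<sigma> - \<delta>..\<sigma> + \<delta>} \<subseteq> S" and \<sigma>: "\<sigma> \<in> interior S"
    and j: "jet (left \<sigma>) y y1 y2" and d: "deriv_on (left \<sigma>) y \<sigma> = y1 \<sigma>"
  shows "\<exists>c1 c2. jet S (corner \<delta> \<sigma> y) c1 c2 \<and>
    (\<forall>t. t \<ge> \<sigma> + \<delta> \<longrightarrow> corner \<delta> \<sigma> y t = 0 \<and> c1 t = 0 \<and> c2 t = 0) \<and>
    (\<forall>t\<in>S. t \<le> \<sigma> \<longrightarrow> corner \<delta> \<sigma> y t = y t - (hump0 (\<sigma> - \<delta>) t / (2 * \<delta>)) *\<^sub>R y1 \<sigma>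
       \<and> c1 t = y1 t - (hump1 (\<sigma> - \<delta>) t / (2 * \<delta>)) *\<^sub>R y1 \<sigma> \<and> c2 t = y2 t - (hump2 (\<sigma> - \<delta>) t / (2 * \<delta>)) *\<^sub>R y1 \<sigma>) \<and>
    (\<forall>t\<in>S. \<sigma> < t \<longrightarrow> corner \<delta> \<sigma> y t = - (hump0 (- (\<sigma> + \<delta>)) (- t) / (2 * \<delta>)) *\<^sub>R y1 \<sigma>
       \<and> c1 t = (hump1 (- (\<sigma> + \<delta>)) (- t) / (2 * \<delta>)) *\<^sub>R y1 \<sigma>)"
proof -
  let ?v = "y1 \<sigma>" and ?k = "1 / (2 * \<delta>)"
  note lf = left_facts[OF \<sigma>]
  have T2: "is_interval (S \<inter> {\<sigma>..})" "closed (S \<inter> {\<sigma>..})"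
    using interval closed by (auto simp: is_interval_Int is_interval_ci)
  have y0: "y \<sigma> = 0" using y by (simp add: left_kernel_def)
  have out: "y t = 0" "y1 t = 0" "y2 t = 0" if "t \<notin> left \<sigma>" for t
    using jetD(1-3)[OF j, THEN L2_onD(3)] that by blast+
  have hl: "jet (left \<sigma>) (\<lambda>t. if t \<in> left \<sigma> then hump0 (\<sigma> - \<delta>) t *\<^sub>R ?v else 0)
     (\<lambda>t. if t \<in> left \<sigma> then hump1 (\<sigma> - \<delta>) t *\<^sub>R ?v else 0) (\<lambda>t. if t \<in> left \<sigma> then hump2 (\<sigma> - \<delta>) t *\<^sub>R ?v else 0)"
    by (rule hump_jet_left[OF lf(2,3) _ \<delta>(1)]) (simp add: left_def)
  have hr: "jet (S \<inter> {\<sigma>..}) (\<lambda>t. if t \<in> S \<inter> {\<sigma>..} then hump0 (- (\<sigma> + \<delta>)) (- t) *\<^sub>R ?v else 0)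
     (\<lambda>t. if t \<in> S \<inter> {\<sigma>..} then - hump1 (- (\<sigma> + \<delta>)) (- t) *\<^sub>R ?v else 0)
     (\<lambda>t. if t \<in> S \<inter> {\<sigma>..} then hump2 (- (\<sigma> + \<delta>)) (- t) *\<^sub>R ?v else 0)"
    by (rule hump_jet_right[OF T2 _ \<delta>(1)]) simp
  define l0 where "l0 t = y t + (-?k) *\<^sub>R (if t \<in> left \<sigma> then hump0 (\<sigma> - \<delta>) t *\<^sub>R ?v else 0)" for t
  define l1 where "l1 t = y1 t + (-?k) *\<^sub>R (if t \<in> left \<sigma> then hump1 (\<sigma> - \<delta>) t *\<^sub>R ?v else 0)" for t
  define l2 where "l2 t = y2 t + (-?k) *\<^sub>R (if t \<in> left \<sigma> then hump2 (\<sigma> - \<delta>) t *\<^sub>R ?v else 0)" for t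
  define r0 where "r0 t = 0 + (-?k) *\<^sub>R (if t \<in> S \<inter> {\<sigma>..} then hump0 (- (\<sigma> + \<delta>)) (- t) *\<^sub>R ?v else 0)" for t
  define r1 where "r1 t = 0 + (-?k) *\<^sub>R (if t \<in> S \<inter> {\<sigma>..} then - hump1 (- (\<sigma> + \<delta>)) (- t) *\<^sub>R ?v else 0)" for t
  define r2 where "r2 t = 0 + (-?k) *\<^sub>R (if t \<in> S \<inter> {\<sigma>..} then hump2 (- (\<sigma> + \<delta>)) (- t) *\<^sub>R ?v else 0)" for t
  have jr: "jet (S \<inter> {\<sigma>..}) r0 r1 r2"
    unfolding r0_def[abs_def] r1_def[abs_def] r2_def[abs_def] by (rule jet_add_scaleR[OF jet_zero hr])
  have jl: "jet (S \<inter> {..\<sigma>}) l0 l1 l2"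
    unfolding l0_def[abs_def] l1_def[abs_def] l2_def[abs_def] left_def[symmetric] by (rule jet_add_scaleR[OF j hl])
  have e1: "l0 \<sigma> = r0 \<sigma>" using \<delta>(1) lf(1,5) by (simp add: hump0_def y0 l0_def r0_def)
  have l1: "l1 \<sigma> = ?v + (- (1/2)) *\<^sub>R ?v" using \<delta>(1) lf(5) by (simp add: hump1_def l1_def)
  have r1: "r1 \<sigma> = (1/2) *\<^sub>R ?v" using \<delta>(1) lf(1) by (simp add: hump1_def r1_def)
  have e2: "l1 \<sigma> = r1 \<sigma>" unfolding l1 r1 using scaleR_left_distrib[of 1 "- (1/2)" ?v] by simp
  let ?c0 = "\<lambda>t. if t \<le> \<sigma> then l0 t else r0 t" and ?c1 = "\<lambda>t. if t \<le> \<sigma> then l1 t else r1 t"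
    and ?c2 = "\<lambda>t. if t \<le> \<sigma> then l2 t else r2 t"
  have g: "jet S ?c0 ?c1 ?c2" by (rule jet_glue[OF interval closed lf(1) jl jr e1 e2])
  have c: "corner \<delta> \<sigma> y t = ?c0 t" for t
  proof (cases "t \<in> S")
    case True
    then have "t \<in> left \<sigma> \<longleftrightarrow> t \<le> \<sigma>" by (simp add: left_def)
    then show ?thesis using True by (simp add: corner_def d l0_def r0_def)
  next
    case False
    then show ?thesis using out(1)[of t] by (simp add: corner_def l0_def r0_def left_def)
  qed
  have A: "corner \<delta> \<sigma> y t = 0 \<and> ?c1 t = 0 \<and> ?c2 t = 0" if "t \<ge> \<sigma> + \<delta>" for t
    using that \<delta>(1) unfolding c by (simp add: r0_def r1_def r2_def hump0_def hump1_def hump2_def)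
  have B: "corner \<delta> \<sigma> y t = y t - (hump0 (\<sigma> - \<delta>) t / (2 * \<delta>)) *\<^sub>R y1 \<sigma>
       \<and> ?c1 t = y1 t - (hump1 (\<sigma> - \<delta>) t / (2 * \<delta>)) *\<^sub>R y1 \<sigma> \<and> ?c2 t = y2 t - (hump2 (\<sigma> - \<delta>) t / (2 * \<delta>)) *\<^sub>R y1 \<sigma>"
    if "t \<in> S" "t \<le> \<sigma>" for t
    using that unfolding c by (simp add: l0_def l1_def l2_def left_def)
  have C: "corner \<delta> \<sigma> y t = - (hump0 (- (\<sigma> + \<delta>)) (- t) / (2 * \<delta>)) *\<^sub>R y1 \<sigma>
       \<and> ?c1 t = (hump1 (- (\<sigma> + \<delta>)) (- t) / (2 * \<delta>)) *\<^sub>R y1 \<sigma>" if "t \<in> S" "\<sigma> < t" for t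
    using that unfolding c by (simp add: r0_def r1_def)
  have g': "jet S (corner \<delta> \<sigma> y) ?c1 ?c2" using g by (simp add: c[abs_def])
  show ?thesis using g' A B C by blast
qed

end

lemma frontier_interval_cases:
  fixes S :: "real set"
  assumes S: "is_interval S" and t: "t \<in> frontier S"
  shows "(\<forall>x\<in>S. t \<le> x) \<or> (\<forall>x\<in>S. x \<le> t)"
proof (rule ccontr)
  assume "\<not> ?thesis"
  then obtain a b where ab: "a \<in> S" "a < t" "b \<in> S" "t < b" by force
  have "{a<..<b} \<subseteq> S" using Icc_subset_interval[OF S ab(1,3)] by force
  then have "t \<in> interior S" using ab by (intro interiorI[of "{a<..<b}"]) auto
  then show False using t by (simp add: frontier_def)
qed

context sl_coefficients
begin

lemma energy_add_left: "energy t (a + a') (b + b') x y = energy t a b x y + energy t a' b' x y"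
  using mom_linear[of t a 1 a' b b'] force_linear[of t a 1 a' b b'] by (simp add: energy_def inner_add_left)

lemma energy_add_right: "energy t x y (a + a') (b + b') = energy t x y a b + energy t x y a' b'"
  by (simp add: energy_def inner_add_right)

lemma energy_square:
  "t \<in> S \<Longrightarrow> energy t (a + a') (b + b') (a + a') (b + b') = energy t a b a b + 2 * energy t a b a' b' + energy t a' b' a' b'"
  by (simp add: energy_add_left energy_add_right energy_sym[of t a' b' a b])

end

context sl_operator
begin

lemma corner_dirichlet:
  assumes y: "left_kernel \<sigma> y" and \<delta>: "0 < \<delta>" "{\<sigma> - \<delta>..\<sigma> + \<delta>} \<subseteq> S" and \<sigma>: "\<sigma> \<in> interior S"
  shows "dirichlet (corner \<delta> \<sigma> y)"
  unfolding dirichlet_def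
proof
  fix t assume t: "t \<in> frontier S"
  then have tS: "t \<in> S" using closed by (simp add: frontier_def)
  have in': "\<sigma> - \<delta> \<in> S" "\<sigma> + \<delta> \<in> S" using \<delta> by auto
  show "corner \<delta> \<sigma> y t = 0"
    using frontier_interval_cases[OF interval t]
  proof
    assume min: "\<forall>x\<in>S. t \<le> x"
    then have "t \<le> \<sigma> - \<delta>" using in' by blast
    moreover have "y t = 0" using y min tS by (simp add: left_kernel_def)
    ultimately show ?thesis using \<delta>(1) by (simp add: corner_def hump0_def)
  next
    assume "\<forall>x\<in>S. x \<le> t"
    then have "\<sigma> + \<delta> \<le> t" using in' by blast
    then show ?thesis using \<delta>(1) by (simp add: corner_def hump0_def)
  qed
qed

lemma left_AE:
  assumes \<sigma>: "\<sigma> \<in> interior S" and ae: "AE t in lebesgue_on (left \<sigma>). p t"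
  shows "AE t in lebesgue_on S. t \<le> \<sigma> \<longrightarrow> p t"
proof -
  have L: "left \<sigma> \<in> sets lebesgue" using left_facts(3)[OF \<sigma>] by (rule closed_sets_lebesgue)
  have "AE t in lebesgue. t \<in> left \<sigma> \<longrightarrow> p t" using ae L by (subst (asm) AE_restrict_space_iff) auto
  then have "AE t in lebesgue. t \<in> S \<longrightarrow> t \<le> \<sigma> \<longrightarrow> p t" by eventually_elim (auto simp: left_def)
  then show ?thesis using S_sets by (subst AE_restrict_space_iff) auto
qed

text \<open>On \<open>{\<sigma> - \<delta>..\<sigma>}\<close> the function is \<open>y + w\<close>
  with \<open>w\<close> the parabola. By Green's identity the energy of \<open>y\<close> cancels the
  boundary term at \<open>\<sigma> - \<delta>\<close>, and twice the mixed energy is the boundary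
  value of momentum times \<open>w\<close> at \<open>\<sigma>\<close>, namely
  \<open>- (\<delta> / 2)\<close> times \<open>P v \<bullet> v\<close>. Only the energies of the two
  parabolas remain.\<close>

lemma corner_ell_AE:
  assumes y: "left_kernel \<sigma> y" and \<delta>: "0 < \<delta>" "{\<sigma> - \<delta>..\<sigma> + \<delta>} \<subseteq> S" and \<sigma>: "\<sigma> \<in> interior S"
  shows "\<exists>c1 c2. jet S (corner \<delta> \<sigma> y) c1 c2 \<and>
    (AE t in lebesgue_on S. t \<le> \<sigma> - \<delta> \<longrightarrow> ell t (corner \<delta> \<sigma> y t) (c1 t) (c2 t) = 0) \<and>
    (\<forall>t \<ge> \<sigma> + \<delta>. corner \<delta> \<sigma> y t = 0) \<and> (y \<noteq> 0 \<longrightarrow> deriv_on (left \<sigma>) y \<sigma> \<noteq> 0) \<and>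
    form (corner \<delta> \<sigma> y) (corner \<delta> \<sigma> y) =
      - (\<delta> / 2) * ((P \<sigma> *v deriv_on (left \<sigma>) y \<sigma>) \<bullet> deriv_on (left \<sigma>) y \<sigma>)
      + integral {\<sigma> - \<delta>..\<sigma>} (\<lambda>t. energy t (- ((t - (\<sigma> - \<delta>))\<^sup>2 / (4 * \<delta>)) *\<^sub>R deriv_on (left \<sigma>) y \<sigma>)
          (- ((t - (\<sigma> - \<delta>)) / (2 * \<delta>)) *\<^sub>R deriv_on (left \<sigma>) y \<sigma>)
          (- ((t - (\<sigma> - \<delta>))\<^sup>2 / (4 * \<delta>)) *\<^sub>R deriv_on (left \<sigma>) y \<sigma>)
          (- ((t - (\<sigma> - \<delta>)) / (2 * \<delta>)) *\<^sub>R deriv_on (left \<sigma>) y \<sigma>))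
      + integral {\<sigma>..\<sigma> + \<delta>} (\<lambda>t. energy t (- (((\<sigma> + \<delta>) - t)\<^sup>2 / (4 * \<delta>)) *\<^sub>R deriv_on (left \<sigma>) y \<sigma>)
          ((((\<sigma> + \<delta>) - t) / (2 * \<delta>)) *\<^sub>R deriv_on (left \<sigma>) y \<sigma>)
          (- (((\<sigma> + \<delta>) - t)\<^sup>2 / (4 * \<delta>)) *\<^sub>R deriv_on (left \<sigma>) y \<sigma>)
          ((((\<sigma> + \<delta>) - t) / (2 * \<delta>)) *\<^sub>R deriv_on (left \<sigma>) y \<sigma>))"
proof -
  obtain y1 y2 where j: "jet (left \<sigma>) y y1 y2" and ae: "AE t in lebesgue_on (left \<sigma>). ell t (y t) (y1 t) (y2 t) = 0"
    and sol: "sl_coefficients.solution (left \<sigma>) P Q R y y1" and d: "deriv_on (left \<sigma>) y \<sigma> = y1 \<sigma>"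
    using left_kernelE[OF y \<sigma>] by blast
  interpret T: sl_coefficients "left \<sigma>" P Q R P1 Q1 by (rule left_facts(7)[OF \<sigma>])
  obtain c1 c2 where c: "jet S (corner \<delta> \<sigma> y) c1 c2"
    and cr: "\<And>t. t \<ge> \<sigma> + \<delta> \<Longrightarrow> corner \<delta> \<sigma> y t = 0 \<and> c1 t = 0 \<and> c2 t = 0"
    and cl: "\<And>t. t \<in> S \<Longrightarrow> t \<le> \<sigma> \<Longrightarrow> corner \<delta> \<sigma> y t = y t - (hump0 (\<sigma> - \<delta>) t / (2 * \<delta>)) *\<^sub>R y1 \<sigma>
       \<and> c1 t = y1 t - (hump1 (\<sigma> - \<delta>) t / (2 * \<delta>)) *\<^sub>R y1 \<sigma> \<and> c2 t = y2 t - (hump2 (\<sigma> - \<delta>) t / (2 * \<delta>)) *\<^sub>R y1 \<sigma>"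
    and cm: "\<And>t. t \<in> S \<Longrightarrow> \<sigma> < t \<Longrightarrow> corner \<delta> \<sigma> y t = - (hump0 (- (\<sigma> + \<delta>)) (- t) / (2 * \<delta>)) *\<^sub>R y1 \<sigma>
       \<and> c1 t = (hump1 (- (\<sigma> + \<delta>)) (- t) / (2 * \<delta>)) *\<^sub>R y1 \<sigma>"
    using corner_jet[OF y \<delta> \<sigma> j d] by blast
  let ?v = "y1 \<sigma>" and ?\<alpha> = "\<sigma> - \<delta>" and ?\<beta> = "\<sigma> + \<delta>" and ?U = "corner \<delta> \<sigma> y"
  note lf = left_facts[OF \<sigma>]
  have y0: "y \<sigma> = 0" using y by (simp add: left_kernel_def)
  have ab: "?\<alpha> \<in> S" "?\<beta> \<in> S" "?\<alpha> \<le> ?\<beta>" using \<delta> by auto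
  have subl: "{?\<alpha>..\<sigma>} \<subseteq> left \<sigma>" "{?\<alpha>..\<sigma>} \<subseteq> S" using \<delta> by (auto simp: left_def)
  have Z: "AE t in lebesgue_on S. t \<le> ?\<alpha> \<longrightarrow> ell t (?U t) (c1 t) (c2 t) = 0"
  proof -
    have "AE t in lebesgue_on S. t \<in> S" using S_sets by (subst AE_restrict_space_iff) auto
    then show ?thesis using left_AE[OF \<sigma> ae]
    proof eventually_elim
      case (elim t)
      then show ?case using cl[of t] \<delta>(1) by (auto simp: hump0_def hump1_def hump2_def)
    qed
  qed
  \<comment> \<open>A kernel element already vanishes at \<open>\<sigma>\<close>; if its slope
    vanished too, its Cauchy data there would be zero.\<close>
  have nz: "y \<noteq> 0 \<longrightarrow> ?v \<noteq> 0"
  proof (intro impI notI)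
    assume yn: "y \<noteq> 0" and v: "?v = 0"
    have "y t = 0" for t
    proof (cases "t \<in> left \<sigma>")
      case True
      show ?thesis by (rule T.solution_unique(1)[OF sol True lf(5) y0 v])
    next
      case False
      then show ?thesis using L2_onD(3)[OF jetD(1)[OF j]] by blast
    qed
    then show False using yn by (simp add: fun_eq_iff)
  qed
  define w where "w t = - ((t - ?\<alpha>)\<^sup>2 / (4 * \<delta>)) *\<^sub>R ?v" for t
  define w1 where "w1 t = - ((t - ?\<alpha>) / (2 * \<delta>)) *\<^sub>R ?v" for t
  have wd: "(w has_vector_derivative w1 t) (at t within {?\<alpha>..\<sigma>})" for t
  proof -
    have "((\<lambda>t. - ((t - ?\<alpha>)\<^sup>2 / (4 * \<delta>))) has_real_derivative - ((t - ?\<alpha>) / (2 * \<delta>))) (at t within {?\<alpha>..\<sigma>})"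
      using \<delta>(1) by (auto intro!: derivative_eq_intros simp: field_simps)
    then have "((\<lambda>t. - ((t - ?\<alpha>)\<^sup>2 / (4 * \<delta>))) has_vector_derivative - ((t - ?\<alpha>) / (2 * \<delta>))) (at t within {?\<alpha>..\<sigma>})"
      by (simp add: has_real_derivative_iff_has_vector_derivative)
    from bounded_linear.has_vector_derivative[OF bounded_linear_scaleR_left this, of ?v]
    show ?thesis by (simp add: w_def[abs_def] w1_def)
  qed
  have yd: "(y has_vector_derivative y1 t) (at t within {?\<alpha>..\<sigma>})" if "t \<in> {?\<alpha>..\<sigma>}" for t
    using jet_derivs(3)[OF lf(2) j] subl(1) that by (blast intro: has_vector_derivative_within_subset)
  have solg: "((\<lambda>t. mom t (y t) (y1 t) \<bullet> u t) has_vector_derivative energy t (y t) (y1 t) (u t) (u1 t)) (at t within {?\<alpha>..\<sigma>})"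
    if "t \<in> {?\<alpha>..\<sigma>}" "\<And>t. t \<in> {?\<alpha>..\<sigma>} \<Longrightarrow> (u has_vector_derivative u1 t) (at t within {?\<alpha>..\<sigma>})" for t u u1
    by (rule T.solution_green[OF sol that(2) subl(1) that(1)])
  have le: "?\<alpha> \<le> \<sigma>" using \<delta> by simp
  have I1: "((\<lambda>t. energy t (y t) (y1 t) (y t) (y1 t)) has_integral mom \<sigma> (y \<sigma>) (y1 \<sigma>) \<bullet> y \<sigma> - mom ?\<alpha> (y ?\<alpha>) (y1 ?\<alpha>) \<bullet> y ?\<alpha>) {?\<alpha>..\<sigma>}"
    by (rule fundamental_theorem_of_calculus[OF le]) (rule solg, assumption, rule yd)
  have I2: "((\<lambda>t. energy t (y t) (y1 t) (w t) (w1 t)) has_integral mom \<sigma> (y \<sigma>) (y1 \<sigma>) \<bullet> w \<sigma> - mom ?\<alpha> (y ?\<alpha>) (y1 ?\<alpha>) \<bullet> w ?\<alpha>) {?\<alpha>..\<sigma>}"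
    by (rule fundamental_theorem_of_calculus[OF le]) (rule solg, assumption, rule wd)
  have "continuous_on {?\<alpha>..\<sigma>} (\<lambda>t. energy t (w t) (w1 t) (w t) (w1 t))"
    unfolding w_def w1_def by (intro energy_cont continuous_intros subl(2)) (use \<delta>(1) in auto)
  then have I3: "((\<lambda>t. energy t (w t) (w1 t) (w t) (w1 t)) has_integral integral {?\<alpha>..\<sigma>} (\<lambda>t. energy t (w t) (w1 t) (w t) (w1 t))) {?\<alpha>..\<sigma>}"
    by (intro integrable_integral integrable_continuous_real)
  have eU: "energy t (?U t) (c1 t) (?U t) (c1 t) = energy t (y t) (y1 t) (y t) (y1 t) + 2 * energy t (y t) (y1 t) (w t) (w1 t) + energy t (w t) (w1 t) (w t) (w1 t)"
    if t: "t \<in> {?\<alpha>..\<sigma>}" for t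
  proof -
    have tS: "t \<in> S" using t subl by blast
    have h: "hump0 ?\<alpha> t = (t - ?\<alpha>)\<^sup>2 / 2" "hump1 ?\<alpha> t = t - ?\<alpha>" using t by (auto simp: hump0_def hump1_def)
    have "?U t = y t + w t" "c1 t = y1 t + w1 t" using cl[OF tS] t by (auto simp: w_def w1_def h)
    then show ?thesis using energy_square[OF tS] by simp
  qed
  have vals: "mom \<sigma> 0 ?v = P \<sigma> *v ?v" "w \<sigma> = - (\<delta> / 4) *\<^sub>R ?v" "w ?\<alpha> = 0"
    using \<delta>(1) by (simp_all add: mom_def y0 w_def power2_eq_square)
  have left_int: "((\<lambda>t. energy t (?U t) (c1 t) (?U t) (c1 t)) has_integral
      (- (mom ?\<alpha> (y ?\<alpha>) (y1 ?\<alpha>) \<bullet> y ?\<alpha>) + 2 * (- (\<delta> / 4) * ((P \<sigma> *v ?v) \<bullet> ?v)))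
      + integral {?\<alpha>..\<sigma>} (\<lambda>t. energy t (w t) (w1 t) (w t) (w1 t))) {?\<alpha>..\<sigma>}"
  proof -
    have "((\<lambda>t. energy t (y t) (y1 t) (y t) (y1 t) + 2 * energy t (y t) (y1 t) (w t) (w1 t) + energy t (w t) (w1 t) (w t) (w1 t))
       has_integral (- (mom ?\<alpha> (y ?\<alpha>) (y1 ?\<alpha>) \<bullet> y ?\<alpha>) + 2 * (- (\<delta> / 4) * ((P \<sigma> *v ?v) \<bullet> ?v)))
      + integral {?\<alpha>..\<sigma>} (\<lambda>t. energy t (w t) (w1 t) (w t) (w1 t))) {?\<alpha>..\<sigma>}"
      using I1 I2 by (intro has_integral_add I3 has_integral_mult_right) (simp_all add: vals y0)
    then show ?thesis by (rule has_integral_eq[rotated]) (simp add: eU)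
  qed
  define x where "x t = - (((\<sigma> + \<delta>) - t)\<^sup>2 / (4 * \<delta>)) *\<^sub>R ?v" for t
  define x1 where "x1 t = (((\<sigma> + \<delta>) - t) / (2 * \<delta>)) *\<^sub>R ?v" for t
  have subr: "{\<sigma>..?\<beta>} \<subseteq> S" using \<delta> by auto
  have "continuous_on {\<sigma>..?\<beta>} (\<lambda>t. energy t (x t) (x1 t) (x t) (x1 t))"
    unfolding x_def x1_def by (intro energy_cont continuous_intros subr) (use \<delta>(1) in auto)
  then have "((\<lambda>t. energy t (x t) (x1 t) (x t) (x1 t)) has_integral integral {\<sigma>..?\<beta>} (\<lambda>t. energy t (x t) (x1 t) (x t) (x1 t))) {\<sigma>..?\<beta>}"
    by (intro integrable_integral integrable_continuous_real)
  then have right_int: "((\<lambda>t. energy t (?U t) (c1 t) (?U t) (c1 t)) has_integral integral {\<sigma>..?\<beta>} (\<lambda>t. energy t (x t) (x1 t) (x t) (x1 t))) {\<sigma>..?\<beta>}"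
  proof (rule has_integral_spike_finite[rotated 2])
    fix t assume t: "t \<in> {\<sigma>..?\<beta>} - {\<sigma>}"
    then have tS: "t \<in> S" "\<sigma> < t" using subr by auto
    have h: "hump0 (- ?\<beta>) (- t) = (?\<beta> - t)\<^sup>2 / 2" "hump1 (- ?\<beta>) (- t) = ?\<beta> - t"
      using t by (auto simp: hump0_def hump1_def)
    have "?U t = x t" "c1 t = x1 t" using cm[OF tS] unfolding h by (auto simp: x_def x1_def)
    then show "energy t (?U t) (c1 t) (?U t) (c1 t) = energy t (x t) (x1 t) (x t) (x1 t)" by simp
  qed simp
  have tot: "integral {?\<alpha>..?\<beta>} (\<lambda>t. energy t (?U t) (c1 t) (?U t) (c1 t)) =
     ((- (mom ?\<alpha> (y ?\<alpha>) (y1 ?\<alpha>) \<bullet> y ?\<alpha>) + 2 * (- (\<delta> / 4) * ((P \<sigma> *v ?v) \<bullet> ?v)))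
      + integral {?\<alpha>..\<sigma>} (\<lambda>t. energy t (w t) (w1 t) (w t) (w1 t)))
      + integral {\<sigma>..?\<beta>} (\<lambda>t. energy t (x t) (x1 t) (x t) (x1 t))"
    by (rule integral_unique, rule has_integral_combine[OF _ _ left_int right_int]) (use \<delta> in auto)
  \<comment> \<open>The function solves the equation to the left of this interval and is zero to the
    right of it, so the form becomes compact even when the edge extends to minus infinity.\<close>
  have fi: "form ?U ?U = integral {?\<alpha>..?\<beta>} (\<lambda>t. energy t (?U t) (c1 t) (?U t) (c1 t))
    - mom ?\<beta> (?U ?\<beta>) (c1 ?\<beta>) \<bullet> ?U ?\<beta> + mom ?\<alpha> (?U ?\<alpha>) (c1 ?\<alpha>) \<bullet> ?U ?\<alpha>"
  proof (rule form_interval_AE[OF c c ab])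
    show "AE t in lebesgue_on S. t \<notin> {?\<alpha>..?\<beta>} \<longrightarrow> ell t (?U t) (c1 t) (c2 t) \<bullet> ?U t = 0"
      using Z
    proof eventually_elim
      case (elim t)
      then show ?case using cr[of t] by (cases "t \<le> ?\<alpha>") auto
    qed
  qed
  have "?U ?\<alpha> = y ?\<alpha>" "c1 ?\<alpha> = y1 ?\<alpha>" "?U ?\<beta> = 0"
    using cl[OF ab(1)] cr[of ?\<beta>] \<delta>(1) by (simp_all add: hump0_def hump1_def)
  then have "form ?U ?U = - (\<delta> / 2) * ((P \<sigma> *v ?v) \<bullet> ?v)
      + integral {?\<alpha>..\<sigma>} (\<lambda>t. energy t (w t) (w1 t) (w t) (w1 t))
      + integral {\<sigma>..?\<beta>} (\<lambda>t. energy t (x t) (x1 t) (x t) (x1 t))"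
    unfolding fi tot by simp
  then have F: "form ?U ?U = - (\<delta> / 2) * ((P \<sigma> *v ?v) \<bullet> ?v)
      + integral {?\<alpha>..\<sigma>} (\<lambda>t. energy t (- ((t - ?\<alpha>)\<^sup>2 / (4 * \<delta>)) *\<^sub>R ?v) (- ((t - ?\<alpha>) / (2 * \<delta>)) *\<^sub>R ?v)
          (- ((t - ?\<alpha>)\<^sup>2 / (4 * \<delta>)) *\<^sub>R ?v) (- ((t - ?\<alpha>) / (2 * \<delta>)) *\<^sub>R ?v))
      + integral {\<sigma>..?\<beta>} (\<lambda>t. energy t (- (((\<sigma> + \<delta>) - t)\<^sup>2 / (4 * \<delta>)) *\<^sub>R ?v) ((((\<sigma> + \<delta>) - t) / (2 * \<delta>)) *\<^sub>R ?v)
          (- (((\<sigma> + \<delta>) - t)\<^sup>2 / (4 * \<delta>)) *\<^sub>R ?v) ((((\<sigma> + \<delta>) - t) / (2 * \<delta>)) *\<^sub>R ?v))"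
    by (simp only: w_def w1_def x_def x1_def)
  have zr: "\<forall>t\<ge>?\<beta>. ?U t = 0" using cr by blast
  show ?thesis unfolding d by (rule exI[of _ c1], rule exI[of _ c2], intro conjI c Z zr nz F)
qed

lemma corner_form_negative:
  assumes \<sigma>: "\<sigma> \<in> interior S"
  obtains \<delta>0 where "\<delta>0 > 0" "{\<sigma> - \<delta>0..\<sigma> + \<delta>0} \<subseteq> S"
    "\<And>\<delta> y. 0 < \<delta> \<Longrightarrow> \<delta> < \<delta>0 \<Longrightarrow> left_kernel \<sigma> y \<Longrightarrow> y \<noteq> 0 \<Longrightarrow> form (corner \<delta> \<sigma> y) (corner \<delta> \<sigma> y) < 0"
proof -
  obtain \<delta>0 where d0: "\<delta>0 > 0" "{\<sigma> - \<delta>0..\<sigma> + \<delta>0} \<subseteq> S"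
    and neg: "\<And>\<delta> v a b a' b'. 0 < \<delta> \<Longrightarrow> \<delta> < \<delta>0 \<Longrightarrow> v \<noteq> 0 \<Longrightarrow>
      a = (\<lambda>t. - ((t - (\<sigma> - \<delta>))\<^sup>2 / (4 * \<delta>))) \<Longrightarrow> b = (\<lambda>t. - ((t - (\<sigma> - \<delta>)) / (2 * \<delta>))) \<Longrightarrow>
      a' = (\<lambda>t. - (((\<sigma> + \<delta>) - t)\<^sup>2 / (4 * \<delta>))) \<Longrightarrow> b' = (\<lambda>t. ((\<sigma> + \<delta>) - t) / (2 * \<delta>)) \<Longrightarrow>
      - (\<delta> / 2) * ((P \<sigma> *v v) \<bullet> v)
      + integral {\<sigma> - \<delta>..\<sigma>} (\<lambda>t. energy t (a t *\<^sub>R v) (b t *\<^sub>R v) (a t *\<^sub>R v) (b t *\<^sub>R v))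
      + integral {\<sigma>..\<sigma> + \<delta>} (\<lambda>t. energy t (a' t *\<^sub>R v) (b' t *\<^sub>R v) (a' t *\<^sub>R v) (b' t *\<^sub>R v)) < 0"
    using corner_energy_bound[OF \<sigma>] by blast
  show ?thesis
  proof (rule that[OF d0])
    fix \<delta> y assume \<delta>: "0 < \<delta>" "\<delta> < \<delta>0" and y: "left_kernel \<sigma> y" "y \<noteq> 0"
    have "{\<sigma> - \<delta>..\<sigma> + \<delta>} \<subseteq> {\<sigma> - \<delta>0..\<sigma> + \<delta>0}" using \<delta> by auto
    then have sub: "{\<sigma> - \<delta>..\<sigma> + \<delta>} \<subseteq> S" using d0(2) by blast
    show "form (corner \<delta> \<sigma> y) (corner \<delta> \<sigma> y) < 0"
      using corner_ell_AE[OF y(1) \<delta>(1) sub \<sigma>] neg[OF \<delta> _ refl refl refl refl, of "deriv_on (left \<sigma>) y \<sigma>"] y(2) by auto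
  qed
qed

text \<open>The function with the later corner solves the equation up to
  \<open>\<sigma>' - \<delta>\<close>, and the other one vanishes from
  \<open>\<sigma> + \<delta>\<close> on, so \<open>ell\<close> of the later one pairs to zero
  pointwise. The opposite order follows by \<open>form_sym\<close>.\<close>

lemma corner_form_orthogonal:
  assumes y: "left_kernel \<sigma> y" and \<sigma>: "\<sigma> \<in> interior S" "{\<sigma> - \<delta>..\<sigma> + \<delta>} \<subseteq> S"
    and y': "left_kernel \<sigma>' y'" and \<sigma>': "\<sigma>' \<in> interior S" "{\<sigma>' - \<delta>..\<sigma>' + \<delta>} \<subseteq> S"
    and \<delta>: "0 < \<delta>" "\<sigma> + \<delta> \<le> \<sigma>' - \<delta>"
  shows "form (corner \<delta> \<sigma>' y') (corner \<delta> \<sigma> y) = 0" "form (corner \<delta> \<sigma> y) (corner \<delta> \<sigma>' y') = 0"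
proof -
  obtain c1 c2 where c: "jet S (corner \<delta> \<sigma> y) c1 c2" and z: "\<And>t. t \<ge> \<sigma> + \<delta> \<Longrightarrow> corner \<delta> \<sigma> y t = 0"
    using corner_ell_AE[OF y \<delta>(1) \<sigma>(2,1)] by blast
  obtain c1' c2' where c': "jet S (corner \<delta> \<sigma>' y') c1' c2'"
    and z': "AE t in lebesgue_on S. t \<le> \<sigma>' - \<delta> \<longrightarrow> ell t (corner \<delta> \<sigma>' y' t) (c1' t) (c2' t) = 0"
    using corner_ell_AE[OF y' \<delta>(1) \<sigma>'(2,1)] by blast
  have "AE t in lebesgue_on S. ell t (corner \<delta> \<sigma>' y' t) (c1' t) (c2' t) \<bullet> corner \<delta> \<sigma> y t = 0"
    using z'
  proof eventually_elim
    case (elim t)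
    then show ?case using z[of t] \<delta> by (cases "t \<le> \<sigma>' - \<delta>") auto
  qed
  then show "form (corner \<delta> \<sigma>' y') (corner \<delta> \<sigma> y) = 0"
    unfolding form_ell[OF c' jetD(1)[OF c]] by (rule integral_eq_zero_AE)
  then show "form (corner \<delta> \<sigma> y) (corner \<delta> \<sigma>' y') = 0"
    using form_sym[OF c corner_dirichlet[OF y \<delta>(1) \<sigma>(2,1)] c' corner_dirichlet[OF y' \<delta>(1) \<sigma>'(2,1)]] by simp
qed

end

section \<open>Conjoined bases\<close>

context sl_coefficients
begin

text \<open>Conjoined bases in the sense of Reid: the columns span a Lagrangian space of solutions.\<close>

definition Zmat :: "(real \<Rightarrow> real^'d^'d) \<Rightarrow> (real \<Rightarrow> real^'d^'d) \<Rightarrow> real \<Rightarrow> real^'d^'d" where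
  "Zmat Y Y1 t = P t ** Y1 t + Q t ** Y t"

definition Fmat :: "(real \<Rightarrow> real^'d^'d) \<Rightarrow> (real \<Rightarrow> real^'d^'d) \<Rightarrow> real \<Rightarrow> real^'d^'d" where
  "Fmat Y Y1 t = transpose (Q t) ** Y1 t + R t ** Y t"

definition conjoined :: "(real \<Rightarrow> real^'d^'d) \<Rightarrow> (real \<Rightarrow> real^'d^'d) \<Rightarrow> bool" where
  "conjoined Y Y1 \<longleftrightarrow>
     (\<forall>t\<in>S. (Y has_vector_derivative Y1 t) (at t within S)) \<and>
     (\<forall>t\<in>S. (Zmat Y Y1 has_vector_derivative Fmat Y Y1 t) (at t within S)) \<and>
     (\<forall>t\<in>S. \<forall>c e. (Y t *v c) \<bullet> (Zmat Y Y1 t *v e) = (Zmat Y Y1 t *v c) \<bullet> (Y t *v e)) \<and>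
     (\<forall>t\<in>S. \<forall>c. Y t *v c = 0 \<longrightarrow> Zmat Y Y1 t *v c = 0 \<longrightarrow> c = 0)"

lemma Zmat_mom: "Zmat Y Y1 t *v c = mom t (Y t *v c) (Y1 t *v c)"
  by (simp add: Zmat_def mom_def matrix_vector_mult_add_rdistrib matrix_vector_mul_assoc)

lemma Fmat_force: "Fmat Y Y1 t *v c = force t (Y t *v c) (Y1 t *v c)"
  by (simp add: Fmat_def force_def matrix_vector_mult_add_rdistrib matrix_vector_mul_assoc del: transpose_matrix_vector)

lemma mv_tendsto_zero:
  fixes A :: "'x \<Rightarrow> real^'n^'m"
  assumes A: "(A \<longlongrightarrow> 0) F" and c: "\<forall>\<^sub>F t in F. norm (c t) \<le> M"
  shows "((\<lambda>t. A t *v c t) \<longlongrightarrow> 0) F"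
proof -
  obtain C where C: "C > 0" "\<And>(A::real^'n^'m) x. norm (A *v x) \<le> norm A * norm x * C"
    using bounded_bilinear.pos_bounded[OF bounded_bilinear_matrix_vector_mult] by blast
  show ?thesis
  proof (rule Lim_null_comparison)
    show "\<forall>\<^sub>F t in F. norm (A t *v c t) \<le> norm (A t) * (M * C)"
      using c
    proof eventually_elim
      case (elim t)
      have "norm (A t *v c t) \<le> norm (A t) * (norm (c t) * C)" using C(2)[of "A t" "c t"] by (simp add: mult.assoc)
      also have "\<dots> \<le> norm (A t) * (M * C)" using elim C(1) by (intro mult_left_mono mult_right_mono) auto
      finally show ?case .
    qed
    have "((\<lambda>t. norm (A t) * (M * C)) \<longlongrightarrow> norm (0::real^'n^'m) * (M * C)) F" by (intro tendsto_intros A)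
    then show "((\<lambda>t. norm (A t) * (M * C)) \<longlongrightarrow> 0) F" by simp
  qed
qed

text \<open>At a focal point \<open>t0\<close> the kernel of \<open>Y t0\<close> is mapped by \<open>P t0 Y1 t0\<close> into the orthogonal complement
  of the range of \<open>Y t0\<close>, so \<open>Y\<close> becomes injective at first order.\<close>

lemma conjoined_injective_bound:
  assumes Y: "conjoined Y Y1" and t0: "t0 \<in> S"
  shows "\<exists>k>0. \<exists>e>0. \<forall>t\<in>S. \<forall>c. \<bar>t - t0\<bar> < e \<longrightarrow> k * \<bar>t - t0\<bar> * norm c \<le> norm (Y t *v c)"
proof (rule ccontr)
  assume neg: "\<not> ?thesis"
  let ?Z = "Zmat Y Y1"
  \<comment> \<open>Negating the bound for all \<open>k\<close> and \<open>e\<close> of the form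
    \<open>1 / real (Suc n)\<close> yields points \<open>t n\<close> and, after normalization, unit
    vectors \<open>d n\<close> on which \<open>Y (t n)\<close> is of smaller order than the distance
    to \<open>t0\<close>.\<close>
  have "\<exists>t c. t \<in> S \<and> \<bar>t - t0\<bar> < 1 / real (Suc n) \<and> norm (Y t *v c) < 1 / real (Suc n) * \<bar>t - t0\<bar> * norm c" for n
  proof -
    have "1 / real (Suc n) > 0" by simp
    then have "\<not> (\<forall>t\<in>S. \<forall>c. \<bar>t - t0\<bar> < 1 / real (Suc n) \<longrightarrow> 1 / real (Suc n) * \<bar>t - t0\<bar> * norm c \<le> norm (Y t *v c))"
      using neg by blast
    then show ?thesis unfolding not_le[symmetric] by blast
  qed
  then obtain t c where tc: "\<And>n. t n \<in> S" "\<And>n. \<bar>t n - t0\<bar> < 1 / real (Suc n)"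
    "\<And>n. norm (Y (t n) *v c n) < 1 / real (Suc n) * \<bar>t n - t0\<bar> * norm (c n)" by metis
  have cn: "norm (c n) > 0" and tn: "t n \<noteq> t0" for n
    using tc(3)[of n] norm_ge_zero[of "Y (t n) *v c n"] by (cases "c n = 0"; cases "t n = t0"; simp)+
  define d where "d n = c n /\<^sub>R norm (c n)" for n
  have d1: "norm (d n) = 1" for n using cn[of n] by (simp add: d_def)
  have Yd: "norm (Y (t n) *v d n) \<le> 1 / real (Suc n) * \<bar>t n - t0\<bar>" for n
  proof -
    have "norm (Y (t n) *v d n) = norm (Y (t n) *v c n) / norm (c n)"
      by (simp add: d_def matrix_vector_mult_scaleR divide_inverse mult.commute)
    also have "\<dots> \<le> 1 / real (Suc n) * \<bar>t n - t0\<bar>"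
      using tc(3)[of n] cn[of n] by (simp add: pos_divide_le_eq)
    finally show ?thesis .
  qed
  have "\<forall>n. d n \<in> sphere 0 1" using d1 by simp
  then obtain d' r where dr: "d' \<in> sphere 0 1" "strict_mono r" "(d \<circ> r) \<longlonglongrightarrow> d'"
    using compact_sphere[of "0::real^'d" 1] unfolding compact_def by metis
  have inv0: "(\<lambda>n. 1 / real (Suc n)) \<longlonglongrightarrow> 0" using LIMSEQ_Suc[OF lim_1_over_n] by simp
  have tl: "(\<lambda>n. t n) \<longlonglongrightarrow> t0"
  proof -
    have "(\<lambda>n. t n - t0) \<longlonglongrightarrow> 0"
    proof (rule Lim_null_comparison[OF _ inv0])
      have "norm (t n - t0) \<le> 1 / real (Suc n)" for n using tc(2)[of n] by simp
      then show "\<forall>\<^sub>F n in sequentially. norm (t n - t0) \<le> 1 / real (Suc n)" by (rule always_eventually[OF allI])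
    qed
    then show ?thesis by (simp add: LIM_zero_iff)
  qed
  then have tr: "(\<lambda>n. t (r n)) \<longlonglongrightarrow> t0" using LIMSEQ_subseq_LIMSEQ[OF tl dr(2)] by (simp add: o_def)
  have filt: "filterlim (\<lambda>n. t (r n)) (at t0 within S) sequentially"
    unfolding filterlim_at using tr tc(1) tn by (auto intro: always_eventually)
  have Yder: "(Y has_vector_derivative Y1 t0) (at t0 within S)" using Y t0 by (simp add: conjoined_def)
  have "(Y \<longlongrightarrow> Y t0) (at t0 within S)" using has_vector_derivative_continuous[OF Yder] by (simp add: continuous_within)
  then have Yt: "(\<lambda>n. Y (t (r n))) \<longlonglongrightarrow> Y t0" using filterlim_compose filt by blast
  have quot: "(\<lambda>n. (Y (t (r n)) - Y t0) /\<^sub>R (t (r n) - t0)) \<longlonglongrightarrow> Y1 t0"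
    using filterlim_compose[OF Yder[unfolded has_vector_derivative_iff_tendsto] filt] .
  have dl: "(\<lambda>n. d (r n)) \<longlonglongrightarrow> d'" using dr(3) by (simp add: o_def)
  note mvt = bounded_bilinear.tendsto[OF bounded_bilinear_matrix_vector_mult]
  have rinv: "(\<lambda>n. 1 / real (Suc (r n))) \<longlonglongrightarrow> 0" using LIMSEQ_subseq_LIMSEQ[OF inv0 dr(2)] by (simp add: o_def)
  have "(\<lambda>n. Y (t (r n)) *v d (r n)) \<longlonglongrightarrow> 0"
  proof (rule Lim_null_comparison[OF _ rinv])
    have "norm (Y (t (r n)) *v d (r n)) \<le> 1 / real (Suc (r n))" for n
    proof -
      have "1 / real (Suc (r n)) \<le> 1" by simp
      then have "\<bar>t (r n) - t0\<bar> \<le> 1" using tc(2)[of "r n"] by linarith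
      then have "1 / real (Suc (r n)) * \<bar>t (r n) - t0\<bar> \<le> 1 / real (Suc (r n)) * 1" by (intro mult_left_mono) auto
      then show ?thesis using Yd[of "r n"] by linarith
    qed
    then show "\<forall>\<^sub>F n in sequentially. norm (Y (t (r n)) *v d (r n)) \<le> 1 / real (Suc (r n))" by simp
  qed
  then have Y0: "Y t0 *v d' = 0" using LIMSEQ_unique[OF mvt[OF Yt dl]] by blast
  define p where "p = ?Z t0 *v d'"
  have iso: "p \<bullet> (Y t0 *v e) = 0" for e
  proof -
    have "(Y t0 *v d') \<bullet> (?Z t0 *v e) = (?Z t0 *v d') \<bullet> (Y t0 *v e)" using Y t0 by (simp add: conjoined_def)
    then show ?thesis by (simp add: Y0 p_def)
  qed
  \<comment> \<open>As \<open>p\<close> is orthogonal to the range of \<open>Y t0\<close>, that term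
    drops out of the difference quotient and only the small vector
    \<open>Y (t (r n)) *v d (r n)\<close> is left.\<close>
  have q: "p \<bullet> (((Y (t (r n)) - Y t0) /\<^sub>R (t (r n) - t0)) *v d (r n)) = (p \<bullet> (Y (t (r n)) *v d (r n))) / (t (r n) - t0)" for n
    using iso[of "d (r n)"]
    by (simp add: scaleR_matrix_vector_assoc[symmetric] matrix_vector_mult_diff_rdistrib inner_diff_right divide_inverse mult.commute)
  have "(\<lambda>n. (p \<bullet> (Y (t (r n)) *v d (r n))) / (t (r n) - t0)) \<longlonglongrightarrow> 0"
  proof (rule Lim_null_comparison)
    have "norm ((p \<bullet> (Y (t (r n)) *v d (r n))) / (t (r n) - t0)) \<le> norm p * (1 / real (Suc (r n)))" for n
    proof -
      have "\<bar>p \<bullet> (Y (t (r n)) *v d (r n))\<bar> \<le> norm p * norm (Y (t (r n)) *v d (r n))" by (rule Cauchy_Schwarz_ineq2)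
      also have "\<dots> \<le> norm p * (1 / real (Suc (r n)) * \<bar>t (r n) - t0\<bar>)" by (intro mult_left_mono Yd) simp
      finally have "\<bar>p \<bullet> (Y (t (r n)) *v d (r n))\<bar> \<le> (norm p * (1 / real (Suc (r n)))) * \<bar>t (r n) - t0\<bar>" by (simp only: mult.assoc)
      then show ?thesis using tn[of "r n"] by (simp add: abs_divide pos_divide_le_eq)
    qed
    then show "\<forall>\<^sub>F n in sequentially. norm ((p \<bullet> (Y (t (r n)) *v d (r n))) / (t (r n) - t0)) \<le> norm p * (1 / real (Suc (r n)))" by simp
    show "(\<lambda>n. norm p * (1 / real (Suc (r n)))) \<longlonglongrightarrow> 0" using tendsto_mult_left[OF rinv, of "norm p"] by simp
  qed
  moreover have "(\<lambda>n. p \<bullet> (((Y (t (r n)) - Y t0) /\<^sub>R (t (r n) - t0)) *v d (r n))) \<longlonglongrightarrow> p \<bullet> (Y1 t0 *v d')"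
    by (intro tendsto_inner tendsto_const mvt quot dl)
  ultimately have "p \<bullet> (Y1 t0 *v d') = 0" unfolding q using LIMSEQ_unique by blast
  \<comment> \<open>Hence the pairing just computed is the quadratic form of \<open>P t0\<close> at
    \<open>Y1 t0 *v d'\<close>, and positivity annihilates this vector; then all Cauchy data of
    \<open>d'\<close> vanish.\<close>
  moreover have "p = P t0 *v (Y1 t0 *v d')" by (simp add: p_def Zmat_mom mom_def Y0)
  ultimately have "Y1 t0 *v d' = 0" using P_pos[OF t0, of "Y1 t0 *v d'"] by (auto simp: inner_commute)
  then have "?Z t0 *v d' = 0" by (simp add: Zmat_mom Y0)
  then have "d' = 0" using Y t0 Y0 by (simp add: conjoined_def)
  then show False using dr(1) by simp
qed

text \<open>Picone's identity for \<open>f = Y c\<close>, where \<open>c\<close> is any choice of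
  coefficients. The boundary form is independent of the choice by isotropy, and continuous even
  where \<open>Y\<close> degenerates. Where \<open>Y\<close> is invertible, its derivative falls
  short of the energy by the quadratic form of \<open>P\<close> at \<open>f1 - Y1 c\<close>.\<close>

lemma conjoined_boundary_form:
  assumes Y: "conjoined Y Y1" and f: "\<And>t. t \<in> S \<Longrightarrow> (f has_vector_derivative f1 t) (at t within S)"
    and c: "\<And>t. t \<in> T \<Longrightarrow> Y t *v c t = f t" and T: "T \<subseteq> S"
  shows "continuous_on T (\<lambda>t. f t \<bullet> (Zmat Y Y1 t *v c t))"
    "\<And>t0. t0 \<in> interior T \<Longrightarrow> invertible (Y t0) \<Longrightarrow>
      \<exists>D. ((\<lambda>t. f t \<bullet> (Zmat Y Y1 t *v c t)) has_vector_derivative D) (at t0) \<and> D \<le> energy t0 (f t0) (f1 t0) (f t0) (f1 t0)"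
proof -
  let ?Z = "Zmat Y Y1"
  have Yd: "(Y has_vector_derivative Y1 t) (at t within S)" and Zd: "(?Z has_vector_derivative Fmat Y Y1 t) (at t within S)"
    and iso: "(Y t *v a) \<bullet> (?Z t *v b) = (?Z t *v a) \<bullet> (Y t *v b)" if "t \<in> S" for t a b
    using Y that by (auto simp: conjoined_def)
  show "continuous_on T (\<lambda>t. f t \<bullet> (?Z t *v c t))"
    unfolding continuous_on_def
  proof
    fix t0 assume t0T: "t0 \<in> T"
    then have t0: "t0 \<in> S" using T by blast
    let ?F = "at t0 within T"
    let ?c0 = "c t0"
    have lim: "(g \<longlongrightarrow> g t0) ?F" if "(g has_vector_derivative g') (at t0 within S)" for g :: "real \<Rightarrow> 'z::real_normed_vector" and g'
      using has_vector_derivative_continuous[OF has_vector_derivative_within_subset[OF that T]] by (simp add: continuous_within)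
    obtain k e where k: "k > 0" "e > 0" "\<And>t c. t \<in> S \<Longrightarrow> \<bar>t - t0\<bar> < e \<Longrightarrow> k * \<bar>t - t0\<bar> * norm c \<le> norm (Y t *v c)"
      using conjoined_injective_bound[OF Y t0] by blast
    \<comment> \<open>\<open>g s\<close> is \<open>Y s\<close> applied to \<open>c s - c t0\<close>.
      It is differentiable and zero at \<open>t0\<close>, hence of order \<open>s - t0\<close>; the
      injectivity bound of the same order keeps \<open>c\<close> bounded near
      \<open>t0\<close>.\<close>
    define g where "g t = f t - Y t *v ?c0" for t
    have "((\<lambda>t. Y t *v ?c0) has_vector_derivative Y1 t0 *v ?c0) (at t0 within S)"
      by (rule bounded_linear.has_vector_derivative[OF bounded_bilinear.bounded_linear_left[OF bounded_bilinear_matrix_vector_mult] Yd[OF t0]])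
    then have "(g has_vector_derivative f1 t0 - Y1 t0 *v ?c0) (at t0 within S)"
      unfolding g_def[abs_def] by (intro has_vector_derivative_diff f[OF t0])
    from has_vector_derivative_within_subset[OF this T]
    have gq: "((\<lambda>s. (g s - g t0) /\<^sub>R (s - t0)) \<longlongrightarrow> f1 t0 - Y1 t0 *v ?c0) ?F"
      unfolding has_vector_derivative_iff_tendsto .
    have g0: "g t0 = 0" using c[OF t0T] by (simp add: g_def)
    define G where "G = norm (f1 t0 - Y1 t0 *v ?c0) + 1"
    have "\<forall>\<^sub>F s in ?F. norm ((g s - g t0) /\<^sub>R (s - t0)) < G"
      by (rule order_tendstoD(2)[OF tendsto_norm[OF gq]]) (simp add: G_def)
    moreover have "\<forall>\<^sub>F s in ?F. s \<in> T \<and> s \<noteq> t0 \<and> \<bar>s - t0\<bar> < e"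
      using k(2) by (auto simp: eventually_at dist_real_def)
    ultimately have bd: "\<forall>\<^sub>F s in ?F. norm (c s) \<le> G / k + norm ?c0"
    proof eventually_elim
      case (elim s)
      then have sS: "s \<in> S" "0 < \<bar>s - t0\<bar>" using T by auto
      have "Y s *v (c s - ?c0) = g s" using c[of s] elim by (simp add: g_def matrix_vector_mult_diff_distrib)
      then have "k * \<bar>s - t0\<bar> * norm (c s - ?c0) \<le> norm (g s)" using k(3)[OF sS(1), of "c s - ?c0"] elim by simp
      also have "norm (g s) \<le> G * \<bar>s - t0\<bar>"
      proof -
        have "norm (g s) / \<bar>s - t0\<bar> < G" using elim(1) g0 by (simp add: divide_inverse mult.commute)
        then show ?thesis using sS(2) by (simp add: pos_divide_less_eq less_imp_le)
      qed
      finally have "\<bar>s - t0\<bar> * (k * norm (c s - ?c0)) \<le> \<bar>s - t0\<bar> * G" by (simp add: mult_ac)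
      then have "k * norm (c s - ?c0) \<le> G" using sS(2) by (rule mult_left_le_imp_le)
      then have "norm (c s - ?c0) \<le> G / k" using k(1) by (simp add: pos_le_divide_eq mult.commute)
      then show ?case using norm_triangle_ineq[of "c s - ?c0" ?c0] by simp
    qed
    define M where "M = G / k + norm ?c0"
    have dZ: "((\<lambda>t. ?Z t - ?Z t0) \<longlongrightarrow> 0) ?F" and dY: "((\<lambda>t. Y t0 - Y t) \<longlongrightarrow> 0) ?F" and df: "((\<lambda>t. f t - f t0) \<longlongrightarrow> 0) ?F"
      using lim[OF Zd[OF t0]] tendsto_minus[OF LIM_zero[OF lim[OF Yd[OF t0]]]] lim[OF f[OF t0]] by (simp_all add: LIM_zero)
    note z1 = mv_tendsto_zero[OF dZ bd] and y1 = mv_tendsto_zero[OF dY bd]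
    have z2: "((\<lambda>t. (f t - f t0) \<bullet> (?Z t *v c t)) \<longlongrightarrow> 0) ?F"
    proof -
      obtain C where C: "C > 0" "\<And>(A::real^'d^'d) x. norm (A *v x) \<le> norm A * norm x * C"
        using bounded_bilinear.pos_bounded[OF bounded_bilinear_matrix_vector_mult] by blast
      have "\<forall>\<^sub>F t in ?F. norm (?Z t) < norm (?Z t0) + 1"
        by (rule order_tendstoD(2)[OF tendsto_norm[OF lim[OF Zd[OF t0]]]]) simp
      then have "\<forall>\<^sub>F t in ?F. norm ((f t - f t0) \<bullet> (?Z t *v c t)) \<le> norm (f t - f t0) * ((norm (?Z t0) + 1) * M * C)"
        using bd
      proof eventually_elim
        case (elim t)
        have "norm ((f t - f t0) \<bullet> (?Z t *v c t)) \<le> norm (f t - f t0) * norm (?Z t *v c t)"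
          by (simp only: real_norm_def Cauchy_Schwarz_ineq2)
        also have "\<dots> \<le> norm (f t - f t0) * (norm (?Z t) * norm (c t) * C)" by (intro mult_left_mono C(2)) simp
        also have "\<dots> \<le> norm (f t - f t0) * ((norm (?Z t0) + 1) * M * C)"
          using elim C(1) by (intro mult_left_mono mult_right_mono mult_mono) (auto simp: M_def)
        finally show ?case .
      qed
      moreover have "((\<lambda>t. norm (f t - f t0) * ((norm (?Z t0) + 1) * M * C)) \<longlongrightarrow> 0) ?F"
        using tendsto_mult_right[OF tendsto_norm_zero[OF df], of "(norm (?Z t0) + 1) * M * C"] by simp
      ultimately show ?thesis by (rule Lim_null_comparison)
    qed
    \<comment> \<open>All terms but the last tend to zero, using only boundedness of
      \<open>c\<close>. Isotropy at \<open>t0\<close> trades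
      \<open>f t0 \<bullet> (?Z t0 *v c t)\<close> for a pairing with \<open>Y t0 *v c t\<close>,
      which is close to \<open>f t\<close>.\<close>
    let ?B = "\<lambda>t. (f t - f t0) \<bullet> (?Z t *v c t) + f t0 \<bullet> ((?Z t - ?Z t0) *v c t)
       + (?Z t0 *v ?c0) \<bullet> ((Y t0 - Y t) *v c t) + (?Z t0 *v ?c0) \<bullet> (f t - f t0) + f t0 \<bullet> (?Z t0 *v ?c0)"
    have "(?B \<longlongrightarrow> 0 + f t0 \<bullet> 0 + (?Z t0 *v ?c0) \<bullet> 0 + (?Z t0 *v ?c0) \<bullet> 0 + f t0 \<bullet> (?Z t0 *v ?c0)) ?F"
      by (intro tendsto_intros z1 y1 z2 df)
    moreover have "?B t = f t \<bullet> (?Z t *v c t)" if t: "t \<in> T" for t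
    proof -
      have "f t0 \<bullet> (?Z t0 *v c t) = (?Z t0 *v ?c0) \<bullet> (Y t0 *v c t)"
        using iso[OF t0, of ?c0 "c t"] c[OF t0T] by simp
      then show ?thesis
        using c[OF t] by (simp add: inner_diff_left inner_diff_right matrix_vector_mult_diff_rdistrib inner_commute[of "f t0" "?Z t0 *v ?c0"])
    qed
    then have "\<forall>\<^sub>F t in ?F. ?B t = f t \<bullet> (?Z t *v c t)" by (auto simp: eventually_at_filter)
    ultimately show "((\<lambda>t. f t \<bullet> (?Z t *v c t)) \<longlongrightarrow> f t0 \<bullet> (?Z t0 *v c t0)) ?F"
      using Lim_transform_eventually by fastforce
  qed
  show "\<exists>D. ((\<lambda>t. f t \<bullet> (?Z t *v c t)) has_vector_derivative D) (at t0) \<and> D \<le> energy t0 (f t0) (f1 t0) (f t0) (f1 t0)"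
    if t0i: "t0 \<in> interior T" and inv0: "invertible (Y t0)" for t0
  proof -
    have t0T: "t0 \<in> T" and t0S: "t0 \<in> interior S" using t0i interior_subset interior_mono[OF T] by blast+
    then have t0: "t0 \<in> S" using T by blast
    have at: "at t0 within S = at t0" using t0S by (rule at_within_interior)
    obtain k e where k: "k > 0" "e > 0" "\<And>t c. t \<in> S \<Longrightarrow> \<bar>t - t0\<bar> < e \<Longrightarrow> k * \<bar>t - t0\<bar> * norm c \<le> norm (Y t *v c)"
      using conjoined_injective_bound[OF Y t0] by blast
    obtain e' where e': "e' > 0" "ball t0 e' \<subseteq> T" using t0i by (meson mem_interior)
    \<comment> \<open>Near \<open>t0\<close> but off it, invertibility comes from the injectivity
      bound; at \<open>t0\<close> it is assumed. So near \<open>t0\<close> the coefficients are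
      forced to be \<open>c'\<close>, which is differentiable.\<close>
    have inv: "invertible (Y t) \<and> t \<in> T" if "\<bar>t - t0\<bar> < min e e'" for t
    proof
      show tT: "t \<in> T" using e' that by (auto simp: ball_def dist_real_def)
      show "invertible (Y t)"
      proof (cases "t = t0")
        case False
        have "x = 0" if "Y t *v x = 0" for x
        proof -
          have "k * \<bar>t - t0\<bar> * norm x \<le> 0" using k(3)[of t x] tT T \<open>\<bar>t - t0\<bar> < min e e'\<close> that by auto
          then show ?thesis using False k(1) by (simp add: mult_le_0_iff)
        qed
        then show ?thesis by (simp add: invertible_left_inverse matrix_left_invertible_ker)
      qed (use inv0 in simp)
    qed
    define c' where "c' t = matrix_inv (Y t) *v f t" for t
    have cc': "c t = c' t" if "\<bar>t - t0\<bar> < min e e'" for t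
      using c[of t] matrix_inv_mult(2)[of "Y t"] inv[OF that] by (simp add: c'_def matrix_vector_mul_assoc flip: c)
    have ev: "\<forall>\<^sub>F s in at t0. invertible (Y s)"
      unfolding eventually_at using inv k(2) e'(1) by (intro exI[of _ "min e e'"]) (auto simp: dist_real_def)
    have "\<exists>D. (c' has_vector_derivative D) (at t0)"
      unfolding c'_def[abs_def]
      using bounded_bilinear.has_vector_derivative[OF bounded_bilinear_matrix_vector_mult
          has_vector_derivative_matrix_inv[OF Yd[OF t0, unfolded at] ev inv0] f[OF t0, unfolded at]] by blast
    then obtain cD where c'D: "(c' has_vector_derivative cD) (at t0)" by blast
    have cD: "(c has_vector_derivative cD) (at t0)"
      by (rule has_vector_derivative_transform_within_open[OF c'D, of "ball t0 (min e e')"])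
        (use k(2) e'(1) cc' in \<open>auto simp: dist_real_def abs_minus_commute[of t0]\<close>)
    note mvd = bounded_bilinear.has_vector_derivative[OF bounded_bilinear_matrix_vector_mult]
    have "((\<lambda>t. Y t *v c t) has_vector_derivative Y t0 *v cD + Y1 t0 *v c t0) (at t0)"
      by (rule mvd[OF Yd[OF t0, unfolded at] cD])
    then have "(f has_vector_derivative Y t0 *v cD + Y1 t0 *v c t0) (at t0)"
      by (rule has_vector_derivative_transform_within_open[of _ _ _ "ball t0 (min e e')"])
        (use k(2) e'(1) c inv in \<open>auto simp: dist_real_def abs_minus_commute[of t0]\<close>)
    then have f1: "f1 t0 = Y t0 *v cD + Y1 t0 *v c t0"
      using f[OF t0, unfolded at] vector_derivative_unique_at by blast
    let ?a = "f1 t0" and ?r = "Y1 t0 *v c t0"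
    have Zc: "?Z t0 *v c t0 = P t0 *v ?r + Q t0 *v f t0" by (simp add: Zmat_mom mom_def c[OF t0T])
    have Fc: "Fmat Y Y1 t0 *v c t0 = force t0 (f t0) ?r" by (simp add: Fmat_force c[OF t0T])
    have "((\<lambda>t. f t \<bullet> (?Z t *v c t)) has_vector_derivative
        f t0 \<bullet> (?Z t0 *v cD + Fmat Y Y1 t0 *v c t0) + ?a \<bullet> (?Z t0 *v c t0)) (at t0)"
      by (rule bounded_bilinear.has_vector_derivative[OF bounded_bilinear_inner f[OF t0, unfolded at] mvd[OF Zd[OF t0, unfolded at] cD]])
    \<comment> \<open>The gap is fact 3, the nonnegative square in Picone's identity; symmetry of
      \<open>P\<close> in fact 4 matches the mixed terms.\<close>
    moreover have "f t0 \<bullet> (?Z t0 *v cD + Fmat Y Y1 t0 *v c t0) + ?a \<bullet> (?Z t0 *v c t0) \<le> energy t0 (f t0) ?a (f t0) ?a"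
    proof -
      have 1: "f t0 \<bullet> (?Z t0 *v cD) = (P t0 *v ?r + Q t0 *v f t0) \<bullet> (?a - ?r)"
        using iso[OF t0, of "c t0" cD] by (simp add: c[OF t0T] f1 Zc)
      have 2: "f t0 \<bullet> force t0 (f t0) ?r = ?r \<bullet> (Q t0 *v f t0) + (R t0 *v f t0) \<bullet> f t0"
        using QT_dot[of t0 ?r "f t0"] by (simp add: force_def inner_add_right inner_commute del: transpose_matrix_vector)
      have 3: "0 \<le> (P t0 *v (?a - ?r)) \<bullet> (?a - ?r)"
        using P_pos[OF t0, of "?a - ?r"] by (cases "?a - ?r = 0") (auto simp: inner_commute)
      have 4: "(P t0 *v ?a) \<bullet> ?r = (P t0 *v ?r) \<bullet> ?a" using P_dot[OF t0, of ?a ?r] by (simp add: inner_commute)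
      show ?thesis
        unfolding inner_add_right Zc Fc 1 2 energy_eq using 3 4
        by (simp add: inner_add_left inner_add_right inner_diff_left inner_diff_right matrix_vector_mult_diff_distrib
            inner_commute[of ?a] inner_commute[of ?r])
    qed
    ultimately show ?thesis by blast
  qed
qed

text \<open>The boundary form is zero at both ends because \<open>f\<close> is, and its derivative
  is dominated by the energy. Finitely many singular points are harmless for the fundamental theorem
  since the boundary form is continuous across them.\<close>

lemma conjoined_energy_nonneg:
  assumes Y: "conjoined Y Y1" and f: "\<And>t. t \<in> S \<Longrightarrow> (f has_vector_derivative f1 t) (at t within S)" and f1: "continuous_on S f1"
    and ab: "\<alpha> \<in> S" "\<beta> \<in> S" "\<alpha> \<le> \<beta>" "f \<alpha> = 0" "f \<beta> = 0"
    and r: "\<And>t. t \<in> {\<alpha>..\<beta>} \<Longrightarrow> f t \<in> range (\<lambda>c. Y t *v c)"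
    and fin: "finite {t \<in> interior S. \<not> invertible (Y t)}"
  shows "0 \<le> integral {\<alpha>..\<beta>} (\<lambda>t. energy t (f t) (f1 t) (f t) (f1 t))"
proof -
  have T: "{\<alpha>..\<beta>} \<subseteq> S" using Icc_subset_interval[OF interval ab(1,2)] .
  have "\<exists>c. Y t *v c = f t" if "t \<in> {\<alpha>..\<beta>}" for t using r[OF that] by auto
  then obtain c where c: "\<And>t. t \<in> {\<alpha>..\<beta>} \<Longrightarrow> Y t *v c t = f t" by metis
  let ?B = "\<lambda>t. f t \<bullet> (Zmat Y Y1 t *v c t)" and ?e = "\<lambda>t. energy t (f t) (f1 t) (f t) (f1 t)"
  note bf = conjoined_boundary_form[OF Y f c T]
  let ?K = "{t \<in> interior S. \<not> invertible (Y t)}"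
  have ex: "\<exists>D. (?B has_vector_derivative D) (at t) \<and> D \<le> ?e t" if "t \<in> {\<alpha><..<\<beta>} - ?K" for t
  proof (rule bf(2))
    show ti: "t \<in> interior {\<alpha>..\<beta>}" using that by simp
    then show "invertible (Y t)" using that interior_mono[OF T] by blast
  qed
  define D where "D t = (SOME D. (?B has_vector_derivative D) (at t) \<and> D \<le> ?e t)" for t
  have D: "(?B has_vector_derivative D t) (at t)" "D t \<le> ?e t" if "t \<in> {\<alpha><..<\<beta>} - ?K" for t
    using someI_ex[OF ex[OF that]] unfolding D_def by blast+
  \<comment> \<open>At the exceptional points the value is irrelevant for the integral; choosing the
    energy there makes the comparison hold everywhere.\<close>
  define D' where "D' t = (if t \<in> {\<alpha><..<\<beta>} - ?K then D t else ?e t)" for t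
  have D'i: "(D' has_integral ?B \<beta> - ?B \<alpha>) {\<alpha>..\<beta>}"
  proof (rule fundamental_theorem_of_calculus_interior_strong[OF fin ab(3) _ bf(1)])
    fix t assume t: "t \<in> {\<alpha><..<\<beta>} - ?K"
    show "(?B has_vector_derivative D' t) (at t)" unfolding D'_def if_P[OF t] by (rule D(1)[OF t])
  qed
  have "continuous_on S f" using has_vector_derivative_continuous[OF f] by (simp add: continuous_on_eq_continuous_within)
  then have "continuous_on {\<alpha>..\<beta>} ?e" using f1 T by (intro energy_cont) (blast intro: continuous_on_subset)+
  then have ei: "(?e has_integral integral {\<alpha>..\<beta>} ?e) {\<alpha>..\<beta>}" by (intro integrable_integral integrable_continuous_real)
  have "D' t \<le> ?e t" for t
  proof (cases "t \<in> {\<alpha><..<\<beta>} - ?K")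
    case True
    show ?thesis unfolding D'_def if_P[OF True] by (rule D(2)[OF True])
  next
    case False
    show ?thesis unfolding D'_def if_not_P[OF False] by (rule order_refl)
  qed
  then have "?B \<beta> - ?B \<alpha> \<le> integral {\<alpha>..\<beta>} ?e"
    by (intro has_integral_le[OF D'i ei])
  then show ?thesis using ab by simp
qed

end

section \<open>Nonnegativity of the form on functions in the range of a conjoined basis\<close>

context sl_operator
begin

text \<open>The condition at singular points survives the cutoff because the range of
  \<open>Y t\<close> is a linear space, so \<open>conjoined_energy_nonneg\<close> applies to the cut
  off functions and nonnegativity passes to the limit.\<close>

lemma form_nonneg:
  assumes Y: "conjoined Y Y1" and fin: "finite {t \<in> interior S. \<not> invertible (Y t)}"
    and f: "jet S f g h" "dirichlet f"
    and r: "\<And>t. t \<in> interior S \<Longrightarrow> \<not> invertible (Y t) \<Longrightarrow> f t \<in> range (\<lambda>c. Y t *v c)"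
  shows "0 \<le> form f f"
proof -
  have rng: "f t \<in> range (\<lambda>c. Y t *v c)" if tS: "t \<in> S" for t
  proof -
    have "t \<in> frontier S \<or> t \<in> interior S" using tS closed by (simp add: frontier_def)
    then consider "t \<in> frontier S" | "t \<in> interior S" "\<not> invertible (Y t)" | "invertible (Y t)" by blast
    then show ?thesis
    proof cases
      case 1
      then show ?thesis using f(2) by (auto simp: dirichlet_def intro!: image_eqI[of _ _ 0])
    next
      case 3
      then have "f t = Y t *v (matrix_inv (Y t) *v f t)"
        by (simp add: matrix_vector_mul_assoc matrix_inv_mult)
      then show ?thesis by blast
    qed (rule r)
  qed
  obtain t0 where t0: "t0 \<in> S" using nondegenerate by blast
  obtain n0 :: nat where n0: "\<bar>t0\<bar> < real n0" using reals_Archimedean2 by blast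
  have nn: "0 \<le> form (\<lambda>t. cut n t *\<^sub>R f t) (\<lambda>t. cut n t *\<^sub>R f t)" if n: "n \<ge> n0" for n
  proof -
    have "\<bar>t0\<bar> \<le> 2 * real n + 2" using n n0 by simp
    then obtain \<alpha> \<beta> where ab: "\<alpha> \<in> S" "\<beta> \<in> S" "\<alpha> \<le> \<beta>"
      "\<And>f. dirichlet f \<Longrightarrow> cut n \<alpha> *\<^sub>R f \<alpha> = 0" "\<And>f. dirichlet f \<Longrightarrow> cut n \<beta> *\<^sub>R f \<beta> = 0"
      "\<And>t. t \<in> S \<Longrightarrow> t \<notin> {\<alpha>..\<beta>} \<Longrightarrow> cut n t = 0"
      using cut_truncation[OF t0, of n] by metis
    note jf = cut_jet[OF f(1), of n, unfolded cut_jet_def]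
    let ?f0 = "\<lambda>t. cut n t *\<^sub>R f t" and ?f1 = "\<lambda>t. cut1 n t *\<^sub>R f t + cut n t *\<^sub>R g t"
    have "form ?f0 ?f0 = integral {\<alpha>..\<beta>} (\<lambda>t. energy t (?f0 t) (?f1 t) (?f0 t) (?f1 t))
        - mom \<beta> (?f0 \<beta>) (?f1 \<beta>) \<bullet> ?f0 \<beta> + mom \<alpha> (?f0 \<alpha>) (?f1 \<alpha>) \<bullet> ?f0 \<alpha>"
      by (rule form_interval[OF jf jf ab(1-3)]) (simp add: ab(6))
    moreover have "0 \<le> integral {\<alpha>..\<beta>} (\<lambda>t. energy t (?f0 t) (?f1 t) (?f0 t) (?f1 t))"
    proof (rule conjoined_energy_nonneg[OF Y _ _ ab(1-3) ab(4,5)[OF f(2)] _ fin])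
      show "(?f0 has_vector_derivative ?f1 t) (at t within S)" if "t \<in> S" for t
        using jet_derivs(3)[OF interval jf that] .
      show "continuous_on S ?f1" using jet_derivs(2)[OF interval jf] .
      show "?f0 t \<in> range (\<lambda>c. Y t *v c)" if t: "t \<in> {\<alpha>..\<beta>}" for t
      proof -
        have "t \<in> S" using t Icc_subset_interval[OF interval ab(1,2)] by blast
        then obtain c where "f t = Y t *v c" using rng by blast
        then have "?f0 t = Y t *v (cut n t *\<^sub>R c)" by (simp add: matrix_vector_mult_scaleR)
        then show ?thesis by blast
      qed
    qed
    ultimately show ?thesis using ab(4,5)[OF f(2)] by simp
  qed
  have "\<forall>\<^sub>F n in sequentially. 0 \<le> form (\<lambda>t. cut n t *\<^sub>R f t) (\<lambda>t. cut n t *\<^sub>R f t)"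
    using eventually_ge_at_top[of n0] by eventually_elim (rule nn)
  then show ?thesis by (rule tendsto_lowerbound[OF form_cut_cut[OF f(1) f(1)]]) simp
qed

end

section \<open>Conjoined bases from solutions, and the finite left end\<close>

context sl_coefficients
begin

definition columns :: "('d \<Rightarrow> real \<Rightarrow> real^'d) \<Rightarrow> real \<Rightarrow> real^'d^'d" where
  "columns y t = (\<chi> i k. y k t $ i)"

lemma columns_mult: "columns y t *v c = (\<Sum>k\<in>UNIV. c $ k *\<^sub>R y k t)"
  by (simp add: columns_def vec_eq_iff matrix_vector_mult_def mult.commute)

lemma columns_deriv:
  assumes "\<And>k. (y k has_vector_derivative y1 k t) (at t within T)"
  shows "(columns y has_vector_derivative columns y1 t) (at t within T)"
proof -
  have lin: "bounded_linear (\<lambda>v :: real^'d. (\<chi> i j. if j = k then v $ i else 0) :: real^'d^'d)" for k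
    unfolding linear_conv_bounded_linear[symmetric] by (rule linearI) (simp_all add: vec_eq_iff)
  have eq: "columns z = (\<lambda>t. \<Sum>k\<in>UNIV. (\<chi> i j. if j = k then z k t $ i else 0))" for z
    by (simp add: fun_eq_iff columns_def vec_eq_iff)
  show ?thesis
    unfolding eq by (intro has_vector_derivative_sum bounded_linear.has_vector_derivative[OF lin] assms)
qed

text \<open>Isotropy at one point suffices, since the Wronskian \<open>W\<close> has as derivative
  the difference of two equal energies. Independence of the Cauchy data at \<open>t0\<close> is
  carried to every other point by uniqueness.\<close>

lemma conjoined_from_solutions:
  assumes s: "\<And>k. solution (y k) (y1 k)" and t0: "t0 \<in> S"
    and iso: "\<And>k l. y k t0 \<bullet> mom t0 (y l t0) (y1 l t0) = mom t0 (y k t0) (y1 k t0) \<bullet> y l t0"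
    and ind: "\<And>c::real^'d. (\<Sum>k\<in>UNIV. c $ k *\<^sub>R y k t0) = 0 \<Longrightarrow> (\<Sum>k\<in>UNIV. c $ k *\<^sub>R mom t0 (y k t0) (y1 k t0)) = 0 \<Longrightarrow> c = 0"
  shows "conjoined (columns y) (columns y1)" "\<And>c. solution (\<lambda>t. columns y t *v c) (\<lambda>t. columns y1 t *v c)"
proof -
  let ?Y = "columns y" and ?Y1 = "columns y1"
  have Z: "Zmat ?Y ?Y1 t = columns (\<lambda>k t. mom t (y k t) (y1 k t)) t" for t
    unfolding Zmat_def columns_def mom_def
    by (simp add: vec_eq_iff matrix_matrix_mult_def matrix_vector_mult_def)
  have F: "Fmat ?Y ?Y1 t = columns (\<lambda>k t. force t (y k t) (y1 k t)) t" for t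
    unfolding Fmat_def columns_def force_def
    by (simp add: vec_eq_iff matrix_matrix_mult_def matrix_vector_mult_def del: transpose_matrix_vector)
  have Yd: "(?Y has_vector_derivative ?Y1 t) (at t within S)" if "t \<in> S" for t
    using s that by (intro columns_deriv) (simp add: solution_def)
  have Zd: "(Zmat ?Y ?Y1 has_vector_derivative Fmat ?Y ?Y1 t) (at t within S)" if "t \<in> S" for t
    unfolding Z[abs_def] F using s that by (intro columns_deriv) (simp add: solution_def)
  note mvl = bounded_linear.has_vector_derivative[OF bounded_bilinear.bounded_linear_left[OF bounded_bilinear_matrix_vector_mult]]
  show sol: "solution (\<lambda>t. ?Y t *v c) (\<lambda>t. ?Y1 t *v c)" for c
    unfolding solution_def
  proof (intro conjI ballI)
    fix t assume t: "t \<in> S"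
    show "((\<lambda>t. ?Y t *v c) has_vector_derivative ?Y1 t *v c) (at t within S)" by (rule mvl[OF Yd[OF t]])
    show "((\<lambda>s. mom s (?Y s *v c) (?Y1 s *v c)) has_vector_derivative force t (?Y t *v c) (?Y1 t *v c)) (at t within S)"
      using mvl[OF Zd[OF t], of c] by (simp add: Zmat_mom Fmat_force)
  next
    show "continuous_on S (\<lambda>t. ?Y1 t *v c)"
      unfolding columns_mult using s by (intro continuous_intros) (simp add: solution_def)
  qed
  have wr: "(?Y t *v a) \<bullet> (Zmat ?Y ?Y1 t *v b) = (Zmat ?Y ?Y1 t *v a) \<bullet> (?Y t *v b)" if t: "t \<in> S" for t a b
  proof -
    define W where "W t = mom t (?Y t *v b) (?Y1 t *v b) \<bullet> (?Y t *v a) - mom t (?Y t *v a) (?Y1 t *v a) \<bullet> (?Y t *v b)" for t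
    have "(W has_vector_derivative 0) (at t within S)" if t: "t \<in> S" for t
    proof -
      have d: "((\<lambda>t. ?Y t *v c) has_vector_derivative ?Y1 t *v c) (at t within S)" if "t \<in> S" for t c
        using sol[of c] that by (simp add: solution_def)
      have "(W has_vector_derivative energy t (?Y t *v b) (?Y1 t *v b) (?Y t *v a) (?Y1 t *v a) - energy t (?Y t *v a) (?Y1 t *v a) (?Y t *v b) (?Y1 t *v b)) (at t within S)"
        unfolding W_def[abs_def]
        by (intro has_vector_derivative_diff solution_green[OF sol d order_refl t])
      then show ?thesis using energy_sym[OF t] by simp
    qed
    then have "\<exists>w. \<forall>t\<in>S. W t = w"
      using interval by (intro has_derivative_zero_constant) (auto simp: is_interval_convex has_vector_derivative_def)
    then have "W t = W t0" using t t0 by auto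
    also have "W t0 = 0"
    proof -
      have 1: "mom t0 (?Y t0 *v c) (?Y1 t0 *v c) = (\<Sum>k\<in>UNIV. c $ k *\<^sub>R mom t0 (y k t0) (y1 k t0))" for c
        using Z[of t0] columns_mult[of "\<lambda>k t. mom t (y k t) (y1 k t)" t0 c] by (simp add: Zmat_mom[symmetric])
      let ?m = "\<lambda>k. mom t0 (y k t0) (y1 k t0)"
      have e: "(\<Sum>k\<in>UNIV. a $ k *\<^sub>R ?m k) \<bullet> (\<Sum>l\<in>UNIV. b $ l *\<^sub>R y l t0) = (\<Sum>k\<in>UNIV. \<Sum>l\<in>UNIV. a $ k * b $ l * (?m k \<bullet> y l t0))" for a b :: "real^'d"
        by (simp add: inner_sum_left inner_sum_right sum_distrib_left mult_ac) (rule sum.swap)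
      have sw: "(\<Sum>k\<in>UNIV. \<Sum>l\<in>UNIV. a $ k * b $ l * (?m k \<bullet> y l t0)) = (\<Sum>k\<in>UNIV. \<Sum>l\<in>UNIV. b $ k * a $ l * (?m k \<bullet> y l t0))"
      proof -
        have sy: "?m k \<bullet> y l t0 = ?m l \<bullet> y k t0" for k l using iso[of k l] by (simp add: inner_commute)
        show ?thesis by (subst sum.swap) (intro sum.cong refl, metis sy mult.commute)
      qed
      have "W t0 = (\<Sum>k\<in>UNIV. b $ k *\<^sub>R ?m k) \<bullet> (\<Sum>l\<in>UNIV. a $ l *\<^sub>R y l t0) - (\<Sum>k\<in>UNIV. a $ k *\<^sub>R ?m k) \<bullet> (\<Sum>l\<in>UNIV. b $ l *\<^sub>R y l t0)"
        unfolding W_def 1 by (simp only: columns_mult)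
      then show ?thesis unfolding e sw by simp
    qed
    finally show ?thesis by (simp add: W_def Zmat_mom inner_commute)
  qed
  have nd: "c = 0" if t: "t \<in> S" and z: "?Y t *v c = 0" "Zmat ?Y ?Y1 t *v c = 0" for t c
  proof -
    have "?Y1 t *v c = 0" using z P_inj[OF t] by (simp add: Zmat_mom mom_def)
    then have z0: "?Y t0 *v c = 0" "?Y1 t0 *v c = 0"
      using solution_unique[OF sol t0 t, of c] z(1) by simp_all
    then have "Zmat ?Y ?Y1 t0 *v c = 0" by (simp add: Zmat_mom)
    then show ?thesis using ind[of c] z0(1) unfolding Z columns_mult by simp
  qed
  show "conjoined ?Y ?Y1" unfolding conjoined_def using Yd Zd wr nd by blast
qed

text \<open>The velocity is the inverse of \<open>P\<close> applied to momentum minus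
  \<open>Q y\<close>, and every factor in this expression is continuously differentiable.\<close>

lemma solution_second_derivative:
  assumes s: "solution y y1"
  obtains y2 where "continuous_on S y2" "\<And>t. t \<in> S \<Longrightarrow> (y1 has_vector_derivative y2 t) (at t within S)"
    "\<And>t. t \<in> S \<Longrightarrow> ell t (y t) (y1 t) (y2 t) = 0"
proof -
  let ?I = "\<lambda>t. matrix_inv (P t)"
  define y2 where "y2 t = ?I t *v (force t (y t) (y1 t) - (Q t *v y1 t + Q1 t *v y t)) - ?I t *v (P1 t *v y1 t)" for t
  have yd: "(y has_vector_derivative y1 t) (at t within S)" and md: "((\<lambda>s. mom s (y s) (y1 s)) has_vector_derivative force t (y t) (y1 t)) (at t within S)"
    if "t \<in> S" for t using s that by (auto simp: solution_def)
  have cy: "continuous_on S y" "continuous_on S y1"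
    using has_vector_derivative_continuous[OF yd] s by (auto simp: continuous_on_eq_continuous_within solution_def)
  have PI: "?I t *v (P t *v v) = v" "P t *v (?I t *v v) = v" if "t \<in> S" for t v
    using matrix_inv_mult[OF P_invertible[OF that]] by (simp_all add: matrix_vector_mul_assoc)
  have y1: "y1 t = ?I t *v (mom t (y t) (y1 t) - Q t *v y t)" if "t \<in> S" for t
    using PI(1)[OF that] by (simp add: mom_def)
  show ?thesis
  proof (rule that[of y2])
    show "continuous_on S y2"
      unfolding y2_def force_def
      by (intro continuous_intros cont_mv continuous_on_transpose matrix_inv_P_cont Q_cont R_cont P1_cont Q1_cont cy)
    show "ell t (y t) (y1 t) (y2 t) = 0" if "t \<in> S" for t
      using PI(2)[OF that] by (simp add: ell_def y2_def matrix_vector_mult_diff_distrib)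
    show "(y1 has_vector_derivative y2 t) (at t within S)" if t: "t \<in> S" for t
    proof -
      have inv: "\<forall>\<^sub>F s in at t within S. invertible (P s)" using P_invertible by (auto simp: eventually_at_filter)
      note mvd = bounded_bilinear.has_vector_derivative[OF bounded_bilinear_matrix_vector_mult]
      have "((\<lambda>t. ?I t *v (mom t (y t) (y1 t) - Q t *v y t)) has_vector_derivative
         ?I t *v (force t (y t) (y1 t) - (Q t *v y1 t + Q1 t *v y t)) + (- (?I t ** P1 t ** ?I t)) *v (mom t (y t) (y1 t) - Q t *v y t)) (at t within S)"
        by (intro mvd has_vector_derivative_matrix_inv[OF P_deriv[OF t] inv P_invertible[OF t]] has_vector_derivative_diff md yd Q_deriv t)
      moreover have "(- (?I t ** P1 t ** ?I t)) *v (mom t (y t) (y1 t) - Q t *v y t) = - (?I t *v (P1 t *v y1 t))"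
        using PI(1)[OF t, of "y1 t"]
        by (simp add: mom_def bounded_bilinear.minus_left[OF bounded_bilinear_matrix_vector_mult] flip: matrix_vector_mul_assoc)
      ultimately have A: "((\<lambda>t. ?I t *v (mom t (y t) (y1 t) - Q t *v y t)) has_vector_derivative y2 t) (at t within S)"
        by (simp add: y2_def)
      show ?thesis by (rule has_vector_derivative_transform[OF t _ A]) (rule y1)
    qed
  qed
qed

lemma solution_jet_compact:
  assumes s: "solution y y1" and S: "compact S"
  obtains y2 where "jet S (\<lambda>t. if t \<in> S then y t else 0) (\<lambda>t. if t \<in> S then y1 t else 0) (\<lambda>t. if t \<in> S then y2 t else 0)"
    "\<And>t. t \<in> S \<Longrightarrow> ell t (y t) (y1 t) (y2 t) = 0"
proof -
  obtain y2 where y2: "continuous_on S y2" "\<And>t. t \<in> S \<Longrightarrow> (y1 has_vector_derivative y2 t) (at t within S)"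
    "\<And>t. t \<in> S \<Longrightarrow> ell t (y t) (y1 t) (y2 t) = 0" using solution_second_derivative[OF s] by blast
  have yd: "(y has_vector_derivative y1 t) (at t within S)" if "t \<in> S" for t using s that by (simp add: solution_def)
  have cy: "continuous_on S y" "continuous_on S y1"
    using has_vector_derivative_continuous[OF yd] s by (auto simp: continuous_on_eq_continuous_within solution_def)
  have bdd: "\<exists>B. \<forall>t\<in>S. norm (g t) \<le> B" if "continuous_on S g" for g :: "real \<Rightarrow> real^'d"
    using compact_imp_bounded[OF compact_continuous_image[OF that S]] by (auto simp: bounded_iff)
  obtain B0 where B0: "\<And>t. t \<in> S \<Longrightarrow> norm (y t) \<le> B0" using bdd[OF cy(1)] by blast
  obtain B1 where B1: "\<And>t. t \<in> S \<Longrightarrow> norm (y1 t) \<le> B1" using bdd[OF cy(2)] by blast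
  obtain B2 where B2: "\<And>t. t \<in> S \<Longrightarrow> norm (y2 t) \<le> B2" using bdd[OF y2(1)] by blast
  obtain r where r: "\<And>t. t \<in> S \<Longrightarrow> \<bar>t\<bar> \<le> r" using compact_imp_bounded[OF S] by (auto simp: bounded_iff)
  have "jet S (\<lambda>t. if t \<in> S then y t else 0) (\<lambda>t. if t \<in> S then y1 t else 0) (\<lambda>t. if t \<in> S then y2 t else 0)"
  proof (rule jetI[OF interval closed, where B="max B0 (max B1 B2)" and r=r])
    show "primitive_on S y y1" by (rule primitive_onI_C1[OF interval yd cy(2)])
    show "primitive_on S y1 y2" by (rule primitive_onI_C1[OF interval y2(2) y2(1)])
    show "y2 \<in> borel_measurable (lebesgue_on S)" using y2(1) S_sets by (rule continuous_imp_measurable_on_sets_lebesgue)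
    show "norm (y t) \<le> max B0 (max B1 B2)" "norm (y1 t) \<le> max B0 (max B1 B2)" "norm (y2 t) \<le> max B0 (max B1 B2)" if "t \<in> S" for t
      using B0[OF that] B1[OF that] B2[OF that] by linarith+
    show "y t = 0 \<and> y1 t = 0 \<and> y2 t = 0" if "t \<in> S" "r < \<bar>t\<bar>" for t using r[OF that(1)] that(2) by simp
  qed
  then show ?thesis using that y2(3) by blast
qed

lemma solution_exists:
  assumes a: "a \<in> S" "\<And>t. t \<in> S \<Longrightarrow> a \<le> t"
  shows "\<exists>y y1. solution y y1 \<and> y a = 0 \<and> mom a (y a) (y1 a) = v"
proof -
  obtain X where X: "X a = (0, v)" "\<And>t. t \<in> S \<Longrightarrow> (X has_vector_derivative blinfun_apply (Blinfun (ham t)) (X t)) (at t within S)"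
    using linear_ode_exists[OF interval a ham_cont, of "(0, v)"] by blast
  define y where "y t = fst (X t)" for t
  define p where "p t = snd (X t)" for t
  define y1 where "y1 t = matrix_inv (P t) *v (p t - Q t *v y t)" for t
  have Xd: "(X has_vector_derivative (y1 t, force t (y t) (y1 t))) (at t within S)" if "t \<in> S" for t
    using X(2)[OF that] unfolding bounded_linear_Blinfun_apply[OF bounded_linear_ham]
    by (simp add: ham_def Let_def y_def p_def y1_def case_prod_beta)
  have yd: "(y has_vector_derivative y1 t) (at t within S)" if "t \<in> S" for t
    using bounded_linear.has_vector_derivative[OF bounded_linear_fst Xd[OF that]] by (simp add: y_def[abs_def])
  have pd: "(p has_vector_derivative force t (y t) (y1 t)) (at t within S)" if "t \<in> S" for t
    using bounded_linear.has_vector_derivative[OF bounded_linear_snd Xd[OF that]] by (simp add: p_def[abs_def])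
  have m: "mom t (y t) (y1 t) = p t" if "t \<in> S" for t
    using matrix_inv_mult[OF P_invertible[OF that]] by (simp add: mom_def y1_def matrix_vector_mul_assoc)
  have cy: "continuous_on S y" "continuous_on S p"
    using has_vector_derivative_continuous[OF yd] has_vector_derivative_continuous[OF pd]
    by (auto simp: continuous_on_eq_continuous_within)
  have "continuous_on S y1"
    unfolding y1_def by (intro continuous_intros cont_mv matrix_inv_P_cont Q_cont cy)
  moreover have "((\<lambda>s. mom s (y s) (y1 s)) has_vector_derivative force t (y t) (y1 t)) (at t within S)" if "t \<in> S" for t
    by (rule has_vector_derivative_transform[OF that m pd[OF that]])
  ultimately have "solution y y1" unfolding solution_def using yd by blast
  moreover have "y a = 0" "mom a (y a) (y1 a) = v" using X(1) m[OF a(1)] by (simp_all add: y_def p_def)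
  ultimately show ?thesis by blast
qed

end

context sl_operator
begin

text \<open>The second clause says that the columns satisfy the condition at the left end, in the
  only direction that the upper bound uses: the kernel of \<open>Y \<sigma>\<close> injects into the
  Dirichlet kernel at \<open>\<sigma>\<close>.\<close>

definition left_basis :: "(real \<Rightarrow> real^'d^'d) \<Rightarrow> (real \<Rightarrow> real^'d^'d) \<Rightarrow> bool" where
  "left_basis Y Y1 \<longleftrightarrow> conjoined Y Y1 \<and> (\<forall>\<sigma>\<in>interior S. \<forall>c. Y \<sigma> *v c = 0 \<longrightarrow>
     left_kernel \<sigma> (\<lambda>t. if t \<in> left \<sigma> then Y t *v c else 0))"

text \<open>The columns start at \<open>a\<close> with value zero and the unit vectors as momenta;
  these Cauchy data form a Lagrangian space.\<close>

lemma left_basis_finite_end: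
  assumes a: "a \<in> S" "\<And>t. t \<in> S \<Longrightarrow> a \<le> t"
  shows "\<exists>Y Y1. left_basis Y Y1"
proof -
  have "\<forall>k. \<exists>y y1. solution y y1 \<and> y a = 0 \<and> mom a (y a) (y1 a) = axis k 1"
    using solution_exists[OF a] by blast
  then obtain y y1 where y: "\<And>k. solution (y k) (y1 k)" "\<And>k. y k a = 0" "\<And>k. mom a (y k a) (y1 k a) = axis k 1"
    by metis
  have ind: "c = 0" if "(\<Sum>k\<in>UNIV. c $ k *\<^sub>R mom a (y k a) (y1 k a)) = 0" for c :: "real^'d"
  proof -
    have "(\<Sum>k\<in>UNIV. c $ k *\<^sub>R (axis k 1 :: real^'d)) = c"
      using basis_expansion[of c] by (simp add: scalar_mult_eq_scaleR)
    then show ?thesis using that by (simp add: y(3))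
  qed
  note cj = conjoined_from_solutions[of y y1 a, OF y(1) a(1)]
  have C: "conjoined (columns y) (columns y1)" and sol: "\<And>c. solution (\<lambda>t. columns y t *v c) (\<lambda>t. columns y1 t *v c)"
    using cj ind by (simp_all add: y(2))
  have Ya: "columns y a *v c = 0" for c by (simp add: columns_mult y(2))
  have K: "left_kernel \<sigma> (\<lambda>t. if t \<in> left \<sigma> then columns y t *v c else 0)" if \<sigma>: "\<sigma> \<in> interior S" and c: "columns y \<sigma> *v c = 0" for \<sigma> c
  proof -
    let ?y = "\<lambda>t. if t \<in> left \<sigma> then columns y t *v c else 0"
    note lf = left_facts[OF \<sigma>]
    interpret T: sl_coefficients "left \<sigma>" P Q R P1 Q1 by (rule lf(7))
    have "left \<sigma> \<subseteq> {a..\<sigma>}" using a(2) by (auto simp: left_def)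
    then have comp: "compact (left \<sigma>)" using lf(3) bounded_subset[OF compact_imp_bounded[OF compact_Icc]] by (simp add: compact_eq_bounded_closed)
    have "T.solution (\<lambda>t. columns y t *v c) (\<lambda>t. columns y1 t *v c)"
      using sol[of c] lf(4) unfolding solution_def T.solution_def
      by (blast intro: has_vector_derivative_within_subset continuous_on_subset)
    then obtain y2 where j: "jet (left \<sigma>) ?y (\<lambda>t. if t \<in> left \<sigma> then columns y1 t *v c else 0) (\<lambda>t. if t \<in> left \<sigma> then y2 t else 0)"
      and z: "\<And>t. t \<in> left \<sigma> \<Longrightarrow> ell t (columns y t *v c) (columns y1 t *v c) (y2 t) = 0"
      using T.solution_jet_compact[OF _ comp] by blast
    have "AE t in lebesgue_on (left \<sigma>). t \<in> left \<sigma>" using closed_sets_lebesgue[OF lf(3)] by (subst AE_restrict_space_iff) auto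
    then have "AE t in lebesgue_on (left \<sigma>). sturm_liouville (left \<sigma>) P Q R ?y t = 0"
      using T.L_AE[OF j]
    proof eventually_elim
      case (elim t)
      then show ?case using z[of t] by simp
    qed
    moreover have "?y \<in> W22_on (left \<sigma>)" using j W22_on_iff_jet[OF lf(3)] by blast
    moreover have "?y b = 0" if "b \<in> S" "\<forall>t\<in>S. b \<le> t" for b
    proof -
      have "b = a" using that a by (simp add: antisym)
      then show ?thesis by (simp add: Ya)
    qed
    ultimately show ?thesis using c by (simp add: left_kernel_def)
  qed
  show ?thesis unfolding left_basis_def using C K by blast
qed

end

section \<open>Conjoined bases on a half-line\<close>

context sl_operator
begin

text \<open>At \<open>b\<close> the humps starting at \<open>b - 1\<close> and \<open>b - 2\<close>
  have values 1/2 and 2 and slopes 1 and 2; the two vector coefficients solve the resulting two by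
  two system.\<close>

lemma end_jet:
  assumes b: "b \<in> S" "\<And>t. t \<in> S \<Longrightarrow> t \<le> b" and un: "b - 2 \<in> S"
  shows "\<exists>w w1 w2. jet S w w1 w2 \<and> w b = c \<and> w1 b = v \<and> (\<forall>t. t \<le> b - 2 \<longrightarrow> w t = 0 \<and> w1 t = 0 \<and> w2 t = 0)"
proof -
  let ?w = "\<lambda>t. (if t \<in> S then hump0 (b - 1) t *\<^sub>R (2 *\<^sub>R (v - c)) else 0) + 1 *\<^sub>R (if t \<in> S then hump0 (b - 2) t *\<^sub>R (c - (1/2) *\<^sub>R v) else 0)"
  let ?w1 = "\<lambda>t. (if t \<in> S then hump1 (b - 1) t *\<^sub>R (2 *\<^sub>R (v - c)) else 0) + 1 *\<^sub>R (if t \<in> S then hump1 (b - 2) t *\<^sub>R (c - (1/2) *\<^sub>R v) else 0)"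
  let ?w2 = "\<lambda>t. (if t \<in> S then hump2 (b - 1) t *\<^sub>R (2 *\<^sub>R (v - c)) else 0) + 1 *\<^sub>R (if t \<in> S then hump2 (b - 2) t *\<^sub>R (c - (1/2) *\<^sub>R v) else 0)"
  have "jet S ?w ?w1 ?w2"
    by (intro jet_add_scaleR hump_jet_left[OF interval closed, where \<delta>=1] hump_jet_left[OF interval closed, where \<delta>=2])
      (use b in auto)
  moreover have "?w b = c" "?w1 b = v"
    using b(1) by (simp_all add: hump0_def hump1_def algebra_simps) (simp_all flip: scaleR_add_left scaleR_left_diff_distrib add: scaleR_2)
  moreover have "\<forall>t. t \<le> b - 2 \<longrightarrow> ?w t = 0 \<and> ?w1 t = 0 \<and> ?w2 t = 0"
    by (auto simp: hump0_def hump1_def hump2_def)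
  ultimately show ?thesis by blast
qed

text \<open>Lagrange's identity, with the Wronskian at \<open>b\<close> as only boundary term
  because \<open>w\<close> vanishes near minus infinity.\<close>

lemma form_end:
  assumes b: "b \<in> S" "\<And>t. t \<in> S \<Longrightarrow> t \<le> b" and z: "jet S z z1 z2" and w: "jet S w w1 w2"
    and a: "a \<in> S" "\<And>t. t \<le> a \<Longrightarrow> w t = 0 \<and> w1 t = 0 \<and> w2 t = 0"
  shows "form w z - form z w = mom b (z b) (z1 b) \<bullet> w b - mom b (w b) (w1 b) \<bullet> z b"
proof -
  have ab: "a \<le> b" using b a by blast
  have sub: "{a..b} \<subseteq> S" using Icc_subset_interval[OF interval a(1) b(1)] .
  have out: "w t = 0 \<and> w1 t = 0 \<and> w2 t = 0" if "t \<in> S" "t \<notin> {a..b}" for t using a(2)[of t] b(2)[OF that(1)] that by auto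
  have "form w z = integral {a..b} (\<lambda>t. energy t (w t) (w1 t) (z t) (z1 t)) - mom b (w b) (w1 b) \<bullet> z b + mom a (w a) (w1 a) \<bullet> z a"
    by (rule form_interval[OF w z a(1) b(1) ab]) (simp add: out)
  moreover have "form z w = integral {a..b} (\<lambda>t. energy t (z t) (z1 t) (w t) (w1 t)) - mom b (z b) (z1 b) \<bullet> w b + mom a (z a) (z1 a) \<bullet> w a"
    by (rule form_interval[OF z w a(1) b(1) ab]) (simp add: out)
  moreover have "integral {a..b} (\<lambda>t. energy t (w t) (w1 t) (z t) (z1 t)) = integral {a..b} (\<lambda>t. energy t (z t) (z1 t) (w t) (w1 t))"
    by (rule integral_cong) (use sub energy_sym in blast)
  ultimately show ?thesis using a(2)[of a] by simp
qed

lemma L_combination_AE: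
  assumes "f \<in> W22_on S" "g \<in> W22_on S"
  shows "(\<lambda>t. f t + c *\<^sub>R g t) \<in> W22_on S" "AE t in lebesgue_on S. L (\<lambda>t. f t + c *\<^sub>R g t) t = L f t + c *\<^sub>R L g t"
proof -
  obtain f1 f2 g1 g2 where f: "jet S f f1 f2" and g: "jet S g g1 g2" using assms W22_on_iff_jet[OF closed] by blast
  note j = jet_add_scaleR[OF f g, of c]
  show "(\<lambda>t. f t + c *\<^sub>R g t) \<in> W22_on S" using jet_W22[OF j] .
  show "AE t in lebesgue_on S. L (\<lambda>t. f t + c *\<^sub>R g t) t = L f t + c *\<^sub>R L g t"
    using L_AE[OF j] L_AE[OF f] L_AE[OF g] by eventually_elim (simp add: ell_linear)
qed

text \<open>The kernel of the maximal operator: nothing is imposed at a finite end, and at an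
  infinite end only membership in \<open>W22_on\<close>.\<close>

definition kernel :: "(real \<Rightarrow> real^'d) set" where
  "kernel = {z \<in> W22_on S. AE t in lebesgue_on S. L z t = 0}"

lemma kernel_form: "z \<in> kernel \<Longrightarrow> form z u = 0"
  unfolding form_def kernel_def
  by (rule integral_eq_zero_AE) (auto elim: eventually_mono)

text \<open>Since \<open>form z\<close> vanishes, Lagrange's identity between \<open>z\<close> and
  the cut off \<open>y\<close> says that the form of the latter with \<open>z\<close> equals the
  Wronskian at \<open>b\<close>, for every large \<open>n\<close>. The limit of these forms is
  \<open>form y z\<close>, which is zero. Only \<open>y\<close> is cut off, so
  \<open>form_cut_tendsto\<close> is used with the constant multiplier 1 on the other side.\<close>

lemma kernel_isotropic:
  assumes b: "b \<in> S" "\<And>t. t \<in> S \<Longrightarrow> t \<le> b" and un: "\<And>t. t \<le> b \<Longrightarrow> t \<in> S"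
    and z: "z \<in> kernel" "jet S z z1 z2" and y: "y \<in> kernel" "jet S y y1 y2"
  shows "mom b (z b) (z1 b) \<bullet> y b = mom b (y b) (y1 b) \<bullet> z b"
proof -
  obtain n0 :: nat where n0: "\<bar>b\<bar> < real n0" using reals_Archimedean2 by blast
  let ?D = "mom b (z b) (z1 b) \<bullet> y b - mom b (y b) (y1 b) \<bullet> z b"
  have eq: "form (\<lambda>t. cut n t *\<^sub>R y t) (\<lambda>t. 1 *\<^sub>R z t) = ?D" if n: "n \<ge> n0" for n
  proof -
    define a where "a = - (2 * real n + 2)"
    have bn: "\<bar>b\<bar> < 2 * real n + 1" using n n0 by simp
    have a: "a \<in> S" using bn by (intro un) (simp add: a_def)
    note jc = cut_jet[OF y(2), of n, unfolded cut_jet_def]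
    have ci: "cut n a = 0" "cut1 n a = 0"
      using wave_integer[of n] wave_minus[of "2 * real n + 2"] unfolding a_def by (simp_all add: cut_def cut1_def shell_def)
    let ?w = "\<lambda>t. cut n t *\<^sub>R y t" and ?w1 = "\<lambda>t. cut1 n t *\<^sub>R y t + cut n t *\<^sub>R y1 t"
      and ?w2 = "\<lambda>t. (cut2 n t *\<^sub>R y t + cut1 n t *\<^sub>R y1 t) + (cut1 n t *\<^sub>R y1 t + cut n t *\<^sub>R y2 t)"
    have ab: "a \<le> b" using bn by (simp add: a_def)
    have sub: "{a..b} \<subseteq> S" using Icc_subset_interval[OF interval a b(1)] .
    have out: "?w t = 0 \<and> ?w1 t = 0 \<and> ?w2 t = 0" if "t \<in> S" "t \<notin> {a..b}" for t
      using b(2)[OF that(1)] that(2) by (auto simp: cut_def cut1_def cut2_def shell_def a_def)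
    have "form ?w z = integral {a..b} (\<lambda>t. energy t (?w t) (?w1 t) (z t) (z1 t)) - mom b (?w b) (?w1 b) \<bullet> z b + mom a (?w a) (?w1 a) \<bullet> z a"
      by (rule form_interval[OF jc z(2) a b(1) ab]) (simp add: out)
    moreover have "form z ?w = integral {a..b} (\<lambda>t. energy t (z t) (z1 t) (?w t) (?w1 t)) - mom b (z b) (z1 b) \<bullet> ?w b + mom a (z a) (z1 a) \<bullet> ?w a"
      by (rule form_interval[OF z(2) jc a b(1) ab]) (simp add: out)
    moreover have "integral {a..b} (\<lambda>t. energy t (?w t) (?w1 t) (z t) (z1 t)) = integral {a..b} (\<lambda>t. energy t (z t) (z1 t) (?w t) (?w1 t))"
      by (rule integral_cong) (use sub energy_sym in blast)
    moreover have "?w b = y b" "?w1 b = y1 b" using bn by (simp_all add: cut_def cut1_def shell_def)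
    ultimately show ?thesis using kernel_form[OF z(1)] by (simp add: ci)
  qed
  have lim: "(\<lambda>n. form (\<lambda>t. cut n t *\<^sub>R y t) (\<lambda>t. 1 *\<^sub>R z t)) \<longlonglongrightarrow> form y z"
    by (rule form_cut_tendsto[OF y(2) jetD(1)[OF z(2)], of "\<lambda>n t. 1"]) auto
  have "\<forall>\<^sub>F n in sequentially. form (\<lambda>t. cut n t *\<^sub>R y t) (\<lambda>t. 1 *\<^sub>R z t) = ?D"
    using eventually_ge_at_top[of n0] by eventually_elim (rule eq)
  then have "(\<lambda>n. ?D) \<longlonglongrightarrow> form y z" by (rule Lim_transform_eventually[OF lim])
  then have "?D = form y z" using LIMSEQ_unique tendsto_const by blast
  then show ?thesis using kernel_form[OF y(1)] by simp
qed

lemma W22_L2: "f \<in> W22_on S \<Longrightarrow> f \<in> L2_on S"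
  by (simp add: W22_on_def)

text \<open>The boundary data of the kernel of \<open>L\<^sup>*\<close> form a coisotropic space, because data
  symplectically orthogonal to it extend to \<open>w\<close> with \<open>L w\<close> orthogonal to the kernel of \<open>L\<^sup>*\<close>,
  hence in the (closed) range of the minimal operator.\<close>

lemma kernel_coisotropic:
  assumes D: "D \<subseteq> W22_on S" "D \<noteq> {}" "\<And>f g c. f \<in> D \<Longrightarrow> g \<in> D \<Longrightarrow> (\<lambda>t. f t + c *\<^sub>R g t) \<in> D"
    and range: "\<And>fs h. (\<And>n. fs n \<in> D) \<Longrightarrow> h \<in> L2_on S \<Longrightarrow>
       (\<lambda>n. LINT t|lebesgue_on S. (norm (L (fs n) t - h t))\<^sup>2) \<longlonglongrightarrow> 0 \<Longrightarrow>
       \<exists>f\<in>D. AE t in lebesgue_on S. L f t = h t"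
    and adj: "\<And>g h. g \<in> L2_on S \<Longrightarrow> h \<in> L2_on S \<Longrightarrow>
       (\<forall>f\<in>D. form f g = (LINT t|lebesgue_on S. f t \<bullet> h t)) \<longleftrightarrow>
       (\<exists>w\<in>W22_on S. (AE t in lebesgue_on S. w t = g t) \<and> (AE t in lebesgue_on S. L w t = h t))"
    and b: "b \<in> S" "\<And>t. t \<in> S \<Longrightarrow> t \<le> b" and un: "b - 2 \<in> S"
    and orth: "\<And>z z1 z2. z \<in> kernel \<Longrightarrow> jet S z z1 z2 \<Longrightarrow> c \<bullet> mom b (z b) (z1 b) = p \<bullet> z b"
  shows "\<exists>z z1 z2. z \<in> kernel \<and> jet S z z1 z2 \<and> z b = c \<and> mom b (z b) (z1 b) = p"
proof -
  \<comment> \<open>Every \<open>w\<close> in \<open>W22_on\<close> lies in the domain of the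
    adjoint, with image \<open>L w\<close>.\<close>
  have pair: "form f w = form w f" if f: "f \<in> D" and w: "w \<in> W22_on S" for f w
  proof -
    have "\<exists>w'\<in>W22_on S. (AE t in lebesgue_on S. w' t = w t) \<and> (AE t in lebesgue_on S. L w' t = L w t)" using w by auto
    then have "form f w = (LINT t|lebesgue_on S. f t \<bullet> L w t)" using adj[OF W22_L2[OF w] L_L2[OF w]] f by blast
    then show ?thesis by (simp add: form_def inner_commute)
  qed
  \<comment> \<open>By \<open>pair\<close>, Lagrange's identity with a function of arbitrary data at
    \<open>b\<close> has no boundary term, so members of \<open>D\<close> have zero Cauchy data
    there.\<close>
  have Dend: "f b = 0 \<and> mom b (f b) (f1 b) = 0" if f: "f \<in> D" "jet S f f1 f2" for f f1 f2
  proof -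
    have key: "mom b (f b) (f1 b) \<bullet> c' = (P b *v v' + Q b *v c') \<bullet> f b" for c' v'
    proof -
      obtain w w1 w2 where w: "jet S w w1 w2" "w b = c'" "w1 b = v'" "\<And>t. t \<le> b - 2 \<Longrightarrow> w t = 0 \<and> w1 t = 0 \<and> w2 t = 0"
        using end_jet[OF b un] by blast
      show ?thesis using form_end[OF b f(2) w(1) un w(4)] pair[OF f(1) jet_W22[OF w(1)]] w(2,3) by (simp add: mom_def)
    qed
    have "(P b *v f b) \<bullet> f b = 0" using key[of 0 "f b"] by simp
    then have fb: "f b = 0" using P_pos[OF b(1), of "f b"] by (auto simp: inner_commute)
    then have "mom b (f b) (f1 b) \<bullet> mom b (f b) (f1 b) = 0" using key by simp
    then show ?thesis using fb inner_eq_zero_iff by blast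
  qed
  define v where "v = matrix_inv (P b) *v (p - Q b *v c)"
  have mv: "mom b c v = p"
    using matrix_inv_mult[OF P_invertible[OF b(1)]] by (simp add: mom_def v_def matrix_vector_mul_assoc)
  obtain w w1 w2 where w: "jet S w w1 w2" "w b = c" "w1 b = v" "\<And>t. t \<le> b - 2 \<Longrightarrow> w t = 0 \<and> w1 t = 0 \<and> w2 t = 0"
    using end_jet[OF b un] by blast
  have wW: "w \<in> W22_on S" using jet_W22[OF w(1)] .
  have wz: "form w z = 0" if z: "z \<in> kernel" for z
  proof -
    obtain z1 z2 where jz: "jet S z z1 z2" using z W22_on_iff_jet[OF closed] unfolding kernel_def by blast
    show ?thesis
      using form_end[OF b jz w(1) un w(4)] kernel_form[OF z, of w] orth[OF z jz] by (simp add: w(2,3) mv inner_commute)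
  qed
  have WD: "f \<in> W22_on S" if "f \<in> D" for f using D(1) that by blast
  \<comment> \<open>\<open>L w\<close> is projected onto the range of \<open>D\<close>, which is
    closed by the hypothesis \<open>range\<close>; the aim is to show that nothing remains.\<close>
  have "\<exists>m\<in>L ` D. \<forall>u\<in>L ` D. (LINT t|lebesgue_on S. (L w t - m t) \<bullet> u t) = 0"
  proof (rule L2_on_projection[OF S_sets])
    show "L ` D \<subseteq> L2_on S" using L_L2 WD by blast
    show "L ` D \<noteq> {}" using D(2) by blast
    show "\<exists>w\<in>L ` D. AE t in lebesgue_on S. w t = u t + c *\<^sub>R v t" if uv: "u \<in> L ` D" "v \<in> L ` D" for u v c
    proof -
      obtain f g where fg: "f \<in> D" "g \<in> D" "u = L f" "v = L g" using uv by blast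
      then show ?thesis using D(3)[OF fg(1,2), of c] L_combination_AE(2)[OF WD[OF fg(1)] WD[OF fg(2)], of c] by blast
    qed
    show "\<exists>m\<in>L ` D. AE t in lebesgue_on S. m t = h t"
      if fs: "\<And>n. fs n \<in> L ` D" and h: "h \<in> L2_on S" and l: "(\<lambda>n. LINT t|lebesgue_on S. (norm (fs n t - h t))\<^sup>2) \<longlonglongrightarrow> 0" for fs h
    proof -
      have "\<forall>n. \<exists>f. f \<in> D \<and> fs n = L f" using fs by blast
      from choice[OF this] obtain gs where gs: "\<And>n. gs n \<in> D" "\<And>n. fs n = L (gs n)" by blast
      then show ?thesis using range[of gs h] h l by auto
    qed
    show "L w \<in> L2_on S" using L_L2[OF wW] .
  qed
  then obtain f where f: "f \<in> D" and perp: "\<And>u. u \<in> D \<Longrightarrow> (LINT t|lebesgue_on S. (L w t - L f t) \<bullet> L u t) = 0" by blast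
  define g where "g t = L w t - L f t" for t
  have gL: "g \<in> L2_on S"
    using L2_on_add_scaleR[OF L_L2[OF wW] L_L2[OF WD[OF f]], of "-1"] by (simp add: g_def[abs_def])
  have "\<forall>u\<in>D. form u g = (LINT t|lebesgue_on S. u t \<bullet> (\<lambda>t. 0) t)"
    using perp by (simp add: form_def g_def inner_commute)
  \<comment> \<open>The remainder \<open>g\<close> is orthogonal to the range of \<open>D\<close>,
    so by \<open>adj\<close> with \<open>h = 0\<close> it is almost everywhere an element of the
    kernel.\<close>
  then obtain z where z: "z \<in> W22_on S" "AE t in lebesgue_on S. z t = g t" "AE t in lebesgue_on S. L z t = 0"
    using adj[OF gL L2_on_zero] by blast
  have zk: "z \<in> kernel" using z by (simp add: kernel_def)
  have i1: "integrable (lebesgue_on S) (\<lambda>t. L w t \<bullet> z t)" "integrable (lebesgue_on S) (\<lambda>t. L f t \<bullet> z t)"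
    using L2_on_integrable_inner L_L2 wW WD[OF f] W22_L2[OF z(1)] by blast+
  \<comment> \<open>The remainder is orthogonal to \<open>L w\<close> by the assumption on the
    boundary data and to \<open>L f\<close> by \<open>pair\<close>, hence to itself.\<close>
  have "(LINT t|lebesgue_on S. z t \<bullet> z t) = (LINT t|lebesgue_on S. L w t \<bullet> z t - L f t \<bullet> z t)"
  proof (rule integral_cong_AE)
    show "AE t in lebesgue_on S. z t \<bullet> z t = L w t \<bullet> z t - L f t \<bullet> z t"
      using z(2) by eventually_elim (simp add: g_def inner_diff_left)
  qed (use i1 L2_on_integrable_inner[OF W22_L2[OF z(1)] W22_L2[OF z(1)]] in \<open>auto intro: borel_measurable_integrable\<close>)
  also have "\<dots> = form w z - form f z" using i1 by (simp add: form_def)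
  also have "\<dots> = 0" using wz[OF zk] pair[OF f z(1)] kernel_form[OF zk, of f] by simp
  finally have "AE t in lebesgue_on S. z t \<bullet> z t = 0"
    using integral_nonneg_eq_0_iff_AE[OF L2_on_integrable_inner[OF W22_L2[OF z(1)] W22_L2[OF z(1)]]] by simp
  then have Lwf: "AE t in lebesgue_on S. L w t = L f t"
    using z(2) by eventually_elim (simp add: g_def)
  \<comment> \<open>Subtracting \<open>f\<close> makes \<open>w\<close> a solution without changing
    its data at \<open>b\<close>, as those of \<open>f\<close> are zero.\<close>
  define y where "y t = w t + (-1) *\<^sub>R f t" for t
  obtain f1 f2 where jf: "jet S f f1 f2" using WD[OF f] W22_on_iff_jet[OF closed] by blast
  have jy: "jet S y (\<lambda>t. w1 t + (-1) *\<^sub>R f1 t) (\<lambda>t. w2 t + (-1) *\<^sub>R f2 t)"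
    unfolding y_def[abs_def] by (rule jet_add_scaleR[OF w(1) jf])
  have "AE t in lebesgue_on S. L y t = 0"
    using L_combination_AE(2)[OF wW WD[OF f], of "-1"] Lwf unfolding y_def[abs_def] by eventually_elim simp
  then have "y \<in> kernel" using jet_W22[OF jy] by (simp add: kernel_def)
  moreover have "mom b 0 (f1 b) = 0" using Dend[OF f jf] by metis
  then have "y b = c" "mom b (y b) (w1 b + (-1) *\<^sub>R f1 b) = p"
    using Dend[OF f jf] mv mom_linear[of b c "-1" "f b" v "f1 b"] by (simp_all add: y_def w(2,3))
  ultimately show ?thesis using jy by blast
qed

text \<open>\<open>\<Lambda>\<close> consists of the Cauchy data at \<open>b\<close> of the kernel.
  It equals its symplectic complement, by \<open>kernel_isotropic\<close> and
  \<open>kernel_coisotropic\<close>, so it has dimension \<open>CARD('d)\<close>, and a basis of it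
  provides the columns.\<close>

lemma left_basis_infinite_end:
  assumes D: "D \<subseteq> W22_on S" "D \<noteq> {}" "\<And>f g c. f \<in> D \<Longrightarrow> g \<in> D \<Longrightarrow> (\<lambda>t. f t + c *\<^sub>R g t) \<in> D"
    and range: "\<And>fs h. (\<And>n. fs n \<in> D) \<Longrightarrow> h \<in> L2_on S \<Longrightarrow>
       (\<lambda>n. LINT t|lebesgue_on S. (norm (L (fs n) t - h t))\<^sup>2) \<longlonglongrightarrow> 0 \<Longrightarrow>
       \<exists>f\<in>D. AE t in lebesgue_on S. L f t = h t"
    and adj: "\<And>g h. g \<in> L2_on S \<Longrightarrow> h \<in> L2_on S \<Longrightarrow>
       (\<forall>f\<in>D. form f g = (LINT t|lebesgue_on S. f t \<bullet> h t)) \<longleftrightarrow>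
       (\<exists>w\<in>W22_on S. (AE t in lebesgue_on S. w t = g t) \<and> (AE t in lebesgue_on S. L w t = h t))"
    and Sb: "S = {..b}"
  shows "\<exists>Y Y1. left_basis Y Y1"
proof -
  have b: "b \<in> S" "\<And>t. t \<in> S \<Longrightarrow> t \<le> b" and un: "b - 2 \<in> S" "\<And>t. t \<le> b \<Longrightarrow> t \<in> S" by (auto simp: Sb)
  define \<Lambda> where "\<Lambda> = {(z b, mom b (z b) (z1 b)) |z z1 z2. z \<in> kernel \<and> jet S z z1 z2}"
  \<comment> \<open>\<open>J\<close> turns the symplectic pairing into the inner product, so the
    symplectic complement of \<open>\<Lambda>\<close> is the orthogonal complement of its image and
    the dimension can be counted.\<close>
  define J where "J = (\<lambda>x :: (real^'d) \<times> (real^'d). (snd x, - fst x))"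
  have linJ: "linear J" unfolding J_def by (rule linearI) auto
  have injJ: "inj J" unfolding J_def by (rule injI) (auto simp: prod_eq_iff)
  have mk: "(w b, mom b (w b) (w1 b)) \<in> \<Lambda>" if "w \<in> kernel" "jet S w w1 w2" for w w1 w2
    using that unfolding \<Lambda>_def by blast
  have sub: "subspace \<Lambda>"
  proof (rule subspaceI)
    have "(\<lambda>t. 0) \<in> kernel" using L_AE[OF jet_zero] jet_W22[OF jet_zero] by (simp add: kernel_def)
    then have "(0 :: real^'d, mom b 0 0) \<in> \<Lambda>" unfolding \<Lambda>_def using jet_zero[of S]
      by (intro CollectI exI[of _ "\<lambda>t. 0"] conjI) auto
    then show "0 \<in> \<Lambda>" by (simp add: zero_prod_def)
    have comb: "x + k *\<^sub>R y \<in> \<Lambda>" if xy: "x \<in> \<Lambda>" "y \<in> \<Lambda>" for x y k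
    proof -
      obtain z z1 z2 u u1 u2 where z: "z \<in> kernel" "jet S z z1 z2" "x = (z b, mom b (z b) (z1 b))"
        and u: "u \<in> kernel" "jet S u u1 u2" "y = (u b, mom b (u b) (u1 b))" using xy unfolding \<Lambda>_def by blast
      have zu: "z \<in> W22_on S" "u \<in> W22_on S" "AE t in lebesgue_on S. L z t = 0" "AE t in lebesgue_on S. L u t = 0"
        using z(1) u(1) by (auto simp: kernel_def)
      note j = jet_add_scaleR[OF z(2) u(2), of k]
      have "AE t in lebesgue_on S. L (\<lambda>t. z t + k *\<^sub>R u t) t = 0"
        using L_combination_AE(2)[OF zu(1,2), of k] zu(3,4) by eventually_elim simp
      then have "(\<lambda>t. z t + k *\<^sub>R u t) \<in> kernel" using jet_W22[OF j] by (simp add: kernel_def)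
      from mk[OF this j] show ?thesis by (simp add: z(3) u(3) mom_linear)
    qed
    show "x + y \<in> \<Lambda>" if "x \<in> \<Lambda>" "y \<in> \<Lambda>" for x y using comb[OF that, of 1] by simp
    show "k *\<^sub>R x \<in> \<Lambda>" if "x \<in> \<Lambda>" for k x using comb[OF \<open>0 \<in> \<Lambda>\<close> that, of k] by simp
  qed
  have iso: "fst x \<bullet> snd y = snd x \<bullet> fst y" if xy: "x \<in> \<Lambda>" "y \<in> \<Lambda>" for x y
  proof -
    obtain z z1 z2 u u1 u2 where z: "z \<in> kernel" "jet S z z1 z2" "x = (z b, mom b (z b) (z1 b))"
      and u: "u \<in> kernel" "jet S u u1 u2" "y = (u b, mom b (u b) (u1 b))" using xy unfolding \<Lambda>_def by blast
    have "mom b (z b) (z1 b) \<bullet> u b = mom b (u b) (u1 b) \<bullet> z b" by (rule kernel_isotropic[OF b un(2) z(1,2) u(1,2)])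
    then show ?thesis unfolding z(3) u(3) by (simp add: inner_commute)
  qed
  have "{y \<in> UNIV. \<forall>x\<in>J ` \<Lambda>. orthogonal x y} = \<Lambda>"
  proof (intro equalityI subsetI)
    fix y assume "y \<in> {y \<in> UNIV. \<forall>x\<in>J ` \<Lambda>. orthogonal x y}"
    then have oJ: "\<forall>x\<in>\<Lambda>. orthogonal (J x) y" by simp
    have o: "snd x \<bullet> fst y = fst x \<bullet> snd y" if "x \<in> \<Lambda>" for x
      using bspec[OF oJ that] by (simp add: J_def orthogonal_def inner_prod_def)
    have "\<exists>z z1 z2. z \<in> kernel \<and> jet S z z1 z2 \<and> z b = fst y \<and> mom b (z b) (z1 b) = snd y"
    proof (rule kernel_coisotropic[OF D range adj b un(1)])
      fix z z1 z2 assume "z \<in> kernel" "jet S z z1 z2"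
      then have "(z b, mom b (z b) (z1 b)) \<in> \<Lambda>" unfolding \<Lambda>_def by blast
      from o[OF this] show "fst y \<bullet> mom b (z b) (z1 b) = snd y \<bullet> z b" by (simp add: inner_commute)
    qed
    then obtain z z1 z2 where z: "z \<in> kernel" "jet S z z1 z2" "z b = fst y" "mom b (z b) (z1 b) = snd y" by blast
    then have "(z b, mom b (z b) (z1 b)) \<in> \<Lambda>" unfolding \<Lambda>_def by blast
    then show "y \<in> \<Lambda>" unfolding z(4) by (simp add: z(3))
  next
    fix y assume y: "y \<in> \<Lambda>"
    have "orthogonal (J x) y" if "x \<in> \<Lambda>" for x
      using iso[OF that y] by (simp add: J_def orthogonal_def inner_prod_def)
    then show "y \<in> {y \<in> UNIV. \<forall>x\<in>J ` \<Lambda>. orthogonal x y}" by simp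
  qed
  moreover have "dim {y \<in> UNIV. \<forall>x\<in>J ` \<Lambda>. orthogonal x y} + dim (J ` \<Lambda>) = dim (UNIV :: ((real^'d) \<times> (real^'d)) set)"
    by (rule dim_subspace_orthogonal_to_vectors) (use linear_subspace_image[OF linJ sub] in auto)
  moreover have "dim (J ` \<Lambda>) = dim \<Lambda>" using dim_image_eq[OF linJ inj_on_subset[OF injJ]] by blast
  ultimately have dimL: "dim \<Lambda> = CARD('d)" by (simp add: dim_UNIV)
  obtain B where B: "B \<subseteq> \<Lambda>" "independent B" "\<Lambda> \<subseteq> span B" "card B = dim \<Lambda>" using basis_exists by blast
  have finB: "finite B" using B(2) by (rule independent_imp_finite)
  obtain e where e: "bij_betw e (UNIV :: 'd set) B"
    using finite_same_card_bij[of "UNIV :: 'd set" B] finB B(4) dimL by auto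
  have "\<forall>k. \<exists>z. \<exists>z1. \<exists>z2. z \<in> kernel \<and> jet S z z1 z2 \<and> e k = (z b, mom b (z b) (z1 b))"
  proof
    fix k
    have "e k \<in> \<Lambda>" using e B(1) bij_betwE by fastforce
    then show "\<exists>z. \<exists>z1. \<exists>z2. z \<in> kernel \<and> jet S z z1 z2 \<and> e k = (z b, mom b (z b) (z1 b))" unfolding \<Lambda>_def by blast
  qed
  from choice[OF this] obtain y where "\<forall>k. \<exists>z1. \<exists>z2. y k \<in> kernel \<and> jet S (y k) z1 z2 \<and> e k = (y k b, mom b (y k b) (z1 b))" by blast
  from choice[OF this] obtain y1 where "\<forall>k. \<exists>z2. y k \<in> kernel \<and> jet S (y k) (y1 k) z2 \<and> e k = (y k b, mom b (y k b) (y1 k b))" by blast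
  from choice[OF this] obtain y2 where y: "\<And>k. y k \<in> kernel" "\<And>k. jet S (y k) (y1 k) (y2 k)" "\<And>k. e k = (y k b, mom b (y k b) (y1 k b))" by blast
  have ez: "AE t in lebesgue_on S. ell t (y k t) (y1 k t) (y2 k t) = 0" for k
  proof -
    have "AE t in lebesgue_on S. L (y k) t = 0" using y(1)[of k] by (simp add: kernel_def)
    then show ?thesis using L_AE[OF y(2)[of k]] by eventually_elim simp
  qed
  have sol: "solution (y k) (y1 k)" for k by (rule jet_kernel_solution[OF y(2) ez])
  have C: "conjoined (columns y) (columns y1)"
  proof (rule conjoined_from_solutions(1)[OF sol b(1)])
    show "y k b \<bullet> mom b (y l b) (y1 l b) = mom b (y k b) (y1 k b) \<bullet> y l b" for k l
      using kernel_isotropic[OF b un(2) y(1,2) y(1,2), of k l] by (simp add: inner_commute)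
    fix c :: "real^'d"
    assume 0: "(\<Sum>k\<in>UNIV. c $ k *\<^sub>R y k b) = 0" "(\<Sum>k\<in>UNIV. c $ k *\<^sub>R mom b (y k b) (y1 k b)) = 0"
    have "(\<Sum>k\<in>UNIV. c $ k *\<^sub>R e k) = 0"
      using 0 by (simp add: y(3) prod_eq_iff fst_sum snd_sum)
    moreover have inj: "inv_into UNIV e (e k) = k" for k
      using e by (simp add: bij_betw_def inv_into_f_f)
    have "(\<Sum>k\<in>UNIV. c $ k *\<^sub>R e k) = (\<Sum>x\<in>B. c $ (inv_into UNIV e x) *\<^sub>R x)"
      using sum.reindex_bij_betw[OF e, of "\<lambda>x. c $ (inv_into UNIV e x) *\<^sub>R x"] by (simp add: inj)
    ultimately have s0: "(\<Sum>x\<in>B. c $ (inv_into UNIV e x) *\<^sub>R x) = 0" by simp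
    have "c $ k = 0" for k
    proof -
      have "e k \<in> B" using e bij_betwE by fastforce
      then have "c $ (inv_into UNIV e (e k)) = 0" using independentD[OF B(2) finB order_refl s0] by blast
      then show ?thesis using e by (simp add: bij_betw_def inv_into_f_f)
    qed
    then show "c = 0" by (simp add: vec_eq_iff)
  qed
  have K: "left_kernel \<sigma> (\<lambda>t. if t \<in> left \<sigma> then columns y t *v c else 0)" if \<sigma>: "\<sigma> \<in> interior S" and c: "columns y \<sigma> *v c = 0" for \<sigma> c
  proof -
    let ?y = "\<lambda>t. if t \<in> left \<sigma> then columns y t *v c else 0"
    note lf = left_facts[OF \<sigma>]
    interpret T: sl_coefficients "left \<sigma>" P Q R P1 Q1 by (rule lf(7))
    have all: "\<exists>w1 w2. jet S (\<lambda>t. \<Sum>k\<in>F. c $ k *\<^sub>R y k t) w1 w2 \<and> (AE t in lebesgue_on S. ell t (\<Sum>k\<in>F. c $ k *\<^sub>R y k t) (w1 t) (w2 t) = 0)"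
      if "finite F" for F
      using that
    proof (induction F rule: finite_induct)
      case empty
      show ?case by (rule exI[of _ "\<lambda>t. 0"], rule exI[of _ "\<lambda>t. 0"]) simp
    next
      case (insert k F)
      then obtain w1 w2 where w: "jet S (\<lambda>t. \<Sum>k\<in>F. c $ k *\<^sub>R y k t) w1 w2"
        "AE t in lebesgue_on S. ell t (\<Sum>k\<in>F. c $ k *\<^sub>R y k t) (w1 t) (w2 t) = 0" by blast
      note j = jet_add_scaleR[OF w(1) y(2)[of k], of "c $ k"]
      have "AE t in lebesgue_on S. ell t ((\<Sum>k\<in>F. c $ k *\<^sub>R y k t) + c $ k *\<^sub>R y k t) (w1 t + c $ k *\<^sub>R y1 k t) (w2 t + c $ k *\<^sub>R y2 k t) = 0"
        using w(2) ez[of k] by eventually_elim (simp add: ell_linear)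
      then show ?case using j insert(1,2) by (intro exI conjI) (simp_all add: add.commute)
    qed
    obtain w1 w2 where w: "jet S (\<lambda>t. columns y t *v c) w1 w2" "AE t in lebesgue_on S. ell t (columns y t *v c) (w1 t) (w2 t) = 0"
      using all[of UNIV] unfolding columns_mult by auto
    have j: "jet (left \<sigma>) ?y (\<lambda>t. if t \<in> left \<sigma> then w1 t else 0) (\<lambda>t. if t \<in> left \<sigma> then w2 t else 0)"
      by (rule jet_restrict[OF w(1) lf(2,3,4) closed])
    have Ll: "left \<sigma> \<in> sets lebesgue" using closed_sets_lebesgue[OF lf(3)] .
    have "AE t in lebesgue. t \<in> S \<longrightarrow> ell t (columns y t *v c) (w1 t) (w2 t) = 0"
      using w(2) S_sets by (subst (asm) AE_restrict_space_iff) auto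
    then have "AE t in lebesgue. t \<in> left \<sigma> \<longrightarrow> t \<in> left \<sigma> \<and> ell t (columns y t *v c) (w1 t) (w2 t) = 0"
      by eventually_elim (use lf(4) in blast)
    then have "AE t in lebesgue_on (left \<sigma>). t \<in> left \<sigma> \<and> ell t (columns y t *v c) (w1 t) (w2 t) = 0"
      using Ll by (subst AE_restrict_space_iff) auto
    then have "AE t in lebesgue_on (left \<sigma>). sturm_liouville (left \<sigma>) P Q R ?y t = 0"
      using T.L_AE[OF j] by eventually_elim simp
    moreover have "?y \<in> W22_on (left \<sigma>)" using j W22_on_iff_jet[OF lf(3)] by blast
    \<comment> \<open>A half-line has no least element, so the left-end condition in
      \<open>left_kernel\<close> is void; square integrability of the columns takes its
      place.\<close>
    moreover have "\<not> (\<forall>t\<in>S. a \<le> t)" if "a \<in> S" for a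
    proof
      assume "\<forall>t\<in>S. a \<le> t"
      moreover have "a - 1 \<in> S" using b(2)[OF that] by (intro un(2)) simp
      ultimately have "a \<le> a - 1" by blast
      then show False by simp
    qed
    ultimately show ?thesis using c by (auto simp: left_kernel_def)
  qed
  show ?thesis unfolding left_basis_def using C K by blast
qed

end

section \<open>Coefficients of the linearization\<close>

text \<open>The domain \<open>U\<close> has a boundary at edge ends, so derivatives are taken within
  \<open>U\<close>. A line that stays in \<open>U\<close>, such as one in a position or velocity
  direction, still has an ordinary derivative.\<close>

lemma line_derivative:
  fixes F :: "'a::real_normed_vector \<Rightarrow> real"
  assumes d: "\<And>z. z \<in> U \<Longrightarrow> (F has_derivative DF z) (at z within U)" and U: "\<And>s. z + s *\<^sub>R e \<in> U"
  shows "((\<lambda>s. F (z + s *\<^sub>R e)) has_real_derivative DF (z + s *\<^sub>R e) e) (at s)"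
proof -
  have 1: "((\<lambda>s. z + s *\<^sub>R e) has_derivative (\<lambda>s. s *\<^sub>R e)) (at s within UNIV)"
    by (auto intro!: derivative_eq_intros)
  have 2: "(F has_derivative DF (z + s *\<^sub>R e)) (at (z + s *\<^sub>R e) within range (\<lambda>s. z + s *\<^sub>R e))"
    by (rule has_derivative_subset[OF d[OF U]]) (use U in blast)
  interpret bounded_linear "DF (z + s *\<^sub>R e)" by (rule has_derivative_bounded_linear[OF 2])
  have "((\<lambda>s. F (z + s *\<^sub>R e)) has_derivative (\<lambda>h. DF (z + s *\<^sub>R e) (h *\<^sub>R e))) (at s)"
    using has_derivative_in_compose[OF 1 2] by simp
  then show ?thesis unfolding has_field_derivative_def by (simp add: scaleR mult.commute[of _ "DF (z + s *\<^sub>R e) e"])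
qed

lemma blinfun_has_derivative:
  assumes "(DF has_derivative blinfun_apply D2) (at z within U)"
  shows "((\<lambda>z. blinfun_apply (DF z) a) has_derivative (\<lambda>h. blinfun_apply (blinfun_apply D2 h) a)) (at z within U)"
  by (rule bounded_linear.has_derivative[OF blinfun.bounded_linear_left assms])

text \<open>The mean value theorem twice, first along \<open>a\<close> for the increment along
  \<open>b\<close>, then along \<open>b\<close> for the derivative in direction
  \<open>a\<close>.\<close>

lemma mixed_difference:
  fixes F :: "'a::real_normed_vector \<Rightarrow> real" and DF :: "'a \<Rightarrow> 'a \<Rightarrow>\<^sub>L real" and D2F :: "'a \<Rightarrow> 'a \<Rightarrow>\<^sub>L 'a \<Rightarrow>\<^sub>L real"
  assumes d: "\<And>z. z \<in> U \<Longrightarrow> (F has_derivative blinfun_apply (DF z)) (at z within U)"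
    and d2: "\<And>z. z \<in> U \<Longrightarrow> (DF has_derivative blinfun_apply (D2F z)) (at z within U)"
    and U: "\<And>s r. z + s *\<^sub>R a + r *\<^sub>R b \<in> U" and h: "h > 0"
  shows "\<exists>s r. 0 < s \<and> s < h \<and> 0 < r \<and> r < h \<and>
    F (z + h *\<^sub>R a + h *\<^sub>R b) - F (z + h *\<^sub>R a) - F (z + h *\<^sub>R b) + F z = h\<^sup>2 * D2F (z + s *\<^sub>R a + r *\<^sub>R b) b a"
proof -
  have U1: "z + r *\<^sub>R b + s *\<^sub>R a \<in> U" "z + s *\<^sub>R a \<in> U" for s r
    using U[of s r] U[of s 0] by (simp_all add: add_ac)
  define \<phi> where "\<phi> s = F (z + h *\<^sub>R b + s *\<^sub>R a) - F (z + s *\<^sub>R a)" for s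
  define \<phi>' where "\<phi>' s = DF (z + h *\<^sub>R b + s *\<^sub>R a) a - DF (z + s *\<^sub>R a) a" for s
  have "(\<phi> has_real_derivative \<phi>' s) (at s)" for s
    unfolding \<phi>_def \<phi>'_def by (rule DERIV_diff[OF line_derivative[OF d] line_derivative[OF d]]) (use U1 in auto)
  then obtain s where s: "0 < s" "s < h" "\<phi> h - \<phi> 0 = (h - 0) * \<phi>' s"
    using MVT2[OF h, of \<phi> \<phi>'] by blast
  define \<psi> where "\<psi> r = blinfun_apply (DF (z + s *\<^sub>R a + r *\<^sub>R b)) a" for r
  define \<psi>' where "\<psi>' r = D2F (z + s *\<^sub>R a + r *\<^sub>R b) b a" for r
  have "(\<psi> has_real_derivative \<psi>' r) (at r)" for r
    unfolding \<psi>_def \<psi>'_def by (rule line_derivative[OF blinfun_has_derivative[OF d2]]) (use U in auto)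
  then obtain r where r: "0 < r" "r < h" "\<psi> h - \<psi> 0 = (h - 0) * \<psi>' r"
    using MVT2[OF h, of \<psi> \<psi>'] by blast
  have "F (z + h *\<^sub>R a + h *\<^sub>R b) - F (z + h *\<^sub>R a) - F (z + h *\<^sub>R b) + F z = \<phi> h - \<phi> 0"
    by (simp add: \<phi>_def add_ac)
  also have "\<dots> = h * (\<psi> h - \<psi> 0)" unfolding s(3) \<psi>_def \<phi>'_def by (simp add: add_ac)
  also have "\<dots> = h\<^sup>2 * D2F (z + s *\<^sub>R a + r *\<^sub>R b) b a" unfolding r(3) \<psi>'_def by (simp add: power2_eq_square)
  finally show ?thesis using s(1,2) r(1,2) by blast
qed

text \<open>Schwarz's theorem for directions whose plane through \<open>z\<close> lies in
  \<open>U\<close>, so it also covers edge ends, where \<open>U\<close> is no neighbourhood of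
  \<open>z\<close>. The mixed difference is symmetric in \<open>a\<close> and \<open>b\<close> and,
  divided by \<open>(h n)\<^sup>2\<close>, tends to both values.\<close>

lemma second_derivative_symmetric:
  fixes F :: "'a::real_normed_vector \<Rightarrow> real" and DF :: "'a \<Rightarrow> 'a \<Rightarrow>\<^sub>L real" and D2F :: "'a \<Rightarrow> 'a \<Rightarrow>\<^sub>L 'a \<Rightarrow>\<^sub>L real"
  assumes d: "\<And>z. z \<in> U \<Longrightarrow> (F has_derivative blinfun_apply (DF z)) (at z within U)"
    and d2: "\<And>z. z \<in> U \<Longrightarrow> (DF has_derivative blinfun_apply (D2F z)) (at z within U)"
    and c: "continuous_on U D2F" and U: "\<And>s r. z + s *\<^sub>R a + r *\<^sub>R b \<in> U"
  shows "D2F z a b = D2F z b a"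
proof -
  have U': "z + s *\<^sub>R b + r *\<^sub>R a \<in> U" for s r using U[of r s] by (simp add: add_ac)
  define h where "h n = 1 / real (Suc n)" for n
  have h0: "h n > 0" for n by (simp add: h_def)
  have hl: "h \<longlonglongrightarrow> 0" unfolding h_def by (rule LIMSEQ_Suc[OF lim_1_over_n])
  have "\<forall>n. \<exists>s. \<exists>r. 0 < s \<and> s < h n \<and> 0 < r \<and> r < h n \<and>
    F (z + h n *\<^sub>R a + h n *\<^sub>R b) - F (z + h n *\<^sub>R a) - F (z + h n *\<^sub>R b) + F z = (h n)\<^sup>2 * D2F (z + s *\<^sub>R a + r *\<^sub>R b) b a"
    using mixed_difference[OF d d2 U h0] by blast
  from choice[OF this] obtain s where "\<forall>n. \<exists>r. 0 < s n \<and> s n < h n \<and> 0 < r \<and> r < h n \<and>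
    F (z + h n *\<^sub>R a + h n *\<^sub>R b) - F (z + h n *\<^sub>R a) - F (z + h n *\<^sub>R b) + F z = (h n)\<^sup>2 * D2F (z + s n *\<^sub>R a + r *\<^sub>R b) b a" by blast
  from choice[OF this] obtain r where sr: "\<And>n. 0 < s n" "\<And>n. s n < h n" "\<And>n. 0 < r n" "\<And>n. r n < h n"
    "\<And>n. F (z + h n *\<^sub>R a + h n *\<^sub>R b) - F (z + h n *\<^sub>R a) - F (z + h n *\<^sub>R b) + F z = (h n)\<^sup>2 * D2F (z + s n *\<^sub>R a + r n *\<^sub>R b) b a" by blast
  have "\<forall>n. \<exists>s. \<exists>r. 0 < s \<and> s < h n \<and> 0 < r \<and> r < h n \<and>
    F (z + h n *\<^sub>R b + h n *\<^sub>R a) - F (z + h n *\<^sub>R b) - F (z + h n *\<^sub>R a) + F z = (h n)\<^sup>2 * D2F (z + s *\<^sub>R b + r *\<^sub>R a) a b"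
    using mixed_difference[OF d d2 U' h0] by blast
  from choice[OF this] obtain s' where "\<forall>n. \<exists>r. 0 < s' n \<and> s' n < h n \<and> 0 < r \<and> r < h n \<and>
    F (z + h n *\<^sub>R b + h n *\<^sub>R a) - F (z + h n *\<^sub>R b) - F (z + h n *\<^sub>R a) + F z = (h n)\<^sup>2 * D2F (z + s' n *\<^sub>R b + r *\<^sub>R a) a b" by blast
  from choice[OF this] obtain r' where sr': "\<And>n. 0 < s' n" "\<And>n. s' n < h n" "\<And>n. 0 < r' n" "\<And>n. r' n < h n"
    "\<And>n. F (z + h n *\<^sub>R b + h n *\<^sub>R a) - F (z + h n *\<^sub>R b) - F (z + h n *\<^sub>R a) + F z = (h n)\<^sup>2 * D2F (z + s' n *\<^sub>R b + r' n *\<^sub>R a) a b" by blast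
  have lim0: "q \<longlonglongrightarrow> 0" if "\<And>n. 0 < q n" "\<And>n. q n < h n" for q :: "nat \<Rightarrow> real"
    by (rule tendsto_sandwich[OF _ _ tendsto_const hl]) (use that in \<open>auto intro!: always_eventually less_imp_le\<close>)
  have lim: "(\<lambda>n. D2F (z + q n *\<^sub>R a' + p n *\<^sub>R b') x y) \<longlonglongrightarrow> D2F z x y"
    if q: "q \<longlonglongrightarrow> 0" "p \<longlonglongrightarrow> 0" and in_U: "\<And>n. z + q n *\<^sub>R a' + p n *\<^sub>R b' \<in> U" for q p :: "nat \<Rightarrow> real" and a' b' x y
  proof -
    have "(\<lambda>n. z + q n *\<^sub>R a' + p n *\<^sub>R b') \<longlonglongrightarrow> z + 0 *\<^sub>R a' + 0 *\<^sub>R b'"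
      by (intro tendsto_intros q)
    then have "(\<lambda>n. D2F (z + q n *\<^sub>R a' + p n *\<^sub>R b')) \<longlonglongrightarrow> D2F z"
      by (intro continuous_on_tendsto_compose[OF c]) (use in_U U[of 0 0] in auto)
    then show ?thesis by (intro tendsto_intros)
  qed
  have "D2F (z + s n *\<^sub>R a + r n *\<^sub>R b) b a = D2F (z + s' n *\<^sub>R b + r' n *\<^sub>R a) a b" for n
  proof -
    have "(h n)\<^sup>2 * D2F (z + s n *\<^sub>R a + r n *\<^sub>R b) b a = (h n)\<^sup>2 * D2F (z + s' n *\<^sub>R b + r' n *\<^sub>R a) a b"
      unfolding sr(5)[symmetric] sr'(5)[symmetric] by (simp add: add_ac)
    then show ?thesis using h0[of n] by simp
  qed
  moreover have "(\<lambda>n. D2F (z + s n *\<^sub>R a + r n *\<^sub>R b) b a) \<longlonglongrightarrow> D2F z b a"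
    by (rule lim[OF lim0 lim0]) (use sr U in auto)
  moreover have "(\<lambda>n. D2F (z + s' n *\<^sub>R b + r' n *\<^sub>R a) a b) \<longlonglongrightarrow> D2F z a b"
    by (rule lim[OF lim0 lim0]) (use sr' U' in auto)
  ultimately show ?thesis using LIMSEQ_unique by fastforce
qed

lemma hessians_symmetric:
  fixes F :: "real \<Rightarrow> real^'d \<Rightarrow> real^'d \<Rightarrow> real"
  assumes "C2_on (S \<times> UNIV \<times> UNIV) (\<lambda>(t, q, v). F t q v)" and t: "t \<in> S"
  shows "transpose (hess_vv F t q v) = hess_vv F t q v" "transpose (hess_qq F t q v) = hess_qq F t q v"
proof -
  let ?U = "S \<times> (UNIV :: (real^'d) set) \<times> (UNIV :: (real^'d) set)"
  let ?F = "\<lambda>z. case z of (t, q, v) \<Rightarrow> F t q v"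
  obtain DF :: "real \<times> (real^'d) \<times> (real^'d) \<Rightarrow> (real \<times> (real^'d) \<times> (real^'d)) \<Rightarrow>\<^sub>L real"
    and D2F :: "real \<times> (real^'d) \<times> (real^'d) \<Rightarrow> (real \<times> (real^'d) \<times> (real^'d)) \<Rightarrow>\<^sub>L (real \<times> (real^'d) \<times> (real^'d)) \<Rightarrow>\<^sub>L real"
    where d: "\<And>z. z \<in> ?U \<Longrightarrow> (?F has_derivative blinfun_apply (DF z)) (at z within ?U)"
      and d2: "\<And>z. z \<in> ?U \<Longrightarrow> (DF has_derivative blinfun_apply (D2F z)) (at z within ?U)"
      and c: "continuous_on ?U D2F"
    using assms(1) unfolding C2_on_def by blast
  have gv: "grad_v F t q v $ i = DF (t, q, v) (0, 0, axis i 1)" for q v i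
    using line_derivative[OF d, of "(t, q, v)" "(0, 0, axis i 1)" 0] t
    by (simp add: grad_v_def partial_def DERIV_imp_deriv)
  have gq: "grad_q F t q v $ i = DF (t, q, v) (0, axis i 1, 0)" for q v i
    using line_derivative[OF d, of "(t, q, v)" "(0, axis i 1, 0)" 0] t
    by (simp add: grad_q_def partial_def DERIV_imp_deriv)
  note d3 = blinfun_has_derivative[OF d2]
  have hv: "hess_vv F t q v $ i $ k = D2F (t, q, v) (0, 0, axis k 1) (0, 0, axis i 1)" for i k
    using line_derivative[OF d3, of "(t, q, v)" "(0, 0, axis k 1)" "(0, 0, axis i 1)" 0] t
    by (simp add: hess_vv_def partial_def DERIV_imp_deriv gv)
  have hq: "hess_qq F t q v $ i $ k = D2F (t, q, v) (0, axis k 1, 0) (0, axis i 1, 0)" for i k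
    using line_derivative[OF d3, of "(t, q, v)" "(0, axis k 1, 0)" "(0, axis i 1, 0)" 0] t
    by (simp add: hess_qq_def partial_def DERIV_imp_deriv gq)
  have sym: "D2F (t, q, v) (0, a) (0, b) = D2F (t, q, v) (0, b) (0, a)" for a b
    by (rule second_derivative_symmetric[OF d d2 c]) (use t in \<open>auto simp: prod_eq_iff mem_Times_iff\<close>)
  show "transpose (hess_vv F t q v) = hess_vv F t q v" "transpose (hess_qq F t q v) = hess_qq F t q v"
    by (simp_all add: vec_eq_iff transpose_def hv hq sym)
qed

text \<open>The regularity condition is imposed on the inverse of \<open>P\<close>, whereas
  \<open>ell\<close> contains the derivative of \<open>P\<close>; inverting once more transfers
  it.\<close>

lemma C1_inverse_matrix:
  fixes M :: "real \<Rightarrow> real^'d^'d"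
  assumes "C1_on S (\<lambda>t. matrix_inv (M t))" and inv: "\<And>t. t \<in> S \<Longrightarrow> invertible (M t)"
  shows "C1_on S M"
proof -
  obtain D where d: "\<And>t. t \<in> S \<Longrightarrow> ((\<lambda>t. matrix_inv (M t)) has_vector_derivative D t) (at t within S)"
    and c: "continuous_on S D" using assms(1) unfolding C1_on_def by blast
  let ?D = "\<lambda>t. - (M t ** D t ** M t)"
  have D: "(M has_vector_derivative ?D t) (at t within S)" if t: "t \<in> S" for t
  proof -
    have "\<forall>\<^sub>F s in at t within S. invertible (matrix_inv (M s))"
      by (rule eventually_at_topological[THEN iffD2]) (use invertible_matrix_inv[OF inv] in blast)
    from has_vector_derivative_matrix_inv[OF d[OF t] this invertible_matrix_inv[OF inv[OF t]]]
    have "((\<lambda>s. matrix_inv (matrix_inv (M s))) has_vector_derivative ?D t) (at t within S)"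
      by (simp add: matrix_inv_involutive[OF inv[OF t]])
    then show ?thesis
      by (rule has_vector_derivative_transform[OF t, rotated]) (simp add: matrix_inv_involutive[OF inv])
  qed
  have cM: "continuous_on S M"
    using D has_vector_derivative_continuous continuous_on_eq_continuous_within by blast
  have "continuous_on S ?D"
    by (intro continuous_on_minus bounded_bilinear.continuous_on[OF bounded_bilinear_matrix_matrix_mult] cM c)
  then show ?thesis unfolding C1_on_def by (intro exI[of _ ?D] conjI ballI D)
qed

lemma edge_interval:
  assumes "lend G j < rend G j"
  shows "is_interval (edge G j)" "closed (edge G j)" "\<exists>a\<in>edge G j. \<exists>b\<in>edge G j. a < b"
    "interior (edge G j) = {t. lend G j < ereal t \<and> ereal t < rend G j}"
proof -
  show "is_interval (edge G j)"
    unfolding is_interval_1 edge_def mem_Collect_eq Ball_def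
  proof (intro ballI allI impI, elim conjE)
    fix a b x :: real assume "lend G j \<le> ereal a" "ereal b \<le> rend G j" "a \<le> x" "x \<le> b"
    then show "lend G j \<le> ereal x \<and> ereal x \<le> rend G j"
      using order_trans[of "lend G j" "ereal a" "ereal x"] order_trans[of "ereal x" "ereal b" "rend G j"] by simp
  qed
  have e: "edge G j = ereal -` {lend G j..rend G j}" by (auto simp: edge_def)
  show cl: "closed (edge G j)" unfolding e
    by (rule continuous_closed_vimage) (auto intro: continuous_at_ereal)
  obtain a where a: "lend G j < ereal a" "ereal a < rend G j" using ereal_dense2[OF assms] by blast
  obtain b where b: "ereal a < ereal b" "ereal b < rend G j" using ereal_dense2[OF a(2)] by blast
  have "a \<in> edge G j" using a by (simp add: edge_def less_imp_le)
  moreover have "b \<in> edge G j" using b less_trans[OF a(1) b(1)] by (simp add: edge_def less_imp_le)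
  moreover have "a < b" using b(1) by simp
  ultimately show "\<exists>a\<in>edge G j. \<exists>b\<in>edge G j. a < b" by blast
  have o: "open (ereal -` {lend G j<..<rend G j})"
    by (rule continuous_open_vimage) (auto intro: continuous_at_ereal)
  show "interior (edge G j) = {t. lend G j < ereal t \<and> ereal t < rend G j}"
  proof (intro equalityI subsetI)
    fix t assume t: "t \<in> interior (edge G j)"
    then obtain r where r: "r > 0" "cball t r \<subseteq> edge G j" by (meson mem_interior_cball)
    have "t - r \<in> cball t r" "t + r \<in> cball t r" using r(1) by (simp_all add: dist_real_def)
    then have 1: "lend G j \<le> ereal (t - r)" "ereal (t + r) \<le> rend G j" using subsetD[OF r(2)] by (simp_all add: edge_def)
    have 2: "ereal (t - r) < ereal t" "ereal t < ereal (t + r)" using r(1) by simp_all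
    show "t \<in> {t. lend G j < ereal t \<and> ereal t < rend G j}"
      using le_less_trans[OF 1(1) 2(1)] less_le_trans[OF 2(2) 1(2)] by simp
  next
    fix t assume "t \<in> {t. lend G j < ereal t \<and> ereal t < rend G j}"
    then show "t \<in> interior (edge G j)"
      by (intro interiorI[OF o]) (auto simp: edge_def)
  qed
qed

lemma edge_sl_coefficients:
  fixes G :: "('v, 'e) metric_digraph" and Lag :: "('e, 'd::finite) lagrangian"
  assumes G: "metric_graph G" and C2: "lagrangian_C2 G Lag" and conv: "lagrangian_convex G Lag"
    and reg: "regular_coefficients G Lag x" and j: "j \<in> arcs G"
  shows "\<exists>P1 Q1. sl_coefficients (edge G j) (coeff_P G Lag x j) (coeff_Q G Lag x j) (coeff_R G Lag x j) P1 Q1"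
proof -
  have le: "lend G j < rend G j" using G j by (simp add: metric_graph_def)
  have C: "C2_on (edge G j \<times> UNIV \<times> UNIV) (\<lambda>(t, q, v). Lag j t q v)"
    using C2 j by (simp add: lagrangian_C2_def edge_phase_space_def)
  have pos: "w \<bullet> (coeff_P G Lag x j t *v w) > 0" if "t \<in> edge G j" "w \<noteq> 0" for t w
    using conv j that by (simp add: lagrangian_convex_def coeff_P_def)
  have "invertible (coeff_P G Lag x j t)" if "t \<in> edge G j" for t
    unfolding invertible_left_inverse matrix_left_invertible_ker
    using pos[OF that] by (metis inner_zero_right less_irrefl)
  moreover have "C1_on (edge G j) (\<lambda>t. matrix_inv (coeff_P G Lag x j t))"
    using reg j by (simp add: regular_coefficients_def)
  ultimately have "C1_on (edge G j) (coeff_P G Lag x j)" by (intro C1_inverse_matrix[of _ "coeff_P G Lag x j"])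
  then obtain P1 where P1: "\<And>t. t \<in> edge G j \<Longrightarrow> (coeff_P G Lag x j has_vector_derivative P1 t) (at t within edge G j)"
    "continuous_on (edge G j) P1" unfolding C1_on_def by blast
  have "C1_on (edge G j) (coeff_Q G Lag x j)" using reg j by (simp add: regular_coefficients_def)
  then obtain Q1 where Q1: "\<And>t. t \<in> edge G j \<Longrightarrow> (coeff_Q G Lag x j has_vector_derivative Q1 t) (at t within edge G j)"
    "continuous_on (edge G j) Q1" unfolding C1_on_def by blast
  have "sl_coefficients (edge G j) (coeff_P G Lag x j) (coeff_Q G Lag x j) (coeff_R G Lag x j) P1 Q1"
  proof
    show "continuous_on (edge G j) (coeff_R G Lag x j)" using reg j by (simp add: regular_coefficients_def)
    fix t assume t: "t \<in> edge G j"
    show "transpose (coeff_P G Lag x j t) = coeff_P G Lag x j t" "transpose (coeff_R G Lag x j t) = coeff_R G Lag x j t"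
      unfolding coeff_P_def coeff_R_def by (rule hessians_symmetric[OF C t])+
  qed (fact edge_interval[OF le] P1 Q1 pos)+
  then show ?thesis by blast
qed

section \<open>Superpositions of broken solutions\<close>

lemma sum_fun_apply: "(sum f A) t = (\<Sum>i\<in>A. f i t)"
  for f :: "'i \<Rightarrow> 'b \<Rightarrow> 'c::comm_monoid_add"
  by (induction A rule: infinite_finite_induct) auto

lemma scaleR_fun_apply: "(c *\<^sub>R f) t = c *\<^sub>R f t"
  by (simp add: scaleR_fun_def)

context sl_operator
begin

text \<open>For fixed \<open>\<delta>\<close> the construction is linear because
  \<open>corner\<close> uses only \<open>y\<close> and its slope at \<open>\<sigma>\<close>.\<close>

lemma left_kernel_combination:
  assumes \<sigma>: "\<sigma> \<in> interior S" and y: "left_kernel \<sigma> y" "left_kernel \<sigma> y'"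
  shows "left_kernel \<sigma> (\<lambda>t. y t + c *\<^sub>R y' t)"
    "corner \<delta> \<sigma> (\<lambda>t. y t + c *\<^sub>R y' t) = (\<lambda>t. corner \<delta> \<sigma> y t + c *\<^sub>R corner \<delta> \<sigma> y' t)"
proof -
  interpret T: sl_coefficients "left \<sigma>" P Q R P1 Q1 by (rule left_facts(7)[OF \<sigma>])
  obtain y1 y2 where a: "jet (left \<sigma>) y y1 y2" "AE t in lebesgue_on (left \<sigma>). ell t (y t) (y1 t) (y2 t) = 0"
    "deriv_on (left \<sigma>) y \<sigma> = y1 \<sigma>" by (rule left_kernelE[OF y(1) \<sigma>])
  obtain y1' y2' where b: "jet (left \<sigma>) y' y1' y2'" "AE t in lebesgue_on (left \<sigma>). ell t (y' t) (y1' t) (y2' t) = 0"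
    "deriv_on (left \<sigma>) y' \<sigma> = y1' \<sigma>" by (rule left_kernelE[OF y(2) \<sigma>])
  note j = jet_add_scaleR[OF a(1) b(1), of c]
  have "AE t in lebesgue_on (left \<sigma>). sturm_liouville (left \<sigma>) P Q R (\<lambda>t. y t + c *\<^sub>R y' t) t = 0"
    using T.L_AE[OF j] a(2) b(2) by eventually_elim (simp add: ell_linear)
  moreover have "(\<lambda>t. y t + c *\<^sub>R y' t) \<in> W22_on (left \<sigma>)" using j W22_on_iff_jet[OF left_facts(3)[OF \<sigma>]] by blast
  ultimately show "left_kernel \<sigma> (\<lambda>t. y t + c *\<^sub>R y' t)" using y by (simp add: left_kernel_def)
  have d: "deriv_on (left \<sigma>) (\<lambda>t. y t + c *\<^sub>R y' t) \<sigma> = y1 \<sigma> + c *\<^sub>R y1' \<sigma>"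
    by (rule T.deriv_on_jet[OF j left_facts(5)[OF \<sigma>]])
  show "corner \<delta> \<sigma> (\<lambda>t. y t + c *\<^sub>R y' t) = (\<lambda>t. corner \<delta> \<sigma> y t + c *\<^sub>R corner \<delta> \<sigma> y' t)"
    unfolding corner_def d a(3) b(3) by (auto simp: algebra_simps)
qed

lemma left_kernel_zero:
  assumes \<sigma>: "\<sigma> \<in> interior S"
  shows "left_kernel \<sigma> 0" "corner \<delta> \<sigma> 0 = 0"
proof -
  interpret T: sl_coefficients "left \<sigma>" P Q R P1 Q1 by (rule left_facts(7)[OF \<sigma>])
  have z: "(0 :: real \<Rightarrow> real^'d) = (\<lambda>t. 0)" by (simp add: fun_eq_iff)
  have "AE t in lebesgue_on (left \<sigma>). sturm_liouville (left \<sigma>) P Q R (\<lambda>t. 0) t = 0"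
    using T.L_AE[OF jet_zero] by eventually_elim simp
  moreover have "(\<lambda>t. 0) \<in> W22_on (left \<sigma>)" using jet_zero W22_on_iff_jet[OF left_facts(3)[OF \<sigma>]] by blast
  ultimately show "left_kernel \<sigma> 0" unfolding z by (simp add: left_kernel_def)
  have "deriv_on (left \<sigma>) (\<lambda>t. 0 :: real^'d) \<sigma> = 0"
    by (rule T.deriv_on_jet[OF jet_zero left_facts(5)[OF \<sigma>]])
  then show "corner \<delta> \<sigma> 0 = 0" unfolding z by (auto simp: corner_def)
qed

lemma left_kernel_sum:
  assumes \<sigma>: "\<sigma> \<in> interior S" and B: "finite B" "\<And>y. y \<in> B \<Longrightarrow> left_kernel \<sigma> y"
  shows "left_kernel \<sigma> (\<Sum>y\<in>B. c y *\<^sub>R y)" "corner \<delta> \<sigma> (\<Sum>y\<in>B. c y *\<^sub>R y) = (\<Sum>y\<in>B. c y *\<^sub>R corner \<delta> \<sigma> y)"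
proof -
  have "left_kernel \<sigma> (\<Sum>y\<in>B. c y *\<^sub>R y) \<and> corner \<delta> \<sigma> (\<Sum>y\<in>B. c y *\<^sub>R y) = (\<Sum>y\<in>B. c y *\<^sub>R corner \<delta> \<sigma> y)"
    using B
  proof (induction B rule: finite_induct)
    case empty
    show ?case unfolding sum.empty using left_kernel_zero[OF \<sigma>] by blast
  next
    case (insert z B)
    define s where "s = (\<Sum>y\<in>B. c y *\<^sub>R y)"
    have s: "left_kernel \<sigma> s" "corner \<delta> \<sigma> s = (\<Sum>y\<in>B. c y *\<^sub>R corner \<delta> \<sigma> y)" using insert by (auto simp: s_def)
    have z: "left_kernel \<sigma> z" using insert by simp
    have e: "(\<Sum>y\<in>insert z B. c y *\<^sub>R y) = (\<lambda>t. s t + c z *\<^sub>R z t)"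
      unfolding sum.insert[OF insert(1,2)] s_def[symmetric]
      by (rule ext) (simp only: plus_fun_apply scaleR_fun_apply add.commute)
    show ?case unfolding e left_kernel_combination(2)[OF \<sigma> s(1) z]
      unfolding s(2) sum.insert[OF insert(1,2)]
    proof
      show "left_kernel \<sigma> (\<lambda>t. s t + c z *\<^sub>R z t)" by (rule left_kernel_combination(1)[OF \<sigma> s(1) z])
      show "(\<lambda>t. (\<Sum>y\<in>B. c y *\<^sub>R corner \<delta> \<sigma> y) t + c z *\<^sub>R corner \<delta> \<sigma> z t) =
        c z *\<^sub>R corner \<delta> \<sigma> z + (\<Sum>y\<in>B. c y *\<^sub>R corner \<delta> \<sigma> y)"
        by (rule ext) (simp only: plus_fun_apply scaleR_fun_apply add.commute)
    qed
  qed
  then show "left_kernel \<sigma> (\<Sum>y\<in>B. c y *\<^sub>R y)" "corner \<delta> \<sigma> (\<Sum>y\<in>B. c y *\<^sub>R y) = (\<Sum>y\<in>B. c y *\<^sub>R corner \<delta> \<sigma> y)"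
    by blast+
qed

lemma form_linear_left:
  assumes f: "f \<in> W22_on S" "f' \<in> W22_on S" and u: "u \<in> L2_on S"
  shows "form (\<lambda>t. f t + c *\<^sub>R f' t) u = form f u + c * form f' u"
proof -
  obtain g h where j: "jet S f g h" using f(1) W22_on_iff_jet[OF closed] by blast
  obtain g' h' where j': "jet S f' g' h'" using f(2) W22_on_iff_jet[OF closed] by blast
  note i = L2_on_integrable_inner[OF ell_L2[OF j] u] L2_on_integrable_inner[OF ell_L2[OF j'] u]
  show ?thesis
    unfolding form_ell[OF j u] form_ell[OF j' u] form_ell[OF jet_add_scaleR[OF j j'] u] ell_linear
    using i by (simp add: inner_add_left)
qed

lemma form_linear_right:
  assumes f: "f \<in> W22_on S" and u: "u \<in> L2_on S" "u' \<in> L2_on S"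
  shows "form f (\<lambda>t. u t + c *\<^sub>R u' t) = form f u + c * form f u'"
  unfolding form_def
  using L2_on_integrable_inner[OF L_L2[OF f] u(1)] L2_on_integrable_inner[OF L_L2[OF f] u(2)]
  by (simp add: inner_add_right)

lemma W22_on_L2: "f \<in> W22_on S \<Longrightarrow> f \<in> L2_on S"
  by (simp add: W22_on_def)

lemma W22_on_zero: "0 \<in> W22_on S"
proof -
  have "(\<lambda>t. 0) \<in> W22_on S" using jet_zero W22_on_iff_jet[OF closed] by blast
  then show ?thesis by (simp add: zero_fun_def)
qed

lemma W22_on_combination: "f \<in> W22_on S \<Longrightarrow> f' \<in> W22_on S \<Longrightarrow> (\<lambda>t. f t + c *\<^sub>R f' t) \<in> W22_on S"
  unfolding W22_on_iff_jet[OF closed] by (elim exE) (intro exI, rule jet_add_scaleR)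

lemma form_zero: "form 0 u = 0" "form f 0 = 0"
proof -
  have "AE t in lebesgue_on S. L (\<lambda>t. 0) t = 0" using L_AE[OF jet_zero] by eventually_elim simp
  then have "AE t in lebesgue_on S. L 0 t \<bullet> u t = 0" unfolding zero_fun_def by eventually_elim simp
  then show "form 0 u = 0" unfolding form_def by (rule integral_eq_zero_AE)
  show "form f 0 = 0" by (simp add: form_def)
qed

lemma form_sum:
  assumes "finite A" "\<And>i. i \<in> A \<Longrightarrow> f i \<in> W22_on S"
  shows "(\<Sum>i\<in>A. f i) \<in> W22_on S" "u \<in> L2_on S \<Longrightarrow> form (\<Sum>i\<in>A. f i) u = (\<Sum>i\<in>A. form (f i) u)"
    "w \<in> W22_on S \<Longrightarrow> form w (\<Sum>i\<in>A. f i) = (\<Sum>i\<in>A. form w (f i))"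
proof -
  have "(\<Sum>i\<in>A. f i) \<in> W22_on S \<and> (u \<in> L2_on S \<longrightarrow> form (\<Sum>i\<in>A. f i) u = (\<Sum>i\<in>A. form (f i) u)) \<and>
    (w \<in> W22_on S \<longrightarrow> form w (\<Sum>i\<in>A. f i) = (\<Sum>i\<in>A. form w (f i)))"
    using assms
  proof (induction A rule: finite_induct)
    case empty
    show ?case unfolding sum.empty using W22_on_zero form_zero by blast
  next
    case (insert k A)
    define s where "s = (\<Sum>i\<in>A. f i)"
    have s: "s \<in> W22_on S" "u \<in> L2_on S \<longrightarrow> form s u = (\<Sum>i\<in>A. form (f i) u)"
      "w \<in> W22_on S \<longrightarrow> form w s = (\<Sum>i\<in>A. form w (f i))" using insert by (auto simp: s_def)
    have k: "f k \<in> W22_on S" using insert by simp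
    have e: "(\<Sum>i\<in>insert k A. f i) = (\<lambda>t. s t + 1 *\<^sub>R f k t)"
      unfolding sum.insert[OF insert(1,2)] s_def[symmetric]
      by (rule ext) (simp only: plus_fun_apply scaleR_one add.commute)
    show ?case unfolding e
      using W22_on_combination[OF s(1) k, of 1] form_linear_left[OF s(1) k, of u 1]
        form_linear_right[OF _ W22_on_L2[OF s(1)] W22_on_L2[OF k], of w 1] s(2,3) insert(1,2) by simp
  qed
  then show "(\<Sum>i\<in>A. f i) \<in> W22_on S" "u \<in> L2_on S \<Longrightarrow> form (\<Sum>i\<in>A. f i) u = (\<Sum>i\<in>A. form (f i) u)"
    "w \<in> W22_on S \<Longrightarrow> form w (\<Sum>i\<in>A. f i) = (\<Sum>i\<in>A. form w (f i))" by blast+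
qed

text \<open>One \<open>\<delta>\<close> serves all corners: small enough that each corner alone is
  negative and that the rounding intervals do not overlap. Then the form of the sum is the sum of
  the diagonal terms.\<close>

lemma corner_sum_negative:
  assumes F: "finite F" "F \<subseteq> interior S"
  shows "\<exists>\<delta>. \<forall>y. (\<forall>\<sigma>\<in>F. left_kernel \<sigma> (y \<sigma>)) \<longrightarrow>
    (\<Sum>\<sigma>\<in>F. corner \<delta> \<sigma> (y \<sigma>)) \<in> W22_on S \<and> dirichlet (\<Sum>\<sigma>\<in>F. corner \<delta> \<sigma> (y \<sigma>)) \<and>
    form (\<Sum>\<sigma>\<in>F. corner \<delta> \<sigma> (y \<sigma>)) (\<Sum>\<sigma>\<in>F. corner \<delta> \<sigma> (y \<sigma>)) \<le> 0 \<and>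
    ((\<exists>\<sigma>\<in>F. y \<sigma> \<noteq> 0) \<longrightarrow> form (\<Sum>\<sigma>\<in>F. corner \<delta> \<sigma> (y \<sigma>)) (\<Sum>\<sigma>\<in>F. corner \<delta> \<sigma> (y \<sigma>)) < 0)"
proof -
  have ev1: "\<forall>\<^sub>F \<delta> in at_right 0. {\<sigma> - \<delta>..\<sigma> + \<delta>} \<subseteq> S \<and>
      (\<forall>y. left_kernel \<sigma> y \<longrightarrow> y \<noteq> 0 \<longrightarrow> form (corner \<delta> \<sigma> y) (corner \<delta> \<sigma> y) < 0)" if "\<sigma> \<in> F" for \<sigma>
  proof -
    obtain \<delta>0 where d: "\<delta>0 > 0" "{\<sigma> - \<delta>0..\<sigma> + \<delta>0} \<subseteq> S"
      "\<And>\<delta> y. 0 < \<delta> \<Longrightarrow> \<delta> < \<delta>0 \<Longrightarrow> left_kernel \<sigma> y \<Longrightarrow> y \<noteq> 0 \<Longrightarrow> form (corner \<delta> \<sigma> y) (corner \<delta> \<sigma> y) < 0"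
      using corner_form_negative[of \<sigma>] F(2) \<open>\<sigma> \<in> F\<close> by blast
    show ?thesis
    proof (rule eventually_at_right_real[OF d(1), THEN eventually_mono])
      fix \<delta> assume \<delta>: "\<delta> \<in> {0<..<\<delta>0}"
      then have "{\<sigma> - \<delta>..\<sigma> + \<delta>} \<subseteq> {\<sigma> - \<delta>0..\<sigma> + \<delta>0}" by auto
      then show "{\<sigma> - \<delta>..\<sigma> + \<delta>} \<subseteq> S \<and>
        (\<forall>y. left_kernel \<sigma> y \<longrightarrow> y \<noteq> 0 \<longrightarrow> form (corner \<delta> \<sigma> y) (corner \<delta> \<sigma> y) < 0)"
        using d(2) d(3)[of \<delta>] \<delta> by auto
    qed
  qed
  have ev2: "\<forall>\<^sub>F \<delta> in at_right 0. \<sigma> < \<sigma>' \<longrightarrow> \<sigma> + \<delta> \<le> \<sigma>' - \<delta>" for \<sigma> \<sigma>' :: real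
  proof (cases "\<sigma> < \<sigma>'")
    case True
    then have "0 < (\<sigma>' - \<sigma>) / 2" by simp
    then show ?thesis by (rule eventually_at_right_real[THEN eventually_mono]) auto
  qed simp
  have "\<forall>\<^sub>F \<delta> in at_right (0::real). 0 < \<delta>" by (rule eventually_at_right_less)
  moreover have "\<forall>\<^sub>F \<delta> in at_right 0. \<forall>\<sigma>\<in>F. {\<sigma> - \<delta>..\<sigma> + \<delta>} \<subseteq> S \<and>
      (\<forall>y. left_kernel \<sigma> y \<longrightarrow> y \<noteq> 0 \<longrightarrow> form (corner \<delta> \<sigma> y) (corner \<delta> \<sigma> y) < 0)"
    by (rule eventually_ball_finite[OF F(1)]) (use ev1 in blast)
  moreover have "\<forall>\<^sub>F \<delta> in at_right 0. \<forall>\<sigma>\<in>F. \<forall>\<sigma>'\<in>F. \<sigma> < \<sigma>' \<longrightarrow> \<sigma> + \<delta> \<le> \<sigma>' - \<delta>"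
    by (intro eventually_ball_finite[OF F(1)] ballI ev2)
  ultimately have "\<forall>\<^sub>F \<delta> in at_right 0. 0 < \<delta> \<and> (\<forall>\<sigma>\<in>F. {\<sigma> - \<delta>..\<sigma> + \<delta>} \<subseteq> S \<and>
      (\<forall>y. left_kernel \<sigma> y \<longrightarrow> y \<noteq> 0 \<longrightarrow> form (corner \<delta> \<sigma> y) (corner \<delta> \<sigma> y) < 0)) \<and>
      (\<forall>\<sigma>\<in>F. \<forall>\<sigma>'\<in>F. \<sigma> < \<sigma>' \<longrightarrow> \<sigma> + \<delta> \<le> \<sigma>' - \<delta>)"
    by eventually_elim blast
  from eventually_happens[OF this] obtain \<delta> where \<delta>: "0 < \<delta>" "\<And>\<sigma>. \<sigma> \<in> F \<Longrightarrow> {\<sigma> - \<delta>..\<sigma> + \<delta>} \<subseteq> S"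
    "\<And>\<sigma> y. \<sigma> \<in> F \<Longrightarrow> left_kernel \<sigma> y \<Longrightarrow> y \<noteq> 0 \<Longrightarrow> form (corner \<delta> \<sigma> y) (corner \<delta> \<sigma> y) < 0"
    "\<And>\<sigma> \<sigma>'. \<sigma> \<in> F \<Longrightarrow> \<sigma>' \<in> F \<Longrightarrow> \<sigma> < \<sigma>' \<Longrightarrow> \<sigma> + \<delta> \<le> \<sigma>' - \<delta>" by auto
  show ?thesis
  proof (rule exI[of _ \<delta>], intro allI impI)
    fix y assume y: "\<forall>\<sigma>\<in>F. left_kernel \<sigma> (y \<sigma>)"
    define k where "k \<sigma> = corner \<delta> \<sigma> (y \<sigma>)" for \<sigma>
    have kW: "k \<sigma> \<in> W22_on S" "dirichlet (k \<sigma>)" if "\<sigma> \<in> F" for \<sigma>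
    proof -
      have i: "\<sigma> \<in> interior S" "left_kernel \<sigma> (y \<sigma>)" using that F(2) y by auto
      show "k \<sigma> \<in> W22_on S" using corner_ell_AE[OF i(2) \<delta>(1) \<delta>(2)[OF that] i(1)] jet_W22 unfolding k_def by blast
      show "dirichlet (k \<sigma>)" unfolding k_def by (rule corner_dirichlet[OF i(2) \<delta>(1) \<delta>(2)[OF that] i(1)])
    qed
    have orth: "form (k \<sigma>) (k \<sigma>') = 0" if s: "\<sigma> \<in> F" "\<sigma>' \<in> F" "\<sigma> \<noteq> \<sigma>'" for \<sigma> \<sigma>'
    proof -
      have i: "\<sigma> \<in> interior S" "left_kernel \<sigma> (y \<sigma>)" "\<sigma>' \<in> interior S" "left_kernel \<sigma>' (y \<sigma>')" using s F(2) y by auto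
      show ?thesis
      proof (cases "\<sigma> < \<sigma>'")
        case True
        show ?thesis unfolding k_def
          by (rule corner_form_orthogonal(2)[OF i(2,1) \<delta>(2)[OF s(1)] i(4,3) \<delta>(2)[OF s(2)] \<delta>(1) \<delta>(4)[OF s(1,2) True]])
      next
        case False
        then have "\<sigma>' < \<sigma>" using s(3) by simp
        show ?thesis unfolding k_def
          by (rule corner_form_orthogonal(1)[OF i(4,3) \<delta>(2)[OF s(2)] i(2,1) \<delta>(2)[OF s(1)] \<delta>(1) \<delta>(4)[OF s(2,1) \<open>\<sigma>' < \<sigma>\<close>]])
      qed
    qed
    have sW: "sum k F \<in> W22_on S" by (rule form_sum(1)[OF F(1) kW(1)])
    have diag: "(\<Sum>\<tau>\<in>F. form (k \<sigma>) (k \<tau>)) = form (k \<sigma>) (k \<sigma>)" if "\<sigma> \<in> F" for \<sigma>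
      using sum.remove[OF F(1) that, of "\<lambda>\<tau>. form (k \<sigma>) (k \<tau>)"] orth[OF that] by (simp add: sum.neutral)
    have "form (sum k F) (sum k F) = (\<Sum>\<sigma>\<in>F. form (k \<sigma>) (sum k F))"
      by (rule form_sum(2)[OF F(1) kW(1) W22_on_L2[OF sW]])
    also have "\<dots> = (\<Sum>\<sigma>\<in>F. form (k \<sigma>) (k \<sigma>))"
      by (rule sum.cong[OF refl]) (simp add: form_sum(3)[OF F(1) kW(1) kW(1)] diag)
    finally have e: "form (sum k F) (sum k F) = (\<Sum>\<sigma>\<in>F. form (k \<sigma>) (k \<sigma>))" .
    have le: "form (k \<sigma>) (k \<sigma>) \<le> 0" if "\<sigma> \<in> F" for \<sigma>
    proof (cases "y \<sigma> = 0")
      case True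
      have "\<sigma> \<in> interior S" using that F(2) by blast
      then show ?thesis unfolding k_def True left_kernel_zero(2)[OF \<open>\<sigma> \<in> interior S\<close>] form_zero(1) by simp
    next
      case False
      then show ?thesis unfolding k_def using \<delta>(3)[OF that _ False] y that by (blast intro: less_imp_le)
    qed
    have "dirichlet (sum k F)" using kW(2) by (simp add: dirichlet_def sum_fun_apply)
    moreover have "form (sum k F) (sum k F) \<le> 0" unfolding e by (rule sum_nonpos) (use le in blast)
    moreover have "form (sum k F) (sum k F) < 0" if "\<exists>\<sigma>\<in>F. y \<sigma> \<noteq> 0"
    proof -
      obtain \<sigma> where s: "\<sigma> \<in> F" "y \<sigma> \<noteq> 0" using \<open>\<exists>\<sigma>\<in>F. y \<sigma> \<noteq> 0\<close> by blast
      have "form (k \<sigma>) (k \<sigma>) < 0" unfolding k_def using \<delta>(3)[OF s(1) _ s(2)] y s by blast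
      moreover have "(\<Sum>\<sigma>\<in>F - {\<sigma>}. form (k \<sigma>) (k \<sigma>)) \<le> 0" by (rule sum_nonpos) (use le in blast)
      ultimately show ?thesis unfolding e sum.remove[OF F(1) s(1), of "\<lambda>\<sigma>. form (k \<sigma>) (k \<sigma>)"] by simp
    qed
    ultimately show "(\<Sum>\<sigma>\<in>F. corner \<delta> \<sigma> (y \<sigma>)) \<in> W22_on S \<and> dirichlet (\<Sum>\<sigma>\<in>F. corner \<delta> \<sigma> (y \<sigma>)) \<and>
      form (\<Sum>\<sigma>\<in>F. corner \<delta> \<sigma> (y \<sigma>)) (\<Sum>\<sigma>\<in>F. corner \<delta> \<sigma> (y \<sigma>)) \<le> 0 \<and>
      ((\<exists>\<sigma>\<in>F. y \<sigma> \<noteq> 0) \<longrightarrow> form (\<Sum>\<sigma>\<in>F. corner \<delta> \<sigma> (y \<sigma>)) (\<Sum>\<sigma>\<in>F. corner \<delta> \<sigma> (y \<sigma>)) < 0)"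
      using sW unfolding k_def by blast
  qed
qed

text \<open>For each conjugate point the coefficients combine the basis into a single kernel
  element, to which the sum over corners applies. The inequality \<open>\<le> 0\<close> is recorded
  for all coefficients because, on a graph, some edges may receive only zeros.\<close>

lemma negative_family:
  assumes F: "finite F" "F \<subseteq> interior S"
    and B: "\<And>\<sigma>. \<sigma> \<in> F \<Longrightarrow> finite (B \<sigma>)" "\<And>\<sigma>. \<sigma> \<in> F \<Longrightarrow> independent (B \<sigma>)" "\<And>\<sigma> y. \<sigma> \<in> F \<Longrightarrow> y \<in> B \<sigma> \<Longrightarrow> left_kernel \<sigma> y"
  shows "\<exists>u. \<forall>c. (\<Sum>p\<in>Sigma F B. c p *\<^sub>R u p) \<in> W22_on S \<and> dirichlet (\<Sum>p\<in>Sigma F B. c p *\<^sub>R u p) \<and>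
    form (\<Sum>p\<in>Sigma F B. c p *\<^sub>R u p) (\<Sum>p\<in>Sigma F B. c p *\<^sub>R u p) \<le> 0 \<and>
    ((\<exists>p\<in>Sigma F B. c p \<noteq> 0) \<longrightarrow> form (\<Sum>p\<in>Sigma F B. c p *\<^sub>R u p) (\<Sum>p\<in>Sigma F B. c p *\<^sub>R u p) < 0)"
proof -
  obtain \<delta> where \<delta>: "\<And>y. (\<forall>\<sigma>\<in>F. left_kernel \<sigma> (y \<sigma>)) \<Longrightarrow>
    (\<Sum>\<sigma>\<in>F. corner \<delta> \<sigma> (y \<sigma>)) \<in> W22_on S \<and> dirichlet (\<Sum>\<sigma>\<in>F. corner \<delta> \<sigma> (y \<sigma>)) \<and>
    form (\<Sum>\<sigma>\<in>F. corner \<delta> \<sigma> (y \<sigma>)) (\<Sum>\<sigma>\<in>F. corner \<delta> \<sigma> (y \<sigma>)) \<le> 0 \<and>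
    ((\<exists>\<sigma>\<in>F. y \<sigma> \<noteq> 0) \<longrightarrow> form (\<Sum>\<sigma>\<in>F. corner \<delta> \<sigma> (y \<sigma>)) (\<Sum>\<sigma>\<in>F. corner \<delta> \<sigma> (y \<sigma>)) < 0)"
    using corner_sum_negative[OF F] by blast
  define u where "u p = corner \<delta> (fst p) (snd p)" for p
  show ?thesis
  proof (rule exI[of _ u], rule allI)
    fix c :: "real \<times> (real \<Rightarrow> real^'d) \<Rightarrow> real"
    define y where "y \<sigma> = (\<Sum>b\<in>B \<sigma>. c (\<sigma>, b) *\<^sub>R b)" for \<sigma>
    have i: "\<sigma> \<in> interior S" if "\<sigma> \<in> F" for \<sigma> using that F(2) by blast
    have y: "\<forall>\<sigma>\<in>F. left_kernel \<sigma> (y \<sigma>)"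
      unfolding y_def by (intro ballI left_kernel_sum(1) i B)
    have "(\<Sum>p\<in>Sigma F B. c p *\<^sub>R u p) = (\<Sum>\<sigma>\<in>F. \<Sum>b\<in>B \<sigma>. c (\<sigma>, b) *\<^sub>R corner \<delta> \<sigma> b)"
      using B(1) by (subst sum.Sigma[OF F(1)]) (auto simp: u_def intro!: sum.cong)
    also have "\<dots> = (\<Sum>\<sigma>\<in>F. corner \<delta> \<sigma> (y \<sigma>))"
      unfolding y_def by (intro sum.cong refl left_kernel_sum(2)[symmetric] i B)
    finally have e: "(\<Sum>p\<in>Sigma F B. c p *\<^sub>R u p) = (\<Sum>\<sigma>\<in>F. corner \<delta> \<sigma> (y \<sigma>))" .
    have "\<exists>\<sigma>\<in>F. y \<sigma> \<noteq> 0" if "\<exists>p\<in>Sigma F B. c p \<noteq> 0"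
    proof -
      obtain \<sigma> b where p: "\<sigma> \<in> F" "b \<in> B \<sigma>" "c (\<sigma>, b) \<noteq> 0" using \<open>\<exists>p\<in>Sigma F B. c p \<noteq> 0\<close> by blast
      have "y \<sigma> \<noteq> 0"
        using independentD[OF B(2)[OF p(1)] B(1)[OF p(1)] order_refl, of "\<lambda>b. c (\<sigma>, b)" b] p unfolding y_def by blast
      then show ?thesis using p(1) by blast
    qed
    then show "(\<Sum>p\<in>Sigma F B. c p *\<^sub>R u p) \<in> W22_on S \<and> dirichlet (\<Sum>p\<in>Sigma F B. c p *\<^sub>R u p) \<and>
      form (\<Sum>p\<in>Sigma F B. c p *\<^sub>R u p) (\<Sum>p\<in>Sigma F B. c p *\<^sub>R u p) \<le> 0 \<and>
      ((\<exists>p\<in>Sigma F B. c p \<noteq> 0) \<longrightarrow> form (\<Sum>p\<in>Sigma F B. c p *\<^sub>R u p) (\<Sum>p\<in>Sigma F B. c p *\<^sub>R u p) < 0)"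
      unfolding e using \<delta>[OF y] by blast
  qed
qed

end

section \<open>Counting negative directions\<close>

text \<open>If no such vector existed, the functionals together would map \<open>span B\<close>
  injectively into the span of \<open>card K\<close> unit functions.\<close>

lemma common_kernel_vector:
  fixes B :: "'a::real_vector set" and \<Phi> :: "'k \<Rightarrow> 'a \<Rightarrow> real"
  assumes B: "finite B" "independent B" and K: "finite K" "\<And>k. k \<in> K \<Longrightarrow> linear (\<Phi> k)" "card K < card B"
  shows "\<exists>v\<in>span B. v \<noteq> 0 \<and> (\<forall>k\<in>K. \<Phi> k v = 0)"
proof (rule ccontr)
  assume neg: "\<not> ?thesis"
  define T where "T v = (\<lambda>k. if k \<in> K then \<Phi> k v else 0)" for v
  have lin: "linear T"
  proof (rule linearI)
    show "T (v + w) = T v + T w" for v w using linear_add[OF K(2)] by (auto simp: T_def fun_eq_iff)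
    show "T (c *\<^sub>R v) = c *\<^sub>R T v" for c v using linear_scale[OF K(2)] by (auto simp: T_def fun_eq_iff scaleR_fun_def)
  qed
  have "v = 0" if v: "v \<in> span B" "T v = 0" for v
  proof -
    have "\<Phi> k v = 0" if "k \<in> K" for k using fun_cong[OF v(2), of k] that by (simp add: T_def)
    then show ?thesis using neg v(1) by blast
  qed
  then have inj: "inj_on T (span B)" using linear_injective_on_subspace_0[OF lin subspace_span] by blast
  have ind: "independent (T ` B)" by (rule linear_independent_injective_image[OF lin B(2) inj])
  define E :: "'k \<Rightarrow> 'k \<Rightarrow> real" where "E k = (\<lambda>i. if i = k then 1 else 0)" for k
  have "T v = (\<Sum>k\<in>K. \<Phi> k v *\<^sub>R E k)" for v
    by (rule ext) (simp add: sum_fun_apply scaleR_fun_apply T_def E_def K(1) if_distrib cong: if_cong)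
  moreover have "(\<Sum>k\<in>K. \<Phi> k v *\<^sub>R E k) \<in> span (E ` K)" for v
    by (intro span_sum span_scale) (rule span_base, rule imageI)
  ultimately have "T v \<in> span (E ` K)" for v by simp
  then have "T ` B \<subseteq> span (E ` K)" by blast
  then have "card (T ` B) \<le> card (E ` K)"
    using real_vector.independent_span_bound[OF finite_imageI[OF K(1)] ind] by blast
  also have "\<dots> \<le> card K" by (rule card_image_le[OF K(1)])
  finally show False using card_image[OF inj_on_subset[OF inj span_superset]] K(3) by simp
qed

text \<open>Independence comes for free: a nontrivial vanishing combination would have negative
  value under \<open>q\<close>, against \<open>q 0 = 0\<close>. No linearity of \<open>q\<close>
  enters.\<close>

lemma negative_definite_family:
  fixes u :: "'i \<Rightarrow> 'a::real_vector" and q :: "'a \<Rightarrow> real"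
  assumes X: "finite X" and q0: "q 0 = 0"
    and q: "\<And>c. \<exists>i\<in>X. c i \<noteq> 0 \<Longrightarrow> q (\<Sum>i\<in>X. c i *\<^sub>R u i) < 0"
  shows "inj_on u X" "independent (u ` X)" "\<And>v. v \<in> span (u ` X) \<Longrightarrow> \<exists>c. v = (\<Sum>i\<in>X. c i *\<^sub>R u i)"
    "\<And>v. v \<in> span (u ` X) \<Longrightarrow> v \<noteq> 0 \<Longrightarrow> q v < 0"
proof -
  have zero: "c i = 0" if "(\<Sum>i\<in>X. c i *\<^sub>R u i) = 0" "i \<in> X" for c i
    using q[of c] q0 that by auto
  show inj: "inj_on u X"
  proof (rule inj_onI, rule ccontr)
    fix i k assume ik: "i \<in> X" "k \<in> X" "u i = u k" "i \<noteq> k"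
    \<comment> \<open>A repeated value would make this nonzero coefficient vector combine to
      zero.\<close>
    define c where "c l = (if l = i then 1 else 0) - (if l = k then 1 else (0::real))" for l
    have "(\<Sum>l\<in>X. c l *\<^sub>R u l) = (\<Sum>l\<in>X. (if l = i then u l else 0)) - (\<Sum>l\<in>X. (if l = k then u l else 0))"
      unfolding sum_subtractf[symmetric] by (rule sum.cong) (auto simp: c_def)
    also have "\<dots> = u i - u k" using X ik(1,2) by simp
    also have "\<dots> = 0" using ik(3) by simp
    finally have "c i = 0" using zero[OF _ ik(1)] by blast
    then show False using ik(4) by (simp add: c_def)
  qed
  have re: "(\<Sum>w\<in>u ` X. g w *\<^sub>R w) = (\<Sum>i\<in>X. g (u i) *\<^sub>R u i)" for g :: "'a \<Rightarrow> real"
    using sum.reindex[OF inj, of "\<lambda>w. g w *\<^sub>R w"] by (simp only: o_def)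
  show "independent (u ` X)"
  proof (rule independent_if_scalars_zero[OF finite_imageI[OF X]])
    fix g w assume "(\<Sum>w\<in>u ` X. g w *\<^sub>R w) = 0" "w \<in> u ` X"
    then show "g w = 0" unfolding re using zero[of "\<lambda>i. g (u i)"] by blast
  qed
  show comb: "\<exists>c. v = (\<Sum>i\<in>X. c i *\<^sub>R u i)" if v: "v \<in> span (u ` X)" for v
  proof -
    obtain g where "v = (\<Sum>w\<in>u ` X. g w *\<^sub>R w)" using v unfolding span_finite[OF finite_imageI[OF X]] by blast
    then show ?thesis unfolding re by (rule exI[of _ "\<lambda>i. g (u i)"])
  qed
  show "q v < 0" if v: "v \<in> span (u ` X)" "v \<noteq> 0" for v
  proof -
    obtain c where c: "v = (\<Sum>i\<in>X. c i *\<^sub>R u i)" using comb[OF v(1)] by blast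
    have "\<exists>i\<in>X. c i \<noteq> 0"
    proof (rule ccontr)
      assume "\<not> ?thesis"
      then have "v = 0" unfolding c by (intro sum.neutral) auto
      then show False using v(2) by blast
    qed
    from q[OF this] show ?thesis unfolding c .
  qed
qed

lemma edim_ge: "B \<subseteq> S \<Longrightarrow> finite B \<Longrightarrow> independent B \<Longrightarrow> enat (card B) \<le> edim S"
  unfolding edim_def by (rule SUP_upper2[of B]) auto

lemma edim_leI: "(\<And>B. B \<subseteq> S \<Longrightarrow> finite B \<Longrightarrow> independent B \<Longrightarrow> enat (card B) \<le> n) \<Longrightarrow> edim S \<le> n"
  unfolding edim_def by (rule SUP_least) auto

lemma edim_obtain:
  assumes "enat n \<le> edim S"
  obtains B where "B \<subseteq> S" "finite B" "independent B" "card B = n"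
proof -
  have "\<exists>B. B \<subseteq> S \<and> finite B \<and> independent B \<and> card B = n"
  proof (cases n)
    case 0
    then show ?thesis by (intro exI[of _ "{}"]) (simp add: independent_empty)
  next
    case (Suc m)
    have "\<exists>B. B \<subseteq> S \<and> finite B \<and> independent B \<and> n \<le> card B"
    proof (rule ccontr)
      assume neg: "\<not> ?thesis"
      have "edim S \<le> enat m"
      proof (rule edim_leI)
        fix B assume "B \<subseteq> S" "finite B" "independent B"
        then have "\<not> n \<le> card B" using neg by blast
        then show "enat (card B) \<le> enat m" using Suc by simp
      qed
      with assms have "enat n \<le> enat m" by (rule order_trans)
      then show False using Suc by simp
    qed
    then obtain B where B: "B \<subseteq> S" "finite B" "independent B" "n \<le> card B" by blast
    obtain C where C: "C \<subseteq> B" "card C = n" "finite C" using obtain_subset_with_card_n[OF B(4)] by blast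
    have "independent C" by (rule independent_mono[OF B(3) C(1)])
    then show ?thesis using C B(1) by blast
  qed
  then show ?thesis using that by blast
qed

text \<open>\<open>E\<close> is a basis of the orthogonal complement of the range, whose dimension
  is that of the kernel because a matrix and its transpose have equal rank.\<close>

lemma range_conditions:
  fixes A :: "real^'d^'d"
  shows "\<exists>E. finite E \<and> card E = dim {c. A *v c = 0} \<and> (\<forall>w. (\<forall>e\<in>E. w \<bullet> e = 0) \<longrightarrow> w \<in> range (\<lambda>c. A *v c))"
proof -
  have sub: "subspace (range (\<lambda>c. M *v c))" for M :: "real^'d^'d"
    by (rule linear_subspace_image[OF matrix_vector_mul_linear subspace_UNIV])
  define R where "R = range (\<lambda>c. A *v c)"
  define W where "W = {y \<in> UNIV. \<forall>x\<in>R. orthogonal x y}"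
  have R: "subspace R" unfolding R_def by (rule sub)
  have W: "subspace W" unfolding W_def using subspace_orthogonal_to_vectors[of R] by simp
  have d1: "dim W + dim R = dim (UNIV :: (real^'d) set)"
    unfolding W_def by (rule dim_subspace_orthogonal_to_vectors[OF R subspace_UNIV]) simp
  have "{c. A *v c = 0} = {y \<in> UNIV. \<forall>x\<in>range (\<lambda>c. transpose A *v c). orthogonal x y}"
  proof (intro equalityI subsetI)
    fix c assume "c \<in> {c. A *v c = 0}"
    then show "c \<in> {y \<in> UNIV. \<forall>x\<in>range (\<lambda>c. transpose A *v c). orthogonal x y}"
      by (auto simp: orthogonal_def dot_lmul_matrix)
  next
    fix c assume "c \<in> {y \<in> UNIV. \<forall>x\<in>range (\<lambda>c. transpose A *v c). orthogonal x y}"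
    then have "\<forall>z. (transpose A *v z) \<bullet> c = 0" by (auto simp: orthogonal_def)
    then have "(A *v c) \<bullet> (A *v c) = 0" by (simp add: dot_lmul_matrix)
    then show "c \<in> {c. A *v c = 0}" by simp
  qed
  then have "dim {c. A *v c = 0} + dim (range (\<lambda>c. transpose A *v c)) = dim (UNIV :: (real^'d) set)"
    using dim_subspace_orthogonal_to_vectors[OF sub[of "transpose A"] subspace_UNIV] by simp
  moreover have "dim (range (\<lambda>c. transpose A *v c)) = dim R"
    unfolding R_def rank_dim_range[symmetric] by (rule rank_transpose)
  ultimately have dW: "dim W = dim {c. A *v c = 0}" using d1 by simp
  obtain E where E: "E \<subseteq> W" "independent E" "W \<subseteq> span E" "card E = dim W" by (rule basis_exists)
  have "w \<in> R" if w: "\<forall>e\<in>E. w \<bullet> e = 0" for w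
  proof -
    define V where "V = {y \<in> UNIV. \<forall>x\<in>W. orthogonal x y}"
    have "orthogonal w x" if "x \<in> W" for x
    proof (rule orthogonal_to_span[of x E])
      show "x \<in> span E" using that E(3) by blast
      show "orthogonal w y" if "y \<in> E" for y using w that by (simp add: orthogonal_def)
    qed
    then have wV: "w \<in> V" by (simp add: V_def orthogonal_commute)
    have V: "subspace V" unfolding V_def using subspace_orthogonal_to_vectors[of W] by simp
    have "dim V + dim W = dim (UNIV :: (real^'d) set)"
      unfolding V_def by (rule dim_subspace_orthogonal_to_vectors[OF W subspace_UNIV]) simp
    then have "dim V \<le> dim R" using d1 by simp
    moreover have "R \<subseteq> V" by (auto simp: V_def W_def orthogonal_commute)
    ultimately have "R = V" using subspace_dim_equal[OF R V] by blast
    then show ?thesis using wV by simp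
  qed
  then show ?thesis using E(4) dW independent_imp_finite[OF E(2)] unfolding R_def by auto
qed

section \<open>Linear conditions that force nonnegativity\<close>

context sl_operator
begin

text \<open>Distinct vectors give distinct restricted solutions, so independent vectors in the
  kernel of \<open>Y \<sigma>\<close> give independent members of the Dirichlet kernel.\<close>

lemma left_basis_kernel_dim:
  assumes Y: "left_basis Y Y1" and \<sigma>: "\<sigma> \<in> interior S"
    and n: "\<And>B. finite B \<Longrightarrow> independent B \<Longrightarrow> (\<forall>y\<in>B. left_kernel \<sigma> y) \<Longrightarrow> card B \<le> n"
  shows "dim {c. Y \<sigma> *v c = 0} \<le> n" "\<And>c. Y \<sigma> *v c = 0 \<Longrightarrow> c \<noteq> 0 \<Longrightarrow> \<exists>y. y \<noteq> 0 \<and> left_kernel \<sigma> y"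
proof -
  define \<phi> where "\<phi> c = (\<lambda>t. if t \<in> left \<sigma> then Y t *v c else 0)" for c
  have K: "left_kernel \<sigma> (\<phi> c)" if "Y \<sigma> *v c = 0" for c
    using Y \<sigma> that unfolding left_basis_def \<phi>_def by blast
  have lin: "linear \<phi>"
    by (rule linearI) (auto simp: \<phi>_def fun_eq_iff scaleR_fun_def matrix_vector_right_distrib matrix_vector_mult_scaleR)
  have inj0: "c = 0" if "\<phi> c = 0" for c
  proof -
    have conj: "conjoined Y Y1" using Y unfolding left_basis_def by blast
    obtain k e where ke: "k > 0" "e > 0" "\<And>t c. t \<in> S \<Longrightarrow> \<bar>t - \<sigma>\<bar> < e \<Longrightarrow> k * \<bar>t - \<sigma>\<bar> * norm c \<le> norm (Y t *v c)"
      using conjoined_injective_bound[OF conj left_facts(1)[OF \<sigma>]] by blast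
    obtain r where r: "r > 0" "cball \<sigma> r \<subseteq> S" using \<sigma> by (meson mem_interior_cball)
    \<comment> \<open>A point of \<open>left \<sigma>\<close> near \<open>\<sigma>\<close> but
      different from it, where the first-order bound makes \<open>Y t\<close> injective.\<close>
    define t where "t = \<sigma> - min r (e / 2)"
    have m: "0 < min r (e / 2)" "min r (e / 2) \<le> r" "min r (e / 2) < e" using r ke(2) by auto
    have "t \<in> cball \<sigma> r" using m by (simp add: t_def dist_real_def)
    then have tS: "t \<in> S" using r(2) by blast
    then have "t \<in> left \<sigma>" using m by (simp add: left_def t_def)
    then have "Y t *v c = 0" using fun_cong[OF that, of t] by (simp add: \<phi>_def)
    moreover have "\<bar>t - \<sigma>\<bar> = min r (e / 2)" using m by (simp add: t_def)
    ultimately have "k * min r (e / 2) * norm c \<le> 0" using ke(3)[OF tS, of c] m(3) by simp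
    moreover have "0 < k * min r (e / 2)" using ke(1) m(1) by (rule mult_pos_pos)
    ultimately have "\<not> 0 < norm c" using mult_pos_pos[of "k * min r (e / 2)" "norm c"] by linarith
    then show ?thesis by simp
  qed
  then have inj: "inj \<phi>" using linear_injective_0[OF lin] by blast
  obtain B where B: "B \<subseteq> {c. Y \<sigma> *v c = 0}" "independent B" "{c. Y \<sigma> *v c = 0} \<subseteq> span B" "card B = dim {c. Y \<sigma> *v c = 0}"
    by (rule basis_exists)
  have fin: "finite B" using B(2) by (rule independent_imp_finite)
  have "independent (\<phi> ` B)"
    by (rule linear_independent_injective_image[OF lin B(2) inj_on_subset[OF inj subset_UNIV]])
  moreover have "\<forall>y\<in>\<phi> ` B. left_kernel \<sigma> y" using B(1) K by blast
  ultimately have "card (\<phi> ` B) \<le> n" using n fin by blast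
  then show "dim {c. Y \<sigma> *v c = 0} \<le> n" using B(4) card_image[OF inj_on_subset[OF inj subset_UNIV]] by simp
  show "\<exists>y. y \<noteq> 0 \<and> left_kernel \<sigma> y" if "Y \<sigma> *v c = 0" "c \<noteq> 0" for c
    using K[OF that(1)] inj0 that(2) by blast
qed

text \<open>The conditions in \<open>K\<close> place \<open>f \<sigma>\<close> in the range of
  \<open>Y \<sigma>\<close> at each point of \<open>F\<close>. These include all singular points,
  since a singular \<open>Y \<sigma>\<close> yields a nonzero Dirichlet kernel element.\<close>

lemma nonneg_conditions:
  assumes Y: "left_basis Y Y1" and F: "finite F" "F \<subseteq> interior S"
    and ker: "\<And>\<sigma> y. \<sigma> \<in> interior S \<Longrightarrow> left_kernel \<sigma> y \<Longrightarrow> y \<noteq> 0 \<Longrightarrow> \<sigma> \<in> F"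
    and n: "\<And>\<sigma> B. \<sigma> \<in> interior S \<Longrightarrow> finite B \<Longrightarrow> independent B \<Longrightarrow> (\<forall>y\<in>B. left_kernel \<sigma> y) \<Longrightarrow> card B \<le> n \<sigma>"
  shows "\<exists>K. finite K \<and> card K \<le> sum n F \<and>
    (\<forall>f\<in>W22_on S. dirichlet f \<longrightarrow> (\<forall>(\<sigma>, e)\<in>K. f \<sigma> \<bullet> e = 0) \<longrightarrow> 0 \<le> form f f)"
proof -
  have conj: "conjoined Y Y1" using Y unfolding left_basis_def by blast
  have inF: "\<sigma> \<in> F" if s: "\<sigma> \<in> interior S" "\<not> invertible (Y \<sigma>)" for \<sigma>
  proof -
    obtain c where c: "Y \<sigma> *v c = 0" "c \<noteq> 0"
      using s(2) unfolding invertible_left_inverse matrix_left_invertible_ker by blast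
    show ?thesis using left_basis_kernel_dim(2)[OF Y s(1) n[OF s(1)] c] ker[OF s(1)] by blast
  qed
  have "\<forall>\<sigma>. \<exists>E. finite E \<and> card E = dim {c. Y \<sigma> *v c = 0} \<and> (\<forall>w. (\<forall>e\<in>E. w \<bullet> e = 0) \<longrightarrow> w \<in> range (\<lambda>c. Y \<sigma> *v c))"
    using range_conditions by blast
  from choice[OF this] obtain E where E: "\<And>\<sigma>. finite (E \<sigma>)" "\<And>\<sigma>. card (E \<sigma>) = dim {c. Y \<sigma> *v c = 0}"
    "\<And>\<sigma> w. (\<forall>e\<in>E \<sigma>. w \<bullet> e = 0) \<Longrightarrow> w \<in> range (\<lambda>c. Y \<sigma> *v c)" by blast
  show ?thesis
  proof (rule exI[of _ "Sigma F E"], intro conjI ballI impI)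
    show "finite (Sigma F E)" using F(1) E(1) by (rule finite_SigmaI)
    have "card (Sigma F E) = (\<Sum>\<sigma>\<in>F. card (E \<sigma>))" using F(1) E(1) by simp
    also have "\<dots> \<le> sum n F"
      unfolding E(2) by (rule sum_mono) (use left_basis_kernel_dim(1)[OF Y _ n] F(2) in blast)
    finally show "card (Sigma F E) \<le> sum n F" .
    fix f assume f: "f \<in> W22_on S" "dirichlet f" "\<forall>(\<sigma>, e)\<in>Sigma F E. f \<sigma> \<bullet> e = 0"
    obtain g h where j: "jet S f g h" using f(1) W22_on_iff_jet[OF closed] by blast
    show "0 \<le> form f f"
    proof (rule form_nonneg[OF conj _ j f(2)])
      show "finite {t \<in> interior S. \<not> invertible (Y t)}" using inF by (intro finite_subset[OF _ F(1)]) blast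
      show "f t \<in> range (\<lambda>c. Y t *v c)" if "t \<in> interior S" "\<not> invertible (Y t)" for t
        by (rule E(3)) (use inF[OF that] f(3) in blast)
    qed
  qed
qed

end

section \<open>The metric graph\<close>

text \<open>Extension by zero from one edge to the graph; it transports statements about the graph
  operators to a single edge.\<close>

definition emb :: "'e \<Rightarrow> (real \<Rightarrow> real^'d) \<Rightarrow> ('e, 'd::finite) graph_fun" where
  "emb j f = (\<lambda>k t. if k = j then f t else 0)"

lemma emb_same [simp]: "emb j f j = f" and emb_other: "k \<noteq> j \<Longrightarrow> emb j f k = (\<lambda>t. 0)"
  by (simp_all add: emb_def)

lemma zero_fun_eta: "(\<lambda>t. 0) = 0"
  by (rule ext) simp

lemma emb_outside: "k \<noteq> j \<Longrightarrow> emb j f k = 0"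
  by (rule trans[OF emb_other zero_fun_eta])

section \<open>Restriction of the graph operators to a single edge\<close>

locale graph_linearization =
  fixes G :: "('v, 'e) metric_digraph" and Lag :: "('e, 'd::finite) lagrangian" and x :: "'e \<Rightarrow> real \<Rightarrow> real^'d"
  assumes G: "metric_graph G" and C2: "lagrangian_C2 G Lag" and convex: "lagrangian_convex G Lag"
    and reg: "regular_coefficients G Lag x"
    and minimal: "operator_in G (minimal_operator G Lag x)"
    and fredholm: "fredholm_op G (minimal_operator G Lag x)"
    and adjoint: "is_adjoint G (minimal_operator G Lag x) (maximal_operator G Lag x)"
begin

abbreviation A :: "('e, 'd) graph_fun \<Rightarrow> ('e, 'd) graph_fun" where "A \<equiv> graph_operator G Lag x"

abbreviation Le :: "'e \<Rightarrow> (real \<Rightarrow> real^'d) \<Rightarrow> real \<Rightarrow> real^'d" where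
  "Le j \<equiv> edge_operator G Lag x j (edge G j)"

definition edge_form :: "'e \<Rightarrow> (real \<Rightarrow> real^'d) \<Rightarrow> real" where
  "edge_form j f = (LINT t|lebesgue_on (edge G j). Le j f t \<bullet> f t)"

lemma edges_finite: "finite (arcs G)"
proof -
  have "fin_digraph (pre_digraph.truncate G)" using G by (simp add: metric_graph_def)
  then show ?thesis using fin_digraph.finite_arcs by (fastforce simp: pre_digraph.truncate_def)
qed

lemma edge_ends: "j \<in> arcs G \<Longrightarrow> lend G j < rend G j"
  using G by (simp add: metric_graph_def)

lemma A_edge: "j \<in> arcs G \<Longrightarrow> A f j = Le j (f j)"
  by (simp add: graph_operator_def)

lemma zero_W22: "(\<lambda>t. 0 :: real^'d) \<in> W22_on (edge G j)" if "j \<in> arcs G"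
  using jet_zero W22_on_iff_jet[OF edge_interval(2)[OF edge_ends[OF that]]] by blast

lemma zero_L2: "(\<lambda>t. 0 :: real^'d) \<in> L2_on (edge G j)" if "j \<in> arcs G"
  using zero_W22[OF that] by (simp add: W22_on_def)

lemma emb_W22: "f \<in> W22_on (edge G j) \<Longrightarrow> j \<in> arcs G \<Longrightarrow> emb j f \<in> W22_graph G"
  for f :: "real \<Rightarrow> real^'d"
  unfolding W22_graph_def
proof (intro CollectI conjI ballI allI impI)
  fix k assume "f \<in> W22_on (edge G j)" "k \<in> arcs G"
  then show "emb j f k \<in> W22_on (edge G k)" by (cases "k = j") (simp_all add: emb_other zero_W22)
next
  fix k assume "j \<in> arcs G" "k \<notin> arcs G"
  then have "k \<noteq> j" by blast
  then show "emb j f k = 0" by (rule emb_outside)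
qed

lemma emb_L2: "f \<in> L2_on (edge G j) \<Longrightarrow> j \<in> arcs G \<Longrightarrow> emb j f \<in> L2_graph G"
  for f :: "real \<Rightarrow> real^'d"
  unfolding L2_graph_def
proof (intro CollectI conjI ballI allI impI)
  fix k assume "f \<in> L2_on (edge G j)" "k \<in> arcs G"
  then show "emb j f k \<in> L2_on (edge G k)" by (cases "k = j") (simp_all add: emb_other zero_L2)
next
  fix k assume "j \<in> arcs G" "k \<notin> arcs G"
  then have "k \<noteq> j" by blast
  then show "emb j f k = 0" by (rule emb_outside)
qed

text \<open>\<open>L_L2\<close> on an edge is read off from the adjoint hypothesis, which presents
  the maximal operator on all of \<open>W22_graph\<close> as an operator in
  \<open>L2_graph\<close>.\<close>

lemma edge_sl_operator:
  assumes j: "j \<in> arcs G"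
  shows "\<exists>P1 Q1. sl_operator (edge G j) (coeff_P G Lag x j) (coeff_Q G Lag x j) (coeff_R G Lag x j) P1 Q1"
proof -
  obtain P1 Q1 where c: "sl_coefficients (edge G j) (coeff_P G Lag x j) (coeff_Q G Lag x j) (coeff_R G Lag x j) P1 Q1"
    using edge_sl_coefficients[OF G C2 convex reg j] by blast
  have "Le j f \<in> L2_on (edge G j)" if "f \<in> W22_on (edge G j)" for f
  proof -
    have "A (emb j f) \<in> L2_graph G"
      using adjoint emb_W22[OF that j] by (simp add: is_adjoint_def operator_in_def maximal_operator_def)
    then have "A (emb j f) j \<in> L2_on (edge G j)" using j by (simp add: L2_graph_def)
    then show ?thesis by (simp add: A_edge[OF j])
  qed
  then have "sl_operator (edge G j) (coeff_P G Lag x j) (coeff_Q G Lag x j) (coeff_R G Lag x j) P1 Q1"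
    unfolding edge_operator_def by (intro sl_operator.intro[OF c] sl_operator_axioms.intro)
  then show ?thesis by blast
qed

lemma Le_zero_AE: "AE t in lebesgue_on (edge G j). Le j (\<lambda>t. 0) t = 0" if j: "j \<in> arcs G"
proof -
  obtain P1 Q1 where "sl_operator (edge G j) (coeff_P G Lag x j) (coeff_Q G Lag x j) (coeff_R G Lag x j) P1 Q1"
    using edge_sl_operator[OF j] by blast
  then interpret sl_operator "edge G j" "coeff_P G Lag x j" "coeff_Q G Lag x j" "coeff_R G Lag x j" P1 Q1 .
  show ?thesis using L_AE[OF jet_zero] unfolding edge_operator_def by eventually_elim simp
qed

lemma inner_emb:
  fixes g :: "real \<Rightarrow> real^'d"
  assumes j: "j \<in> arcs G"
  shows "l2_inner G f (emb j g) = (LINT t|lebesgue_on (edge G j). f j t \<bullet> g t)"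
proof -
  have "(\<Sum>k\<in>arcs G - {j}. LINT t|lebesgue_on (edge G k). f k t \<bullet> emb j g k t) = 0"
    by (rule sum.neutral) (simp add: emb_other)
  then show ?thesis
    unfolding l2_inner_def sum.remove[OF edges_finite j, of "\<lambda>k. LINT t|lebesgue_on (edge G k). f k t \<bullet> emb j g k t"] by simp
qed

lemma ae_eq_emb:
  fixes f g :: "real \<Rightarrow> real^'d"
  assumes j: "j \<in> arcs G"
  shows "ae_eq G (emb j f) (emb j g) \<longleftrightarrow> (AE t in lebesgue_on (edge G j). f t = g t)"
    "ae_eq G (A (emb j f)) (emb j g) \<longleftrightarrow> (AE t in lebesgue_on (edge G j). Le j f t = g t)"
proof -
  show "ae_eq G (emb j f) (emb j g) \<longleftrightarrow> (AE t in lebesgue_on (edge G j). f t = g t)"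
  proof
    assume "ae_eq G (emb j f) (emb j g)"
    then have "AE t in lebesgue_on (edge G j). emb j f j t = emb j g j t" using j unfolding ae_eq_def by blast
    then show "AE t in lebesgue_on (edge G j). f t = g t" by simp
  next
    assume a: "AE t in lebesgue_on (edge G j). f t = g t"
    show "ae_eq G (emb j f) (emb j g)" unfolding ae_eq_def
    proof
      fix k show "AE t in lebesgue_on (edge G k). emb j f k t = emb j g k t"
      proof (cases "k = j")
        case True
        show ?thesis unfolding True emb_same by (rule a)
      qed (simp add: emb_other)
    qed
  qed
  show "ae_eq G (A (emb j f)) (emb j g) \<longleftrightarrow> (AE t in lebesgue_on (edge G j). Le j f t = g t)"
  proof
    assume "ae_eq G (A (emb j f)) (emb j g)"
    then have "AE t in lebesgue_on (edge G j). A (emb j f) j t = emb j g j t" using j unfolding ae_eq_def by blast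
    then show "AE t in lebesgue_on (edge G j). Le j f t = g t" by (simp add: A_edge[OF j])
  next
    assume a: "AE t in lebesgue_on (edge G j). Le j f t = g t"
    show "ae_eq G (A (emb j f)) (emb j g)" unfolding ae_eq_def
    proof
      fix k assume k: "k \<in> arcs G"
      show "AE t in lebesgue_on (edge G k). A (emb j f) k t = emb j g k t"
      proof (cases "k = j")
        case True
        show ?thesis unfolding A_edge[OF k] unfolding True emb_same by (rule a)
      next
        case False
        show ?thesis unfolding A_edge[OF k] emb_other[OF False] by (rule Le_zero_AE[OF k])
      qed
    qed
  qed
qed

text \<open>Linearity of \<open>W22_0_on\<close> is inherited from the domain of the minimal
  operator being a subspace.\<close>

lemma minimal_edge_domain:
  fixes f g :: "real \<Rightarrow> real^'d"
  assumes j: "j \<in> arcs G"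
  shows "f \<in> W22_0_on (edge G j) \<Longrightarrow> emb j f \<in> W22_0_graph G"
    "(\<lambda>t. 0 :: real^'d) \<in> W22_0_on (edge G j)"
    "f \<in> W22_0_on (edge G j) \<Longrightarrow> g \<in> W22_0_on (edge G j) \<Longrightarrow> (\<lambda>t. f t + c *\<^sub>R g t) \<in> W22_0_on (edge G j)"
proof -
  have sub: "subspace (W22_0_graph G :: ('e, 'd) graph_fun set)"
    using minimal by (simp add: operator_in_def minimal_operator_def)
  have z: "(\<lambda>t. 0 :: real^'d) \<in> W22_0_on (edge G k)" if "k \<in> arcs G" for k
  proof -
    have "(0 :: ('e, 'd) graph_fun) k \<in> W22_0_on (edge G k)"
      using subspace_0[OF sub] that unfolding W22_0_graph_def by blast
    then show ?thesis by (simp add: zero_fun_eta)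
  qed
  show "(\<lambda>t. 0 :: real^'d) \<in> W22_0_on (edge G j)" by (rule z[OF j])
  have e: "emb j f \<in> W22_0_graph G" if f: "f \<in> W22_0_on (edge G j)" for f :: "real \<Rightarrow> real^'d"
    unfolding W22_0_graph_def
  proof (intro CollectI conjI ballI allI impI)
    fix k assume "k \<in> arcs G"
    then show "emb j f k \<in> W22_0_on (edge G k)" using f by (cases "k = j") (simp_all add: emb_other z)
  next
    fix k assume "k \<notin> arcs G"
    then have "k \<noteq> j" using j by blast
    then show "emb j f k = 0" by (rule emb_outside)
  qed
  show "f \<in> W22_0_on (edge G j) \<Longrightarrow> emb j f \<in> W22_0_graph G" by (rule e)
  assume "f \<in> W22_0_on (edge G j)" "g \<in> W22_0_on (edge G j)"
  then have "emb j f + c *\<^sub>R emb j g \<in> W22_0_graph G" by (intro subspace_add[OF sub] subspace_scale[OF sub] e)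
  then have "(emb j f + c *\<^sub>R emb j g) j \<in> W22_0_on (edge G j)" using j unfolding W22_0_graph_def by blast
  moreover have "(emb j f + c *\<^sub>R emb j g) j = (\<lambda>t. f t + c *\<^sub>R g t)"
    by (rule ext) (simp only: plus_fun_apply scaleR_fun_apply emb_same)
  ultimately show "(\<lambda>t. f t + c *\<^sub>R g t) \<in> W22_0_on (edge G j)" by simp
qed

text \<open>Approximants extended by zero converge on the graph, because the operator annihilates
  the zero components up to null sets; the closed range in \<open>fredholm_op\<close> then gives a
  preimage, whose component on \<open>j\<close> is taken.\<close>

lemma edge_range_closed:
  assumes j: "j \<in> arcs G" and fs: "\<And>n. fs n \<in> W22_0_on (edge G j)" and h: "h \<in> L2_on (edge G j)"
    and lim: "(\<lambda>n. LINT t|lebesgue_on (edge G j). (norm (Le j (fs n) t - h t))\<^sup>2) \<longlonglongrightarrow> 0"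
  shows "\<exists>f\<in>W22_0_on (edge G j). AE t in lebesgue_on (edge G j). Le j f t = h t"
proof -
  have e: "l2_norm G (A (emb j (fs n)) - emb j h) = sqrt (LINT t|lebesgue_on (edge G j). (norm (Le j (fs n) t - h t))\<^sup>2)" for n
  proof -
    let ?u = "A (emb j (fs n)) - emb j h"
    have "(\<Sum>k\<in>arcs G - {j}. LINT t|lebesgue_on (edge G k). ?u k t \<bullet> ?u k t) = 0"
    proof (rule sum.neutral, rule ballI)
      fix k assume k: "k \<in> arcs G - {j}"
      have kj: "k \<in> arcs G" "k \<noteq> j" using k by blast+
      have u: "?u k t = Le k (\<lambda>t. 0) t" for t by (simp add: A_edge[OF kj(1)] emb_other[OF kj(2)])
      show "(LINT t|lebesgue_on (edge G k). ?u k t \<bullet> ?u k t) = 0"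
        unfolding u by (rule integral_eq_zero_AE) (use Le_zero_AE[OF kj(1)] in eventually_elim, simp)
    qed
    then have "l2_inner G ?u ?u = (LINT t|lebesgue_on (edge G j). ?u j t \<bullet> ?u j t)"
      unfolding l2_inner_def sum.remove[OF edges_finite j, of "\<lambda>k. LINT t|lebesgue_on (edge G k). ?u k t \<bullet> ?u k t"] by simp
    moreover have "?u j t = Le j (fs n) t - h t" for t by (simp add: A_edge[OF j])
    ultimately show ?thesis by (simp add: l2_norm_def power2_norm_eq_inner)
  qed
  have tend: "l2_tendsto G (\<lambda>n. A (emb j (fs n))) (emb j h)"
    unfolding l2_tendsto_def e using tendsto_real_sqrt[OF lim] by simp
  have rng: "\<And>fs h. h \<in> L2_graph G \<Longrightarrow> (\<forall>n. fs n \<in> W22_0_graph G) \<Longrightarrow> l2_tendsto G (\<lambda>n. A (fs n)) h \<Longrightarrow>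
      \<exists>f\<in>W22_0_graph G. ae_eq G (A f) h"
    using fredholm unfolding fredholm_op_def minimal_operator_def fst_conv snd_conv by blast
  have "\<exists>f\<in>W22_0_graph G. ae_eq G (A f) (emb j h)"
    by (rule rng[OF emb_L2[OF h j] allI tend]) (rule minimal_edge_domain(1)[OF j fs])
  then obtain f where f: "f \<in> W22_0_graph G" "ae_eq G (A f) (emb j h)" by blast
  have "f j \<in> W22_0_on (edge G j)" using f(1) j unfolding W22_0_graph_def by blast
  moreover have "AE t in lebesgue_on (edge G j). A f j t = emb j h j t" using f(2) j unfolding ae_eq_def by blast
  then have "AE t in lebesgue_on (edge G j). Le j (f j) t = h t" by (simp add: A_edge[OF j])
  ultimately show ?thesis by blast
qed

text \<open>Pairing with a function supported on one edge sees only the component on that edge, so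
  the adjoint relation on the graph splits.\<close>

lemma edge_adjoint:
  assumes j: "j \<in> arcs G" and g: "g \<in> L2_on (edge G j)" and h: "h \<in> L2_on (edge G j)"
  shows "(\<forall>f\<in>W22_0_on (edge G j). (LINT t|lebesgue_on (edge G j). Le j f t \<bullet> g t) = (LINT t|lebesgue_on (edge G j). f t \<bullet> h t)) \<longleftrightarrow>
    (\<exists>w\<in>W22_on (edge G j). (AE t in lebesgue_on (edge G j). w t = g t) \<and> (AE t in lebesgue_on (edge G j). Le j w t = h t))"
    (is "?l \<longleftrightarrow> ?r")
proof -
  have adj: "\<And>g h. g \<in> L2_graph G \<Longrightarrow> h \<in> L2_graph G \<Longrightarrow>
     (\<forall>f\<in>W22_0_graph G. l2_inner G (A f) g = l2_inner G f h) \<longleftrightarrow> (\<exists>w\<in>W22_graph G. ae_eq G w g \<and> ae_eq G (A w) h)"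
    using adjoint unfolding is_adjoint_def minimal_operator_def maximal_operator_def fst_conv snd_conv by blast
  have "?l \<longleftrightarrow> (\<forall>f\<in>W22_0_graph G. l2_inner G (A f) (emb j g) = l2_inner G f (emb j h))"
    unfolding inner_emb[OF j] A_edge[OF j]
  proof (intro iffI ballI)
    fix f :: "('e, 'd) graph_fun" assume l: ?l and "f \<in> W22_0_graph G"
    then have "f j \<in> W22_0_on (edge G j)" using j unfolding W22_0_graph_def by blast
    then show "(LINT t|lebesgue_on (edge G j). Le j (f j) t \<bullet> g t) = (LINT t|lebesgue_on (edge G j). f j t \<bullet> h t)"
      using l by blast
  next
    fix f :: "real \<Rightarrow> real^'d" assume l: "\<forall>f\<in>W22_0_graph G. (LINT t|lebesgue_on (edge G j). Le j (f j) t \<bullet> g t) = (LINT t|lebesgue_on (edge G j). f j t \<bullet> h t)"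
      and "f \<in> W22_0_on (edge G j)"
    then show "(LINT t|lebesgue_on (edge G j). Le j f t \<bullet> g t) = (LINT t|lebesgue_on (edge G j). f t \<bullet> h t)"
      using bspec[OF l minimal_edge_domain(1)[OF j]] by (simp only: emb_same)
  qed
  also have "\<dots> \<longleftrightarrow> (\<exists>w\<in>W22_graph G. ae_eq G w (emb j g) \<and> ae_eq G (A w) (emb j h))"
    by (rule adj[OF emb_L2[OF g j] emb_L2[OF h j]])
  also have "\<dots> \<longleftrightarrow> ?r"
  proof
    assume "\<exists>w\<in>W22_graph G. ae_eq G w (emb j g) \<and> ae_eq G (A w) (emb j h)"
    then obtain w where w: "w \<in> W22_graph G" "ae_eq G w (emb j g)" "ae_eq G (A w) (emb j h)" by blast
    have "w j \<in> W22_on (edge G j)" using w(1) j unfolding W22_graph_def by blast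
    moreover have "AE t in lebesgue_on (edge G j). w j t = emb j g j t" "AE t in lebesgue_on (edge G j). A w j t = emb j h j t"
      using w(2,3) j unfolding ae_eq_def by blast+
    ultimately show ?r unfolding emb_same A_edge[OF j] by blast
  next
    assume ?r
    then obtain w where w: "w \<in> W22_on (edge G j)" "AE t in lebesgue_on (edge G j). w t = g t" "AE t in lebesgue_on (edge G j). Le j w t = h t"
      by blast
    then show "\<exists>w\<in>W22_graph G. ae_eq G w (emb j g) \<and> ae_eq G (A w) (emb j h)"
      using emb_W22[OF w(1) j] ae_eq_emb[OF j] by blast
  qed
  finally show ?thesis .
qed

end

lemma edge_frontier:
  assumes "lend G j < rend G j"
  shows "frontier (edge G j) = {t. ereal t = lend G j \<or> ereal t = rend G j}"
proof -
  have "frontier (edge G j) = edge G j - {t. lend G j < ereal t \<and> ereal t < rend G j}"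
    unfolding frontier_def closure_closed[OF edge_interval(2)[OF assms]] edge_interval(4)[OF assms] ..
  also have "\<dots> = {t. ereal t = lend G j \<or> ereal t = rend G j}"
    using assms by (auto simp: edge_def)
  finally show ?thesis .
qed

text \<open>Translates the left-end condition of \<open>left_kernel\<close> into the one by
  \<open>lend\<close>; for an infinite left end both sides are false.\<close>

lemma edge_minimum:
  assumes le: "lend G j < rend G j"
  shows "a \<in> edge G j \<and> (\<forall>t\<in>edge G j. a \<le> t) \<longleftrightarrow> ereal a = lend G j"
proof
  assume a: "a \<in> edge G j \<and> (\<forall>t\<in>edge G j. a \<le> t)"
  show "ereal a = lend G j"
  proof (rule ccontr)
    assume "ereal a \<noteq> lend G j"
    moreover have "lend G j \<le> ereal a" using a by (simp add: edge_def)
    ultimately have "lend G j < ereal a" by order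
    then obtain c where c: "lend G j < ereal c" "ereal c < ereal a" using ereal_dense2 by blast
    have "ereal c \<le> rend G j" using c(2) a order_trans[of "ereal c" "ereal a" "rend G j"] by (simp add: edge_def)
    then have "c \<in> edge G j" using c(1) by (simp add: edge_def less_imp_le)
    then show False using a c(2) by force
  qed
next
  assume "ereal a = lend G j"
  then show "a \<in> edge G j \<and> (\<forall>t\<in>edge G j. a \<le> t)"
    using le by (auto simp: edge_def ereal_less_eq(3)[symmetric] simp del: ereal_less_eq(3))
qed

lemma vanishes_at_vertices_iff:
  assumes "\<And>j. j \<in> arcs G \<Longrightarrow> lend G j < rend G j"
  shows "vanishes_at_vertices G f \<longleftrightarrow> (\<forall>j\<in>arcs G. \<forall>t\<in>frontier (edge G j). f j t = 0)"
  using edge_frontier[OF assms] by (auto simp: vanishes_at_vertices_def edge_end_def)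

lemma sum_enat: "(\<Sum>i\<in>A. enat (f i)) = enat (\<Sum>i\<in>A. f i)"
  by (induction A rule: infinite_finite_induct) (simp_all add: zero_enat_def)

section \<open>Index bounds on the graph\<close>

context graph_linearization
begin

abbreviation ker :: "'e \<Rightarrow> real \<Rightarrow> (real \<Rightarrow> real^'d) set" where
  "ker j \<sigma> \<equiv> left_dirichlet_kernel G Lag x j \<sigma>"

lemma left_kernel_iff:
  assumes j: "j \<in> arcs G" and \<sigma>: "\<sigma> \<in> interior (edge G j)"
    and op: "sl_operator (edge G j) (coeff_P G Lag x j) (coeff_Q G Lag x j) (coeff_R G Lag x j) P1 Q1"
  shows "sl_operator.left_kernel (edge G j) (coeff_P G Lag x j) (coeff_Q G Lag x j) (coeff_R G Lag x j) \<sigma> y \<longleftrightarrow> y \<in> ker j \<sigma>"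
proof -
  interpret sl_operator "edge G j" "coeff_P G Lag x j" "coeff_Q G Lag x j" "coeff_R G Lag x j" P1 Q1 by (rule op)
  have "ereal \<sigma> \<le> rend G j" using \<sigma> interior_subset by (auto simp: edge_def)
  then have l: "left \<sigma> = left_part G j \<sigma>"
    unfolding left_def unfolding left_part_def edge_def
    using order_trans[of "ereal _" "ereal \<sigma>" "rend G j"] by auto
  have "(\<forall>a\<in>edge G j. (\<forall>t\<in>edge G j. a \<le> t) \<longrightarrow> y a = 0) \<longleftrightarrow> (\<forall>a. ereal a = lend G j \<longrightarrow> y a = 0)"
    unfolding edge_minimum[OF edge_ends[OF j], symmetric] by blast
  then show ?thesis
    unfolding left_kernel_def l left_dirichlet_kernel_def left_dirichlet_domain_def edge_operator_def by simp
qed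

lemma edge_lower:
  assumes j: "j \<in> arcs G" and F: "finite F" "F \<subseteq> interior (edge G j)"
    and B: "\<And>\<sigma>. \<sigma> \<in> F \<Longrightarrow> finite (B \<sigma>)" "\<And>\<sigma>. \<sigma> \<in> F \<Longrightarrow> independent (B \<sigma>)" "\<And>\<sigma>. \<sigma> \<in> F \<Longrightarrow> B \<sigma> \<subseteq> ker j \<sigma>"
  shows "\<exists>u. \<forall>c. (\<Sum>p\<in>Sigma F B. c p *\<^sub>R u p) \<in> W22_on (edge G j) \<and>
    (\<forall>t\<in>frontier (edge G j). (\<Sum>p\<in>Sigma F B. c p *\<^sub>R u p) t = 0) \<and>
    edge_form j (\<Sum>p\<in>Sigma F B. c p *\<^sub>R u p) \<le> 0 \<and>
    ((\<exists>p\<in>Sigma F B. c p \<noteq> 0) \<longrightarrow> edge_form j (\<Sum>p\<in>Sigma F B. c p *\<^sub>R u p) < 0)"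
proof -
  obtain P1 Q1 where op: "sl_operator (edge G j) (coeff_P G Lag x j) (coeff_Q G Lag x j) (coeff_R G Lag x j) P1 Q1"
    using edge_sl_operator[OF j] by blast
  then interpret sl_operator "edge G j" "coeff_P G Lag x j" "coeff_Q G Lag x j" "coeff_R G Lag x j" P1 Q1 .
  have e: "edge_form j f = form f f" for f by (simp add: edge_form_def form_def edge_operator_def)
  have lk: "left_kernel \<sigma> y" if "\<sigma> \<in> F" "y \<in> B \<sigma>" for \<sigma> y
    using left_kernel_iff[OF j subsetD[OF F(2) that(1)] op] B(3) that by blast
  show ?thesis unfolding e
    by (rule negative_family[of F B, unfolded dirichlet_def]) (simp_all add: F B lk)
qed

lemma edge_upper:
  assumes j: "j \<in> arcs G" and F: "finite F" "F \<subseteq> interior (edge G j)"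
    and ker: "\<And>\<sigma> y. \<sigma> \<in> interior (edge G j) \<Longrightarrow> y \<in> ker j \<sigma> \<Longrightarrow> y \<noteq> 0 \<Longrightarrow> \<sigma> \<in> F"
    and n: "\<And>\<sigma>. \<sigma> \<in> interior (edge G j) \<Longrightarrow> edim (ker j \<sigma>) \<le> enat (n \<sigma>)"
  shows "\<exists>K. finite K \<and> card K \<le> sum n F \<and> (\<forall>f\<in>W22_on (edge G j). (\<forall>t\<in>frontier (edge G j). f t = 0) \<longrightarrow>
    (\<forall>(\<sigma>, e)\<in>K. f \<sigma> \<bullet> e = 0) \<longrightarrow> 0 \<le> edge_form j f)"
proof -
  obtain P1 Q1 where op: "sl_operator (edge G j) (coeff_P G Lag x j) (coeff_Q G Lag x j) (coeff_R G Lag x j) P1 Q1"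
    using edge_sl_operator[OF j] by blast
  then interpret sl_operator "edge G j" "coeff_P G Lag x j" "coeff_Q G Lag x j" "coeff_R G Lag x j" P1 Q1 .
  note le = edge_ends[OF j]
  have form_eq: "form f g = (LINT t|lebesgue_on (edge G j). Le j f t \<bullet> g t)" for f g
    by (simp add: form_def edge_operator_def)
  have "\<exists>Y Y1. left_basis Y Y1"
  proof (cases "lend G j")
    case (real a)
    have "a \<in> edge G j \<and> (\<forall>t\<in>edge G j. a \<le> t)" unfolding edge_minimum[OF le] using real by simp
    then show ?thesis by (intro left_basis_finite_end[of a]) blast+
  next
    case PInf
    then show ?thesis using le by simp
  next
    case MInf
    \<comment> \<open>No edge is a full line, so an edge with infinite left end is a half-line with
      a finite right end at which boundary data can be compared.\<close>
    have "rend G j \<noteq> \<infinity>" using G j MInf by (simp add: metric_graph_def)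
    then obtain b where b: "rend G j = ereal b" using le MInf by (cases "rend G j") auto
    have Sb: "edge G j = {..b}" by (auto simp: edge_def MInf b)
    show ?thesis
    proof (rule left_basis_infinite_end[OF _ _ _ _ _ Sb, of "W22_0_on (edge G j)"])
      show "W22_0_on (edge G j) \<subseteq> (W22_on (edge G j) :: (real \<Rightarrow> real^'d) set)" by (auto simp: W22_0_on_def)
      show "(W22_0_on (edge G j) :: (real \<Rightarrow> real^'d) set) \<noteq> {}" using minimal_edge_domain(2)[OF j] by blast
      show "(\<lambda>t. f t + c *\<^sub>R g t) \<in> W22_0_on (edge G j)"
        if "f \<in> W22_0_on (edge G j)" "g \<in> W22_0_on (edge G j)" for f g :: "real \<Rightarrow> real^'d" and c
        by (rule minimal_edge_domain(3)[OF j that])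
      show "\<exists>f\<in>W22_0_on (edge G j). AE t in lebesgue_on (edge G j). L f t = h t"
        if "\<And>n. fs n \<in> W22_0_on (edge G j)" "h \<in> L2_on (edge G j)"
          "(\<lambda>n. LINT t|lebesgue_on (edge G j). (norm (L (fs n) t - h t))\<^sup>2) \<longlonglongrightarrow> 0" for fs h
        by (rule edge_range_closed[OF j, of fs h, unfolded edge_operator_def]) (fact that)+
      show "(\<forall>f\<in>W22_0_on (edge G j). form f g = (LINT t|lebesgue_on (edge G j). f t \<bullet> h t)) \<longleftrightarrow>
        (\<exists>w\<in>W22_on (edge G j). (AE t in lebesgue_on (edge G j). w t = g t) \<and> (AE t in lebesgue_on (edge G j). L w t = h t))"
        if "g \<in> L2_on (edge G j)" "h \<in> L2_on (edge G j)" for g h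
        using edge_adjoint[OF j that] unfolding form_eq edge_operator_def .
    qed
  qed
  then obtain Y Y1 where Y: "left_basis Y Y1" by blast
  note iff = left_kernel_iff[OF j _ op]
  have "\<exists>K. finite K \<and> card K \<le> sum n F \<and>
    (\<forall>f\<in>W22_on (edge G j). dirichlet f \<longrightarrow> (\<forall>(\<sigma>, e)\<in>K. f \<sigma> \<bullet> e = 0) \<longrightarrow> 0 \<le> form f f)"
  proof (rule nonneg_conditions[OF Y F])
    show "\<sigma> \<in> F" if "\<sigma> \<in> interior (edge G j)" "left_kernel \<sigma> y" "y \<noteq> 0" for \<sigma> y
      by (rule ker[OF that(1) _ that(3)]) (use iff[OF that(1)] that(2) in blast)
    show "card B \<le> n \<sigma>" if "\<sigma> \<in> interior (edge G j)" "finite B" "independent B" "\<forall>y\<in>B. left_kernel \<sigma> y" for \<sigma> B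
    proof -
      have "B \<subseteq> ker j \<sigma>" using iff[OF that(1)] that(4) by blast
      then have "enat (card B) \<le> enat (n \<sigma>)" using edim_ge[OF _ that(2,3)] n[OF that(1)] order_trans by blast
      then show ?thesis by simp
    qed
  qed
  then show ?thesis unfolding dirichlet_def edge_form_def form_eq .
qed

lemma inner_edge_form: "l2_inner G (A f) f = (\<Sum>j\<in>arcs G. edge_form j (f j))"
  unfolding l2_inner_def edge_form_def by (rule sum.cong) (simp_all add: A_edge)

lemma dirichlet_operator_domain:
  "f \<in> fst (dirichlet_operator G Lag x) \<longleftrightarrow> f \<in> W22_graph G \<and> (\<forall>j\<in>arcs G. \<forall>t\<in>frontier (edge G j). f j t = 0)"
  by (simp add: vanishes_at_vertices_iff[OF edge_ends] dirichlet_operator_def maximal_operator_def)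

lemma morse_index_lower:
  assumes F: "\<And>j. j \<in> arcs G \<Longrightarrow> finite (F j)" "\<And>j. j \<in> arcs G \<Longrightarrow> F j \<subseteq> interior (edge G j)"
    and n: "\<And>j \<sigma>. j \<in> arcs G \<Longrightarrow> \<sigma> \<in> F j \<Longrightarrow> enat (n j \<sigma>) \<le> edim (ker j \<sigma>)"
  shows "enat (\<Sum>j\<in>arcs G. \<Sum>\<sigma>\<in>F j. n j \<sigma>) \<le> morse_index G (dirichlet_operator G Lag x)"
proof -
  have "\<forall>p\<in>Sigma (arcs G) F. \<exists>B. B \<subseteq> ker (fst p) (snd p) \<and> finite B \<and> independent B \<and> card B = n (fst p) (snd p)"
  proof
    fix p assume "p \<in> Sigma (arcs G) F"
    then have "enat (n (fst p) (snd p)) \<le> edim (ker (fst p) (snd p))" using n by auto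
    then show "\<exists>B. B \<subseteq> ker (fst p) (snd p) \<and> finite B \<and> independent B \<and> card B = n (fst p) (snd p)"
      by (rule edim_obtain) blast
  qed
  from bchoice[OF this] obtain B0 where B0: "\<forall>p\<in>Sigma (arcs G) F. B0 p \<subseteq> ker (fst p) (snd p) \<and>
    finite (B0 p) \<and> independent (B0 p) \<and> card (B0 p) = n (fst p) (snd p)" by blast
  define B where "B j \<sigma> = B0 (j, \<sigma>)" for j \<sigma>
  have B: "B j \<sigma> \<subseteq> ker j \<sigma>" "finite (B j \<sigma>)" "independent (B j \<sigma>)" "card (B j \<sigma>) = n j \<sigma>"
    if "j \<in> arcs G" "\<sigma> \<in> F j" for j \<sigma>
    using bspec[OF B0, of "(j, \<sigma>)"] that unfolding B_def by auto
  define Y where "Y j = Sigma (F j) (B j)" for j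
  have Y: "finite (Y j)" "card (Y j) = (\<Sum>\<sigma>\<in>F j. n j \<sigma>)" if "j \<in> arcs G" for j
  proof -
    show "finite (Y j)" unfolding Y_def using F(1)[OF that] B(2)[OF that] by (rule finite_SigmaI)
    have "card (Y j) = (\<Sum>\<sigma>\<in>F j. card (B j \<sigma>))" unfolding Y_def using F(1)[OF that] B(2)[OF that] by simp
    then show "card (Y j) = (\<Sum>\<sigma>\<in>F j. n j \<sigma>)" using B(4)[OF that] by simp
  qed
  have "\<forall>j\<in>arcs G. \<exists>u. \<forall>c. (\<Sum>p\<in>Y j. c p *\<^sub>R u p) \<in> W22_on (edge G j) \<and>
    (\<forall>t\<in>frontier (edge G j). (\<Sum>p\<in>Y j. c p *\<^sub>R u p) t = 0) \<and>
    edge_form j (\<Sum>p\<in>Y j. c p *\<^sub>R u p) \<le> 0 \<and>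
    ((\<exists>p\<in>Y j. c p \<noteq> 0) \<longrightarrow> edge_form j (\<Sum>p\<in>Y j. c p *\<^sub>R u p) < 0)"
    unfolding Y_def by (intro ballI edge_lower F B)
  from bchoice[OF this] obtain u where u: "\<And>j c. j \<in> arcs G \<Longrightarrow> (\<Sum>p\<in>Y j. c p *\<^sub>R u j p) \<in> W22_on (edge G j)"
    "\<And>j c t. j \<in> arcs G \<Longrightarrow> t \<in> frontier (edge G j) \<Longrightarrow> (\<Sum>p\<in>Y j. c p *\<^sub>R u j p) t = 0"
    "\<And>j c. j \<in> arcs G \<Longrightarrow> edge_form j (\<Sum>p\<in>Y j. c p *\<^sub>R u j p) \<le> 0"
    "\<And>j c. j \<in> arcs G \<Longrightarrow> (\<exists>p\<in>Y j. c p \<noteq> 0) \<Longrightarrow> edge_form j (\<Sum>p\<in>Y j. c p *\<^sub>R u j p) < 0"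
    by blast
  define X where "X = Sigma (arcs G) Y"
  define U where "U p = emb (fst p) (u (fst p) (snd p))" for p
  define s where "s c j = (\<Sum>p\<in>Y j. c (j, p) *\<^sub>R u j p)" for c :: "'e \<times> real \<times> (real \<Rightarrow> real^'d) \<Rightarrow> real" and j
  have X: "finite X" "card X = (\<Sum>j\<in>arcs G. \<Sum>\<sigma>\<in>F j. n j \<sigma>)"
  proof -
    show "finite X" unfolding X_def using edges_finite Y(1) by (rule finite_SigmaI)
    show "card X = (\<Sum>j\<in>arcs G. \<Sum>\<sigma>\<in>F j. n j \<sigma>)" unfolding X_def using edges_finite Y by simp
  qed
  \<comment> \<open>On each edge the superposition reduces to the family belonging to that edge, so
    domain and form can be treated edge by edge.\<close>
  have comp: "(\<Sum>p\<in>X. c p *\<^sub>R U p) k = (if k \<in> arcs G then s c k else 0)" for c k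
  proof -
    have "(\<Sum>p\<in>X. c p *\<^sub>R U p) = (\<Sum>j\<in>arcs G. \<Sum>p\<in>Y j. c (j, p) *\<^sub>R emb j (u j p))"
      unfolding X_def using Y(1) by (subst sum.Sigma[OF edges_finite]) (auto simp: U_def intro!: sum.cong)
    then have "(\<Sum>p\<in>X. c p *\<^sub>R U p) k = (\<Sum>j\<in>arcs G. \<Sum>p\<in>Y j. c (j, p) *\<^sub>R emb j (u j p) k)"
      by (simp only: sum_fun_apply scaleR_fun_apply)
    also have "\<dots> = (\<Sum>j\<in>arcs G. if j = k then s c j else 0)"
    proof (rule sum.cong[OF refl])
      fix j
      show "(\<Sum>p\<in>Y j. c (j, p) *\<^sub>R emb j (u j p) k) = (if j = k then s c j else 0)"
      proof (cases "j = k")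
        case True
        show ?thesis unfolding s_def True emb_same by simp
      next
        case False
        then have "k \<noteq> j" by blast
        then show ?thesis unfolding emb_outside[OF \<open>k \<noteq> j\<close>] using False by simp
      qed
    qed
    also have "\<dots> = (if k \<in> arcs G then s c k else 0)" using edges_finite by (rule sum.delta)
    finally show ?thesis .
  qed
  have dom: "(\<Sum>p\<in>X. c p *\<^sub>R U p) \<in> fst (dirichlet_operator G Lag x)" for c
    unfolding dirichlet_operator_domain W22_graph_def comp
    using u(1,2) unfolding s_def by (simp add: comp)
  define q where "q f = l2_inner G (A f) f" for f
  have q: "q (\<Sum>p\<in>X. c p *\<^sub>R U p) = (\<Sum>j\<in>arcs G. edge_form j (s c j))" for c
    unfolding q_def inner_edge_form by (rule sum.cong) (simp_all add: comp)
  have neg: "q (\<Sum>p\<in>X. c p *\<^sub>R U p) < 0" if "\<exists>p\<in>X. c p \<noteq> 0" for c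
  proof -
    obtain j p where jp: "j \<in> arcs G" "p \<in> Y j" "c (j, p) \<noteq> 0" using \<open>\<exists>p\<in>X. c p \<noteq> 0\<close> unfolding X_def by blast
    have "edge_form j (s c j) < 0" unfolding s_def
      by (rule u(4)[OF jp(1), of "\<lambda>p. c (j, p)"]) (use jp in blast)
    moreover have "(\<Sum>k\<in>arcs G - {j}. edge_form k (s c k)) \<le> 0"
    proof (rule sum_nonpos)
      fix k assume "k \<in> arcs G - {j}"
      then have "k \<in> arcs G" by blast
      then show "edge_form k (s c k) \<le> 0" unfolding s_def by (rule u(3)[of k "\<lambda>p. c (k, p)"])
    qed
    ultimately show ?thesis unfolding q sum.remove[OF edges_finite jp(1), of "\<lambda>k. edge_form k (s c k)"] by simp
  qed
  have q0: "q 0 = 0" by (simp add: q_def l2_inner_def)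
  have fam: "inj_on U X" "independent (U ` X)" "\<And>v. v \<in> span (U ` X) \<Longrightarrow> \<exists>c. v = (\<Sum>p\<in>X. c p *\<^sub>R U p)"
    "\<And>v. v \<in> span (U ` X) \<Longrightarrow> v \<noteq> 0 \<Longrightarrow> q v < 0"
    by (rule negative_definite_family[of X q U]; (rule X(1) | rule q0 | assumption | erule neg))+
  let ?V = "span (U ` X)"
  have "enat (card X) = enat (card (U ` X))" by (simp add: card_image[OF fam(1)])
  also have "\<dots> \<le> edim ?V" by (rule edim_ge[OF span_superset finite_imageI[OF X(1)] fam(2)])
  also have "\<dots> \<le> morse_index G (dirichlet_operator G Lag x)"
    unfolding morse_index_def
  proof (rule SUP_upper, intro CollectI conjI ballI impI)
    show "subspace ?V" by (rule subspace_span)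
    show "?V \<subseteq> fst (dirichlet_operator G Lag x)"
    proof
      fix v assume "v \<in> ?V"
      from fam(3)[OF this] show "v \<in> fst (dirichlet_operator G Lag x)" using dom by blast
    qed
    show "l2_inner G (snd (dirichlet_operator G Lag x) v) v < 0" if "v \<in> ?V" "v \<noteq> 0" for v
      using fam(4)[OF that] by (simp add: q_def dirichlet_operator_def maximal_operator_def)
  qed
  finally show ?thesis unfolding X(2) .
qed

text \<open>A negative subspace with more independent vectors than there are conditions contains a
  nonzero vector satisfying all conditions on all edges, on which the form would be
  nonnegative.\<close>

lemma morse_index_upper:
  assumes F: "\<And>j. j \<in> arcs G \<Longrightarrow> finite (F j)" "\<And>j. j \<in> arcs G \<Longrightarrow> F j \<subseteq> interior (edge G j)"
    and ker: "\<And>j \<sigma> y. j \<in> arcs G \<Longrightarrow> \<sigma> \<in> interior (edge G j) \<Longrightarrow> y \<in> ker j \<sigma> \<Longrightarrow> y \<noteq> 0 \<Longrightarrow> \<sigma> \<in> F j"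
    and n: "\<And>j \<sigma>. j \<in> arcs G \<Longrightarrow> \<sigma> \<in> interior (edge G j) \<Longrightarrow> edim (ker j \<sigma>) \<le> enat (n j \<sigma>)"
  shows "morse_index G (dirichlet_operator G Lag x) \<le> enat (\<Sum>j\<in>arcs G. \<Sum>\<sigma>\<in>F j. n j \<sigma>)"
proof -
  have "\<forall>j\<in>arcs G. \<exists>K. finite K \<and> card K \<le> sum (n j) (F j) \<and> (\<forall>f\<in>W22_on (edge G j). (\<forall>t\<in>frontier (edge G j). f t = 0) \<longrightarrow>
    (\<forall>(\<sigma>, e)\<in>K. f \<sigma> \<bullet> e = 0) \<longrightarrow> 0 \<le> edge_form j f)"
    by (intro ballI edge_upper F n) (use ker in blast)+
  from bchoice[OF this] obtain K where K: "\<And>j. j \<in> arcs G \<Longrightarrow> finite (K j)" "\<And>j. j \<in> arcs G \<Longrightarrow> card (K j) \<le> sum (n j) (F j)"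
    "\<And>j f. j \<in> arcs G \<Longrightarrow> f \<in> W22_on (edge G j) \<Longrightarrow> (\<forall>t\<in>frontier (edge G j). f t = 0) \<Longrightarrow>
      (\<forall>(\<sigma>, e)\<in>K j. f \<sigma> \<bullet> e = 0) \<Longrightarrow> 0 \<le> edge_form j f" by blast
  define \<Phi> where "\<Phi> k f = f (fst k) (fst (snd k)) \<bullet> snd (snd k)" for k :: "'e \<times> real \<times> (real^'d)" and f :: "('e, 'd) graph_fun"
  have lin: "linear (\<Phi> k)" for k
    by (rule linearI) (simp_all add: \<Phi>_def scaleR_fun_def inner_add_left)
  have fin: "finite (Sigma (arcs G) K)" using edges_finite K(1) by (rule finite_SigmaI)
  have "card (Sigma (arcs G) K) = (\<Sum>j\<in>arcs G. card (K j))" using edges_finite K(1) by simp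
  also have "\<dots> \<le> (\<Sum>j\<in>arcs G. sum (n j) (F j))" by (rule sum_mono) (rule K(2))
  finally have cK: "card (Sigma (arcs G) K) \<le> (\<Sum>j\<in>arcs G. sum (n j) (F j))" .
  show ?thesis
    unfolding morse_index_def
  proof (rule SUP_least, rule edim_leI, rule ccontr)
    fix V B
    assume V: "V \<in> {V. subspace V \<and> V \<subseteq> fst (dirichlet_operator G Lag x) \<and>
        (\<forall>f\<in>V. f \<noteq> 0 \<longrightarrow> l2_inner G (snd (dirichlet_operator G Lag x) f) f < 0)}"
      and B: "B \<subseteq> V" "finite B" "independent B"
      and "\<not> enat (card B) \<le> enat (\<Sum>j\<in>arcs G. sum (n j) (F j))"
    then have less: "card (Sigma (arcs G) K) < card B" using cK by simp
    have "\<exists>v\<in>span B. v \<noteq> 0 \<and> (\<forall>k\<in>Sigma (arcs G) K. \<Phi> k v = 0)"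
      by (rule common_kernel_vector[OF B(2,3) fin lin less])
    then obtain v where v: "v \<in> span B" "v \<noteq> 0" "\<And>k. k \<in> Sigma (arcs G) K \<Longrightarrow> \<Phi> k v = 0" by blast
    have sub: "subspace V" and dom: "V \<subseteq> fst (dirichlet_operator G Lag x)"
      and neg: "\<And>f. f \<in> V \<Longrightarrow> f \<noteq> 0 \<Longrightarrow> l2_inner G (snd (dirichlet_operator G Lag x) f) f < 0"
      using V by blast+
    have vV: "v \<in> V" using v(1) span_minimal[OF B(1) sub] by blast
    then have d: "v \<in> W22_graph G" "\<And>j t. j \<in> arcs G \<Longrightarrow> t \<in> frontier (edge G j) \<Longrightarrow> v j t = 0"
      using dom dirichlet_operator_domain by blast+
    have "0 \<le> edge_form j (v j)" if j: "j \<in> arcs G" for j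
    proof (rule K(3)[OF j])
      show "v j \<in> W22_on (edge G j)" using d(1) j unfolding W22_graph_def by blast
      show "\<forall>t\<in>frontier (edge G j). v j t = 0" using d(2)[OF j] by blast
      show "\<forall>(\<sigma>, e)\<in>K j. v j \<sigma> \<bullet> e = 0"
        using v(3)[of "(j, _, _)"] j by (auto simp: \<Phi>_def)
    qed
    then have "0 \<le> l2_inner G (A v) v" unfolding inner_edge_form by (rule sum_nonneg)
    moreover have "l2_inner G (A v) v < 0"
      using neg[OF vV v(2)] by (simp add: dirichlet_operator_def maximal_operator_def)
    ultimately show False by simp
  qed
qed

text \<open>If all multiplicities are finite and finitely many are nonzero, the two bounds meet.
  Otherwise finite families of total multiplicity \<open>m\<close>, for every \<open>m\<close>, show
  that both sides are infinite.\<close>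

theorem morse_index_formula:
  "morse_index G (dirichlet_operator G Lag x) = (\<Sum>j\<in>arcs G. \<Sum>\<^sub>\<infinity>\<sigma>\<in>interior (edge G j). edim (ker j \<sigma>))"
proof -
  let ?m = "morse_index G (dirichlet_operator G Lag x)"
  define supp where "supp j = {\<sigma> \<in> interior (edge G j). edim (ker j \<sigma>) \<noteq> 0}" for j
  have supp: "(\<Sum>\<^sub>\<infinity>\<sigma>\<in>interior (edge G j). edim (ker j \<sigma>)) = (\<Sum>\<^sub>\<infinity>\<sigma>\<in>supp j. edim (ker j \<sigma>))" for j
    by (rule infsum_cong_neutral) (auto simp: supp_def)
  show ?thesis
  proof (cases "\<forall>j\<in>arcs G. finite (supp j) \<and> (\<forall>\<sigma>\<in>interior (edge G j). edim (ker j \<sigma>) \<noteq> \<infinity>)")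
    case True
    define n where "n j \<sigma> = the_enat (edim (ker j \<sigma>))" for j \<sigma>
    have n: "edim (ker j \<sigma>) = enat (n j \<sigma>)" if "j \<in> arcs G" "\<sigma> \<in> interior (edge G j)" for j \<sigma>
    proof -
      have "edim (ker j \<sigma>) \<noteq> \<infinity>" using True that by blast
      then show ?thesis unfolding n_def by (cases "edim (ker j \<sigma>)") auto
    qed
    have fin: "finite (supp j)" "supp j \<subseteq> interior (edge G j)" if "j \<in> arcs G" for j
      using True that unfolding supp_def by blast+
    have "(\<Sum>\<^sub>\<infinity>\<sigma>\<in>interior (edge G j). edim (ker j \<sigma>)) = enat (\<Sum>\<sigma>\<in>supp j. n j \<sigma>)" if j: "j \<in> arcs G" for j
    proof -
      have "(\<Sum>\<sigma>\<in>supp j. edim (ker j \<sigma>)) = (\<Sum>\<sigma>\<in>supp j. enat (n j \<sigma>))"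
        by (rule sum.cong[OF refl]) (use n[OF j] fin(2)[OF j] in blast)
      then show ?thesis unfolding supp infsum_finite[OF fin(1)[OF j]] sum_enat .
    qed
    then have r: "(\<Sum>j\<in>arcs G. \<Sum>\<^sub>\<infinity>\<sigma>\<in>interior (edge G j). edim (ker j \<sigma>)) = enat (\<Sum>j\<in>arcs G. \<Sum>\<sigma>\<in>supp j. n j \<sigma>)"
      unfolding sum_enat[symmetric] by (intro sum.cong refl) (simp add: sum_enat)
    show ?thesis unfolding r
    proof (rule antisym)
      show "enat (\<Sum>j\<in>arcs G. \<Sum>\<sigma>\<in>supp j. n j \<sigma>) \<le> ?m"
      proof (rule morse_index_lower[OF fin])
        fix j \<sigma> assume "j \<in> arcs G" "\<sigma> \<in> supp j"
        then show "enat (n j \<sigma>) \<le> edim (ker j \<sigma>)" using n[of j \<sigma>] fin(2)[of j] by auto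
      qed
      show "?m \<le> enat (\<Sum>j\<in>arcs G. \<Sum>\<sigma>\<in>supp j. n j \<sigma>)"
      proof (rule morse_index_upper[OF fin])
        fix j \<sigma> y assume j: "j \<in> arcs G" and \<sigma>: "\<sigma> \<in> interior (edge G j)"
        show "edim (ker j \<sigma>) \<le> enat (n j \<sigma>)" using n[OF j \<sigma>] by simp
        assume y: "y \<in> ker j \<sigma>" "y \<noteq> 0"
        have "enat (card {y}) \<le> edim (ker j \<sigma>)" by (rule edim_ge) (use y in \<open>auto simp: dependent_single\<close>)
        then have "edim (ker j \<sigma>) \<noteq> 0" by (auto simp: zero_enat_def)
        then show "\<sigma> \<in> supp j" using \<sigma> by (simp add: supp_def)
      qed
    qed
  next
    case False
    then have "\<exists>i\<in>arcs G. infinite (supp i) \<or> (\<exists>\<sigma>\<in>interior (edge G i). edim (ker i \<sigma>) = \<infinity>)"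
      by auto
    then obtain i where i: "i \<in> arcs G" "infinite (supp i) \<or> (\<exists>\<sigma>\<in>interior (edge G i). edim (ker i \<sigma>) = \<infinity>)" ..
    \<comment> \<open>Either \<open>m\<close> points of positive multiplicity, each counted once, or
      one point of infinite multiplicity counted \<open>m\<close> times.\<close>
    have large: "\<exists>F. finite F \<and> F \<subseteq> interior (edge G i) \<and> (\<exists>n. (\<forall>\<sigma>\<in>F. enat (n \<sigma>) \<le> edim (ker i \<sigma>)) \<and> sum n F = m)" for m
      using i(2)
    proof
      assume "infinite (supp i)"
      then obtain F where F: "finite F" "card F = m" "F \<subseteq> supp i" using infinite_arbitrarily_large by blast
      have "enat 1 \<le> edim (ker i \<sigma>)" if "\<sigma> \<in> F" for \<sigma>
      proof -
        have "edim (ker i \<sigma>) \<noteq> 0" using F(3) that unfolding supp_def by blast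
        then show ?thesis by (cases "edim (ker i \<sigma>)") (auto simp: zero_enat_def)
      qed
      moreover have "(\<Sum>\<sigma>\<in>F. 1) = m" using F(2) by simp
      ultimately show ?thesis using F(1,3) unfolding supp_def by (intro exI[of _ F] conjI exI[of _ "\<lambda>\<sigma>. 1"]) auto
    next
      assume "\<exists>\<sigma>\<in>interior (edge G i). edim (ker i \<sigma>) = \<infinity>"
      then obtain \<sigma> where "\<sigma> \<in> interior (edge G i)" "edim (ker i \<sigma>) = \<infinity>" by blast
      then show ?thesis by (intro exI[of _ "{\<sigma>}"] conjI exI[of _ "\<lambda>\<sigma>. m"]) auto
    qed
    have "enat m \<le> ?m" "enat m \<le> (\<Sum>\<^sub>\<infinity>\<sigma>\<in>interior (edge G i). edim (ker i \<sigma>))" for m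
    proof -
      obtain F n where F: "finite F" "F \<subseteq> interior (edge G i)" "\<And>\<sigma>. \<sigma> \<in> F \<Longrightarrow> enat (n \<sigma>) \<le> edim (ker i \<sigma>)" "sum n F = m"
        using large[of m] by blast
      \<comment> \<open>The family \<open>F\<close> on the edge \<open>i\<close> and empty families
        on all other edges are enough for the lower bound.\<close>
      have "(\<Sum>j\<in>arcs G. \<Sum>\<sigma>\<in>(if j = i then F else {}). n \<sigma>) = (\<Sum>j\<in>arcs G. if j = i then sum n F else 0)"
        by (rule sum.cong) auto
      also have "\<dots> = m" using edges_finite i(1) F(4) by simp
      finally have "(\<Sum>j\<in>arcs G. \<Sum>\<sigma>\<in>(if j = i then F else {}). n \<sigma>) = m" .
      moreover have "enat (\<Sum>j\<in>arcs G. \<Sum>\<sigma>\<in>(if j = i then F else {}). n \<sigma>) \<le> ?m"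
        by (rule morse_index_lower) (use F in \<open>auto split: if_splits\<close>)
      ultimately show "enat m \<le> ?m" by simp
      have "enat m = (\<Sum>\<sigma>\<in>F. enat (n \<sigma>))" unfolding sum_enat F(4) ..
      also have "\<dots> \<le> (\<Sum>\<sigma>\<in>F. edim (ker i \<sigma>))" by (rule sum_mono) (rule F(3))
      also have "\<dots> \<le> (\<Sum>\<^sub>\<infinity>\<sigma>\<in>interior (edge G i). edim (ker i \<sigma>))"
        by (subst nonneg_infsum_complete) (use F(1,2) in \<open>auto intro!: SUP_upper\<close>)
      finally show "enat m \<le> (\<Sum>\<^sub>\<infinity>\<sigma>\<in>interior (edge G i). edim (ker i \<sigma>))" .
    qed
    note le = this
    have top: "e = \<infinity>" if "\<And>m. enat m \<le> e" for e
    proof (cases e)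
      case (enat k)
      then show ?thesis using that[of "Suc k"] by simp
    qed
    note inf = top[OF le(1)] top[OF le(2)]
    show ?thesis
      unfolding sum.remove[OF edges_finite i(1), of "\<lambda>j. \<Sum>\<^sub>\<infinity>\<sigma>\<in>interior (edge G j). edim (ker j \<sigma>)"] inf by simp
  qed
qed

end

theorem theorem4p8:
  fixes G :: "('v, 'e) metric_digraph"
    and Lag :: "('e, 'd::finite) lagrangian"
    and x :: "'e \<Rightarrow> real \<Rightarrow> real^'d"
  assumes "metric_graph G"
    and "lagrangian_C0 G Lag"
    and "lagrangian_C2 G Lag"
    and "lagrangian_convex G Lag"
    and "lagrangian_quadratic G Lag"
    and "euler_lagrange_solution G Lag x"
    and "vanishes_at_vertices G x"
    and "regular_coefficients G Lag x"
    and "operator_in G (minimal_operator G Lag x)"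
    and "closed_op G (minimal_operator G Lag x)"
    and "densely_defined G (minimal_operator G Lag x)"
    and "symmetric_op G (minimal_operator G Lag x)"
    and "fredholm_op G (minimal_operator G Lag x)"
    and "is_adjoint G (minimal_operator G Lag x) (maximal_operator G Lag x)"
  shows "morse_index G (dirichlet_operator G Lag x) =
    (\<Sum>j\<in>arcs G. \<Sum>\<^sub>\<infinity>\<sigma>\<in>{\<sigma>. lend G j < ereal \<sigma> \<and> ereal \<sigma> < rend G j}.
       edim (left_dirichlet_kernel G Lag x j \<sigma>))"
proof -
  interpret graph_linearization G Lag x
    by (rule graph_linearization.intro) (rule assms)+
  show ?thesis
    unfolding morse_index_formula
    by (rule sum.cong[OF refl]) (simp only: edge_interval(4)[OF edge_ends])
qed

end
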